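(* Let $g',\hat g,C_f,C_t>0$ and $c>0$, and let $(\bar h,\bar U,\bar\Phi,\bar\varphi)$ be an asymptotically-constant smooth convective-wave profile of speed $c$ for the Richard-Gavrilyuk system, with limiting values $(h_0,c,0,\varphi_-)$ at $-\infty$ and $(h_0,c,0,\varphi_+)$ at $+\infty$, reached exponentially fast. Set $$F_\pm:=\sqrt{\frac{\hat g}{C_f\,(g'+3h_0\varphi_\pm)}}.$$ Then the wave is spectrally stable if and only if $$C_f\ge C_t,\qquad F_+\le 2,\qquad F_-\le 2,$$ and it is strongly spectrally stable if and only if $$C_f\ge C_t,\qquad F_+<2,\qquad F_-<2.$$ (The choice of functional space $X$, among those listed in the context, is arbitrary and does not affect the conclusion.)
   Context: The Richard-Gavrilyuk system, with unknowns $(h,U,\Phi,\varphi)(t,x)$, $x\in\mathbb R$, is $$h_t+(hU)_x=0,\quad (hU)_t+(hU^2+p)_x=\hat g h-C|U|U,\quad (hE)_t+(hUE+Up)_x=(\hat g h-C_f|U|U)U,\quad (h\varphi)_t+(h\varphi U)_x=0,$$ with $p=\tfrac12 g'h^2+(\Phi+\varphi)h^3$, $E=\tfrac12U^2+\tfrac12(g'h+(\Phi+\varphi)h^2)$, $C=C_f\frac{\varphi}{\Phi+\varphi}+C_t\frac{\Phi}{\Phi+\varphi}$. A smooth convective wave of speed $c$ is a traveling-wave solution $(h,U,\Phi,\varphi)(t,x)=(\bar h,\bar U,\bar\Phi,\bar\varphi)(x-ct)$ with $\bar U\equiv c$, $\bar\Phi\equiv0$; for $c>0$, this amounts to $$\Big(g'\tfrac{\bar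 h^2}{2}+\bar\varphi\,\bar h^3\Big)'=\hat g\,\bar h-C_f c^2 .$$ It is asymptotically constant if $(\bar h,\bar\varphi)$ has limits at $\pm\infty$; then the limit of $\bar h$ at both ends is necessarily $h_0=C_fc^2/\hat g$, and the limits of $\bar\varphi$ are denoted $\varphi_\pm$. Standing assumptions: $\bar h,\bar\varphi\in\mathcal C^\infty(\mathbb R)$ are positive with $h_0,\varphi_\pm>0$; limits are reached exponentially fast, in the sense that $\bar h-h_0$ and all its derivatives are exponentially localized, i.e. bounded by $C_ke^{-\theta|x|}$ for some $\theta>0$ (and likewise $\bar\varphi-\varphi_\pm$ near $\pm\infty$). Linearized operator. The linearization about the wave, in the frame moving with speed $c$, is $\partial_tW=LW$ for $W=(h,U,\Phi,\varphi)$, where $LW$ has components $$\begin{aligned} (LW)_1&=-\partial_x(\bar h\,U),\\ (LW)_2&=-(g'+3\bar h\bar\varphi)\,\partial_x h+\bar h^{-1}\big(\hat g-\partial_x(\bar h(g'+3\bar h\bar\varphi))\big)h-2C_fc\,\bar h^{-1}U-\bar h^{-1}\partial_x\big(\bar h^3(\Phi+\varphi)\big)-\frac{c^2(C_t-C_f)}{\bar\varphi\,\bar h}\,\Phi,\\ (LW)_3&=-\frac{2(C_f-C_t)c^3}{\bar h^3\bar\varphi}\,\Phi,\\ (LW)_4&=-\bar\varphi_x\,U . \end{aligned}$$ $L$ is regarded as a closed densely defined operator on $X=X_0\times X_1$ with domain $D=X_1\times X_1$ (the first factor is for $(h,U)$, the second for $(\Phi,\varphi)$), where either $X_0=(W^{k,p}(\mathbb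 R))^2$, $X_1=(W^{k+1,p}(\mathbb R))^2$ for some $k\in\mathbb N$, $p\in[1,\infty)$, or $X_0=(BUC^k(\mathbb R))^2$, $X_1=(BUC^{k+1}(\mathbb R))^2$ for some $k\in\mathbb N$ ($BUC^\ell$: functions whose derivatives up to order $\ell$ are bounded and uniformly continuous); functions are complex-valued. A number $\lambda\in\mathbb C$ is outside the spectrum of $L$ iff for every $G\in X$ there is a unique $W\in D$ with $(\lambda-L)W=G$, and $(\lambda-L)^{-1}$ is bounded on $X$. The wave is spectrally stable (on $X$) if the spectrum of $L$ is contained in $\{\lambda:\Re\lambda\le0\}$, and strongly spectrally stable if it is contained in $\{\lambda:\Re\lambda<0\}\cup\{0\}$. *)

theory Defs
  imports "HOL-Analysis.Analysis"
begin

section \<open>The Richard-Gavrilyuk system and its convective waves\<close>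

text \<open>
  Parameters: \<open>gp\<close> is $g'$, \<open>gh\<close> is $\hat g$, and \<open>Cf\<close>, \<open>Ct\<close> are $C_f$, $C_t$.
  In names, \<open>Phi\<close> is $\Phi$ and \<open>phi\<close> is $\varphi$.
\<close>

definition rg_pressure :: "real \<Rightarrow> real \<Rightarrow> real \<Rightarrow> real \<Rightarrow> real" where
  "rg_pressure gp h Phi phi = gp * h^2 / 2 + (Phi + phi) * h^3"

definition rg_energy :: "real \<Rightarrow> real \<Rightarrow> real \<Rightarrow> real \<Rightarrow> real \<Rightarrow> real" where
  "rg_energy gp h U Phi phi = U^2 / 2 + (gp * h + (Phi + phi) * h^2) / 2"

definition rg_friction :: "real \<Rightarrow> real \<Rightarrow> real \<Rightarrow> real \<Rightarrow> real" where
  "rg_friction Cf Ct Phi phi = Cf * (phi / (Phi + phi)) + Ct * (Phi / (Phi + phi))"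

text \<open>
  Classical solutions; the unknowns are functions of \<open>t\<close> and \<open>x\<close>, in this order.
  Differentiability is required because \<open>deriv\<close> is a total operator.
\<close>

definition rg_solution ::
  "real \<Rightarrow> real \<Rightarrow> real \<Rightarrow> real \<Rightarrow> (real \<Rightarrow> real \<Rightarrow> real) \<Rightarrow> (real \<Rightarrow> real \<Rightarrow> real)
    \<Rightarrow> (real \<Rightarrow> real \<Rightarrow> real) \<Rightarrow> (real \<Rightarrow> real \<Rightarrow> real) \<Rightarrow> bool" where
  "rg_solution gp gh Cf Ct h U Phi phi \<longleftrightarrow>
     (let p = (\<lambda>t x. rg_pressure gp (h t x) (Phi t x) (phi t x));
          E = (\<lambda>t x. rg_energy gp (h t x) (U t x) (Phi t x) (phi t x));
          C = (\<lambda>t x. rg_friction Cf Ct (Phi t x) (phi t x))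
      in (\<forall>f\<in>{h, U, Phi, phi}. \<forall>t x.
            (\<lambda>s. f s x) differentiable (at t) \<and> (\<lambda>y. f t y) differentiable (at x)) \<and>
         (\<forall>t x.
            deriv (\<lambda>s. h s x) t + deriv (\<lambda>y. h t y * U t y) x = 0 \<and>
            deriv (\<lambda>s. h s x * U s x) t + deriv (\<lambda>y. h t y * (U t y)^2 + p t y) x
              = gh * h t x - C t x * \<bar>U t x\<bar> * U t x \<and>
            deriv (\<lambda>s. h s x * E s x) t + deriv (\<lambda>y. h t y * U t y * E t y + U t y * p t y) x
              = (gh * h t x - Cf * \<bar>U t x\<bar> * U t x) * U t x \<and>
            deriv (\<lambda>s. h s x * phi s x) t + deriv (\<lambda>y. h t y * phi t y * U t y) x = 0))"

definition smooth_real :: "(real \<Rightarrow> real) \<Rightarrow> bool" where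
  "smooth_real f \<longleftrightarrow> (\<forall>k. (deriv ^^ k) f differentiable_on UNIV)"

definition smooth_convective_wave ::
  "real \<Rightarrow> real \<Rightarrow> real \<Rightarrow> real \<Rightarrow> real
    \<Rightarrow> (real \<Rightarrow> real) \<Rightarrow> (real \<Rightarrow> real) \<Rightarrow> (real \<Rightarrow> real) \<Rightarrow> (real \<Rightarrow> real) \<Rightarrow> bool" where
  "smooth_convective_wave gp gh Cf Ct c h U Phi phi \<longleftrightarrow>
     rg_solution gp gh Cf Ct
       (\<lambda>t x. h (x - c * t)) (\<lambda>t x. U (x - c * t)) (\<lambda>t x. Phi (x - c * t)) (\<lambda>t x. phi (x - c * t)) \<and>
     (\<forall>x. U x = c) \<and> (\<forall>x. Phi x = 0) \<and>
     smooth_real h \<and> smooth_real phi \<and> (\<forall>x. h x > 0) \<and> (\<forall>x. phi x > 0)"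

text \<open>
  For a convective wave with these limits and \<open>c > 0\<close>, the profile equation forces
  \<open>h0 = Cf * c^2 / gh\<close>, so that \<open>h0\<close> is left as a parameter.
\<close>

definition asymptotically_constant ::
  "(real \<Rightarrow> real) \<Rightarrow> (real \<Rightarrow> real) \<Rightarrow> real \<Rightarrow> real \<Rightarrow> real \<Rightarrow> bool" where
  "asymptotically_constant h phi h0 phim phip \<longleftrightarrow>
     (h \<longlongrightarrow> h0) at_bot \<and> (h \<longlongrightarrow> h0) at_top \<and> (phi \<longlongrightarrow> phim) at_bot \<and> (phi \<longlongrightarrow> phip) at_top"

definition exp_localized_on :: "real set \<Rightarrow> (real \<Rightarrow> real) \<Rightarrow> bool" where
  "exp_localized_on A f \<longleftrightarrow>
     (\<exists>\<theta>>0. \<forall>k. \<exists>K. \<forall>x\<in>A. \<bar>(deriv ^^ k) f x\<bar> \<le> K * exp (- \<theta> * \<bar>x\<bar>))"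

definition limits_reached_exp_fast ::
  "(real \<Rightarrow> real) \<Rightarrow> (real \<Rightarrow> real) \<Rightarrow> real \<Rightarrow> real \<Rightarrow> real \<Rightarrow> bool" where
  "limits_reached_exp_fast h phi h0 phim phip \<longleftrightarrow>
     exp_localized_on UNIV (\<lambda>x. h x - h0) \<and>
     exp_localized_on {..0} (\<lambda>x. phi x - phim) \<and>
     exp_localized_on {0..} (\<lambda>x. phi x - phip)"

definition froude :: "real \<Rightarrow> real \<Rightarrow> real \<Rightarrow> real \<Rightarrow> real \<Rightarrow> real" where
  "froude gp gh Cf h0 phi0 = sqrt (gh / (Cf * (gp + 3 * h0 * phi0)))"


section \<open>Function spaces\<close>

text \<open>
  Elements of \<open>W^{k,p}\<close> are represented by Borel functions, identified up to
  Lebesgue-null sets by \<open>space_eq\<close> below. Weak derivatives are those of distribution theory.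
\<close>

definition test_function :: "(real \<Rightarrow> real) \<Rightarrow> bool" where
  "test_function \<eta> \<longleftrightarrow> smooth_real \<eta> \<and> (\<exists>R. \<forall>x. \<bar>x\<bar> > R \<longrightarrow> \<eta> x = 0)"

definition locally_integrable :: "(real \<Rightarrow> complex) \<Rightarrow> bool" where
  "locally_integrable f \<longleftrightarrow> (\<forall>a b. set_integrable lborel {a..b} f)"

definition has_weak_deriv :: "nat \<Rightarrow> (real \<Rightarrow> complex) \<Rightarrow> (real \<Rightarrow> complex) \<Rightarrow> bool" where
  "has_weak_deriv j f g \<longleftrightarrow>
     locally_integrable f \<and> locally_integrable g \<and>
     (\<forall>\<eta>. test_function \<eta> \<longrightarrow>
        (LINT x|lborel. complex_of_real ((deriv ^^ j) \<eta> x) * f x)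
          = (-1)^j * (LINT x|lborel. complex_of_real (\<eta> x) * g x))"

text \<open>A representative of the weak derivative, which is unique up to null sets.\<close>

definition weak_deriv :: "nat \<Rightarrow> (real \<Rightarrow> complex) \<Rightarrow> (real \<Rightarrow> complex)" where
  "weak_deriv j f = (SOME g. has_weak_deriv j f g)"

definition in_Lp :: "real \<Rightarrow> (real \<Rightarrow> complex) \<Rightarrow> bool" where
  "in_Lp p f \<longleftrightarrow> f \<in> borel_measurable lborel \<and> integrable lborel (\<lambda>x. norm (f x) powr p)"

definition Lp_norm :: "real \<Rightarrow> (real \<Rightarrow> complex) \<Rightarrow> real" where
  "Lp_norm p f = (LINT x|lborel. norm (f x) powr p) powr (1 / p)"

definition classical_deriv :: "(real \<Rightarrow> complex) \<Rightarrow> (real \<Rightarrow> complex)" where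
  "classical_deriv f = (\<lambda>x. vector_derivative f (at x))"

text \<open>\<open>Sobolev k p\<close> is \<open>W^{k,p}\<close>, and \<open>BUC k\<close> is \<open>BUC^k\<close>, both on the real line.\<close>

datatype fun_space = Sobolev nat real | BUC nat

fun admissible :: "fun_space \<Rightarrow> bool" where
  "admissible (Sobolev k p) \<longleftrightarrow> 1 \<le> p"
| "admissible (BUC k) \<longleftrightarrow> True"

fun one_more_deriv :: "fun_space \<Rightarrow> fun_space" where
  "one_more_deriv (Sobolev k p) = Sobolev (Suc k) p"
| "one_more_deriv (BUC k) = BUC (Suc k)"

fun space_carrier :: "fun_space \<Rightarrow> (real \<Rightarrow> complex) set" where
  "space_carrier (Sobolev k p) =
     {f. in_Lp p f \<and> (\<forall>j\<le>k. \<exists>g. in_Lp p g \<and> has_weak_deriv j f g)}"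
| "space_carrier (BUC k) =
     {f. (\<forall>j<k. (classical_deriv ^^ j) f differentiable_on UNIV) \<and>
         (\<forall>j\<le>k. bounded (range ((classical_deriv ^^ j) f)) \<and>
                uniformly_continuous_on UNIV ((classical_deriv ^^ j) f))}"

fun space_norm :: "fun_space \<Rightarrow> (real \<Rightarrow> complex) \<Rightarrow> real" where
  "space_norm (Sobolev k p) f = (\<Sum>j\<le>k. Lp_norm p (weak_deriv j f))"
| "space_norm (BUC k) f = (\<Sum>j\<le>k. SUP x. norm ((classical_deriv ^^ j) f x))"

fun space_eq :: "fun_space \<Rightarrow> (real \<Rightarrow> complex) \<Rightarrow> (real \<Rightarrow> complex) \<Rightarrow> bool" where
  "space_eq (Sobolev k p) f g \<longleftrightarrow> (AE x in lborel. f x = g x)"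
| "space_eq (BUC k) f g \<longleftrightarrow> f = g"

fun space_deriv :: "fun_space \<Rightarrow> (real \<Rightarrow> complex) \<Rightarrow> (real \<Rightarrow> complex)" where
  "space_deriv (Sobolev k p) f = weak_deriv 1 f"
| "space_deriv (BUC k) f = classical_deriv f"


section \<open>The linearized operator and its spectrum\<close>

text \<open>
  States are \<open>(h, U, Phi, phi)\<close>. The index \<open>S\<close> is the space of the scalar components of
  $X_0$, and \<open>one_more_deriv S\<close> that of the components of $X_1$.
\<close>

type_synonym state =
  "(real \<Rightarrow> complex) \<times> (real \<Rightarrow> complex) \<times> (real \<Rightarrow> complex) \<times> (real \<Rightarrow> complex)"

definition X_carrier :: "fun_space \<Rightarrow> state set" where
  "X_carrier S =
     space_carrier S \<times> space_carrier S
       \<times> space_carrier (one_more_deriv S) \<times> space_carrier (one_more_deriv S)"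

definition D_carrier :: "fun_space \<Rightarrow> state set" where
  "D_carrier S =
     space_carrier (one_more_deriv S) \<times> space_carrier (one_more_deriv S)
       \<times> space_carrier (one_more_deriv S) \<times> space_carrier (one_more_deriv S)"

fun X_norm :: "fun_space \<Rightarrow> state \<Rightarrow> real" where
  "X_norm S (h, U, Phi, phi) =
     space_norm S h + space_norm S U
       + space_norm (one_more_deriv S) Phi + space_norm (one_more_deriv S) phi"

fun state_eq :: "fun_space \<Rightarrow> state \<Rightarrow> state \<Rightarrow> bool" where
  "state_eq S (h1, U1, Phi1, phi1) (h2, U2, Phi2, phi2) \<longleftrightarrow>
     space_eq S h1 h2 \<and> space_eq S U1 U2 \<and> space_eq S Phi1 Phi2 \<and> space_eq S phi1 phi2"

text \<open>\<open>shifted lam A W\<close> is $(\lambda - A)W$.\<close>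

definition shifted :: "complex \<Rightarrow> (state \<Rightarrow> state) \<Rightarrow> state \<Rightarrow> state" where
  "shifted lam A W =
     (case W of (h, U, Phi, phi) \<Rightarrow> case A W of (Ah, AU, APhi, Aphi) \<Rightarrow>
        (\<lambda>x. lam * h x - Ah x, \<lambda>x. lam * U x - AU x,
         \<lambda>x. lam * Phi x - APhi x, \<lambda>x. lam * phi x - Aphi x))"

definition in_resolvent_set :: "fun_space \<Rightarrow> (state \<Rightarrow> state) \<Rightarrow> complex \<Rightarrow> bool" where
  "in_resolvent_set S A lam \<longleftrightarrow>
     (\<forall>G\<in>X_carrier S. \<exists>W\<in>D_carrier S. state_eq S (shifted lam A W) G \<and>
        (\<forall>W'\<in>D_carrier S. state_eq S (shifted lam A W') G \<longrightarrow> state_eq S W' W)) \<and>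
     (\<exists>K. \<forall>G\<in>X_carrier S. \<forall>W\<in>D_carrier S.
        state_eq S (shifted lam A W) G \<longrightarrow> X_norm S W \<le> K * X_norm S G)"

definition op_spectrum :: "fun_space \<Rightarrow> (state \<Rightarrow> state) \<Rightarrow> complex set" where
  "op_spectrum S A = {lam. \<not> in_resolvent_set S A lam}"

text \<open>The linearization about the wave with profile \<open>(hb, c, 0, phib)\<close>.\<close>

fun rg_linearized ::
  "real \<Rightarrow> real \<Rightarrow> real \<Rightarrow> real \<Rightarrow> real \<Rightarrow> (real \<Rightarrow> real) \<Rightarrow> (real \<Rightarrow> real)
    \<Rightarrow> fun_space \<Rightarrow> state \<Rightarrow> state" where
  "rg_linearized gp gh Cf Ct c hb phib S (h, U, Phi, phi) =
     ((\<lambda>x. - space_deriv S (\<lambda>y. complex_of_real (hb y) * U y) x),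
      (\<lambda>x. - complex_of_real (gp + 3 * hb x * phib x) * space_deriv S h x
            + complex_of_real
                ((1 / hb x) * (gh - deriv (\<lambda>y. hb y * (gp + 3 * hb y * phib y)) x)) * h x
            - complex_of_real (2 * Cf * c * (1 / hb x)) * U x
            - complex_of_real (1 / hb x)
                * space_deriv S (\<lambda>y. complex_of_real ((hb y)^3) * (Phi y + phi y)) x
            - complex_of_real (c^2 * (Ct - Cf) / (phib x * hb x)) * Phi x),
      (\<lambda>x. - complex_of_real (2 * (Cf - Ct) * c^3 / ((hb x)^3 * phib x)) * Phi x),
      (\<lambda>x. - complex_of_real (deriv phib x) * U x))"

definition spectrally_stable ::
  "real \<Rightarrow> real \<Rightarrow> real \<Rightarrow> real \<Rightarrow> real \<Rightarrow> (real \<Rightarrow> real) \<Rightarrow> (real \<Rightarrow> real) \<Rightarrow> fun_space \<Rightarrow> bool" where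
  "spectrally_stable gp gh Cf Ct c hb phib S \<longleftrightarrow>
     op_spectrum S (rg_linearized gp gh Cf Ct c hb phib S) \<subseteq> {lam. Re lam \<le> 0}"

definition strongly_spectrally_stable ::
  "real \<Rightarrow> real \<Rightarrow> real \<Rightarrow> real \<Rightarrow> real \<Rightarrow> (real \<Rightarrow> real) \<Rightarrow> (real \<Rightarrow> real) \<Rightarrow> fun_space \<Rightarrow> bool" where
  "strongly_spectrally_stable gp gh Cf Ct c hb phib S \<longleftrightarrow>
     op_spectrum S (rg_linearized gp gh Cf Ct c hb phib S) \<subseteq> {lam. Re lam < 0} \<union> {0}"

end

theory Submission
  imports Defs
begin

text \<open>
  Eliminating \<open>h\<close>, \<open>\<Phi>\<close> and \<open>\<phi>\<close> from \<open>(\<lambda> - L) W = G\<close> leaves a scalar second order equation for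
  \<open>U\<close>, uniformly elliptic since the profile is positive, together with a multiplication equation for \<open>\<Phi>\<close>
  whose symbol vanishes somewhere with positive real part of \<open>\<lambda>\<close> exactly if \<open>Ct > Cf\<close>.

  For \<open>Re \<lambda> \<ge> 0\<close> there is a complex weight \<open>w\<close> for which the real part of \<open>w p U\<^sup>*\<close>, suitably corrected, is
  strictly increasing along solutions of the first order system for \<open>U\<close> and \<open>p = al U'\<close>. At
  infinity the Froude conditions \<open>F \<le> 2\<close> are what make this possible, while on a compact set a
  different argument of \<open>w\<close> always works, and one passes from one to the other slowly. Monotonicity yields
  uniqueness, existence (as a limit of boundary value problems on long intervals), and a Green's kernel bound
  \<open>K exp (- \<epsilon> |x - y|)\<close>, hence resolvent estimates in all the spaces at once.

  Conversely, if \<open>F > 2\<close> at one end then the dispersion relation of the limiting constant state has a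
  solution with imaginary wave number and \<open>Re \<lambda> > 0\<close> (roll waves), for \<open>F = 2\<close> one with \<open>Re \<lambda> = 0\<close> and \<open>\<lambda> \<noteq> 0\<close>; wave
  packets sent to infinity show that it belongs to the spectrum.
\<close>

section \<open>Ordinary differential equations and energy estimates\<close>

text \<open>The elimination is possible because the unknowns are differentiated in
  \<open>(lam - L) W = G\<close> only through \<open>b U\<close> and the linearized pressure
  \<open>QQ\<close>, and because the profile equation makes the zeroth order terms of the first and
  last equations add up to \<open>rr\<close>. The profile between the two ends is arbitrary and
  \<open>phim\<close>, \<open>phip\<close> may differ, so no perturbation of a constant state is
  available. In the core the Froude condition is replaced by the freedom to let the modulus of the
  weight vary: a decay at the rate \<open>kap / al\<close> completes a square. Origin of the
  constant weight at infinity: with \<open>z = 1 + lam h0 / (Cf c)\<close> the coefficient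
  \<open>qq lam\<close> tends to a positive multiple of \<open>z^2 - 1\<close>, and
  \<open>1 - \<i> T0\<close> is the multiple of the conjugate of \<open>z\<close> with real part 1,
  for which the real part of \<open>w z^2\<close> is the square of the modulus of \<open>z\<close>.
  The energy inequality is quadratic in the solution; it becomes a linear kernel bound by absorbing
  an exponentially weighted supremum, at the price of half of the decay rate. Sources are continuous
  there; rough ones are first smoothed by inverting \<open>u' + u\<close>, and each further
  derivative is read off from the system.\<close>

lemma continuous_on_integral_upper:
  fixes g :: "real \<Rightarrow> 'a::euclidean_space"
  assumes "continuous_on UNIV g"
  shows "continuous_on UNIV (\<lambda>x. integral {a..x} g)"
proof -
  have *: "continuous_on {..b} (\<lambda>x. integral {a..x} g)" for b
  proof -
    \<comment> \<open>For \<open>x < a\<close> the interval is empty and the integral is 0, a value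
      that the truncation \<open>max a x\<close> keeps.\<close>
    have eq: "integral {a..x} g = integral {a..max a x} g" for x
      by (cases "a \<le> x") (auto simp: max_def)
    have "continuous_on {a..max a b} (\<lambda>x. integral {a..x} g)"
      by (intro indefinite_integral_continuous_1 integrable_continuous_real
            continuous_on_subset[OF assms]) auto
    then have "continuous_on {..b} (\<lambda>x. integral {a..max a x} g)"
      by (rule continuous_on_compose2) (auto intro!: continuous_intros)
    then show ?thesis using eq by simp
  qed
  show ?thesis
  proof (rule continuous_at_imp_continuous_on, intro ballI)
    fix x :: real
    have "continuous_on {..<x+1} (\<lambda>x. integral {a..x} g)"
      by (rule continuous_on_subset[OF *[of "x+1"]]) auto
    then show "isCont (\<lambda>x. integral {a..x} g) x"
      by (simp add: continuous_on_eq_continuous_at)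
  qed
qed

lemma has_integral_exp_from:
  fixes M a x :: real
  assumes "M > 0" "a \<le> x"
  shows "((\<lambda>t. exp (M * (t - a))) has_integral (exp (M * (x - a)) - 1) / M) {a..x}"
proof -
  have "((\<lambda>t. exp (M * (t - a)) / M) has_vector_derivative exp (M * (t - a))) (at t within {a..x})" for t
    using assms by (auto intro!: derivative_eq_intros simp: has_real_derivative_iff_has_vector_derivative[symmetric])
  from fundamental_theorem_of_calculus[OF \<open>a \<le> x\<close> this] show ?thesis
    by (simp add: diff_divide_distrib)
qed

text \<open>Picard iteration in the sup norm weighted by \<open>exp (- M * (t - a))\<close>, for which it contracts on
  the whole half line at once.\<close>

lemma lipschitz_ivp_exists:
  fixes f :: "real \<Rightarrow> 'a::euclidean_space \<Rightarrow> 'a"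
  assumes lip: "\<And>t x y. norm (f t x - f t y) \<le> L * norm (x - y)"
    and cont: "\<And>u. continuous_on UNIV u \<Longrightarrow> continuous_on UNIV (\<lambda>t. f t (u t))"
    and bnd: "\<And>t. norm (f t 0) \<le> B" and "L \<ge> 0"
  shows "\<exists>u. u a = u0 \<and> continuous_on UNIV u \<and>
           (\<forall>t\<ge>a. (u has_vector_derivative f t (u t)) (at t within {a..}))"
proof -
  \<comment> \<open>The Lipschitz constant costs a factor \<open>L / M\<close>, at most 1/2; the
    summand 1 keeps \<open>M\<close> positive if \<open>L = 0\<close>.\<close>
  define M where "M = 2 * L + 1"
  have M: "M > 0" "M \<ge> 2 * L" using \<open>L \<ge> 0\<close> by (auto simp: M_def)
  have B0: "B \<ge> 0" using bnd[of 0] norm_ge_zero order_trans by blast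
  define w where "w = (\<lambda>t::real. exp (M * (t - a)))"
  \<comment> \<open>The unknown is the solution divided by \<open>w\<close>, so that the plain sup
    norm of bounded continuous functions can be used. Truncating at \<open>a\<close> makes the image
    constant to the left of \<open>a\<close>, where nothing has to be solved.\<close>
  define Tf where "Tf = (\<lambda>u x. exp (- M * (max x a - a)) *\<^sub>R (u0 + integral {a..x} (\<lambda>t. f t (w t *\<^sub>R u t))))"
  have wpos: "w t > 0" for t by (simp add: w_def)
  have wge1: "w t \<ge> 1" if "t \<ge> a" for t using that M by (simp add: w_def)
  have contg: "continuous_on UNIV (\<lambda>t. f t (w t *\<^sub>R u t))" if "continuous_on UNIV u" for u
    by (rule cont) (use that in \<open>auto intro!: continuous_intros simp: w_def\<close>)
  have intg: "(\<lambda>t. f t (w t *\<^sub>R u t)) integrable_on {a..x}" if "continuous_on UNIV u" for u x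
    by (rule integrable_continuous_real[OF continuous_on_subset[OF contg[OF that]]]) auto
  have wint: "(w has_integral (w x - 1) / M) {a..x}" if "a \<le> x" for x
    using has_integral_exp_from[OF M(1) that] by (simp add: w_def)
  have ew: "exp (- M * (max x a - a)) * w x = 1" if "a \<le> x" for x
    using that by (simp add: w_def max_def flip: exp_add)
  have Tb: "Tf u \<in> bcontfun" if u: "continuous_on UNIV u" "bounded (range u)" for u
  proof -
    obtain S where S: "\<And>t. norm (u t) \<le> S" using u(2) by (auto simp: bounded_iff)
    have S0: "S \<ge> 0" using S[of 0] norm_ge_zero order_trans by blast
    have nb: "norm (f t (w t *\<^sub>R u t)) \<le> (B + L * S) * w t" if "t \<ge> a" for t
    proof -
      have "norm (f t (w t *\<^sub>R u t)) \<le> norm (f t 0) + norm (f t (w t *\<^sub>R u t) - f t 0)"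
        using norm_triangle_ineq[of "f t 0" "f t (w t *\<^sub>R u t) - f t 0"] by simp
      also have "\<dots> \<le> B + L * (w t * S)"
        by (intro add_mono bnd order_trans[OF lip] mult_left_mono \<open>L \<ge> 0\<close>)
          (use S[of t] wpos[of t] in \<open>auto intro!: mult_left_mono\<close>)
      also have "\<dots> \<le> B * w t + L * (w t * S)"
        using mult_left_mono[OF wge1[OF that] B0] by simp
      finally show ?thesis by (simp add: algebra_simps)
    qed
    have "norm (Tf u x) \<le> norm u0 + (B + L * S) / M" for x
    proof (cases "a \<le> x")
      case True
      have "norm (integral {a..x} (\<lambda>t. f t (w t *\<^sub>R u t))) \<le> integral {a..x} (\<lambda>t. (B + L * S) * w t)"
        by (rule integral_norm_bound_integral[OF intg[OF u(1)]])
          (use wint[OF True] nb in \<open>auto intro!: integrable_on_mult_right\<close>)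
      also have "\<dots> = (B + L * S) * ((w x - 1) / M)"
        using wint[OF True] by (simp add: integral_unique)
      also have "\<dots> \<le> (B + L * S) / M * w x"
        using B0 \<open>L \<ge> 0\<close> S0 M by (simp add: field_simps)
      finally have 1: "norm (integral {a..x} (\<lambda>t. f t (w t *\<^sub>R u t))) \<le> (B + L * S) / M * w x" .
      have e1: "exp (- M * (max x a - a)) \<le> 1" using True M by (simp add: max_def)
      have "norm (Tf u x) \<le> exp (- M * (max x a - a)) * (norm u0 + (B + L * S) / M * w x)"
        unfolding Tf_def using 1 norm_triangle_le[of u0] by (auto intro!: mult_left_mono)
      also have "\<dots> = exp (- M * (max x a - a)) * norm u0 + (B + L * S) / M * (exp (- M * (max x a - a)) * w x)"
        by (simp add: algebra_simps)
      also have "\<dots> \<le> norm u0 + (B + L * S) / M"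
        unfolding ew[OF True] using e1 mult_right_mono[OF e1, of "norm u0"] by simp
      finally show ?thesis .
    next
      case False
      then show ?thesis using B0 \<open>L \<ge> 0\<close> S0 M by (simp add: Tf_def max_def)
    qed
    moreover have "continuous_on UNIV (Tf u)"
      unfolding Tf_def
      by (intro continuous_intros continuous_on_integral_upper contg[OF u(1)])
    ultimately show ?thesis by (auto simp: bcontfun_def bounded_iff)
  qed
  define TC where "TC = (\<lambda>u :: real \<Rightarrow>\<^sub>C 'a. Bcontfun (Tf (apply_bcontfun u)))"
  have TC: "apply_bcontfun (TC u) = Tf (apply_bcontfun u)" for u
    unfolding TC_def by (rule Bcontfun_inverse[OF Tb]) auto
  have contr: "dist (TC u) (TC v) \<le> (1/2) * dist u v" for u v
  proof (rule dist_bound)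
    fix x
    show "dist (apply_bcontfun (TC u) x) (apply_bcontfun (TC v) x) \<le> (1/2) * dist u v"
    proof (cases "a \<le> x")
      case True
      have eq: "Tf u x - Tf v x = exp (- M * (max x a - a)) *\<^sub>R
          integral {a..x} (\<lambda>t. f t (w t *\<^sub>R u t) - f t (w t *\<^sub>R v t))"
        unfolding Tf_def by (subst integral_diff) (auto intro!: intg simp: algebra_simps)
      have "norm (integral {a..x} (\<lambda>t. f t (w t *\<^sub>R u t) - f t (w t *\<^sub>R v t)))
          \<le> integral {a..x} (\<lambda>t. (L * dist u v) * w t)"
      proof (rule integral_norm_bound_integral)
        show "(\<lambda>t. f t (w t *\<^sub>R u t) - f t (w t *\<^sub>R v t)) integrable_on {a..x}"
          by (intro integrable_diff intg) auto
        show "(\<lambda>t. (L * dist u v) * w t) integrable_on {a..x}"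
          using wint[OF True] by (auto intro!: integrable_on_mult_right)
        fix t
        have "norm (f t (w t *\<^sub>R u t) - f t (w t *\<^sub>R v t)) \<le> L * (w t * norm (apply_bcontfun u t - apply_bcontfun v t))"
          using lip[of t "w t *\<^sub>R u t" "w t *\<^sub>R v t"] wpos[of t]
          by (simp flip: scaleR_diff_right)
        also have "\<dots> \<le> L * (w t * dist u v)"
          using dist_bounded[of u t v] wpos[of t] \<open>L \<ge> 0\<close>
          by (auto intro!: mult_left_mono simp: dist_norm)
        finally show "norm (f t (w t *\<^sub>R u t) - f t (w t *\<^sub>R v t)) \<le> (L * dist u v) * w t"
          by (simp add: algebra_simps)
      qed
      also have "\<dots> = (L * dist u v) * ((w x - 1) / M)"
        using wint[OF True] by (simp add: integral_unique)
      also have "\<dots> \<le> (L * dist u v) / M * w x"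
        using \<open>L \<ge> 0\<close> M by (simp add: field_simps)
      finally have "norm (Tf u x - Tf v x) \<le> exp (- M * (max x a - a)) * ((L * dist u v) / M * w x)"
        unfolding eq norm_scaleR abs_exp_cancel by (rule mult_left_mono) simp
      also have "\<dots> = (L * dist u v) / M"
        using ew[OF True] by (simp add: mult.left_commute)
      also have "\<dots> \<le> (1/2) * dist u v"
        using mult_right_mono[OF M(2), of "dist u v"] M(1) by (simp add: field_simps)
      finally show ?thesis by (simp add: TC dist_norm)
    next
      case False
      then show ?thesis by (simp add: TC Tf_def)
    qed
  qed
  have "\<exists>!u. TC u = u"
    by (rule banach_fix_type[of "1/2"]) (use contr in auto)
  then obtain v where v: "TC v = v" by blast
  define g where "g = (\<lambda>t. f t (w t *\<^sub>R v t))"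
  define u where "u = (\<lambda>x. u0 + integral {a..x} g)"
  have vfix: "v x = exp (- M * (max x a - a)) *\<^sub>R u x" for x
    using arg_cong[OF v, of apply_bcontfun] unfolding TC Tf_def u_def g_def by metis
  have uv: "u x = w x *\<^sub>R v x" if "x \<ge> a" for x
    using ew[OF that] by (simp add: vfix mult.commute)
  have cg: "continuous_on UNIV g" unfolding g_def by (rule contg) auto
  have "(u has_vector_derivative f t (u t)) (at t within {a..})" if "t \<ge> a" for t
  proof -
    have "(u has_vector_derivative 0 + g t) (at t within {a..t+1})"
      unfolding u_def
      by (intro derivative_intros integral_has_vector_derivative continuous_on_subset[OF cg]) (use that in auto)
    moreover have "at t within {a..t+1} = at t within {a..}"
      by (rule at_within_nhd[of _ "{..<t+1}"]) auto
    ultimately have "(u has_vector_derivative g t) (at t within {a..})" by simp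
    then show ?thesis using uv[OF that] by (simp add: g_def)
  qed
  moreover have "u a = u0" by (simp add: u_def)
  moreover have "continuous_on UNIV u" unfolding u_def
    by (intro continuous_intros continuous_on_integral_upper cg)
  ultimately show ?thesis by blast
qed

section \<open>Energy inequalities for scalar functions on an interval\<close>

lemma integral_le_of_deriv_ge:
  fixes g :: "real \<Rightarrow> real"
  assumes "a \<le> b" "continuous_on {a..b} f"
    and "\<And>x. x \<in> {a..b} \<Longrightarrow> (g has_real_derivative g' x) (at x within {a..b})"
    and "\<And>x. x \<in> {a..b} \<Longrightarrow> f x \<le> g' x"
  shows "integral {a..b} f \<le> g b - g a"
proof -
  \<comment> \<open>The gauge integral provides this without continuity of \<open>g'\<close>, which
    is what allows derivatives that are only known to exist.\<close>
  have "(g' has_integral (g b - g a)) {a..b}"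
    using assms(1,3)
    by (auto intro!: fundamental_theorem_of_calculus simp: has_real_derivative_iff_has_vector_derivative[symmetric])
  moreover have "(f has_integral integral {a..b} f) {a..b}"
    using assms(2) by (auto intro!: integrable_integral integrable_continuous_real)
  ultimately show ?thesis using assms(4) has_integral_le by blast
qed

text \<open>This is the product of three losses in \<open>energy_estimate\<close>:
  \<open>1 + M\<close> from passing from a local integral to a value,
  \<open>exp (d / (2 * C)) = exp (2 * ep)\<close> from removing the weight within distance 1 of
  \<open>x0\<close>, and the last factor from bounding the weighted integral of \<open>y^2\<close>
  by the boundary terms and the source integral.\<close>

definition energy_const :: "real \<Rightarrow> real \<Rightarrow> real \<Rightarrow> real" where
  "energy_const d C M = (1 + M) * exp (d / (2 * C)) * (2 / d * (1 + C) + 1)"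

lemma energy_const_pos: "d > 0 \<Longrightarrow> C > 0 \<Longrightarrow> M \<ge> 0 \<Longrightarrow> energy_const d C M > 0"
  by (simp add: energy_const_def add_pos_pos add_nonneg_pos)

text \<open>The exponential weight costs at most half of the coercivity of \<open>e\<close>; the jump of its slope at
  \<open>x0\<close> is harmless because \<open>e\<close> itself is continuous there.\<close>

lemma energy_weighted:
  fixes y s e :: "real \<Rightarrow> real"
  assumes lr: "x0 \<in> {l..r}" and d: "d > 0" and C: "C > 0"
    and cy: "continuous_on {l..r} y" and cs: "continuous_on {l..r} s"
    and De: "\<And>x. x \<in> {l..r} \<Longrightarrow> (e has_real_derivative e' x) (at x within {l..r})"
    and e': "\<And>x. x \<in> {l..r} \<Longrightarrow> d * (y x)^2 - C * y x * s x \<le> e' x"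
    and eb: "\<And>x. x \<in> {l..r} \<Longrightarrow> \<bar>e x\<bar> \<le> C * (y x)^2"
  defines "ep \<equiv> d / (4 * C)"
  shows "integral {l..r} (\<lambda>x. exp (- 2 * ep * \<bar>x - x0\<bar>) * (d / 2 * (y x)^2 - C * (y x * s x)))
           \<le> exp (- 2 * ep * (r - x0)) * e r - exp (- 2 * ep * (x0 - l)) * e l"
proof -
  let ?f = "\<lambda>x. exp (- 2 * ep * \<bar>x - x0\<bar>) * (d / 2 * (y x)^2 - C * (y x * s x))"
  have epC: "2 * ep * C = d / 2" using C by (simp add: ep_def)
  have ep: "ep > 0" using d C by (simp add: ep_def)
  have cf: "continuous_on A ?f" if "A \<subseteq> {l..r}" for A
    using cy cs that by (auto intro!: continuous_intros intro: continuous_on_subset)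
  \<comment> \<open>\<open>\<sigma>\<close> is the sign of the slope of the weight: 1 to the left of
    \<open>x0\<close> and -1 to the right. The right side is the derivative of the weighted energy
    divided by the weight.\<close>
  have key: "d / 2 * (y x)^2 - C * (y x * s x) \<le> e' x + \<sigma> * (2 * ep) * e x"
    if "x \<in> {l..r}" "\<bar>\<sigma>\<bar> = 1" for x \<sigma>
  proof -
    have "\<bar>\<sigma> * (2 * ep) * e x\<bar> = 2 * ep * \<bar>e x\<bar>" using that ep by (simp add: abs_mult)
    also have "\<dots> \<le> 2 * ep * (C * (y x)^2)" using eb[OF that(1)] ep by (intro mult_left_mono) auto
    also have "\<dots> = d / 2 * (y x)^2" using epC by (simp add: mult.assoc)
    finally show ?thesis using e'[OF that(1)] by (simp add: algebra_simps)
  qed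
  have R: "integral {x0..r} ?f \<le> exp (- 2 * ep * (r - x0)) * e r - exp (- 2 * ep * (x0 - x0)) * e x0"
  proof (rule integral_le_of_deriv_ge)
    fix x assume x: "x \<in> {x0..r}"
    then have xlr: "x \<in> {l..r}" using lr by auto
    have "(e has_real_derivative e' x) (at x within {x0..r})"
      by (rule DERIV_subset[OF De[OF xlr]]) (use lr in auto)
    then show "((\<lambda>x. exp (- 2 * ep * (x - x0)) * e x) has_real_derivative
        exp (- 2 * ep * (x - x0)) * (e' x + (-1) * (2 * ep) * e x)) (at x within {x0..r})"
      by (auto intro!: derivative_eq_intros simp: algebra_simps)
    show "?f x \<le> exp (- 2 * ep * (x - x0)) * (e' x + (-1) * (2 * ep) * e x)"
      using key[OF xlr, of "-1"] x by (auto intro!: mult_left_mono)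
  qed (use lr cf in auto)
  have L: "integral {l..x0} ?f \<le> exp (2 * ep * (x0 - x0)) * e x0 - exp (2 * ep * (l - x0)) * e l"
  proof (rule integral_le_of_deriv_ge)
    fix x assume x: "x \<in> {l..x0}"
    then have xlr: "x \<in> {l..r}" using lr by auto
    have "(e has_real_derivative e' x) (at x within {l..x0})"
      by (rule DERIV_subset[OF De[OF xlr]]) (use lr in auto)
    then show "((\<lambda>x. exp (2 * ep * (x - x0)) * e x) has_real_derivative
        exp (2 * ep * (x - x0)) * (e' x + 1 * (2 * ep) * e x)) (at x within {l..x0})"
      by (auto intro!: derivative_eq_intros simp: algebra_simps)
    have "exp (- 2 * ep * \<bar>x - x0\<bar>) = exp (2 * ep * (x - x0))" using x by (simp add: algebra_simps)
    then show "?f x \<le> exp (2 * ep * (x - x0)) * (e' x + 1 * (2 * ep) * e x)"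
      by (simp only:) (intro mult_left_mono key[OF xlr], auto)
  qed (use lr cf in auto)
  have "integral {l..r} ?f = integral {l..x0} ?f + integral {x0..r} ?f"
    using lr by (intro Henstock_Kurzweil_Integration.integral_combine[symmetric]
        integrable_continuous_real cf) auto
  moreover have "exp (2 * ep * (l - x0)) = exp (- 2 * ep * (x0 - l))"
    by (rule arg_cong[of _ _ exp]) (simp add: algebra_simps)
  moreover have "exp (2 * ep * (x0 - x0)) = 1" "exp (- 2 * ep * (x0 - x0)) = 1" by auto
  ultimately show ?thesis using L R by (simp only: mult_1)
qed

text \<open>Integrate the derivative of \<open>n\<close> times a hat function that is 1 at
  \<open>x0\<close> and 0 at distance 1 from it. An interval of length at least 2 leaves room for
  such a hat on at least one side of \<open>x0\<close>.\<close>

lemma value_le_local_integral: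
  fixes n :: "real \<Rightarrow> real"
  assumes lr: "x0 \<in> {l..r}" "l + 2 \<le> r"
    and n: "\<And>x. x \<in> {l..r} \<Longrightarrow> (n has_real_derivative n' x) (at x within {l..r})"
    and g: "continuous_on {l..r} g" "\<And>x. x \<in> {l..r} \<Longrightarrow> \<bar>n' x\<bar> + n x \<le> g x"
    and n0: "\<And>x. x \<in> {l..r} \<Longrightarrow> n x \<ge> 0"
  shows "\<exists>a b. {a..b} \<subseteq> {l..r} \<and> {a..b} \<subseteq> {x0-1..x0+1} \<and> n x0 \<le> integral {a..b} g"
proof (cases "x0 + 1 \<le> r")
  case True
  have "integral {x0..x0+1} (\<lambda>x. - g x) \<le> (1 - (x0 + 1 - x0)) * n (x0+1) - (1 - (x0 - x0)) * n x0"
  proof (rule integral_le_of_deriv_ge)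
    fix x assume x: "x \<in> {x0..x0+1}"
    then have xlr: "x \<in> {l..r}" using lr True by auto
    have "(n has_real_derivative n' x) (at x within {x0..x0+1})"
      by (rule DERIV_subset[OF n[OF xlr]]) (use lr True in auto)
    then show "((\<lambda>x. (1 - (x - x0)) * n x) has_real_derivative - n x + (1 - (x - x0)) * n' x)
        (at x within {x0..x0+1})"
      by (auto intro!: derivative_eq_intros simp: algebra_simps)
    have "\<bar>(1 - (x - x0)) * n' x\<bar> \<le> 1 * \<bar>n' x\<bar>"
      unfolding abs_mult using x by (intro mult_right_mono) auto
    then show "- g x \<le> - n x + (1 - (x - x0)) * n' x" using g(2)[OF xlr] by auto
  qed (use lr True g in \<open>auto intro!: continuous_intros intro: continuous_on_subset\<close>)
  then have "n x0 \<le> integral {x0..x0+1} g" by simp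
  then show ?thesis using lr True by (intro exI[of _ x0] exI[of _ "x0+1"]) auto
next
  case False
  have "integral {x0-1..x0} (\<lambda>x. - g x) \<le> - (1 + (x0 - x0)) * n x0 - - (1 + (x0 - 1 - x0)) * n (x0-1)"
  proof (rule integral_le_of_deriv_ge)
    fix x assume x: "x \<in> {x0-1..x0}"
    then have xlr: "x \<in> {l..r}" using lr False by auto
    have "(n has_real_derivative n' x) (at x within {x0-1..x0})"
      by (rule DERIV_subset[OF n[OF xlr]]) (use lr False in auto)
    then show "((\<lambda>x. - (1 + (x - x0)) * n x) has_real_derivative - n x - (1 + (x - x0)) * n' x)
        (at x within {x0-1..x0})"
      by (auto intro!: derivative_eq_intros simp: algebra_simps)
    have "\<bar>(1 + (x - x0)) * n' x\<bar> \<le> 1 * \<bar>n' x\<bar>"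
      unfolding abs_mult using x by (intro mult_right_mono) auto
    then show "- g x \<le> - n x - (1 + (x - x0)) * n' x" using g(2)[OF xlr] by auto
  qed (use lr False g in \<open>auto intro!: continuous_intros intro: continuous_on_subset\<close>)
  then have "n x0 \<le> integral {x0-1..x0} g" by simp
  then show ?thesis using lr False by (intro exI[of _ "x0-1"] exI[of _ "x0"]) auto
qed

text \<open>\<open>energy_weighted\<close> controls the integral of \<open>y^2\<close> against a
  weight centred at \<open>x0\<close>, and \<open>value_le_local_integral\<close> turns this into a
  value at \<open>x0\<close>. The boundary terms keep the factor that decays with the distance of
  \<open>x0\<close> to the ends; this decay is what later allows the interval to exhaust the
  line.\<close>

lemma energy_estimate:
  fixes y s e :: "real \<Rightarrow> real"
  assumes lr: "x0 \<in> {l..r}" "l + 2 \<le> r" and d: "d > 0" and C: "C > 0" and M: "M \<ge> 0"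
    and cy: "continuous_on {l..r} y" and cs: "continuous_on {l..r} s"
    and y0: "\<And>x. y x \<ge> 0" and s0: "\<And>x. s x \<ge> 0"
    and De: "\<And>x. x \<in> {l..r} \<Longrightarrow> (e has_real_derivative e' x) (at x within {l..r})"
    and e': "\<And>x. x \<in> {l..r} \<Longrightarrow> d * (y x)^2 - C * y x * s x \<le> e' x"
    and eb: "\<And>x. x \<in> {l..r} \<Longrightarrow> \<bar>e x\<bar> \<le> C * (y x)^2"
    and Dn: "\<And>x. x \<in> {l..r} \<Longrightarrow> ((\<lambda>x. (y x)^2) has_real_derivative n' x) (at x within {l..r})"
    and nb: "\<And>x. x \<in> {l..r} \<Longrightarrow> \<bar>n' x\<bar> \<le> M * ((y x)^2 + y x * s x)"
  defines "ep \<equiv> d / (4 * C)"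
  shows "(y x0)^2 \<le> energy_const d C M *
     (exp (- 2 * ep * (r - x0)) * \<bar>e r\<bar> + exp (- 2 * ep * (x0 - l)) * \<bar>e l\<bar> +
      integral {l..r} (\<lambda>x. exp (- 2 * ep * \<bar>x - x0\<bar>) * (y x * s x)))"
proof -
  let ?w = "\<lambda>x. exp (- 2 * ep * \<bar>x - x0\<bar>)"
  define I where "I = integral {l..r} (\<lambda>x. ?w x * (y x * s x))"
  define Y2 where "Y2 = integral {l..r} (\<lambda>x. ?w x * (y x)^2)"
  define B where "B = exp (- 2 * ep * (r - x0)) * \<bar>e r\<bar> + exp (- 2 * ep * (x0 - l)) * \<bar>e l\<bar>"
  have ep: "ep > 0" using d C by (simp add: ep_def)
  have c1: "continuous_on {l..r} (\<lambda>x. ?w x * (y x * s x))"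
    and c2: "continuous_on {l..r} (\<lambda>x. ?w x * (y x)^2)"
    using cy cs by (auto intro!: continuous_intros)
  have i1: "(\<lambda>x. ?w x * (y x * s x)) integrable_on {l..r}"
    and i2: "(\<lambda>x. ?w x * (y x)^2) integrable_on {l..r}"
    using c1 c2 by (auto intro: integrable_continuous_real)
  have "integral {l..r} (\<lambda>x. ?w x * (d / 2 * (y x)^2 - C * (y x * s x))) = d / 2 * Y2 - C * I"
  proof -
    have "(\<lambda>x. ?w x * (d / 2 * (y x)^2 - C * (y x * s x))) =
        (\<lambda>x. d / 2 * (?w x * (y x)^2) - C * (?w x * (y x * s x)))" by (auto simp: algebra_simps)
    then show ?thesis using i1 i2 unfolding I_def Y2_def
      by (simp add: integral_diff integrable_on_mult_right)
  qed
  moreover have "exp (- 2 * ep * (r - x0)) * e r - exp (- 2 * ep * (x0 - l)) * e l \<le> B"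
    unfolding B_def
    using mult_left_mono[OF abs_ge_self[of "e r"] exp_ge_zero, of "- 2 * ep * (r - x0)"]
      mult_left_mono[OF abs_ge_minus_self[of "e l"] exp_ge_zero, of "- 2 * ep * (x0 - l)"] by linarith
  ultimately have "d / 2 * Y2 - C * I \<le> B"
    using energy_weighted[OF lr(1) d C cy cs De e' eb] unfolding ep_def by linarith
  then have Y2: "Y2 \<le> 2 / d * (B + C * I)" using d by (simp add: field_simps)
  have I0: "I \<ge> 0" unfolding I_def by (intro integral_nonneg i1) (auto intro!: mult_nonneg_nonneg y0 s0)
  have B0: "B \<ge> 0" by (auto simp: B_def)
  let ?g = "\<lambda>x. (1 + M) * ((y x)^2 + y x * s x)"
  have "\<exists>a b. {a..b} \<subseteq> {l..r} \<and> {a..b} \<subseteq> {x0-1..x0+1} \<and> (y x0)^2 \<le> integral {a..b} ?g"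
  proof (rule value_le_local_integral[OF lr Dn])
    show "continuous_on {l..r} ?g" using cy cs by (auto intro!: continuous_intros)
    fix x assume "x \<in> {l..r}"
    from nb[OF this] mult_nonneg_nonneg[OF y0[of x] s0[of x]]
    show "\<bar>n' x\<bar> + (y x)^2 \<le> ?g x" by (simp add: algebra_simps)
  qed auto
  then obtain a b where ab: "{a..b} \<subseteq> {l..r}" "{a..b} \<subseteq> {x0-1..x0+1}"
      "(y x0)^2 \<le> integral {a..b} ?g" by blast
  have cg: "continuous_on {l..r} (\<lambda>x. (1 + M) * exp (2 * ep) * (?w x * (y x)^2 + ?w x * (y x * s x)))"
    by (rule continuous_on_mult[OF continuous_on_const continuous_on_add[OF c2 c1]])
  have "integral {a..b} ?g \<le> integral {a..b} (\<lambda>x. (1 + M) * exp (2 * ep) * (?w x * (y x)^2 + ?w x * (y x * s x)))"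
  proof (rule integral_le)
    show "?g integrable_on {a..b}"
      using cy cs ab(1) by (auto intro!: integrable_continuous_real continuous_intros intro: continuous_on_subset)
    show "(\<lambda>x. (1 + M) * exp (2 * ep) * (?w x * (y x)^2 + ?w x * (y x * s x))) integrable_on {a..b}"
      using continuous_on_subset[OF cg ab(1)] by (rule integrable_continuous_real)
    fix x assume x: "x \<in> {a..b}"
    then have "x \<in> {x0-1..x0+1}" using ab(2) by blast
    \<comment> \<open>Within distance 1 of \<open>x0\<close> the weight is at least
      \<open>exp (- 2 * ep)\<close>.\<close>
    then have "1 * 1 \<le> exp (2 * ep) * ?w x" using ep by (auto simp flip: exp_add simp: algebra_simps abs_if)
    then have "((y x)^2 + y x * s x) * (1 + M) \<le> ((y x)^2 + y x * s x) * (1 + M) * (exp (2 * ep) * ?w x)"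
      using mult_left_mono[of 1 "exp (2 * ep) * ?w x" "((y x)^2 + y x * s x) * (1 + M)"]
        y0[of x] s0[of x] M by simp
    then show "?g x \<le> (1 + M) * exp (2 * ep) * (?w x * (y x)^2 + ?w x * (y x * s x))"
      by (simp add: algebra_simps)
  qed
  also have "\<dots> \<le> integral {l..r} (\<lambda>x. (1 + M) * exp (2 * ep) * (?w x * (y x)^2 + ?w x * (y x * s x)))"
  proof (rule integral_subset_le[OF ab(1)])
    show "(\<lambda>x. (1 + M) * exp (2 * ep) * (?w x * (y x)^2 + ?w x * (y x * s x))) integrable_on {a..b}"
      using continuous_on_subset[OF cg ab(1)] by (rule integrable_continuous_real)
    show "(\<lambda>x. (1 + M) * exp (2 * ep) * (?w x * (y x)^2 + ?w x * (y x * s x))) integrable_on {l..r}"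
      using cg by (rule integrable_continuous_real)
  qed (use M y0 s0 in \<open>auto intro!: mult_nonneg_nonneg add_nonneg_nonneg\<close>)
  also have "\<dots> = (1 + M) * exp (2 * ep) * (Y2 + I)"
    unfolding Y2_def I_def integral_add[OF i2 i1, symmetric] by (rule integral_mult_right)
  also have "\<dots> \<le> (1 + M) * exp (2 * ep) * ((2 / d * (1 + C) + 1) * (B + I))"
  proof (intro mult_left_mono)
    have "2 / d * (B + C * I) + I \<le> (2 / d * (1 + C) + 1) * (B + I)"
      using d C B0 I0 by (simp add: field_simps)
    then show "Y2 + I \<le> (2 / d * (1 + C) + 1) * (B + I)" using Y2 by linarith
  qed (use M in auto)
  also have "\<dots> = energy_const d C M * (B + I)"
    by (simp add: energy_const_def ep_def)
  finally show ?thesis using ab(3) by (simp add: B_def I_def)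
qed

section \<open>Bounded solutions of coercive systems\<close>

lemma cmod_sq_Re: "(cmod z)^2 = Re (z * cnj z)"
  by (metis complex_norm_square Re_complex_of_real)

lemma norm_add_three_le: "norm a \<le> A \<Longrightarrow> norm b \<le> B \<Longrightarrow> norm c \<le> C \<Longrightarrow> norm (a + b + c) \<le> A + B + C"
  by (meson add_mono norm_triangle_le order_refl order_trans)

text \<open>Along a solution of \<open>u' = p / al + f1\<close>, \<open>p' = kap p / al + q u + f2\<close> the assumption
  \<open>coercive\<close> says that the derivative of the indefinite form \<open>energy\<close> is positive definite, up to
  the sources.\<close>

locale coercive_system =
  fixes al :: "real \<Rightarrow> real" and kap :: real and q w w' :: "real \<Rightarrow> complex" and a0 Q Wb d :: real
  assumes al_cont: "continuous_on UNIV al" and q_cont: "continuous_on UNIV q"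
    and a0: "a0 > 0" and al_ge: "al x \<ge> a0" and q_le: "norm (q x) \<le> Q" and kap: "kap \<ge> 0"
    and w_deriv: "(w has_vector_derivative w' x) (at x)" and w_le: "norm (w x) \<le> Wb" and Wb: "Wb > 0"
    and d: "d > 0"
    and coercive: "d * ((norm u)^2 + (norm p)^2) \<le> Re (w x) / al x * (norm p)^2
       + Re ((w' x + \<i> * complex_of_real (kap * Im (w x) / al x)) * p * cnj u)
       + (Re (w x * q x) - kap / 2 * Re (w' x)) * (norm u)^2"
begin

definition solves :: "(real \<Rightarrow> complex) \<Rightarrow> (real \<Rightarrow> complex) \<Rightarrow> real set \<Rightarrow> (real \<Rightarrow> complex) \<Rightarrow> (real \<Rightarrow> complex) \<Rightarrow> bool" where
  "solves f1 f2 A u p \<longleftrightarrow>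
     (\<forall>x\<in>A. (u has_vector_derivative p x / complex_of_real (al x) + f1 x) (at x within A) \<and>
            (p has_vector_derivative complex_of_real kap * p x / complex_of_real (al x) + q x * u x + f2 x) (at x within A))"

text \<open>The term with \<open>kap / 2\<close> removes the contribution of
  \<open>kap p / al\<close> through the real part of \<open>w\<close>: differentiating it produces
  \<open>- kap Re w\<close> times the real part of \<open>u' u\<^sup>*\<close>, with
  \<open>u' = p / al\<close> up to the source. Only the imaginary part of \<open>w\<close> survives,
  as in \<open>coercive\<close>.\<close>

definition energy :: "(real \<Rightarrow> complex) \<Rightarrow> (real \<Rightarrow> complex) \<Rightarrow> real \<Rightarrow> real" where
  "energy u p x = Re (w x * p x * cnj (u x)) - kap / 2 * Re (w x) * (norm (u x))^2"

definition amp :: "(real \<Rightarrow> complex) \<Rightarrow> (real \<Rightarrow> complex) \<Rightarrow> real \<Rightarrow> real" where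
  "amp u p x = sqrt ((norm (u x))^2 + (norm (p x))^2)"

text \<open>The constants are tailored to \<open>energy_estimate\<close>: \<open>Cb\<close> bounds
  the energy by the squared amplitude and also bounds the source terms in its derivative,
  \<open>Mb\<close> bounds the derivative of the squared amplitude. The summand 2 in
  \<open>Mb\<close> accounts for the sources there.\<close>

definition "Cb = Wb * (1 + kap)"
definition "Mb = 2 / a0 + 2 * kap / a0 + 2 * Q + 2"
definition "rate = d / (4 * Cb)"
definition "Kb = energy_const d Cb Mb"

lemma al_pos: "al x > 0" using al_ge[of x] a0 by simp

lemma Q_nonneg: "Q \<ge> 0" using q_le[of 0] norm_ge_zero order_trans by blast

lemma Cb_pos: "Cb > 0" using Wb kap by (simp add: Cb_def add_pos_nonneg)

lemma Mb_nonneg: "Mb \<ge> 0" using a0 kap Q_nonneg by (simp add: Mb_def)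

lemma rate_pos: "rate > 0" using Cb_pos d by (simp add: rate_def)

lemma Kb_pos: "Kb > 0" unfolding Kb_def using energy_const_pos[OF d Cb_pos Mb_nonneg] .

lemma amp_sq: "(amp u p x)^2 = (norm (u x))^2 + (norm (p x))^2" by (simp add: amp_def)

lemma amp_nonneg: "amp u p x \<ge> 0" by (simp add: amp_def)

lemma norm_le_amp: "norm (u x) \<le> amp u p x" "norm (p x) \<le> amp u p x"
  unfolding amp_def by (auto intro: real_le_rsqrt)

lemma amp_le: "amp u p x \<le> norm (u x) + norm (p x)"
  unfolding amp_def by (rule sqrt_sum_squares_le_sum) auto

lemma solves_subset: "solves f1 f2 A u p \<Longrightarrow> B \<subseteq> A \<Longrightarrow> solves f1 f2 B u p"
  unfolding solves_def using has_vector_derivative_within_subset by blast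

lemma solves_continuous:
  "solves f1 f2 A u p \<Longrightarrow> continuous_on A u \<and> continuous_on A p"
  unfolding solves_def by (metis continuous_on_eq_continuous_within has_vector_derivative_continuous)

lemma amp_continuous: "solves f1 f2 A u p \<Longrightarrow> continuous_on A (amp u p)"
  unfolding amp_def using solves_continuous by (auto intro!: continuous_intros)

lemma energy_le: "\<bar>energy u p x\<bar> \<le> Cb * (amp u p x)^2"
proof -
  have "\<bar>Re (w x * p x * cnj (u x))\<bar> \<le> norm (w x) * norm (p x) * norm (u x)"
    by (metis abs_Re_le_cmod complex_mod_cnj norm_mult)
  also have "\<dots> \<le> Wb * amp u p x * amp u p x"
    by (intro mult_mono w_le norm_le_amp) (auto intro!: mult_nonneg_nonneg amp_nonneg less_imp_le[OF Wb])
  finally have 1: "\<bar>Re (w x * p x * cnj (u x))\<bar> \<le> Wb * (amp u p x)^2" by (simp add: power2_eq_square mult.assoc)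
  have "\<bar>kap / 2 * Re (w x) * (norm (u x))^2\<bar> = kap / 2 * \<bar>Re (w x)\<bar> * (norm (u x))^2"
    using kap by (simp add: abs_mult)
  also have "\<dots> \<le> kap * Wb * (amp u p x)^2"
    using kap order_trans[OF abs_Re_le_cmod w_le] Wb
    by (intro mult_mono power_mono norm_le_amp) auto
  finally show ?thesis using 1 unfolding energy_def Cb_def
    by (simp add: algebra_simps)
qed

lemma energy_deriv:
  assumes "solves f1 f2 A u p" "x \<in> A"
  shows "\<exists>e'. (energy u p has_real_derivative e') (at x within A) \<and>
    d * (amp u p x)^2 - Cb * amp u p x * (norm (f1 x) + norm (f2 x)) \<le> e'"
proof -
  define u' where "u' = p x / complex_of_real (al x) + f1 x"
  define p' where "p' = complex_of_real kap * p x / complex_of_real (al x) + q x * u x + f2 x"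
  have Du: "(u has_vector_derivative u') (at x within A)" and Dp: "(p has_vector_derivative p') (at x within A)"
    using assms by (auto simp: solves_def u'_def p'_def)
  have Dw: "(w has_vector_derivative w' x) (at x within A)"
    using w_deriv has_vector_derivative_at_within by blast
  have D1: "((\<lambda>x. Re (w x * p x * cnj (u x))) has_vector_derivative
      Re (w' x * p x * cnj (u x) + w x * p' * cnj (u x) + w x * p x * cnj u')) (at x within A)"
    by (rule bounded_linear.has_vector_derivative[OF bounded_linear_Re])
      (use Dw Du Dp in \<open>auto intro!: derivative_eq_intros
         bounded_linear.has_vector_derivative[OF bounded_linear_cnj] simp: algebra_simps\<close>)
  have D2: "((\<lambda>x. Re (u x * cnj (u x))) has_vector_derivative Re (u' * cnj (u x) + u x * cnj u')) (at x within A)"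
    by (rule bounded_linear.has_vector_derivative[OF bounded_linear_Re])
      (use Du in \<open>auto intro!: derivative_eq_intros
         bounded_linear.has_vector_derivative[OF bounded_linear_cnj] simp: algebra_simps\<close>)
  have D3: "((\<lambda>x. Re (w x)) has_vector_derivative Re (w' x)) (at x within A)"
    by (rule bounded_linear.has_vector_derivative[OF bounded_linear_Re Dw])
  have eq: "energy u p = (\<lambda>x. Re (w x * p x * cnj (u x)) - kap / 2 * (Re (w x) * Re (u x * cnj (u x))))"
    by (rule ext) (simp only: energy_def cmod_sq_Re mult.assoc)
  define e' where "e' = Re (w' x * p x * cnj (u x) + w x * p' * cnj (u x) + w x * p x * cnj u')
      - kap / 2 * (Re (w' x) * (norm (u x))^2 + Re (w x) * (2 * Re (u' * cnj (u x))))"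
  have n2: "Re (u x * cnj (u x)) = (norm (u x))^2" by (simp only: cmod_sq_Re)
  have s2: "Re (u' * cnj (u x) + u x * cnj u') = 2 * Re (u' * cnj (u x))" by simp
  have "(energy u p has_real_derivative e') (at x within A)"
    unfolding eq e'_def n2[symmetric] s2[symmetric]
    by (rule DERIV_cong[OF DERIV_diff[OF D1[folded has_real_derivative_iff_has_vector_derivative]
          DERIV_cmult[OF DERIV_mult[OF D3[folded has_real_derivative_iff_has_vector_derivative]
            D2[folded has_real_derivative_iff_has_vector_derivative]]]]]) simp
  moreover
  \<comment> \<open>After the cancellation of the real part of \<open>w\<close>, the derivative
    consists of exactly the form in \<open>coercive\<close> and of terms linear in the sources,
    collected in \<open>err\<close>.\<close>
  define form where "form = Re (w x) / al x * (norm (p x))^2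
       + Re ((w' x + \<i> * complex_of_real (kap * Im (w x) / al x)) * p x * cnj (u x))
       + (Re (w x * q x) - kap / 2 * Re (w' x)) * (norm (u x))^2"
  define err where "err = w x * f2 x * cnj (u x) + w x * p x * cnj (f1 x)
      + complex_of_real (- kap * Re (w x)) * (f1 x * cnj (u x))"
  have "e' = form + Re err"
    unfolding e'_def form_def err_def u'_def p'_def
    unfolding cmod_sq_Re using al_pos[of x] by (simp add: field_simps)
  moreover have "norm err \<le> Wb * norm (f2 x) * amp u p x + Wb * amp u p x * norm (f1 x)
      + kap * Wb * (norm (f1 x) * amp u p x)"
    unfolding err_def
    by (intro norm_add_three_le; unfold norm_mult complex_mod_cnj norm_of_real;
        intro mult_mono w_le norm_le_amp order_refl)
      (use kap Wb amp_nonneg order_trans[OF abs_Re_le_cmod w_le[of x]] in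
        \<open>auto simp: abs_mult intro!: mult_mono mult_nonneg_nonneg\<close>)
  then have "norm err \<le> Cb * amp u p x * (norm (f1 x) + norm (f2 x)) - kap * Wb * (norm (f2 x) * amp u p x)"
    by (simp add: Cb_def algebra_simps)
  then have "norm err \<le> Cb * amp u p x * (norm (f1 x) + norm (f2 x))"
  proof -
    have "0 \<le> kap * Wb * (norm (f2 x) * amp u p x)" using kap Wb amp_nonneg[of u p x] by simp
    then show ?thesis using \<open>norm err \<le> _ - _\<close> by linarith
  qed
  then have "- Re err \<le> Cb * amp u p x * (norm (f1 x) + norm (f2 x))"
    using abs_Re_le_cmod[of err] by linarith
  moreover have "d * (amp u p x)^2 \<le> form"
    unfolding form_def amp_sq using coercive[of "u x" "p x" x] .
  ultimately show ?thesis by (intro exI[of _ e']) auto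
qed

lemma amp_sq_deriv:
  assumes "solves f1 f2 A u p" "x \<in> A"
  shows "\<exists>n'. ((\<lambda>x. (amp u p x)^2) has_real_derivative n') (at x within A) \<and>
    \<bar>n'\<bar> \<le> Mb * ((amp u p x)^2 + amp u p x * (norm (f1 x) + norm (f2 x)))"
proof -
  define u' where "u' = p x / complex_of_real (al x) + f1 x"
  define p' where "p' = complex_of_real kap * p x / complex_of_real (al x) + q x * u x + f2 x"
  have Du: "(u has_vector_derivative u') (at x within A)" and Dp: "(p has_vector_derivative p') (at x within A)"
    using assms by (auto simp: solves_def u'_def p'_def)
  have D: "((\<lambda>x. (norm (f x))^2) has_real_derivative 2 * Re (f' * cnj (f x))) (at x within A)"
    if "(f has_vector_derivative f') (at x within A)" for f :: "real \<Rightarrow> complex" and f'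
  proof -
    have "((\<lambda>x. Re (f x * cnj (f x))) has_vector_derivative Re (f' * cnj (f x) + f x * cnj f')) (at x within A)"
      by (rule bounded_linear.has_vector_derivative[OF bounded_linear_Re])
        (use that in \<open>auto intro!: derivative_eq_intros
           bounded_linear.has_vector_derivative[OF bounded_linear_cnj] simp: algebra_simps\<close>)
    then show ?thesis
      unfolding cmod_sq_Re by (simp add: has_real_derivative_iff_has_vector_derivative algebra_simps)
  qed
  define Y where "Y = amp u p x"
  have Y: "norm (u x) \<le> Y" "norm (p x) \<le> Y" "Y \<ge> 0" by (auto simp: Y_def norm_le_amp amp_nonneg)
  have DD: "((\<lambda>x. (amp u p x)^2) has_real_derivative 2 * Re (u' * cnj (u x)) + 2 * Re (p' * cnj (p x))) (at x within A)"
    unfolding amp_sq using D[OF Du] D[OF Dp] by (rule DERIV_add)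
  have ia: "1 / al x \<le> 1 / a0" using al_ge[of x] a0 by (simp add: frac_le)
  have nu: "norm u' \<le> 1 / a0 * Y + norm (f1 x)"
  proof -
    have "norm u' \<le> 1 / al x * norm (p x) + norm (f1 x)"
      unfolding u'_def using al_pos[of x] by (intro norm_triangle_le) (simp add: norm_divide)
    moreover have "1 / al x * norm (p x) \<le> 1 / a0 * Y" using ia Y a0 by (intro mult_mono) auto
    ultimately show ?thesis by linarith
  qed
  have np: "norm p' \<le> kap / a0 * Y + Q * Y + norm (f2 x)"
    unfolding p'_def
  proof (intro norm_add_three_le)
    have "norm (complex_of_real kap * p x / complex_of_real (al x)) = kap * (1 / al x * norm (p x))"
      using al_pos[of x] kap by (simp add: norm_divide norm_mult)
    also have "\<dots> \<le> kap * (1 / a0 * Y)"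
      using ia Y a0 kap less_imp_le[OF al_pos[of x]] by (intro mult_mono) auto
    finally show "norm (complex_of_real kap * p x / complex_of_real (al x)) \<le> kap / a0 * Y" by simp
    show "norm (q x * u x) \<le> Q * Y"
      unfolding norm_mult using q_le Y Q_nonneg by (intro mult_mono) auto
  qed auto
  have "\<bar>Re (u' * cnj (u x))\<bar> \<le> (1 / a0 * Y + norm (f1 x)) * Y"
    by (rule order_trans[OF abs_Re_le_cmod]) (use nu Y order_trans[OF norm_ge_zero nu] in \<open>auto simp: norm_mult intro!: mult_mono\<close>)
  moreover have "\<bar>Re (p' * cnj (p x))\<bar> \<le> (kap / a0 * Y + Q * Y + norm (f2 x)) * Y"
    by (rule order_trans[OF abs_Re_le_cmod]) (use np Y order_trans[OF norm_ge_zero np] in \<open>auto simp: norm_mult intro!: mult_mono\<close>)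
  ultimately have "\<bar>2 * Re (u' * cnj (u x)) + 2 * Re (p' * cnj (p x))\<bar>
      \<le> 2 * ((1 / a0 * Y + norm (f1 x)) * Y) + 2 * ((kap / a0 * Y + Q * Y + norm (f2 x)) * Y)"
    by linarith
  also have "\<dots> = (Mb - 2) * Y^2 + 2 * (Y * (norm (f1 x) + norm (f2 x)))"
    by (simp add: Mb_def algebra_simps power2_eq_square)
  also have "\<dots> \<le> Mb * Y^2 + Mb * (Y * (norm (f1 x) + norm (f2 x)))"
    using Y a0 kap Q_nonneg by (intro add_mono mult_right_mono) (auto simp: Mb_def)
  finally show ?thesis
    by (intro exI[of _ "2 * Re (u' * cnj (u x)) + 2 * Re (p' * cnj (p x))"] conjI DD)
      (simp add: Y_def algebra_simps)
qed

lemma amp_estimate: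
  assumes "solves f1 f2 {l..r} u p" "x0 \<in> {l..r}" "l + 2 \<le> r"
    and "continuous_on {l..r} f1" "continuous_on {l..r} f2"
  shows "(amp u p x0)^2 \<le> Kb *
     (exp (- 2 * rate * (r - x0)) * \<bar>energy u p r\<bar> + exp (- 2 * rate * (x0 - l)) * \<bar>energy u p l\<bar> +
      integral {l..r} (\<lambda>x. exp (- 2 * rate * \<bar>x - x0\<bar>) * (amp u p x * (norm (f1 x) + norm (f2 x)))))"
proof -
  obtain e' where e': "\<And>x. x \<in> {l..r} \<Longrightarrow> (energy u p has_real_derivative e' x) (at x within {l..r}) \<and>
    d * (amp u p x)^2 - Cb * amp u p x * (norm (f1 x) + norm (f2 x)) \<le> e' x"
    using energy_deriv[OF assms(1)] by metis
  obtain n' where n': "\<And>x. x \<in> {l..r} \<Longrightarrow> ((\<lambda>x. (amp u p x)^2) has_real_derivative n' x) (at x within {l..r}) \<and>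
    \<bar>n' x\<bar> \<le> Mb * ((amp u p x)^2 + amp u p x * (norm (f1 x) + norm (f2 x)))"
    using amp_sq_deriv[OF assms(1)] by metis
  show ?thesis
    unfolding Kb_def rate_def
    by (rule energy_estimate[where e' = e' and n' = n'])
      (use assms e' n' d Cb_pos Mb_nonneg amp_continuous[OF assms(1)] in
        \<open>auto intro!: continuous_intros amp_nonneg energy_le\<close>)
qed

end

section \<open>Integrals against exponential kernels\<close>

lemma exp_neg_of_nat_tendsto: "c > 0 \<Longrightarrow> (\<lambda>n. exp (- c * real n)) \<longlonglongrightarrow> 0"
  by (rule filterlim_compose[OF exp_at_bot filterlim_tendsto_neg_mult_at_bot[OF tendsto_const]])
    (auto simp: filterlim_real_sequentially)

lemma has_bochner_integral_exp_half:
  assumes "\<epsilon> > (0::real)"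
  shows "has_bochner_integral lborel (\<lambda>x. exp (- \<epsilon> * x) * indicator {0..} x) (1 / \<epsilon>)"
proof (rule has_bochner_integral_nn_integral)
  have "(\<integral>\<^sup>+ x. ennreal (exp (- \<epsilon> * x)) * indicator {0..} x \<partial>lborel) = ennreal (0 - (- exp (- \<epsilon> * 0) / \<epsilon>))"
  proof (rule nn_integral_FTC_atLeast)
    show "((\<lambda>x. - exp (- \<epsilon> * x) / \<epsilon>) has_real_derivative exp (- \<epsilon> * x)) (at x)" for x
      using assms by (auto intro!: derivative_eq_intros)
    have "((\<lambda>x. exp (- \<epsilon> * x)) \<longlongrightarrow> 0) at_top"
      by (rule filterlim_compose[OF exp_at_bot filterlim_tendsto_neg_mult_at_bot[OF tendsto_const]])
        (use assms in \<open>auto simp: filterlim_ident\<close>)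
    then show "((\<lambda>x. - exp (- \<epsilon> * x) / \<epsilon>) \<longlongrightarrow> 0) at_top"
      using tendsto_divide[OF tendsto_minus tendsto_const, of _ 0 _ \<epsilon>] assms by force
  qed auto
  then show "(\<integral>\<^sup>+ x. ennreal (exp (- \<epsilon> * x) * indicator {0..} x) \<partial>lborel) = ennreal (1 / \<epsilon>)"
    by (simp add: ennreal_mult' ennreal_indicator)
qed (use assms in auto)

lemma has_bochner_integral_exp_abs:
  assumes "\<epsilon> > (0::real)"
  shows "has_bochner_integral lborel (\<lambda>x. exp (- \<epsilon> * \<bar>x - x0\<bar>)) (2 / \<epsilon>)"
proof -
  let ?h = "\<lambda>x::real. exp (- \<epsilon> * x) * indicator {0..} x"
  have h: "has_bochner_integral lborel ?h (1 / \<epsilon>)"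
    by (rule has_bochner_integral_exp_half[OF assms])
  have s: "has_bochner_integral lborel (\<lambda>x. ?h (t + c * x)) (1 / \<epsilon>)" if "\<bar>c\<bar> = 1" for c t :: real
    using h that by (subst (asm) lborel_has_bochner_integral_real_affine_iff[of c _ _ t]) auto
  have "has_bochner_integral lborel (\<lambda>x. ?h (- x0 + 1 * x) + ?h (x0 + (-1) * x)) (1 / \<epsilon> + 1 / \<epsilon>)"
    by (intro has_bochner_integral_add s) auto
  \<comment> \<open>Both half line pieces contribute at \<open>x0\<close> itself; this single point
    is discarded.\<close>
  moreover have "AE x in lborel. ?h (- x0 + 1 * x) + ?h (x0 + (-1) * x) = exp (- \<epsilon> * \<bar>x - x0\<bar>)"
    using AE_lborel_singleton[of x0]
    by eventually_elim (auto simp: indicator_def abs_if algebra_simps)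
  ultimately show ?thesis
    by (subst has_bochner_integral_cong_AE[where g = "\<lambda>x. ?h (- x0 + 1 * x) + ?h (x0 + (-1) * x)"]) auto
qed

lemma integrable_exp_abs: "\<epsilon> > 0 \<Longrightarrow> integrable lborel (\<lambda>x::real. exp (- \<epsilon> * \<bar>x - x0\<bar>))"
  using has_bochner_integral_exp_abs by (metis has_bochner_integral_iff)

lemma integral_exp_abs: "\<epsilon> > 0 \<Longrightarrow> (LINT x|lborel. exp (- \<epsilon> * \<bar>x - x0\<bar>)) = 2 / (\<epsilon>::real)"
  using has_bochner_integral_exp_abs by (metis has_bochner_integral_iff)

lemma integrable_exp_abs_mult:
  fixes g :: "real \<Rightarrow> 'a::{banach,second_countable_topology,real_normed_field}"
  assumes "\<epsilon> > 0" "g \<in> borel_measurable lborel" "\<And>x. norm (g x) \<le> B"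
  shows "integrable lborel (\<lambda>x. exp (- \<epsilon> * \<bar>x - x0\<bar>) *\<^sub>R g x)"
proof (rule Bochner_Integration.integrable_bound)
  show "integrable lborel (\<lambda>x. B * exp (- \<epsilon> * \<bar>x - x0\<bar>))"
    using integrable_exp_abs[OF assms(1)] by auto
  show "AE x in lborel. norm (exp (- \<epsilon> * \<bar>x - x0\<bar>) *\<^sub>R g x) \<le> norm (B * exp (- \<epsilon> * \<bar>x - x0\<bar>))"
  proof (intro AE_I2)
    fix x show "norm (exp (- \<epsilon> * \<bar>x - x0\<bar>) *\<^sub>R g x) \<le> norm (B * exp (- \<epsilon> * \<bar>x - x0\<bar>))"
      using mult_left_mono[OF assms(3)[of x], of "exp (- \<epsilon> * \<bar>x - x0\<bar>)"]
        order_trans[OF norm_ge_zero assms(3)[of x]] by (simp add: abs_mult mult.commute)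
  qed
qed (use assms(2) in measurable)

lemma integral_interval_le_lborel:
  fixes g :: "real \<Rightarrow> real"
  assumes "integrable lborel g" "continuous_on UNIV g" "\<And>x. g x \<ge> 0"
  shows "integral {l..r} g \<le> (LINT x|lborel. g x)"
proof -
  have "integral {l..r} g \<le> integral UNIV g"
    by (rule integral_subset_le)
      (use assms in \<open>auto intro: integrable_continuous_real continuous_on_subset integrable_on_lborel\<close>)
  then show ?thesis using integral_lborel[OF assms(1)] by simp
qed

context coercive_system
begin

lemma solves_lin:
  assumes "solves f1 f2 A u p" "solves g1 g2 A v r"
  shows "solves (\<lambda>x. f1 x + c * g1 x) (\<lambda>x. f2 x + c * g2 x) A (\<lambda>x. u x + c * v x) (\<lambda>x. p x + c * r x)"
  using assms unfolding solves_def
  by (fastforce intro!: derivative_eq_intros simp: algebra_simps add_divide_distrib)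

lemma ivp_exists:
  assumes "continuous_on UNIV f1" "continuous_on UNIV f2" "\<And>x. norm (f1 x) \<le> F0" "\<And>x. norm (f2 x) \<le> F0"
  shows "\<exists>u p. solves f1 f2 {l..r} u p \<and> u l = u0 \<and> p l = p0"
proof -
  define f where "f = (\<lambda>t (v::complex \<times> complex). (snd v / complex_of_real (al t) + f1 t,
      complex_of_real kap * snd v / complex_of_real (al t) + q t * fst v + f2 t))"
  define L where "L = 1 / a0 + kap / a0 + Q"
  have bl: "norm (a / complex_of_real (al t)) \<le> 1 / a0 * norm a" for a t
    using al_ge[of t] a0 by (simp add: norm_divide frac_le)
  have "\<exists>z. z l = (u0, p0) \<and> continuous_on UNIV z \<and>
       (\<forall>t\<ge>l. (z has_vector_derivative f t (z t)) (at t within {l..}))"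
  proof (rule lipschitz_ivp_exists)
    fix t and x y :: "complex \<times> complex"
    define a b where "a = fst (x - y)" and "b = snd (x - y)"
    have n: "norm a \<le> norm (x - y)" "norm b \<le> norm (x - y)"
      unfolding a_def b_def by (metis norm_fst_le norm_snd_le prod.collapse)+
    have eq: "f t x - f t y = (b / complex_of_real (al t),
        complex_of_real kap * (b / complex_of_real (al t)) + q t * a)"
      by (simp add: f_def a_def b_def diff_divide_distrib algebra_simps prod_eq_iff)
    have "norm (f t x - f t y) \<le> norm (b / complex_of_real (al t))
        + norm (complex_of_real kap * (b / complex_of_real (al t)) + q t * a)"
      unfolding eq norm_Pair by (rule sqrt_sum_squares_le_sum) auto
    also have "\<dots> \<le> norm (b / complex_of_real (al t)) + (kap * norm (b / complex_of_real (al t)) + norm (q t) * norm a)"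
      using kap by (intro add_left_mono norm_triangle_le) (simp only: norm_mult norm_of_real abs_of_nonneg order_refl)
    also have "\<dots> \<le> 1 / a0 * norm (x - y) + (kap * (1 / a0 * norm (x - y)) + Q * norm (x - y))"
      using n q_le[of t] kap a0 Q_nonneg bl[of b t] mult_left_mono[OF n(2), of "1 / a0"]
      by (intro add_mono mult_mono) auto
    finally show "norm (f t x - f t y) \<le> L * norm (x - y)" by (simp add: L_def algebra_simps)
  next
    fix z :: "real \<Rightarrow> complex \<times> complex" assume "continuous_on UNIV z"
    then show "continuous_on UNIV (\<lambda>t. f t (z t))"
      unfolding f_def using al_pos
      by (intro continuous_intros assms q_cont al_cont) (auto simp: less_le)
  next
    fix t have "norm (f t 0) \<le> norm (f1 t) + norm (f2 t)"
      unfolding f_def by (simp add: norm_Pair sqrt_sum_squares_le_sum)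
    then show "norm (f t 0) \<le> 2 * F0" using assms(3,4)[of t] by simp
  next
    show "L \<ge> 0" using a0 kap Q_nonneg by (simp add: L_def)
  qed
  then obtain z where z: "z l = (u0, p0)"
    "\<And>t. t \<ge> l \<Longrightarrow> (z has_vector_derivative f t (z t)) (at t within {l..})" by blast
  have zd: "(z has_vector_derivative f t (z t)) (at t within {l..r})" if "t \<in> {l..r}" for t
    by (rule has_vector_derivative_within_subset[OF z(2)]) (use that in auto)
  have "solves f1 f2 {l..r} (fst \<circ> z) (snd \<circ> z)"
    unfolding solves_def
    using bounded_linear.has_vector_derivative[OF bounded_linear_fst zd]
      bounded_linear.has_vector_derivative[OF bounded_linear_snd zd]
    by (auto simp: f_def o_def)
  then show ?thesis using z(1) by (intro exI[of _ "fst \<circ> z"] exI[of _ "snd \<circ> z"]) auto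
qed

section \<open>Dirichlet problems on long intervals and their limit\<close>

lemma energy_zero: "u x = 0 \<Longrightarrow> energy u p x = 0" by (simp add: energy_def)

text \<open>The boundary energies vanish with \<open>u\<close>. At a maximum point \<open>x0\<close>
  of the amplitude the quadratic estimate has the right side \<open>amp u p x0\<close> times
  \<open>F0\<close> times an integrated exponential, and one factor \<open>amp u p x0\<close>
  cancels. The constant does not depend on the length of the interval.\<close>

lemma bvp_bound:
  assumes "solves f1 f2 {l..r} u p" "u l = 0" "u r = 0" "l + 2 \<le> r"
    and "continuous_on UNIV f1" "continuous_on UNIV f2" "\<And>x. norm (f1 x) + norm (f2 x) \<le> F0"
    and x: "x \<in> {l..r}"
  shows "amp u p x \<le> Kb * F0 / rate"
proof -
  have cam: "continuous_on {l..r} (amp u p)" by (rule amp_continuous[OF assms(1)])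
  have "\<exists>x0\<in>{l..r}. \<forall>y\<in>{l..r}. amp u p y \<le> amp u p x0"
    using cam assms(4) by (intro continuous_attains_sup) auto
  then obtain x0 where x0: "x0 \<in> {l..r}" and mx: "\<And>y. y \<in> {l..r} \<Longrightarrow> amp u p y \<le> amp u p x0" by blast
  have F0: "F0 \<ge> 0" using order_trans[OF add_nonneg_nonneg[OF norm_ge_zero norm_ge_zero] assms(7)] .
  let ?g = "\<lambda>x. amp u p x0 * F0 * exp (- (2 * rate) * \<bar>x - x0\<bar>)"
  have "(amp u p x0)^2 \<le> Kb * integral {l..r}
      (\<lambda>x. exp (- 2 * rate * \<bar>x - x0\<bar>) * (amp u p x * (norm (f1 x) + norm (f2 x))))"
    using amp_estimate[OF assms(1) x0 assms(4)] assms(2,3,5,6)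
    by (simp add: energy_zero continuous_on_subset)
  also have "\<dots> \<le> Kb * integral {l..r} ?g"
  proof (rule mult_left_mono[OF integral_le less_imp_le[OF Kb_pos]])
    show "(\<lambda>x. exp (- 2 * rate * \<bar>x - x0\<bar>) * (amp u p x * (norm (f1 x) + norm (f2 x)))) integrable_on {l..r}"
      using cam assms(5,6)
      by (auto intro!: integrable_continuous_real continuous_intros intro: continuous_on_subset)
    show "?g integrable_on {l..r}"
      by (auto intro!: integrable_continuous_real continuous_intros)
    fix y assume "y \<in> {l..r}"
    then have "amp u p y * (norm (f1 y) + norm (f2 y)) \<le> amp u p x0 * F0"
      using mx assms(7) by (intro mult_mono amp_nonneg) auto
    then show "exp (- 2 * rate * \<bar>y - x0\<bar>) * (amp u p y * (norm (f1 y) + norm (f2 y))) \<le> ?g y"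
      by (simp add: mult.commute)
  qed
  also have "\<dots> \<le> Kb * (amp u p x0 * F0 * (2 / (2 * rate)))"
  proof (rule mult_left_mono[OF _ less_imp_le[OF Kb_pos]])
    have "integral {l..r} ?g \<le> (LINT x|lborel. ?g x)"
      by (rule integral_interval_le_lborel)
        (use integrable_exp_abs[of "2 * rate" x0] rate_pos F0 amp_nonneg[of u p x0] in
          \<open>auto intro!: continuous_intros integrable_mult_right mult_nonneg_nonneg\<close>)
    also have "\<dots> = amp u p x0 * F0 * (2 / (2 * rate))"
      using integral_exp_abs[of "2 * rate" x0] rate_pos by simp
    finally show "integral {l..r} ?g \<le> amp u p x0 * F0 * (2 / (2 * rate))" .
  qed
  finally have "amp u p x0 * amp u p x0 \<le> (Kb * F0 / rate) * amp u p x0"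
    by (simp add: power2_eq_square algebra_simps)
  then have "amp u p x0 \<le> Kb * F0 / rate"
    using amp_nonneg[of u p x0] Kb_pos F0 rate_pos mult_right_le_imp_le[of "amp u p x0" "amp u p x0" "Kb * F0 / rate"]
    by (cases "amp u p x0 = 0") auto
  then show ?thesis using mx[OF x] by linarith
qed

text \<open>Shooting from the left end: the homogeneous solution with \<open>v l = 0\<close> and
  nonzero \<open>p\<close>-component cannot vanish at \<open>r\<close>, because
  \<open>bvp_bound\<close> with vanishing sources would make it zero. A multiple of it corrects the
  value of any particular solution at \<open>r\<close>.\<close>

lemma bvp_exists:
  assumes "continuous_on UNIV f1" "continuous_on UNIV f2" "\<And>x. norm (f1 x) \<le> F0" "\<And>x. norm (f2 x) \<le> F0"
    and lr: "l + 2 \<le> r"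
  shows "\<exists>u p. solves f1 f2 {l..r} u p \<and> u l = 0 \<and> u r = 0"
proof -
  obtain u p where up: "solves f1 f2 {l..r} u p" "u l = 0" using ivp_exists[OF assms(1-4)] by blast
  obtain v r' where v: "solves (\<lambda>_. 0) (\<lambda>_. 0) {l..r} v r'" "v l = 0" "r' l = 1"
    using ivp_exists[of "\<lambda>_. 0" "\<lambda>_. 0" 0] by fastforce
  have "v r \<noteq> 0"
  proof
    assume "v r = 0"
    then have "amp v r' l \<le> Kb * 0 / rate"
      by (intro bvp_bound[OF v(1,2)]) (use lr in auto)
    then show False using norm_le_amp(2)[of r' l v] v(3) by simp
  qed
  then show ?thesis
    using solves_lin[OF up(1) v(1), of "- u r / v r"] up(2) v(2)
    by (intro exI[of _ "\<lambda>x. u x + (- u r / v r) * v x"] exI[of _ "\<lambda>x. p x + (- u r / v r) * r' x"]) auto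
qed

text \<open>Two Dirichlet solutions on nested intervals differ by a homogeneous solution on the
  smaller one, whose boundary energies are bounded uniformly. \<open>amp_estimate\<close> then makes
  the difference exponentially small far from the ends, so that the solutions form a Cauchy
  sequence, uniformly on compact sets.\<close>

theorem bounded_solution_exists:
  assumes f: "continuous_on UNIV f1" "continuous_on UNIV f2" "\<And>x. norm (f1 x) \<le> F0" "\<And>x. norm (f2 x) \<le> F0"
  shows "\<exists>u p B. solves f1 f2 UNIV u p \<and> (\<forall>x. amp u p x \<le> B)"
proof -
  have F0: "norm (f1 x) + norm (f2 x) \<le> 2 * F0" for x using f(3,4)[of x] by simp
  have "\<exists>u p. solves f1 f2 {- real (Suc n)..real (Suc n)} u p \<and> u (- real (Suc n)) = 0 \<and> u (real (Suc n)) = 0" for n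
    by (rule bvp_exists[OF f]) auto
  then obtain U P where UP: "\<And>n. solves f1 f2 {- real (Suc n)..real (Suc n)} (U n) (P n)"
      "\<And>n. U n (- real (Suc n)) = 0" "\<And>n. U n (real (Suc n)) = 0" by metis
  define S where "S = Kb * (2 * F0) / rate"
  have S: "amp (U n) (P n) x \<le> S" if "\<bar>x\<bar> \<le> real (Suc n)" for n x
    unfolding S_def by (rule bvp_bound[OF UP(1-3)]) (use that f F0 in auto)
  \<comment> \<open>The factor 8 consists of two end points and of the 4 from the squared amplitude
    bound \<open>2 * S\<close> for a difference. The ends lie at \<open>real (Suc n)\<close>, so a
    point with modulus at most \<open>R\<close> has at least the distance \<open>real n - R\<close>
    to them.\<close>
  define b where "b = (\<lambda>R n. sqrt (8 * Kb * Cb * S^2 * exp (- 2 * rate * (real n - R))))"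
  have diff: "amp (\<lambda>x. U n x - U m x) (\<lambda>x. P n x - P m x) x \<le> b R n"
    if "n \<le> m" "\<bar>x\<bar> \<le> R" "R \<le> real n" for n m x R
  proof -
    let ?l = "- real (Suc n)" and ?r = "real (Suc n)"
    let ?v = "\<lambda>x. U n x - U m x" and ?s = "\<lambda>x. P n x - P m x"
    have "solves f1 f2 {?l..?r} (U m) (P m)" by (rule solves_subset[OF UP(1)]) (use that in auto)
    from solves_lin[OF UP(1)[of n] this, of "-1"]
    have sol: "solves (\<lambda>_. 0) (\<lambda>_. 0) {?l..?r} ?v ?s" by simp
    have A: "\<bar>energy ?v ?s y\<bar> \<le> 4 * Cb * S^2" if "\<bar>y\<bar> \<le> ?r" for y
    proof -
      have "(amp ?v ?s y)^2 \<le> (2 * S)^2"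
      proof (rule power_mono)
        have "amp ?v ?s y = norm ((U n y, P n y) - (U m y, P m y))" by (simp add: amp_def norm_Pair)
        also have "\<dots> \<le> amp (U n) (P n) y + amp (U m) (P m) y"
          using norm_triangle_ineq4[of "(U n y, P n y)" "(U m y, P m y)"]
          by (simp only: amp_def norm_Pair)
        also have "\<dots> \<le> 2 * S" using S[of y n] S[of y m] that \<open>n \<le> m\<close> by simp
        finally show "amp ?v ?s y \<le> 2 * S" .
      qed (rule amp_nonneg)
      then have "Cb * (amp ?v ?s y)^2 \<le> Cb * (4 * S^2)" using Cb_pos by (intro mult_left_mono) (auto simp: power_mult_distrib)
      then show ?thesis using energy_le[of ?v ?s y] by simp
    qed
    have "(amp ?v ?s x)^2 \<le> Kb * (exp (- 2 * rate * (?r - x)) * \<bar>energy ?v ?s ?r\<bar> + exp (- 2 * rate * (x - ?l)) * \<bar>energy ?v ?s ?l\<bar>)"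
    proof -
      have "x \<in> {?l..?r}" "?l + 2 \<le> ?r" using that by auto
      from amp_estimate[OF sol this continuous_on_const continuous_on_const]
      show ?thesis by (simp only: norm_zero add_0_right mult_zero_right integral_0)
    qed
    also have "\<dots> \<le> Kb * (exp (- 2 * rate * (real n - R)) * (4 * Cb * S^2) + exp (- 2 * rate * (real n - R)) * (4 * Cb * S^2))"
      using Kb_pos rate_pos that by (intro mult_left_mono add_mono mult_mono A) auto
    finally have "(amp ?v ?s x)^2 \<le> 8 * Kb * Cb * S^2 * exp (- 2 * rate * (real n - R))" by (simp add: algebra_simps)
    then show ?thesis unfolding b_def by (rule real_le_rsqrt)
  qed
  have blim: "b R \<longlonglongrightarrow> 0" for R
  proof -
    have "(\<lambda>n. exp (2 * rate * R) * exp (- (2 * rate) * real n)) \<longlonglongrightarrow> exp (2 * rate * R) * 0"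
      using rate_pos by (intro tendsto_intros exp_neg_of_nat_tendsto) auto
    then have "(\<lambda>n. exp (- 2 * rate * (real n - R))) \<longlonglongrightarrow> 0" by (simp add: algebra_simps flip: exp_add)
    then have "(\<lambda>n. sqrt (8 * Kb * Cb * S^2 * exp (- 2 * rate * (real n - R)))) \<longlonglongrightarrow> sqrt (8 * Kb * Cb * S^2 * 0)"
      by (intro tendsto_intros)
    then show ?thesis by (simp add: b_def)
  qed
  have conv: "convergent (\<lambda>n. Z n x)" if "Z = U \<or> Z = P" for Z x
  proof (rule Cauchy_convergent, rule metric_CauchyI)
    fix e :: real assume "e > 0"
    with blim[of "\<bar>x\<bar>"] have "\<forall>\<^sub>F n in sequentially. b \<bar>x\<bar> n < e / 2"
      by (intro order_tendstoD) auto
    then obtain N where N: "\<And>n. n \<ge> N \<Longrightarrow> b \<bar>x\<bar> n < e / 2" by (auto simp: eventually_sequentially)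
    define N' where "N' = max N (nat \<lceil>\<bar>x\<bar>\<rceil>)"
    have "norm (Z N' x - Z m x) < e / 2" if "m \<ge> N'" for m
    proof -
      have "\<bar>x\<bar> \<le> real N'" by (simp add: N'_def) linarith
      from diff[OF that order_refl this] N[of N'] show ?thesis
        using norm_le_amp[of "\<lambda>x. U N' x - U m x" x "\<lambda>x. P N' x - P m x"]
          norm_le_amp(2)[of "\<lambda>x. P N' x - P m x" x "\<lambda>x. U N' x - U m x"] \<open>Z = U \<or> Z = P\<close>
        by (auto simp: N'_def)
    qed
    then have h: "dist (Z N' x) (Z m x) < e / 2" if "m \<ge> N'" for m using that by (simp add: dist_norm)
    have "dist (Z m x) (Z n x) < e" if "m \<ge> N'" "n \<ge> N'" for m n
      by (rule dist_triangle_half_r[OF h h]) (use that in auto)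
    then show "\<exists>M. \<forall>m\<ge>M. \<forall>n\<ge>M. dist (Z m x) (Z n x) < e" by blast
  qed
  define u where "u = (\<lambda>x. lim (\<lambda>n. U n x))"
  define p where "p = (\<lambda>x. lim (\<lambda>n. P n x))"
  have ulim: "(\<lambda>n. U n x) \<longlonglongrightarrow> u x" and plim: "(\<lambda>n. P n x) \<longlonglongrightarrow> p x" for x
    using conv[of U x] conv[of P x] by (auto simp: u_def p_def convergent_LIMSEQ_iff)
  have ud: "norm (U n x - u x) \<le> b R n" and pd: "norm (P n x - p x) \<le> b R n"
    if "\<bar>x\<bar> \<le> R" "R \<le> real n" for R n x
  proof -
    have "(\<lambda>m. norm (U n x - U m x)) \<longlonglongrightarrow> norm (U n x - u x)" by (intro tendsto_intros ulim)
    then show "norm (U n x - u x) \<le> b R n"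
    proof (rule Lim_bounded)
      show "\<forall>m\<ge>n. norm (U n x - U m x) \<le> b R n"
      proof (intro allI impI)
        fix m assume "n \<le> m"
        from diff[OF this that] norm_le_amp(1)[of "\<lambda>x. U n x - U m x" x "\<lambda>x. P n x - P m x"]
        show "norm (U n x - U m x) \<le> b R n" by linarith
      qed
    qed
    have "(\<lambda>m. norm (P n x - P m x)) \<longlonglongrightarrow> norm (P n x - p x)" by (intro tendsto_intros plim)
    then show "norm (P n x - p x) \<le> b R n"
    proof (rule Lim_bounded)
      show "\<forall>m\<ge>n. norm (P n x - P m x) \<le> b R n"
      proof (intro allI impI)
        fix m assume "n \<le> m"
        from diff[OF this that] norm_le_amp(2)[of "\<lambda>x. P n x - P m x" x "\<lambda>x. U n x - U m x"]
        show "norm (P n x - P m x) \<le> b R n" by linarith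
      qed
    qed
  qed
  have "solves f1 f2 UNIV u p"
    unfolding solves_def
  proof (intro ballI)
    fix x :: real
    define R where "R = \<bar>x\<bar> + 1"
    \<comment> \<open>Dropping the first \<open>N\<close> solutions leaves those that are defined on
      all of \<open>{- R..R}\<close>. There \<open>ud\<close> and \<open>pd\<close> give uniform
      convergence of the solutions, hence of the right sides of the system, and the limit can be
      taken in the derivatives.\<close>
    define N where "N = nat \<lceil>R\<rceil>"
    have RN: "R \<le> real (n + N)" for n unfolding N_def by linarith
    let ?I = "{- R..R}"
    have xI: "x \<in> ?I" "x \<in> interior ?I" by (auto simp: R_def)
    have I: "y \<in> ?I \<Longrightarrow> \<bar>y\<bar> \<le> R" for y by auto
    have sub: "solves f1 f2 ?I (U (n + N)) (P (n + N))" for n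
      by (rule solves_subset[OF UP(1)]) (use RN[of n] in auto)
    have bl: "norm (a / complex_of_real (al t)) \<le> 1 / a0 * norm a" for a t
      using al_ge[of t] a0 by (simp add: norm_divide frac_le)
    have blN: "(\<lambda>n. b R (n + N)) \<longlonglongrightarrow> 0" by (rule LIMSEQ_ignore_initial_segment[OF blim])
    have "\<exists>g. \<forall>y\<in>?I. (\<lambda>n. U (n + N) y) \<longlonglongrightarrow> g y \<and>
        (g has_derivative (\<lambda>h. h *\<^sub>R (p y / complex_of_real (al y) + f1 y))) (at y within ?I)"
    proof (rule has_derivative_sequence[where f' = "\<lambda>n y h. h *\<^sub>R (P (n + N) y / complex_of_real (al y) + f1 y)"])
      show "(\<lambda>n. U (n + N) x) \<longlonglongrightarrow> u x" by (rule LIMSEQ_ignore_initial_segment[OF ulim])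
      show "((U (n + N)) has_derivative (\<lambda>h. h *\<^sub>R (P (n + N) y / complex_of_real (al y) + f1 y))) (at y within ?I)"
        if "y \<in> ?I" for n y using sub[of n] that by (auto simp: solves_def has_vector_derivative_def)
      fix e :: real assume e: "e > 0"
      have "(\<lambda>n. 1 / a0 * b R (n + N)) \<longlonglongrightarrow> 1 / a0 * 0" by (intro tendsto_intros blN)
      then have "\<forall>\<^sub>F n in sequentially. 1 / a0 * b R (n + N) < e" using e by (intro order_tendstoD) auto
      then show "\<forall>\<^sub>F n in sequentially. \<forall>y\<in>?I. \<forall>h. norm (h *\<^sub>R (P (n + N) y / complex_of_real (al y) + f1 y) -
          h *\<^sub>R (p y / complex_of_real (al y) + f1 y)) \<le> e * norm h"
      proof (eventually_elim, intro ballI allI)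
        fix n y and h :: real assume n: "1 / a0 * b R (n + N) < e" and y: "y \<in> ?I"
        have "norm ((P (n + N) y - p y) / complex_of_real (al y)) \<le> 1 / a0 * b R (n + N)"
          by (rule order_trans[OF bl mult_left_mono[OF pd[OF I[OF y] RN[of n]]]]) (use a0 in auto)
        then have "norm ((P (n + N) y - p y) / complex_of_real (al y)) \<le> e" using n by linarith
        then show "norm (h *\<^sub>R (P (n + N) y / complex_of_real (al y) + f1 y) -
          h *\<^sub>R (p y / complex_of_real (al y) + f1 y)) \<le> e * norm h"
          by (simp add: mult.commute[of e] mult_left_mono diff_divide_distrib flip: scaleR_diff_right)
      qed
    qed (use xI in auto)
    then obtain g where g: "\<And>y. y \<in> ?I \<Longrightarrow> (\<lambda>n. U (n + N) y) \<longlonglongrightarrow> g y"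
        "\<And>y. y \<in> ?I \<Longrightarrow> (g has_derivative (\<lambda>h. h *\<^sub>R (p y / complex_of_real (al y) + f1 y))) (at y within ?I)" by blast
    have gu: "g y = u y" if "y \<in> ?I" for y
      using LIMSEQ_unique[OF g(1)[OF that] LIMSEQ_ignore_initial_segment[OF ulim]] .
    have "(u has_vector_derivative (p x / complex_of_real (al x) + f1 x)) (at x within ?I)"
      using has_derivative_transform[OF xI(1) gu[symmetric] g(2)[OF xI(1)]] by (simp add: has_vector_derivative_def)
    then have 1: "(u has_vector_derivative (p x / complex_of_real (al x) + f1 x)) (at x)"
      using at_within_interior[OF xI(2)] by simp
    let ?D = "\<lambda>p u y. complex_of_real kap * p y / complex_of_real (al y) + q y * u y + f2 y"
    have "\<exists>g. \<forall>y\<in>?I. (\<lambda>n. P (n + N) y) \<longlonglongrightarrow> g y \<and>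
        (g has_derivative (\<lambda>h. h *\<^sub>R ?D p u y)) (at y within ?I)"
    proof (rule has_derivative_sequence[where f' = "\<lambda>n y h. h *\<^sub>R ?D (P (n + N)) (U (n + N)) y"])
      show "(\<lambda>n. P (n + N) x) \<longlonglongrightarrow> p x" by (rule LIMSEQ_ignore_initial_segment[OF plim])
      show "((P (n + N)) has_derivative (\<lambda>h. h *\<^sub>R ?D (P (n + N)) (U (n + N)) y)) (at y within ?I)"
        if "y \<in> ?I" for n y using sub[of n] that by (auto simp: solves_def has_vector_derivative_def)
      fix e :: real assume e: "e > 0"
      have "(\<lambda>n. (kap / a0 + Q) * b R (n + N)) \<longlonglongrightarrow> (kap / a0 + Q) * 0" by (intro tendsto_intros blN)
      then have "\<forall>\<^sub>F n in sequentially. (kap / a0 + Q) * b R (n + N) < e" using e by (intro order_tendstoD) auto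
      then show "\<forall>\<^sub>F n in sequentially. \<forall>y\<in>?I. \<forall>h. norm (h *\<^sub>R ?D (P (n + N)) (U (n + N)) y -
          h *\<^sub>R ?D p u y) \<le> e * norm h"
      proof (eventually_elim, intro ballI allI)
        fix n y and h :: real assume n: "(kap / a0 + Q) * b R (n + N) < e" and y: "y \<in> ?I"
        have "norm ((P (n + N) y - p y) / complex_of_real (al y)) \<le> 1 / a0 * b R (n + N)"
          by (rule order_trans[OF bl mult_left_mono[OF pd[OF I[OF y] RN[of n]]]]) (use a0 in auto)
        then have "norm (complex_of_real kap * ((P (n + N) y - p y) / complex_of_real (al y))) \<le> kap * (1 / a0 * b R (n + N))"
          unfolding norm_mult norm_of_real using kap by (simp only: abs_of_nonneg mult_left_mono)
        moreover have "norm (q y * (U (n + N) y - u y)) \<le> Q * b R (n + N)"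
          unfolding norm_mult using q_le ud[OF I[OF y] RN[of n]] Q_nonneg by (intro mult_mono) auto
        ultimately have "norm (complex_of_real kap * ((P (n + N) y - p y) / complex_of_real (al y)) + q y * (U (n + N) y - u y)) \<le> e"
          using n by (intro norm_triangle_le) (simp add: algebra_simps)
        moreover have "?D (P (n + N)) (U (n + N)) y - ?D p u y =
            complex_of_real kap * ((P (n + N) y - p y) / complex_of_real (al y)) + q y * (U (n + N) y - u y)"
          by (simp add: algebra_simps diff_divide_distrib)
        ultimately show "norm (h *\<^sub>R ?D (P (n + N)) (U (n + N)) y - h *\<^sub>R ?D p u y) \<le> e * norm h"
          by (simp only: norm_scaleR real_norm_def mult.commute[of e] mult_left_mono abs_ge_zero flip: scaleR_diff_right)
      qed
    qed (use xI in auto)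
    then obtain g where g: "\<And>y. y \<in> ?I \<Longrightarrow> (\<lambda>n. P (n + N) y) \<longlonglongrightarrow> g y"
        "\<And>y. y \<in> ?I \<Longrightarrow> (g has_derivative (\<lambda>h. h *\<^sub>R ?D p u y)) (at y within ?I)" by blast
    have gp: "g y = p y" if "y \<in> ?I" for y
      using LIMSEQ_unique[OF g(1)[OF that] LIMSEQ_ignore_initial_segment[OF plim]] .
    have "(p has_vector_derivative ?D p u x) (at x within ?I)"
      using has_derivative_transform[OF xI(1) gp[symmetric] g(2)[OF xI(1)]] by (simp add: has_vector_derivative_def)
    then have "(p has_vector_derivative ?D p u x) (at x)"
      using at_within_interior[OF xI(2)] by simp
    with 1 show "(u has_vector_derivative p x / complex_of_real (al x) + f1 x) (at x within UNIV) \<and>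
      (p has_vector_derivative ?D p u x) (at x within UNIV)" by simp
  qed
  moreover have "amp u p x \<le> S" for x
  proof (rule Lim_bounded)
    show "(\<lambda>n. amp (U n) (P n) x) \<longlonglongrightarrow> amp u p x"
      unfolding amp_def by (intro tendsto_intros ulim plim)
    show "\<forall>n\<ge>nat \<lceil>\<bar>x\<bar>\<rceil>. amp (U n) (P n) x \<le> S" by (intro allI impI S) linarith
  qed
  ultimately show ?thesis by blast
qed

text \<open>On growing intervals the boundary terms disappear since the amplitude is bounded. This
  leaves an inequality that is quadratic on both sides, in which the unknown still occurs under the
  integral; the supremum \<open>S\<close> serves to remove it.\<close>

lemma amp_estimate_global:
  assumes sol: "solves f1 f2 UNIV u p" and B: "\<And>x. amp u p x \<le> B"
    and f: "continuous_on UNIV f1" "continuous_on UNIV f2" "\<And>x. norm (f1 x) + norm (f2 x) \<le> F0"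
  shows "amp u p x0 \<le> Kb * (LINT x|lborel. exp (- rate * \<bar>x - x0\<bar>) * (norm (f1 x) + norm (f2 x)))"
proof -
  let ?s = "\<lambda>x. norm (f1 x) + norm (f2 x)"
  let ?y = "amp u p"
  have cy: "continuous_on UNIV ?y" by (rule amp_continuous[OF sol])
  have cs: "continuous_on UNIV ?s" using f by (auto intro!: continuous_intros)
  have B0: "B \<ge> 0" using B[of 0] amp_nonneg[of u p 0] by linarith
  have F0: "F0 \<ge> 0" using order_trans[OF add_nonneg_nonneg[OF norm_ge_zero norm_ge_zero] f(3)] .
  have int1: "integrable lborel (\<lambda>x. exp (- (2 * rate) * \<bar>x - x1\<bar>) * (?y x * ?s x))" for x1
  proof -
    have "norm (?y x * ?s x) \<le> B * F0" for x
      unfolding norm_mult using B[of x] f(3)[of x] amp_nonneg[of u p x] B0 by (intro mult_mono) auto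
    then show ?thesis
      using integrable_exp_abs_mult[of "2 * rate" "\<lambda>x. ?y x * ?s x" "B * F0" x1] rate_pos cy cs
      by (simp add: borel_measurable_continuous_onI continuous_on_mult)
  qed
  have int2: "integrable lborel (\<lambda>x. exp (- rate * \<bar>x - x0\<bar>) * ?s x)"
    using integrable_exp_abs_mult[of rate ?s F0 x0] rate_pos cs f(3)
    by (simp add: borel_measurable_continuous_onI)
  define I where "I = (\<lambda>x1. LINT x|lborel. exp (- (2 * rate) * \<bar>x - x1\<bar>) * (?y x * ?s x))"
  define G where "G = (LINT x|lborel. exp (- rate * \<bar>x - x0\<bar>) * ?s x)"
  have loc: "(?y x1)^2 \<le> Kb * I x1" for x1
  proof -
    have bd: "(?y x1)^2 \<le> Kb * (2 * exp (- 2 * rate * real n) * (Cb * B^2) + I x1)" if "n \<ge> 1" for n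
    proof -
      let ?l = "x1 - real n" and ?r = "x1 + real n"
      have "(?y x1)^2 \<le> Kb * (exp (- 2 * rate * (?r - x1)) * \<bar>energy u p ?r\<bar> + exp (- 2 * rate * (x1 - ?l)) * \<bar>energy u p ?l\<bar> +
          integral {?l..?r} (\<lambda>x. exp (- 2 * rate * \<bar>x - x1\<bar>) * (?y x * ?s x)))"
        by (rule amp_estimate[OF solves_subset[OF sol]]) (use that f in \<open>auto intro: continuous_on_subset\<close>)
      also have "\<dots> = Kb * (exp (- 2 * rate * real n) * \<bar>energy u p ?r\<bar> + exp (- 2 * rate * real n) * \<bar>energy u p ?l\<bar> +
          integral {?l..?r} (\<lambda>x. exp (- 2 * rate * \<bar>x - x1\<bar>) * (?y x * ?s x)))" by simp
      also have "\<dots> \<le> Kb * (exp (- 2 * rate * real n) * (Cb * B^2) + exp (- 2 * rate * real n) * (Cb * B^2) + I x1)"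
      proof (intro mult_left_mono add_mono less_imp_le[OF Kb_pos])
        have e: "\<bar>energy u p y\<bar> \<le> Cb * B^2" for y
          using energy_le[of u p y] by (rule order_trans)
            (intro mult_left_mono power_mono B amp_nonneg less_imp_le[OF Cb_pos])
        then show "\<bar>energy u p ?r\<bar> \<le> Cb * B^2" "\<bar>energy u p ?l\<bar> \<le> Cb * B^2" by auto
        show "integral {?l..?r} (\<lambda>x. exp (- 2 * rate * \<bar>x - x1\<bar>) * (?y x * ?s x)) \<le> I x1"
          using integral_interval_le_lborel[OF int1[of x1], of ?l ?r] cy cs amp_nonneg
          by (simp add: I_def continuous_intros mult_nonneg_nonneg)
      qed auto
      finally show ?thesis by (simp add: algebra_simps)
    qed
    have "(\<lambda>n. exp (- 2 * rate * real n)) \<longlonglongrightarrow> 0"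
      using exp_neg_of_nat_tendsto[of "2 * rate"] rate_pos by simp
    then have "(\<lambda>n. Kb * (2 * exp (- 2 * rate * real n) * (Cb * B^2) + I x1)) \<longlonglongrightarrow> Kb * (2 * 0 * (Cb * B^2) + I x1)"
      by (intro tendsto_intros)
    then show ?thesis using Lim_bounded2[of _ _ 1 "(?y x1)^2"] bd by simp
  qed
  \<comment> \<open>The boundedness of the amplitude makes this supremum finite. Moving the centre
    of the kernel from \<open>x1\<close> to \<open>x0\<close> leaves
    \<open>exp (- 2 * rate * \<bar>x - x0\<bar>)\<close>; one half of the exponent goes with the
    amplitude and is bounded by \<open>S\<close>, the other half goes with the source and gives
    \<open>G\<close>. So \<open>S^2\<close> is at most \<open>Kb * S * G\<close>.\<close>
  define S where "S = (SUP x. exp (- rate * \<bar>x - x0\<bar>) * ?y x)"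
  have bdd: "bdd_above (range (\<lambda>x. exp (- rate * \<bar>x - x0\<bar>) * ?y x))"
  proof (rule bdd_aboveI2)
    show "exp (- rate * \<bar>x - x0\<bar>) * ?y x \<le> 1 * B" for x
      using rate_pos B amp_nonneg by (intro mult_mono) auto
  qed
  have S: "exp (- rate * \<bar>x - x0\<bar>) * ?y x \<le> S" for x
    unfolding S_def by (rule cSUP_upper[OF _ bdd]) auto
  have S0: "S \<ge> 0" using S[of x0] amp_nonneg[of u p x0] by simp
  have G0: "G \<ge> 0" unfolding G_def by (intro Bochner_Integration.integral_nonneg) auto
  have sq: "(exp (- rate * \<bar>x1 - x0\<bar>) * ?y x1)^2 \<le> Kb * S * G" for x1
  proof -
    have "(exp (- rate * \<bar>x1 - x0\<bar>) * ?y x1)^2 = exp (- (2 * rate) * \<bar>x1 - x0\<bar>) * (?y x1)^2"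
      by (simp add: power_mult_distrib flip: exp_double)
    also have "\<dots> \<le> exp (- (2 * rate) * \<bar>x1 - x0\<bar>) * (Kb * I x1)"
      by (intro mult_left_mono loc) auto
    also have "\<dots> = Kb * (LINT x|lborel. exp (- (2 * rate) * \<bar>x1 - x0\<bar>) * (exp (- (2 * rate) * \<bar>x - x1\<bar>) * (?y x * ?s x)))"
      unfolding I_def by simp
    also have "\<dots> \<le> Kb * (LINT x|lborel. S * (exp (- rate * \<bar>x - x0\<bar>) * ?s x))"
    proof (rule mult_left_mono[OF integral_mono less_imp_le[OF Kb_pos]])
      show "integrable lborel (\<lambda>x. exp (- (2 * rate) * \<bar>x1 - x0\<bar>) * (exp (- (2 * rate) * \<bar>x - x1\<bar>) * (?y x * ?s x)))"
        by (intro integrable_mult_right int1)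
      show "integrable lborel (\<lambda>x. S * (exp (- rate * \<bar>x - x0\<bar>) * ?s x))"
        by (intro integrable_mult_right int2)
      fix x
      have "exp (- (2 * rate) * \<bar>x1 - x0\<bar>) * exp (- (2 * rate) * \<bar>x - x1\<bar>) \<le> exp (- (2 * rate) * \<bar>x - x0\<bar>)"
        unfolding exp_add[symmetric] exp_le_cancel_iff distrib_left[symmetric]
        using mult_left_mono_neg[of "\<bar>x - x0\<bar>" "\<bar>x1 - x0\<bar> + \<bar>x - x1\<bar>" "- (2 * rate)"] rate_pos by auto
      also have "\<dots> = exp (- rate * \<bar>x - x0\<bar>) * exp (- rate * \<bar>x - x0\<bar>)" by (simp flip: exp_add)
      finally have "exp (- (2 * rate) * \<bar>x1 - x0\<bar>) * exp (- (2 * rate) * \<bar>x - x1\<bar>) * (?y x * ?s x)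
          \<le> exp (- rate * \<bar>x - x0\<bar>) * exp (- rate * \<bar>x - x0\<bar>) * (?y x * ?s x)"
        using amp_nonneg by (intro mult_right_mono mult_nonneg_nonneg) auto
      also have "\<dots> = (exp (- rate * \<bar>x - x0\<bar>) * ?y x) * (exp (- rate * \<bar>x - x0\<bar>) * ?s x)" by (simp add: algebra_simps)
      also have "\<dots> \<le> S * (exp (- rate * \<bar>x - x0\<bar>) * ?s x)"
        by (intro mult_right_mono S) auto
      finally show "exp (- (2 * rate) * \<bar>x1 - x0\<bar>) * (exp (- (2 * rate) * \<bar>x - x1\<bar>) * (?y x * ?s x))
          \<le> S * (exp (- rate * \<bar>x - x0\<bar>) * ?s x)" by (simp add: mult.assoc)
    qed
    also have "\<dots> = Kb * S * G" unfolding G_def by simp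
    finally show ?thesis .
  qed
  have "S \<le> sqrt (Kb * S * G)"
    unfolding S_def by (rule cSUP_least) (use sq in \<open>auto intro!: real_le_rsqrt simp: S_def\<close>)
  then have "S^2 \<le> Kb * S * G" using S0
    by (metis S0 Kb_pos G0 less_imp_le mult_nonneg_nonneg power_mono real_sqrt_pow2)
  then have "S \<le> Kb * G" using S0 Kb_pos G0
    by (cases "S = 0") (auto simp: power2_eq_square)
  then show ?thesis using S[of x0] by (simp add: G_def)
qed

end

section \<open>Construction of the complex weight\<close>

lemma DERIV_max_0_square: "((\<lambda>y::real. (max 0 y)^2) has_real_derivative 2 * max 0 y) (at y)"
proof (cases "y = 0")
  case True
  have "((\<lambda>h. ((max 0 (y + h))^2 - (max 0 y)^2) / h) \<longlongrightarrow> 0) (at 0)"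
  proof (rule Lim_null_comparison)
    show "\<forall>\<^sub>F h in at 0. norm (((max 0 (y + h))^2 - (max 0 y)^2) / h) \<le> \<bar>h\<bar>"
      by (rule always_eventually) (use True in \<open>auto simp: max_def power2_eq_square\<close>)
    show "((\<lambda>h::real. \<bar>h\<bar>) \<longlongrightarrow> 0) (at 0)" by (rule tendsto_rabs_zero) (rule tendsto_ident_at)
  qed
  then show ?thesis using True by (simp add: DERIV_def)
next
  case False
  then consider "y > 0" | "y < 0" by linarith
  then show ?thesis
  proof cases
    case 1
    have "((\<lambda>y::real. y^2) has_real_derivative 2 * max 0 y) (at y)"
      using 1 by (auto intro!: derivative_eq_intros)
    then show ?thesis
      by (rule has_field_derivative_transform_within_open[where S = "{0<..}"]) (use 1 in auto)
  next
    case 2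
    have "((\<lambda>y::real. 0) has_real_derivative 2 * max 0 y) (at y)"
      using 2 by (auto intro!: derivative_eq_intros)
    then show ?thesis
      by (rule has_field_derivative_transform_within_open[where S = "{..<0}"]) (use 2 in auto)
  qed
qed

text \<open>The antiderivative is the exponent of the modulus of the weight. Compact support of
  \<open>n\<close> keeps it bounded on the whole line, hence the modulus bounded away from 0 and
  from infinity.\<close>

lemma antideriv_compact_support:
  fixes n :: "real \<Rightarrow> real"
  assumes n: "continuous_on UNIV n" "\<And>x. \<bar>x\<bar> \<ge> r \<Longrightarrow> n x = 0" "\<And>x. 0 \<le> n x" "\<And>x. n x \<le> N" and "r > 0"
  shows "\<exists>F. (\<forall>x. (F has_real_derivative n x) (at x)) \<and> (\<forall>x. 0 \<le> F x \<and> F x \<le> N * (2 * r + 1))"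
proof -
  define a where "a = - r - 1"
  define F where "F = (\<lambda>x. integral {a..x} n)"
  have N: "N \<ge> 0" using n(3,4)[of 0] by linarith
  have int: "n integrable_on {s..t}" for s t
    by (rule integrable_continuous_real[OF continuous_on_subset[OF n(1)]]) auto
  have F0: "F x = 0" if "x \<le> - r" for x
    unfolding F_def by (subst integral_cong[of _ _ "\<lambda>_. 0"]) (use n(2) that in auto)
  have F_le: "F x \<le> N * (2 * r + 1)" if "x \<le> r" for x
  proof (cases "a \<le> x")
    case True
    have "F x \<le> integral {a..x} (\<lambda>_. N)" unfolding F_def by (rule integral_le) (use int n in auto)
    also have "\<dots> = N * (x - a)" using True by simp
    also have "\<dots> \<le> N * (2 * r + 1)" using that N by (intro mult_left_mono) (auto simp: a_def)
    finally show ?thesis .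
  qed (use N \<open>r > 0\<close> in \<open>auto simp: F_def\<close>)
  have F_const: "F x = F r" if "x \<ge> r" for x
  proof -
    have "F r + integral {r..x} n = F x"
      unfolding F_def by (rule Henstock_Kurzweil_Integration.integral_combine) (use that \<open>r > 0\<close> int in \<open>auto simp: a_def\<close>)
    moreover have "integral {r..x} n = 0"
      by (subst integral_cong[of _ _ "\<lambda>_. 0"]) (use n(2) that in auto)
    ultimately show ?thesis by simp
  qed
  have "(F has_real_derivative n x) (at x)" for x
  proof (cases "x > a")
    case True
    have "(F has_vector_derivative n x) (at x within {a..x+1})"
      unfolding F_def by (rule integral_has_vector_derivative) (use n(1) True in \<open>auto intro: continuous_on_subset\<close>)
    moreover have "at x within {a..x+1} = at x"
      using True by (intro at_within_interior) auto
    ultimately show ?thesis by (simp add: has_real_derivative_iff_has_vector_derivative)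
  next
    case False
    then have x: "x \<in> {..<-r}" by (auto simp: a_def)
    have "((\<lambda>_. 0) has_real_derivative n x) (at x)" using n(2)[of x] x \<open>r > 0\<close> by auto
    then show ?thesis
      by (rule has_field_derivative_transform_within_open[OF _ _ x]) (auto simp: F0)
  qed
  moreover have "0 \<le> F x" for x unfolding F_def by (rule integral_nonneg[OF int]) (use n in auto)
  moreover have "F x \<le> N * (2 * r + 1)" for x using F_le[of x] F_le[of r] F_const[of x] by (cases "x \<le> r") auto
  ultimately show ?thesis by blast
qed

text \<open>Subtracting \<open>d\<close> from both diagonal coefficients lowers
  \<open>4 * A * C\<close> by at most \<open>d * (4 * (A + C))\<close>, which the gap
  \<open>g\<close> of the discriminant covers. The remaining form is nonnegative by completing a
  square with the roots of \<open>A - d\<close> and \<open>C - d\<close>.\<close>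

lemma quadratic_form_ge:
  fixes A B C s t :: real
  assumes "A > 0" "g > 0" "g \<le> 4 * A * C - B^2" "0 < d" "d * (4 * (A + C)) \<le> g" and st: "s \<ge> 0" "t \<ge> 0"
  shows "d * (t^2 + s^2) \<le> A * s^2 - B * s * t + C * t^2"
proof -
  have AC: "4 * (A * C) > 0" "4 * d * (A + C) \<le> 4 * (A * C)"
  proof -
    have "4 * A * C = 4 * (A * C)" "d * (4 * (A + C)) = 4 * d * (A + C)" by simp_all
    then show "4 * (A * C) > 0" "4 * d * (A + C) \<le> 4 * (A * C)"
      using assms(2,3,5) zero_le_power2[of B] by linarith+
  qed
  then have C: "C > 0" using assms(1) by (simp add: zero_less_mult_iff)
  have "d * A > 0" "d * C > 0" using assms(1,4) C by auto
  moreover have "d * A + d * C \<le> A * C" using AC(2) by (simp add: distrib_left)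
  ultimately have "d * C \<le> A * C" "d * A \<le> C * A" by (simp_all add: mult.commute)
  then have Ad: "A - d \<ge> 0" and Cd: "C - d \<ge> 0" using assms(1) C by auto
  have "4 * ((A - d) * (C - d)) = 4 * A * C - d * (4 * (A + C)) + 4 * d^2"
    by (simp add: algebra_simps power2_eq_square)
  then have "B^2 \<le> 4 * ((A - d) * (C - d))" using assms(3,5) by (smt (verit) zero_le_power2)
  then have "\<bar>B\<bar> \<le> sqrt (4 * ((A - d) * (C - d)))" by (metis real_sqrt_abs real_sqrt_le_mono)
  also have "\<dots> = 2 * (sqrt (A - d) * sqrt (C - d))" by (simp add: real_sqrt_mult)
  finally have Bs: "\<bar>B\<bar> * (s * t) \<le> 2 * (sqrt (A - d) * sqrt (C - d)) * (s * t)"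
    by (rule mult_right_mono) (use st in auto)
  have "0 \<le> (sqrt (A - d) * s - sqrt (C - d) * t)^2" by simp
  also have "\<dots> = (A - d) * s^2 + (C - d) * t^2 - 2 * (sqrt (A - d) * sqrt (C - d)) * (s * t)"
    using Ad Cd by (simp add: power2_diff power_mult_distrib algebra_simps)
  finally have "\<bar>B\<bar> * (s * t) \<le> (A - d) * s^2 + (C - d) * t^2" using Bs by linarith
  moreover have "B * (s * t) \<le> \<bar>B\<bar> * (s * t)" using st by (intro mult_right_mono) auto
  ultimately show ?thesis by (simp add: algebra_simps)
qed

text \<open>The weight is \<open>w = \<omega> (1 - \<i> T)\<close> with \<open>\<omega>' = - 2 n \<omega>\<close>. Near infinity \<open>w\<close> is constant and the
  Froude conditions (through \<open>far\<close>) provide coercivity. In the core the choice \<open>n = kap / (2 al)\<close> removes the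
  first order term, after which any slowly varying \<open>T\<close> with \<open>Re q + T Im q \<ge> 0\<close> works; \<open>T\<close> is
  moved from \<open>T0\<close> to \<open>T1\<close> over a length \<open>L\<close> before \<open>n\<close> is switched off.\<close>

lemma coercive_weight_exists:
  fixes al :: "real \<Rightarrow> real" and q :: "real \<Rightarrow> complex"
  assumes al: "continuous_on UNIV al" "\<And>x. al x \<ge> a0" "\<And>x. al x \<le> a1" and a0: "a0 > 0"
    and q: "continuous_on UNIV q" "\<And>x. norm (q x) \<le> Q" "\<And>x. Im (q x) \<ge> 0"
    and kap: "kap > 0" and R: "R > 0" and \<eta>: "\<eta> > 0" and T0: "T0 \<ge> 0"
    and far: "\<And>x. \<bar>x\<bar> \<ge> R \<Longrightarrow> kap^2 * T0^2 + \<eta> \<le> 4 * al x * (Re (q x) + T0 * Im (q x))"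
    and core: "\<And>x. 0 \<le> Re (q x) + T1 * Im (q x)"
  shows "\<exists>w w' Wb d. coercive_system al kap q w w' a0 Q Wb d"
proof -
  \<comment> \<open>On the core one has \<open>\<bar>x\<bar> \<le> L / 2\<close>, where the profile
    \<open>(1 - (x / L)^2)^2\<close> is at least 9/16; so this height lifts \<open>T\<close> above
    \<open>T1\<close> there.\<close>
  define D where "D = 16 / 9 * \<bar>T1\<bar>"
  \<comment> \<open>The first summand places the core inside half of the length. The second makes
    the transition slow: the slope of \<open>T\<close> is at most \<open>4 * D / L\<close>, so that
    \<open>al * \<bar>T'\<bar>\<close> is at most \<open>kap / 2\<close>.\<close>
  define L where "L = 2 * R + 8 * D * a1 / kap"
  define T where "T = (\<lambda>x. T0 + D * (max 0 (1 - (x / L)^2))^2)"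
  define T' where "T' = (\<lambda>x. D * (2 * max 0 (1 - (x / L)^2) * (- (2 * x / L^2))))"
  \<comment> \<open>This cutoff is 1 as long as \<open>T\<close> may differ from \<open>T0\<close>,
    that is up to \<open>L\<close>, and falls to 0 between \<open>L\<close> and
    \<open>L + 1\<close>.\<close>
  define ct where "ct = (\<lambda>x. max 0 (min 1 (L + 1 - \<bar>x\<bar>)))"
  define n where "n = (\<lambda>x. kap * ct x / (2 * al x))"
  have al_pos: "al x > 0" for x using al(2)[of x] a0 by linarith
  have a1: "a1 > 0" using al_pos[of 0] al(3)[of 0] by linarith
  have D: "D \<ge> 0" by (simp add: D_def)
  have L: "L \<ge> 2 * R" using D a1 kap by (simp add: L_def)
  then have Lpos: "L > 0" using R by linarith
  have DT: "(T has_real_derivative T' x) (at x)" for x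
  proof -
    have "((\<lambda>x. 1 - (x / L)^2) has_real_derivative - (2 * x / L^2)) (at x)"
      using Lpos by (auto intro!: derivative_eq_intros simp: power2_eq_square)
    from DERIV_chain2[OF DERIV_max_0_square this] show ?thesis
      unfolding T_def T'_def by (intro DERIV_cong[OF DERIV_add[OF DERIV_const DERIV_cmult]]) auto
  qed
  have T_ge: "T x \<ge> T0" for x using D by (simp add: T_def)
  have T_le: "T x \<le> T0 + D" for x
  proof -
    have "(max 0 (1 - (x / L)^2))^2 \<le> 1^2" by (rule power_mono) auto
    then show ?thesis using D mult_left_mono[of "(max 0 (1 - (x / L)^2))^2" 1 D] by (simp add: T_def)
  qed
  have T_core: "T x \<ge> T1" if "\<bar>x\<bar> \<le> R" for x
  proof -
    have "\<bar>x / L\<bar> \<le> 1 / 2" using that L Lpos by (simp add: field_simps)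
    then have "(x / L)^2 \<le> (1/2)^2" by (metis abs_le_square_iff abs_of_nonneg zero_le_divide_1_iff zero_le_numeral)
    then have "3/4 \<le> max 0 (1 - (x / L)^2)" by (simp add: power_one_over le_max_iff_disj)
    then have "(3/4)^2 \<le> (max 0 (1 - (x / L)^2))^2" by (rule power_mono) simp
    then have "D * (9/16) \<le> D * (max 0 (1 - (x / L)^2))^2" using D by (intro mult_left_mono) (auto simp: power2_eq_square)
    then show ?thesis using T0 by (simp add: T_def D_def)
  qed
  have T'_far: "T x = T0" "T' x = 0" if "\<bar>x\<bar> \<ge> L" for x
  proof -
    have "1 \<le> \<bar>x / L\<bar>" using that Lpos by simp
    then have "1 \<le> (x / L)^2" by (metis abs_le_square_iff abs_1 one_power2)
    then show "T x = T0" "T' x = 0" by (auto simp: T_def T'_def)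
  qed
  have T'_le: "al x * \<bar>T' x\<bar> \<le> kap / 2" for x
  proof (cases "\<bar>x\<bar> \<ge> L")
    case True then show ?thesis using T'_far kap by simp
  next
    case False
    have "\<bar>T' x\<bar> = D * (2 * max 0 (1 - (x / L)^2) * (2 * \<bar>x\<bar> / L^2))"
      using D by (simp add: T'_def abs_mult)
    also have "\<dots> \<le> D * (2 * 1 * (2 * L / L^2))"
      using D Lpos False by (intro mult_left_mono mult_mono divide_right_mono) auto
    also have "\<dots> = 4 * D / L" using Lpos by (simp add: power2_eq_square)
    finally have "al x * \<bar>T' x\<bar> \<le> a1 * (4 * D / L)"
      using al(3)[of x] a1 by (intro mult_mono) auto
    moreover have "kap * L \<ge> 8 * D * a1" using kap R by (simp add: L_def field_simps)
    then have "a1 * (4 * D / L) \<le> kap / 2" using Lpos by (simp add: field_simps)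
    ultimately show ?thesis by linarith
  qed
  have ct: "0 \<le> ct x" "ct x \<le> 1" for x by (auto simp: ct_def)
  have n0: "0 \<le> n x" for x using ct[of x] al_pos[of x] kap by (simp add: n_def)
  have n_le: "n x \<le> kap / (2 * a0)" for x
    unfolding n_def using ct[of x] al(2)[of x] a0 kap by (intro frac_le) auto
  have al_n: "2 * al x * n x = kap * ct x" for x using al_pos[of x] by (simp add: n_def)
  have "\<exists>F. (\<forall>x. (F has_real_derivative n x) (at x)) \<and> (\<forall>x. 0 \<le> F x \<and> F x \<le> kap / (2 * a0) * (2 * (L + 1) + 1))"
  proof (rule antideriv_compact_support[OF _ _ n0 n_le])
    show "continuous_on UNIV n" unfolding n_def ct_def using al_pos
      by (intro continuous_intros al) (auto simp: less_imp_neq[symmetric])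
    show "n x = 0" if "\<bar>x\<bar> \<ge> L + 1" for x using that by (simp add: n_def ct_def)
  qed (use Lpos in auto)
  then obtain F M where F: "\<And>x. (F has_real_derivative n x) (at x)" "\<And>x. 0 \<le> F x" "\<And>x. F x \<le> M" by blast
  define \<omega> where "\<omega> = (\<lambda>x. exp (- 2 * F x))"
  have \<omega>: "\<omega> x > 0" "\<omega> x \<le> 1" "exp (- 2 * M) \<le> \<omega> x" for x using F(2,3)[of x] by (auto simp: \<omega>_def)
  define w where "w = (\<lambda>x. complex_of_real (\<omega> x) * Complex 1 (- T x))"
  define w' where "w' = (\<lambda>x. complex_of_real (\<omega> x) * Complex (- 2 * n x) (2 * n x * T x - T' x))"
  have Dw: "(w has_vector_derivative w' x) (at x)" for x
  proof -
    have D\<omega>: "(\<omega> has_real_derivative \<omega> x * (- 2 * n x)) (at x)"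
      unfolding \<omega>_def by (rule derivative_eq_intros F(1) refl | simp)+
    have "((\<lambda>x. Complex (\<omega> x) (- (\<omega> x * T x))) has_vector_derivative
        Complex (\<omega> x * (- 2 * n x)) (- (\<omega> x * (- 2 * n x) * T x + T' x * \<omega> x))) (at x)"
      unfolding has_vector_derivative_complex_iff complex.sel
      by (intro conjI DERIV_minus DERIV_mult D\<omega> DT)
    moreover have "w = (\<lambda>x. Complex (\<omega> x) (- (\<omega> x * T x)))"
      by (rule ext) (simp add: w_def complex_eq_iff)
    moreover have "w' x = Complex (\<omega> x * (- 2 * n x)) (- (\<omega> x * (- 2 * n x) * T x + T' x * \<omega> x))"
      by (simp add: w'_def complex_eq_iff algebra_simps)
    ultimately show ?thesis by simp
  qed
  define Wb where "Wb = 1 + (T0 + D)"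
  have w_le: "norm (w x) \<le> Wb" for x
  proof -
    have "norm (w x) \<le> 1 * norm (Complex 1 (- T x))"
      unfolding w_def norm_mult using \<omega>[of x] by (intro mult_right_mono) auto
    also have "\<dots> \<le> 1 + \<bar>T x\<bar>" using complex_norm[of 1 "- T x"] sqrt_sum_squares_le_sum_abs[of 1 "T x"] by simp
    finally show ?thesis using T_le[of x] T_ge[of x] T0 by (simp add: Wb_def)
  qed
  define N where "N = kap / (2 * a0)"
  have w'_le: "\<bar>Re (w' x)\<bar> \<le> 2 * N" for x
  proof -
    have "\<bar>Re (w' x)\<bar> = \<omega> x * (2 * n x)" using \<omega>[of x] n0[of x] by (simp add: w'_def abs_mult)
    also have "\<dots> \<le> 1 * (2 * N)" using \<omega>[of x] n0[of x] n_le[of x] by (intro mult_mono) (auto simp: N_def)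
    finally show ?thesis by simp
  qed
  have Q0: "Q \<ge> 0" using q(2)[of 0] norm_ge_zero order_trans by blast
  \<comment> \<open>The two margins: \<open>\<eta>\<close> is what \<open>far\<close> leaves outside
    of \<open>L\<close>. Inside, the completed square offers \<open>2 * kap^2\<close>, of which
    \<open>kap^2\<close> is used by \<open>n\<close> and \<open>kap^2 / 4\<close> by the slope of
    \<open>T\<close>.\<close>
  define g0 where "g0 = min \<eta> (3 / 4 * kap^2)"
  have g0: "g0 > 0" using \<eta> kap by (simp add: g0_def)
  \<comment> \<open>Up to the factor \<open>(\<omega> x / al x)^2\<close> this is the discriminant
    condition for the form in \<open>coercive\<close>.\<close>
  have key: "4 * (al x)^2 * (n x)^2 + (2 * al x * n x * T x - al x * T' x - kap * T x)^2 + g0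
      \<le> 4 * al x * (Re (q x) + T x * Im (q x) + kap * n x)" for x
  proof -
    have e1: "4 * (al x)^2 * (n x)^2 = kap^2 * (ct x)^2"
      using al_n[of x] by (metis power_mult_distrib mult_2 numeral_Bit0 power2_eq_square mult.assoc four_x_squared)
    have e2: "4 * al x * (Re (q x) + T x * Im (q x) + kap * n x) = 4 * al x * (Re (q x) + T x * Im (q x)) + 2 * kap^2 * ct x"
      using al_n[of x] by (simp add: algebra_simps power2_eq_square)
    show ?thesis
    proof (cases "\<bar>x\<bar> \<le> L")
      case True
      then have ct1: "ct x = 1" by (simp add: ct_def)
      \<comment> \<open>Since the imaginary part of \<open>q\<close> is nonnegative, raising
        \<open>T\<close> only helps: above \<open>T1\<close> in the core, above \<open>T0\<close>
        elsewhere.\<close>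
      have pos: "0 \<le> Re (q x) + T x * Im (q x)"
      proof (cases "\<bar>x\<bar> \<le> R")
        case True
        then show ?thesis using core[of x] mult_right_mono[OF T_core[OF True] q(3)[of x]] by linarith
      next
        case False
        then have "0 < 4 * al x * (Re (q x) + T0 * Im (q x))" using far[of x] \<eta>
          by (smt (verit) zero_le_power2 mult_nonneg_nonneg)
        then have "0 < Re (q x) + T0 * Im (q x)" using al_pos[of x] by (simp add: zero_less_mult_iff)
        then show ?thesis using mult_right_mono[OF T_ge[of x] q(3)[of x]] by linarith
      qed
      then have pos': "0 \<le> 4 * al x * (Re (q x) + T x * Im (q x))" using al_pos[of x] by simp
      have e: "2 * al x * n x * T x - al x * T' x - kap * T x = - (al x * T' x)" using al_n[of x] ct1 by simp
      have "(al x * T' x)^2 \<le> (kap / 2)^2"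
        using T'_le[of x] al_pos[of x] kap by (intro abs_le_square_iff[THEN iffD1]) (auto simp: abs_mult)
      then have "(2 * al x * n x * T x - al x * T' x - kap * T x)^2 \<le> kap^2 / 4"
        unfolding e power2_minus by (simp only: power_divide) simp
      then show ?thesis unfolding e1 e2 ct1 using pos' by (simp add: g0_def)
    next
      case False
      have TT: "T x = T0" "T' x = 0" using T'_far[of x] False by auto
      have xR: "\<bar>x\<bar> \<ge> R" using False L R by linarith
      have E: "2 * al x * n x * T x - al x * T' x - kap * T x = kap * T0 * (ct x - 1)"
        using al_n[of x] by (simp add: TT algebra_simps)
      have "(ct x - 1)^2 \<le> 1" using ct[of x] by (simp add: abs_square_le_1)
      then have "(kap * T0 * (ct x - 1))^2 \<le> kap^2 * T0^2"
        using mult_left_mono[of "(ct x - 1)^2" 1 "kap^2 * T0^2"] by (simp add: power_mult_distrib)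
      \<comment> \<open>Where \<open>n\<close> is being switched off its square costs less than what
        the first order term gains, and the square of \<open>T0 * (ct x - 1)\<close> costs no more
        than in the far field.\<close>
      moreover have "(ct x)^2 \<le> 2 * ct x" using ct[of x] by (simp add: power2_eq_square mult_right_mono)
      then have "kap^2 * (ct x)^2 \<le> kap^2 * (2 * ct x)" by (intro mult_left_mono) auto
      moreover have "g0 \<le> \<eta>" by (simp add: g0_def)
      moreover have "kap^2 * T0^2 + \<eta> \<le> 4 * al x * (Re (q x) + T x * Im (q x))"
        using far[OF xR] by (simp only: TT(1))
      ultimately show ?thesis unfolding e1 e2 E by linarith
    qed
  qed
  define g where "g = exp (- 2 * M)^2 * g0 / a1^2"
  have g: "g > 0" using g0 a1 by (simp add: g_def)
  define m where "m = 1 / a0 + (Wb * Q + kap / 2 * (2 * N))"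
  have Wb: "Wb > 0" using T0 D by (simp add: Wb_def)
  have m: "m > 0" using a0 Wb Q0 kap by (simp add: m_def N_def add_pos_nonneg)
  define d where "d = g / (4 * m)"
  have d: "d > 0" using g m by (simp add: d_def)
  have "coercive_system al kap q w w' a0 Q Wb d"
  proof
    fix u p :: complex and x :: real
    define A where "A = \<omega> x / al x"
    define B where "B = w' x + \<i> * complex_of_real (kap * Im (w x) / al x)"
    define C where "C = Re (w x * q x) - kap / 2 * Re (w' x)"
    have Rew: "Re (w x) = \<omega> x" "Im (w x) = - (\<omega> x * T x)" by (auto simp: w_def)
    have Cx: "C = \<omega> x * (Re (q x) + T x * Im (q x) + kap * n x)"
      by (simp add: C_def w_def w'_def algebra_simps)
    have Bx: "B = complex_of_real (\<omega> x / al x) * Complex (- (2 * al x * n x)) (2 * al x * n x * T x - al x * T' x - kap * T x)"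
      using al_pos[of x] by (simp add: B_def Rew w'_def complex_eq_iff field_simps)
    have B2: "(norm B)^2 = (\<omega> x / al x)^2 * (4 * (al x)^2 * (n x)^2 + (2 * al x * n x * T x - al x * T' x - kap * T x)^2)"
      unfolding Bx norm_mult power_mult_distrib norm_of_real power2_abs
      by (simp add: cmod_power2 power_mult_distrib)
    have "4 * A * C - (norm B)^2 = (\<omega> x / al x)^2 * (4 * al x * (Re (q x) + T x * Im (q x) + kap * n x) -
        (4 * (al x)^2 * (n x)^2 + (2 * al x * n x * T x - al x * T' x - kap * T x)^2))"
      unfolding B2 A_def Cx using al_pos[of x] by (simp add: field_simps power2_eq_square)
    also have "\<dots> \<ge> (exp (- 2 * M) / a1)^2 * g0"
      using key[of x] \<omega>[of x] al_pos[of x] al(3)[of x] g0 by (intro mult_mono power_mono frac_le) auto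
    finally have gap: "g \<le> 4 * A * C - (norm B)^2" by (simp add: g_def power_divide)
    have "A \<le> 1 / a0" unfolding A_def using \<omega>[of x] al(2)[of x] a0 by (intro frac_le) auto
    moreover have "C \<le> Wb * Q + kap / 2 * (2 * N)"
    proof -
      have "Re (w x * q x) \<le> Wb * Q" using complex_Re_le_cmod[of "w x * q x"] w_le[of x] q(2)[of x] Wb
        by (smt (verit) mult_mono norm_ge_zero norm_mult)
      moreover have "- (kap / 2 * Re (w' x)) \<le> kap / 2 * (2 * N)"
        using mult_left_mono[of "- Re (w' x)" "2 * N" "kap / 2"] w'_le[of x] kap by simp
      ultimately show ?thesis by (simp add: C_def)
    qed
    ultimately have "4 * (A + C) \<le> 4 * m" by (simp add: m_def)
    then have "d * (4 * (A + C)) \<le> d * (4 * m)" using d by (intro mult_left_mono) auto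
    also have "\<dots> = g" using m by (simp add: d_def)
    finally have dg: "d * (4 * (A + C)) \<le> g" .
    have "d * ((norm u)^2 + (norm p)^2) \<le> A * (norm p)^2 - norm B * norm p * norm u + C * (norm u)^2"
      by (rule quadratic_form_ge[OF _ g gap d dg]) (use \<omega>[of x] al_pos[of x] in \<open>auto simp: A_def\<close>)
    moreover have "- (norm B * norm p * norm u) \<le> Re (B * p * cnj u)"
      using abs_Re_le_cmod[of "B * p * cnj u"] by (simp add: norm_mult)
    ultimately show "d * ((norm u)^2 + (norm p)^2) \<le> Re (w x) / al x * (norm p)^2
       + Re ((w' x + \<i> * complex_of_real (kap * Im (w x) / al x)) * p * cnj u)
       + (Re (w x * q x) - kap / 2 * Re (w' x)) * (norm u)^2"
      unfolding Rew(1) A_def[symmetric] B_def[symmetric] C_def[symmetric] by linarith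
  qed (use al q a0 kap Dw w_le Wb d in auto)
  then show ?thesis by blast
qed

section \<open>Smooth functions\<close>

text \<open>The derivatives have to exist on the whole line, while the bounds concern
  \<open>I\<close> only; this way one function can be estimated on different sets without one-sided
  derivatives. Quantifying over the derivative treats real and complex functions alike.\<close>

fun dbound :: "real set \<Rightarrow> real \<Rightarrow> nat \<Rightarrow> (real \<Rightarrow> 'a::real_normed_field) \<Rightarrow> bool" where
  "dbound I M 0 f \<longleftrightarrow> (\<forall>x\<in>I. norm (f x) \<le> M)"
| "dbound I M (Suc k) f \<longleftrightarrow> (\<forall>x\<in>I. norm (f x) \<le> M) \<and>
     (\<exists>g. (\<forall>x. (f has_vector_derivative g x) (at x)) \<and> dbound I M k g)"

lemma dbound_SucI:
  "(\<And>x. x \<in> I \<Longrightarrow> norm (f x) \<le> M) \<Longrightarrow> (\<And>x. (f has_vector_derivative g x) (at x)) \<Longrightarrow> dbound I M k g \<Longrightarrow> dbound I M (Suc k) f"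
  by auto

lemma dbound_le: "dbound I M k f \<Longrightarrow> x \<in> I \<Longrightarrow> norm (f x) \<le> M"
  by (cases k) auto

lemma dbound_mono: "dbound I M k f \<Longrightarrow> M \<le> M' \<Longrightarrow> dbound I M' k f"
  by (induction k arbitrary: f) (auto intro: order_trans)

lemma dbound_subset: "dbound I M k f \<Longrightarrow> J \<subseteq> I \<Longrightarrow> dbound J M k f"
  by (induction k arbitrary: f) (auto simp: subset_iff)

lemma dbound_Suc_imp: "dbound I M (Suc k) f \<Longrightarrow> dbound I M k f"
  by (induction k arbitrary: f) auto

lemma dbound_Suc_deriv:
  assumes "dbound I M (Suc k) f" "\<And>x. (f has_vector_derivative g x) (at x)"
  shows "dbound I M k g"
proof -
  obtain g' where g': "\<And>x. (f has_vector_derivative g' x) (at x)" "dbound I M k g'" using assms(1) by auto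
  have "g = g'" using vector_derivative_unique_at[OF assms(2) g'(1)] by auto
  then show ?thesis using g'(2) by simp
qed

lemma dbound_const: "norm c \<le> M \<Longrightarrow> dbound I M k (\<lambda>_. c)"
proof (induction k arbitrary: c)
  case (Suc k)
  have "M \<ge> 0" using Suc.prems norm_ge_zero order_trans by blast
  then have "dbound I M k (\<lambda>_. 0 :: 'a)" using Suc.IH[of 0] by simp
  then show ?case using Suc.prems by (auto intro!: exI[of _ "\<lambda>_. 0"])
qed simp

lemma dbound_zero: "M \<ge> 0 \<Longrightarrow> dbound I M k (\<lambda>_. 0)" by (rule dbound_const) simp

lemma dbound_add: "dbound I M k f \<Longrightarrow> dbound I M' k g \<Longrightarrow> dbound I (M + M') k (\<lambda>x. f x + g x)"
proof (induction k arbitrary: f g)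
  case (Suc k)
  obtain f' g' where "\<And>x. (f has_vector_derivative f' x) (at x)" "dbound I M k f'"
    "\<And>x. (g has_vector_derivative g' x) (at x)" "dbound I M' k g'" using Suc.prems by auto
  then show ?case
    by (intro dbound_SucI[where g = "\<lambda>x. f' x + g' x"] Suc.IH norm_triangle_mono has_vector_derivative_add)
      (use Suc.prems dbound_le in auto)
qed (auto intro: norm_triangle_mono)

text \<open>Each application of the product rule doubles the number of terms, hence the factor
  \<open>2^k\<close>.\<close>

lemma dbound_mult:
  "dbound I M k f \<Longrightarrow> dbound I M' k g \<Longrightarrow> M \<ge> 0 \<Longrightarrow> M' \<ge> 0 \<Longrightarrow> dbound I (2^k * M * M') k (\<lambda>x. f x * g x)"
proof (induction k arbitrary: f g)
  case 0
  then show ?case by (auto simp: norm_mult mult_mono)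
next
  case (Suc k)
  obtain f' where f': "\<And>x. (f has_vector_derivative f' x) (at x)" "dbound I M k f'" using Suc.prems by auto
  obtain g' where g': "\<And>x. (g has_vector_derivative g' x) (at x)" "dbound I M' k g'" using Suc.prems by auto
  have "dbound I (2^k * M * M' + 2^k * M * M') k (\<lambda>x. f x * g' x + f' x * g x)"
    by (intro dbound_add Suc.IH f' g') (use Suc.prems dbound_Suc_imp in blast)+
  then have "dbound I (2^Suc k * M * M') k (\<lambda>x. f x * g' x + f' x * g x)" by (simp add: mult_ac)
  moreover have "((\<lambda>x. f x * g x) has_vector_derivative f x * g' x + f' x * g x) (at x)" for x
    by (rule has_vector_derivative_mult[OF f'(1) g'(1)])
  moreover have "norm (f x * g x) \<le> 2^Suc k * M * M'" if "x \<in> I" for x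
  proof -
    have "norm (f x * g x) \<le> M * M'"
      unfolding norm_mult using dbound_le[OF Suc.prems(1) that] dbound_le[OF Suc.prems(2) that] Suc.prems
      by (intro mult_mono) auto
    also have "\<dots> \<le> 2^Suc k * (M * M')" using Suc.prems one_le_power[of "2::real" "Suc k"]
        mult_right_mono[of 1 "2^Suc k" "M * M'"] by simp
    finally show ?thesis by (simp add: mult.assoc)
  qed
  ultimately show ?case by (intro dbound_SucI[where g = "\<lambda>x. f x * g' x + f' x * g x"])
qed

lemma has_vector_derivative_affine:
  assumes "\<And>x. (f has_vector_derivative g x) (at x)"
  shows "((\<lambda>x. f (c * x + e)) has_vector_derivative c *\<^sub>R g (c * x + e)) (at x)"
proof -
  have "((\<lambda>x. c * x + e) has_real_derivative c) (at x)" by (auto intro!: derivative_eq_intros)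
  then show ?thesis
    using vector_diff_chain_at[of "\<lambda>x. c * x + e" c x f "g (c * x + e)"] assms
    by (simp add: o_def has_real_derivative_iff_has_vector_derivative)
qed

lemma dbound_affine:
  fixes f :: "real \<Rightarrow> 'a::real_normed_field"
  assumes "dbound UNIV M k f" "\<bar>c\<bar> \<le> 1"
  shows "dbound UNIV M k (\<lambda>x. f (c * x + e))"
  using assms(1)
proof (induction k arbitrary: f)
  case (Suc k)
  obtain g where g: "\<And>x. (f has_vector_derivative g x) (at x)" "dbound UNIV M k g" using Suc.prems by auto
  have sc: "dbound UNIV M j (\<lambda>x. c *\<^sub>R h x)" if "dbound UNIV M j h" for j and h :: "real \<Rightarrow> 'a"
    using that
  proof (induction j arbitrary: h)
    case (0 h)
    then show ?case using assms(2) mult_mono[of "\<bar>c\<bar>" 1] by fastforce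
  next
    case (Suc j h)
    then obtain h' where "\<And>x. (h has_vector_derivative h' x) (at x)" "dbound UNIV M j h'" by auto
    moreover have "norm (c *\<^sub>R h x) \<le> M" for x
      using assms(2) mult_mono[of "\<bar>c\<bar>" 1 "norm (h x)" M] dbound_le[OF Suc.prems] by force
    ultimately show ?case using Suc.IH
      by (auto intro!: exI[of _ "\<lambda>x. c *\<^sub>R h' x"] bounded_linear.has_vector_derivative[OF bounded_linear_scaleR_right])
  qed
  have "((\<lambda>x. f (c * x + e)) has_vector_derivative c *\<^sub>R g (c * x + e)) (at x)" for x
    by (rule has_vector_derivative_affine[OF g(1)])
  then show ?case using sc[OF Suc.IH[OF g(2)]] dbound_le[OF Suc.prems]
    by (intro dbound_SucI[where g = "\<lambda>x. c *\<^sub>R g (c * x + e)"]) auto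
qed auto

lemma dbound_of_real:
  "dbound I M k f \<Longrightarrow> dbound I M k (\<lambda>x. of_real (f x) :: 'a::real_normed_field)"
proof (induction k arbitrary: f)
  case (Suc k)
  then obtain g where "\<And>x. (f has_vector_derivative g x) (at x)" "dbound I M k g" by auto
  moreover from this(1) have "((\<lambda>x. of_real (f x) :: 'a) has_vector_derivative of_real (g x)) (at x)" for x
    by (rule bounded_linear.has_vector_derivative[OF bounded_linear_of_real])
  ultimately show ?case
    using Suc.IH dbound_le[OF Suc.prems] by (intro dbound_SucI[where g = "\<lambda>x. of_real (g x)"]) auto
qed auto

text \<open>On the empty set the bounds are void and \<open>dbound\<close> only expresses
  differentiability to order \<open>k\<close>. With this encoding the closure properties of smooth
  and of bounded smooth functions come from the same lemmas.\<close>

definition csmooth :: "(real \<Rightarrow> 'a::real_normed_field) \<Rightarrow> bool" where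
  "csmooth f \<longleftrightarrow> (\<forall>k. dbound {} 0 k f)"

definition bsmooth :: "(real \<Rightarrow> 'a::real_normed_field) \<Rightarrow> bool" where
  "bsmooth f \<longleftrightarrow> (\<forall>k. \<exists>M\<ge>0. dbound UNIV M k f)"

lemma bsmooth_csmooth: "bsmooth f \<Longrightarrow> csmooth f"
  unfolding bsmooth_def csmooth_def
proof
  fix k assume "\<forall>k. \<exists>M\<ge>0. dbound UNIV M k f"
  then obtain M where "dbound UNIV M k f" by blast
  then show "dbound {} 0 k f" by (induction k arbitrary: f) auto
qed

lemma bsmoothI: "(\<And>k. \<exists>M. dbound UNIV M k f) \<Longrightarrow> bsmooth f"
  unfolding bsmooth_def by (meson dbound_mono max.cobounded1 max.cobounded2)

lemma csmooth_has_deriv: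
  assumes "csmooth f" obtains f' where "\<And>x. (f has_vector_derivative f' x) (at x)" "csmooth f'"
proof -
  have "dbound {} 0 (Suc 0) f" using assms by (simp add: csmooth_def del: dbound.simps)
  then obtain f' where f': "\<And>x. (f has_vector_derivative f' x) (at x)" by auto
  moreover have "csmooth f'" unfolding csmooth_def
    using assms dbound_Suc_deriv[OF _ f'] unfolding csmooth_def by blast
  ultimately show ?thesis using that by blast
qed

lemma bsmooth_has_deriv:
  assumes "bsmooth f" obtains f' where "\<And>x. (f has_vector_derivative f' x) (at x)" "bsmooth f'"
proof -
  obtain f' where f': "\<And>x. (f has_vector_derivative f' x) (at x)"
    using csmooth_has_deriv[OF bsmooth_csmooth[OF assms]] by blast
  moreover have "bsmooth f'" unfolding bsmooth_def
    using assms dbound_Suc_deriv[OF _ f'] unfolding bsmooth_def by meson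
  ultimately show ?thesis using that by blast
qed

lemma bsmooth_bounded: assumes "bsmooth f" obtains M where "M \<ge> 0" "\<And>x. norm (f x) \<le> M"
  using assms dbound_le[where I = UNIV and f = f] unfolding bsmooth_def by (metis UNIV_I)

lemma csmooth_continuous: "csmooth f \<Longrightarrow> continuous_on A f"
  by (metis csmooth_has_deriv continuous_at_imp_continuous_on has_vector_derivative_continuous)

lemma csmooth_const [intro!]: "csmooth (\<lambda>_. c)"
  unfolding csmooth_def
proof
  fix k show "dbound {} 0 k (\<lambda>_. c)"
    by (cases k) (auto intro!: exI[of _ "\<lambda>_. 0"] dbound_zero)
qed

lemma bsmooth_const [intro!]: "bsmooth (\<lambda>_. c)"
  by (rule bsmoothI) (use dbound_const in blast)

lemma csmooth_add: "csmooth f \<Longrightarrow> csmooth g \<Longrightarrow> csmooth (\<lambda>x. f x + g x)"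
  unfolding csmooth_def using dbound_add[of "{}" 0 _ f 0 g] by simp

lemma bsmooth_add: "bsmooth f \<Longrightarrow> bsmooth g \<Longrightarrow> bsmooth (\<lambda>x. f x + g x)"
  unfolding bsmooth_def using dbound_add by (metis add_nonneg_nonneg)

lemma csmooth_mult: "csmooth f \<Longrightarrow> csmooth g \<Longrightarrow> csmooth (\<lambda>x. f x * g x)"
  unfolding csmooth_def using dbound_mult[of "{}" 0 _ f 0 g] by simp

lemma bsmooth_mult: "bsmooth f \<Longrightarrow> bsmooth g \<Longrightarrow> bsmooth (\<lambda>x. f x * g x)"
  by (rule bsmoothI) (use dbound_mult in \<open>unfold bsmooth_def, blast\<close>)

lemma bsmooth_minus: "bsmooth f \<Longrightarrow> bsmooth (\<lambda>x. - f x)"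
  using bsmooth_mult[OF bsmooth_const[of "-1"]] by simp

lemma bsmooth_diff: "bsmooth f \<Longrightarrow> bsmooth g \<Longrightarrow> bsmooth (\<lambda>x. f x - g x)"
  using bsmooth_add[OF _ bsmooth_minus] by simp

lemma bsmooth_power: "bsmooth f \<Longrightarrow> bsmooth (\<lambda>x. f x ^ n)"
  by (induction n) (auto intro: bsmooth_mult)

lemma bsmooth_of_real: "bsmooth f \<Longrightarrow> bsmooth (\<lambda>x. of_real (f x))"
  unfolding bsmooth_def using dbound_of_real by blast

text \<open>The derivative \<open>- f' / f^2\<close> contains the reciprocal itself, so a bound for
  \<open>k\<close> derivatives of the reciprocal yields one for \<open>k + 1\<close> of
  them.\<close>

lemma bsmooth_inverse:
  fixes f :: "real \<Rightarrow> 'a::real_normed_field"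
  assumes f: "bsmooth f" and "\<delta> > 0" and \<delta>: "\<And>x. norm (f x) \<ge> \<delta>"
  shows "bsmooth (\<lambda>x. inverse (f x))"
proof (rule bsmoothI)
  obtain f' where f': "\<And>x. (f has_vector_derivative f' x) (at x)" "bsmooth f'"
    using bsmooth_has_deriv[OF f] by blast
  have nz: "f x \<noteq> 0" for x using \<delta>[of x] \<open>\<delta> > 0\<close> by auto
  have le: "norm (inverse (f x)) \<le> inverse \<delta>" for x
    unfolding norm_inverse using \<delta>[of x] \<open>\<delta> > 0\<close> by (intro le_imp_inverse_le) auto
  have D: "((\<lambda>x. inverse (f x)) has_vector_derivative - (f' x * (inverse (f x) * inverse (f x)))) (at x)" for x
    using Deriv.has_derivative_inverse[OF nz[of x] f'(1)[of x, unfolded has_vector_derivative_def]]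
    by (simp add: has_vector_derivative_def mult_ac)
  fix k show "\<exists>M. dbound UNIV M k (\<lambda>x. inverse (f x))"
  proof (induction k)
    case 0
    then show ?case using le by auto
  next
    case (Suc k)
    then obtain M where M: "M \<ge> 0" "dbound UNIV M k (\<lambda>x. inverse (f x))"
      by (meson dbound_mono max.cobounded1 max.cobounded2)
    obtain M' where M': "M' \<ge> 0" "dbound UNIV M' k (\<lambda>x. - f' x)"
      using bsmooth_minus[OF f'(2)] unfolding bsmooth_def by blast
    have "dbound UNIV (2^k * M' * (2^k * M * M)) k (\<lambda>x. - f' x * (inverse (f x) * inverse (f x)))"
      by (intro dbound_mult M M') (use M in auto)
    then have "dbound UNIV (max (inverse \<delta>) (2^k * M' * (2^k * M * M))) k (\<lambda>x. - f' x * (inverse (f x) * inverse (f x)))"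
      by (rule dbound_mono) simp
    then have "dbound UNIV (max (inverse \<delta>) (2^k * M' * (2^k * M * M))) (Suc k) (\<lambda>x. inverse (f x))"
      using D le by (intro dbound_SucI[where g = "\<lambda>x. - f' x * (inverse (f x) * inverse (f x))"])
        (auto simp: le_max_iff_disj)
    then show ?case by blast
  qed
qed

lemma bsmooth_divide:
  fixes f :: "real \<Rightarrow> 'a::real_normed_field"
  assumes "bsmooth g" "bsmooth f" "\<delta> > 0" "\<And>x. norm (f x) \<ge> \<delta>"
  shows "bsmooth (\<lambda>x. g x / f x)"
  unfolding divide_inverse by (rule bsmooth_mult[OF assms(1) bsmooth_inverse[OF assms(2-4)]])

lemma smooth_real_iff_csmooth: "smooth_real f \<longleftrightarrow> csmooth f"
proof
  assume f: "smooth_real f"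
  have D: "((deriv ^^ j) f has_vector_derivative (deriv ^^ Suc j) f x) (at x)" for j x
    using f unfolding smooth_real_def differentiable_on_def
    by (metis UNIV_I DERIV_deriv_iff_real_differentiable funpow.simps(2) has_real_derivative_iff_has_vector_derivative o_apply)
  have "dbound {} 0 k ((deriv ^^ j) f)" for k j
  proof (induction k arbitrary: j)
    case (Suc k)
    show ?case by (rule dbound_SucI[OF _ D Suc]) auto
  qed simp
  from this[of _ 0] show "csmooth f" by (simp add: csmooth_def)
next
  assume f: "csmooth f"
  have "csmooth ((deriv ^^ k) f)" for k
  proof (induction k)
    case (Suc k)
    obtain g where g: "\<And>x. ((deriv ^^ k) f has_vector_derivative g x) (at x)" "csmooth g"
      using csmooth_has_deriv[OF Suc] by blast
    have "deriv ((deriv ^^ k) f) = g"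
      using g(1) by (intro ext DERIV_imp_deriv) (simp add: has_real_derivative_iff_has_vector_derivative)
    then show ?case using g by simp
  qed (use f in simp)
  then show "smooth_real f" unfolding smooth_real_def differentiable_on_def
    by (metis UNIV_I csmooth_has_deriv differentiableI_vector differentiable_at_withinI)
qed

lemma deriv_funpow_Suc:
  assumes "\<And>x. (f has_real_derivative f' x) (at x)"
  shows "(deriv ^^ Suc k) f = (deriv ^^ k) f'"
proof -
  have "deriv f = f'" using assms DERIV_imp_deriv by blast
  then show ?thesis by (simp add: funpow_swap1)
qed

lemma dbound_of_deriv_bounds:
  assumes "smooth_real f" "\<And>j x. j \<le> k \<Longrightarrow> x \<in> I \<Longrightarrow> \<bar>(deriv ^^ j) f x\<bar> \<le> M"
  shows "dbound I M k f"
  using assms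
proof (induction k arbitrary: f)
  case (Suc k)
  obtain f' where f': "\<And>x. (f has_vector_derivative f' x) (at x)" "csmooth f'"
    using csmooth_has_deriv Suc.prems(1) smooth_real_iff_csmooth by metis
  note eq = deriv_funpow_Suc[OF f'(1)[folded has_real_derivative_iff_has_vector_derivative]]
  have "dbound I M k f'"
  proof (rule Suc.IH)
    show "smooth_real f'" using f' smooth_real_iff_csmooth by metis
    fix j x assume "j \<le> k" "x \<in> I"
    with Suc.prems(2)[of "Suc j" x] show "\<bar>(deriv ^^ j) f' x\<bar> \<le> M" unfolding eq by simp
  qed
  then show ?case using f' Suc.prems(2)[of 0] by auto
qed (use assms(2)[of 0] in auto)

text \<open>The standard flat function \<open>exp (- 1 / x)\<close>, extended by 0, with powers of
  \<open>1 / x\<close> included in order to have a family that is closed under differentiation up to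
  linear combinations. Smoothness is then an induction over the whole family.\<close>

definition flat :: "nat \<Rightarrow> real \<Rightarrow> real" where
  "flat n x = (if x \<le> 0 then 0 else (1 / x)^n * exp (- (1 / x)))"

lemma flat_power_aux: "x > 0 \<Longrightarrow> real n * (1 / x) ^ (n - Suc 0) = real n * x * (1 / x) ^ n"
  by (cases n) auto

lemma flat_deriv:
  "(flat n has_real_derivative flat (n + 2) x + - real n * flat (n + 1) x) (at x)"
proof -
  consider "x < 0" | "x = 0" | "x > 0" by linarith
  then show ?thesis
  proof cases
    case 1
    have "((\<lambda>_. 0) has_real_derivative flat (n + 2) x + - real n * flat (n + 1) x) (at x)"
      using 1 by (simp add: flat_def)
    then show ?thesis
      by (rule has_field_derivative_transform_within_open[where S = "{..<0}"]) (use 1 in \<open>auto simp: flat_def\<close>)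
  next
    case 2
    have "((\<lambda>h. flat n h / h) \<longlongrightarrow> 0) (at_right 0)"
    proof -
      have "((\<lambda>h::real. (inverse h)^(n+1) / exp (inverse h)) \<longlongrightarrow> 0) (at_right 0)"
        by (rule filterlim_compose[OF tendsto_power_div_exp_0 filterlim_inverse_at_top_right])
      then show ?thesis
        by (rule Lim_transform_eventually)
          (auto simp: eventually_at_filter flat_def exp_minus field_simps intro!: always_eventually)
    qed
    moreover have "((\<lambda>h. flat n h / h) \<longlongrightarrow> 0) (at_left 0)"
      by (rule Lim_transform_eventually[OF tendsto_const])
        (auto simp: eventually_at_filter flat_def intro!: always_eventually)
    ultimately have "((\<lambda>h. flat n h / h) \<longlongrightarrow> 0) (at 0)" by (simp add: filterlim_split_at)
    then show ?thesis using 2 by (simp add: DERIV_def flat_def)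
  next
    case 3
    have "((\<lambda>x. (1 / x)^n * exp (- (1 / x))) has_real_derivative flat (n + 2) x + - real n * flat (n + 1) x) (at x)"
      using 3 flat_power_aux[of x n] by (auto intro!: derivative_eq_intros simp: flat_def field_simps power2_eq_square)
    then show ?thesis
      by (rule has_field_derivative_transform_within_open[where S = "{0<..}"]) (use 3 in \<open>auto simp: flat_def\<close>)
  qed
qed

lemma csmooth_flat: "csmooth (flat n)"
proof -
  have "dbound {} 0 k (flat n)" for k
  proof (induction k arbitrary: n)
    case (Suc k)
    have "dbound {} 0 k (\<lambda>_. - real n)" using csmooth_const csmooth_def by blast
    from dbound_mult[OF this Suc] have "dbound {} 0 k (\<lambda>x. - real n * flat (n + 1) x)" by simp
    from dbound_add[OF Suc this] have "dbound {} 0 k (\<lambda>x. flat (n + 2) x + - real n * flat (n + 1) x)" by simp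
    then show ?case
      by (intro dbound_SucI[OF _ flat_deriv[unfolded has_real_derivative_iff_has_vector_derivative]]) auto
  qed simp
  then show ?thesis by (simp add: csmooth_def)
qed

lemma csmooth_affine:
  fixes f :: "real \<Rightarrow> 'a::real_normed_field"
  assumes "csmooth f" shows "csmooth (\<lambda>x. f (c * x + e))"
proof -
  have "dbound {} 0 k (\<lambda>x. f (c * x + e))" if "csmooth f" for k and f :: "real \<Rightarrow> 'a"
    using that
  proof (induction k arbitrary: f)
    case (Suc k)
    obtain g where g: "\<And>x. (f has_vector_derivative g x) (at x)" "csmooth g"
      using csmooth_has_deriv[OF Suc.prems] by blast
    have "dbound {} 0 k (\<lambda>_. of_real c :: 'a)" using csmooth_const csmooth_def by blast
    from dbound_mult[OF this Suc.IH[OF g(2)]]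
    have "dbound {} 0 k (\<lambda>x. of_real c * g (c * x + e))" by simp
    moreover have "((\<lambda>x. f (c * x + e)) has_vector_derivative of_real c * g (c * x + e)) (at x)" for x
      using has_vector_derivative_affine[OF g(1)] by (simp add: scaleR_conv_of_real)
    ultimately show ?case by (intro dbound_SucI[where g = "\<lambda>x. of_real c * g (c * x + e)"]) auto
  qed simp
  then show ?thesis using assms by (simp add: csmooth_def)
qed

text \<open>Increasing \<open>m\<close> steepens both edges while the support stays in
  \<open>{a..b}\<close>; since \<open>flat 0\<close> tends to 1 at infinity, the bumps approximate
  the indicator of the open interval.\<close>

definition bump :: "nat \<Rightarrow> real \<Rightarrow> real \<Rightarrow> real \<Rightarrow> real" where
  "bump m a b x = flat 0 (real (Suc m) * (x - a)) * flat 0 (real (Suc m) * (b - x))"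

lemma flat0_bounds: "0 \<le> flat 0 x" "flat 0 x \<le> 1" "x > 0 \<Longrightarrow> flat 0 x > 0"
  by (auto simp: flat_def)

lemma bump_bounds: "0 \<le> bump m a b x" "bump m a b x \<le> 1" "bump m a b x \<le> indicator {a..b} x"
proof -
  show 1: "0 \<le> bump m a b x" "bump m a b x \<le> 1"
    using flat0_bounds unfolding bump_def by (auto intro: mult_le_one)
  show "bump m a b x \<le> indicator {a..b} x"
  proof (cases "x \<in> {a..b}")
    case False
    then have "real (Suc m) * (x - a) \<le> 0 \<or> real (Suc m) * (b - x) \<le> 0"
      by (auto simp: mult_le_0_iff)
    then show ?thesis by (auto simp: bump_def flat_def)
  qed (use 1 in auto)
qed

lemma csmooth_bump: "csmooth (bump m a b)"
proof -
  have "csmooth (\<lambda>x. flat 0 (real (Suc m) * x + - real (Suc m) * a) * flat 0 (- real (Suc m) * x + real (Suc m) * b))"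
    by (intro csmooth_mult csmooth_affine csmooth_flat)
  then show ?thesis unfolding bump_def by (simp only: right_diff_distrib) (simp add: algebra_simps)
qed

lemma test_function_iff: "test_function \<eta> \<longleftrightarrow> csmooth \<eta> \<and> (\<exists>R. \<forall>x. \<bar>x\<bar> > R \<longrightarrow> \<eta> x = 0)"
  by (simp add: test_function_def smooth_real_iff_csmooth)

lemma test_function_bump: "test_function (bump m a b)"
  unfolding test_function_iff
proof (intro conjI csmooth_bump exI allI impI)
  fix x assume "\<bar>x\<bar> > max \<bar>a\<bar> \<bar>b\<bar>"
  then have "x \<notin> {a..b}" by auto
  then show "bump m a b x = 0" using bump_bounds(1,3)[of m a b x] by auto
qed

lemma bump_tendsto: "(\<lambda>m. bump m a b x) \<longlonglongrightarrow> indicator {a<..<b} x"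
proof (cases "x \<in> {a<..<b}")
  case True
  have lim: "(\<lambda>m. flat 0 (real (Suc m) * y)) \<longlonglongrightarrow> 1" if "y > 0" for y
  proof -
    have "(\<lambda>m. exp (- (inverse (real (Suc m)) * inverse y))) \<longlonglongrightarrow> exp (- (0 * inverse y))"
      by (intro tendsto_intros LIMSEQ_inverse_real_of_nat)
    then show ?thesis using that by (simp add: flat_def inverse_eq_divide mult_le_0_iff add_nonneg_pos not_le)
  qed
  have "(\<lambda>m. bump m a b x) \<longlonglongrightarrow> 1 * 1"
    unfolding bump_def by (intro tendsto_mult lim) (use True in auto)
  then show ?thesis using True by simp
next
  case False
  then have "bump m a b x = 0" for m
  proof -
    have "real (Suc m) * (x - a) \<le> 0 \<or> real (Suc m) * (b - x) \<le> 0" using False by (auto simp: mult_le_0_iff)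
    then show ?thesis by (auto simp: bump_def flat_def)
  qed
  then show ?thesis using False by simp
qed

lemma csmooth_bounded_support_bsmooth:
  fixes f :: "real \<Rightarrow> 'a::real_normed_field"
  assumes "csmooth f" "\<And>x. \<bar>x\<bar> > R \<Longrightarrow> f x = 0"
  shows "bsmooth f"
proof (rule bsmoothI)
  fix k show "\<exists>M. dbound UNIV M k f"
    using assms
  proof (induction k arbitrary: f)
    case 0
    have "bounded (f ` {- R..R})"
      by (intro compact_imp_bounded compact_continuous_image csmooth_continuous 0(1)) auto
    then obtain M where M: "\<And>x. x \<in> {- R..R} \<Longrightarrow> norm (f x) \<le> M" unfolding bounded_iff by blast
    have "norm (f x) \<le> max M 0" for x
    proof (cases "\<bar>x\<bar> > R")
      case False
      then have "x \<in> {- R..R}" by auto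
      from M[OF this] show ?thesis by simp
    qed (use 0(2) in simp)
    then show ?case by auto
  next
    case (Suc k)
    obtain M where M: "dbound UNIV M k f" using Suc by blast
    obtain g where g: "\<And>x. (f has_vector_derivative g x) (at x)" "csmooth g"
      using csmooth_has_deriv[OF Suc.prems(1)] by blast
    have "g x = 0" if x: "\<bar>x\<bar> > R" for x
    proof -
      have "((\<lambda>_. 0) has_vector_derivative 0) (at x)" by simp
      then have "(f has_vector_derivative 0) (at x)"
        by (rule has_vector_derivative_transform_within_open[where S = "{x. \<bar>x\<bar> > R}"])
          (use Suc.prems(2) x in \<open>auto intro!: open_Collect_less continuous_intros\<close>)
      then show ?thesis using g(1) vector_derivative_unique_at by blast
    qed
    then obtain M' where "dbound UNIV M' k g" using Suc.IH[OF g(2)] by blast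
    then have "dbound UNIV (max M M') k g" by (rule dbound_mono) simp
    then have "dbound UNIV (max M M') (Suc k) f"
      using g(1) dbound_le[OF M] by (intro dbound_SucI[where g = g]) (auto simp: le_max_iff_disj)
    then show ?case by blast
  qed
qed

lemma test_function_deriv: "test_function \<eta> \<Longrightarrow> (\<And>x. (\<eta> has_real_derivative \<eta>' x) (at x)) \<Longrightarrow> test_function \<eta>'"
  unfolding test_function_iff
proof (elim conjE exE, intro conjI)
  fix R assume \<eta>: "csmooth \<eta>" "\<forall>x. \<bar>x\<bar> > R \<longrightarrow> \<eta> x = 0" and D: "\<And>x. (\<eta> has_real_derivative \<eta>' x) (at x)"
  then show "csmooth \<eta>'"
    by (metis csmooth_has_deriv ext has_real_derivative_iff_has_vector_derivative vector_derivative_unique_at)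
  have "\<eta>' x = 0" if "\<bar>x\<bar> > R" for x
  proof -
    have "((\<lambda>_. 0) has_real_derivative 0) (at x)" by simp
    then have "(\<eta> has_real_derivative 0) (at x)"
      by (rule has_field_derivative_transform_within_open[where S = "{x. \<bar>x\<bar> > R}"])
        (use \<eta>(2) that in \<open>auto intro!: open_Collect_less continuous_intros\<close>)
    then show ?thesis using D DERIV_unique by blast
  qed
  then show "\<exists>R. \<forall>x. \<bar>x\<bar> > R \<longrightarrow> \<eta>' x = 0" by blast
qed

lemma test_function_mult: "csmooth f \<Longrightarrow> test_function \<eta> \<Longrightarrow> test_function (\<lambda>x. f x * \<eta> x)"
  unfolding test_function_iff using csmooth_mult by fastforce

lemma test_function_has_deriv:
  assumes "test_function \<eta>"
  obtains \<eta>' where "\<And>x. (\<eta> has_real_derivative \<eta>' x) (at x)" "test_function \<eta>'"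
  using assms test_function_deriv
  by (metis csmooth_has_deriv has_real_derivative_iff_has_vector_derivative test_function_iff)

section \<open>Weak derivatives\<close>

lemma continuous_has_antiderivative:
  fixes f :: "real \<Rightarrow> real"
  assumes "continuous_on UNIV f"
  shows "\<exists>F. \<forall>x. (F has_real_derivative f x) (at x)"
proof -
  have int: "f integrable_on {s..t}" for s t
    by (rule integrable_continuous_real[OF continuous_on_subset[OF assms]]) auto
  \<comment> \<open>An integral over a reversed interval is 0, so one of the two terms always
    vanishes; the difference is the oriented integral from 0.\<close>
  define F where "F = (\<lambda>x. integral {0..x} f - integral {x..0} f)"
  have "(F has_real_derivative f x) (at x)" for x
  proof -
    define a where "a = min x 0 - 1"
    have eq: "F y = integral {a..y} f - integral {a..0} f" if "y > a" for y
    proof (cases "y \<ge> 0")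
      case True
      have "integral {a..0} f + integral {0..y} f = integral {a..y} f"
        by (rule Henstock_Kurzweil_Integration.integral_combine) (use True int in \<open>auto simp: a_def\<close>)
      then show ?thesis using True by (cases "y = 0") (auto simp: F_def)
    next
      case False
      have "integral {a..y} f + integral {y..0} f = integral {a..0} f"
        by (rule Henstock_Kurzweil_Integration.integral_combine) (use False that int in auto)
      then show ?thesis using False by (auto simp: F_def)
    qed
    have "((\<lambda>y. integral {a..y} f) has_vector_derivative f x) (at x within {a..x+1})"
      by (rule integral_has_vector_derivative) (use assms in \<open>auto intro: continuous_on_subset simp: a_def\<close>)
    moreover have "at x within {a..x+1} = at x" by (intro at_within_interior) (auto simp: a_def)
    ultimately have "((\<lambda>y. integral {a..y} f - integral {a..0} f) has_real_derivative f x - 0) (at x)"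
      by (intro DERIV_diff DERIV_const) (simp add: has_real_derivative_iff_has_vector_derivative)
    then have "((\<lambda>y. integral {a..y} f - integral {a..0} f) has_real_derivative f x) (at x)" by simp
    then show ?thesis
      by (rule has_field_derivative_transform_within_open[where S = "{a<..}"]) (auto simp: eq a_def)
  qed
  then show ?thesis by blast
qed

lemma locally_integrable_mult_bounded_support:
  assumes f: "locally_integrable f" and \<eta>: "\<eta> \<in> borel_measurable borel" "\<And>x. norm (\<eta> x) \<le> M"
    and supp: "\<And>x. \<bar>x\<bar> > R \<Longrightarrow> \<eta> x = 0"
  shows "integrable lborel (\<lambda>x. \<eta> x * f x)"
proof -
  have i: "set_integrable lborel {- R..R} f" using f by (simp add: locally_integrable_def)
  have "integrable lborel (\<lambda>x. \<eta> x * (indicator {- R..R} x *\<^sub>R f x))"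
  proof (rule Bochner_Integration.integrable_bound)
    show "integrable lborel (\<lambda>x. M * norm (indicator {- R..R} x *\<^sub>R f x))"
      using i by (intro integrable_mult_right integrable_norm) (simp add: set_integrable_def)
    show "(\<lambda>x. \<eta> x * (indicator {- R..R} x *\<^sub>R f x)) \<in> borel_measurable lborel"
      using i \<eta>(1) by (intro borel_measurable_times) (auto simp: set_integrable_def)
    have "M \<ge> 0" using \<eta>(2)[of 0] norm_ge_zero order_trans by blast
    then show "AE x in lborel. norm (\<eta> x * (indicator {- R..R} x *\<^sub>R f x)) \<le> norm (M * norm (indicator {- R..R} x *\<^sub>R f x))"
      by (intro AE_I2) (auto simp: norm_mult indicator_def intro!: mult_right_mono \<eta>)
  qed
  moreover have "\<eta> x * (indicator {- R..R} x *\<^sub>R f x) = \<eta> x * f x" for x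
    using supp[of x] by (cases "x \<in> {- R..R}") (auto simp: abs_real_def split: if_splits)
  ultimately show ?thesis by simp
qed

lemma test_function_bounds:
  assumes "test_function \<eta>"
  obtains R M where "R > 0" "\<And>x. \<bar>x\<bar> > R \<Longrightarrow> \<eta> x = 0" "\<And>x. \<bar>\<eta> x\<bar> \<le> M" "\<eta> \<in> borel_measurable borel" "continuous_on UNIV \<eta>"
proof -
  obtain R where R: "\<And>x. \<bar>x\<bar> > R \<Longrightarrow> \<eta> x = 0" and sm: "csmooth \<eta>" using assms by (auto simp: test_function_iff)
  obtain M where "\<And>x. norm (\<eta> x) \<le> M" using csmooth_bounded_support_bsmooth[OF sm R] bsmooth_bounded by metis
  moreover have "continuous_on UNIV \<eta>" using sm by (rule csmooth_continuous)
  ultimately show ?thesis using R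
    by (intro that[of "max R 1" M]) (auto intro: borel_measurable_continuous_onI)
qed

lemma integrable_test_mult:
  assumes "locally_integrable f" "test_function \<eta>"
  shows "integrable lborel (\<lambda>x. complex_of_real (\<eta> x) * f x)"
proof -
  obtain R M where "\<And>x. \<bar>x\<bar> > R \<Longrightarrow> \<eta> x = 0" "\<And>x. \<bar>\<eta> x\<bar> \<le> M" "\<eta> \<in> borel_measurable borel"
    using test_function_bounds[OF assms(2)] by metis
  then show ?thesis
    by (intro locally_integrable_mult_bounded_support[OF assms(1), where R = R and M = M]) auto
qed

text \<open>Closed half lines to the left are stable under intersection and generate the Borel sets.
  The sets on which the integral vanishes form a Dynkin system, which therefore contains all Borel
  sets.\<close>

lemma AE_eq_0_of_interval_integrals:
  fixes f :: "real \<Rightarrow> real"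
  assumes f: "integrable lborel f" and "\<And>a. (LINT x:{..a}|lborel. f x) = 0"
  shows "AE x in lborel. f x = 0"
proof -
  have int: "set_integrable lborel A f" if "A \<in> sets borel" for A
    unfolding set_integrable_def by (rule integrable_mult_indicator) (use f that in auto)
  have UNIV0: "(LINT x|lborel. f x) = 0"
  proof -
    have "(\<lambda>n. LINT x:{..real n}|lborel. f x) \<longlonglongrightarrow> (LINT x|lborel. f x)"
      unfolding set_lebesgue_integral_def
    proof (rule integral_dominated_convergence[where w = "\<lambda>x. norm (f x)"])
      show "AE x in lborel. (\<lambda>n. indicat_real {..real n} x *\<^sub>R f x) \<longlonglongrightarrow> f x"
      proof (intro AE_I2 tendsto_eventually)
        fix x show "\<forall>\<^sub>F n in sequentially. indicat_real {..real n} x *\<^sub>R f x = f x"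
          using eventually_ge_at_top[of "nat \<lceil>x\<rceil>"] by eventually_elim (simp add: indicator_def; linarith)
      qed
    qed (use f in \<open>auto simp: indicator_def\<close>)
    then show ?thesis using assms(2) LIMSEQ_unique[OF _ tendsto_const] by auto
  qed
  have "(LINT x:A|lborel. f x) = 0" if "A \<in> sets lborel" for A
  proof -
    have "Int_stable (range (\<lambda>a::real. {..a}))" "range (\<lambda>a::real. {..a}) \<subseteq> Pow UNIV"
      by (auto simp: Int_stable_def)
    moreover have "A \<in> sigma_sets UNIV (range (\<lambda>a::real. {..a}))"
      using that by (simp add: borel_eq_atMost)
    ultimately show ?thesis
    proof (induction rule: sigma_sets_induct_disjoint)
      case (basic A) then show ?case using assms(2) by auto
    next
      case empty then show ?case by (simp add: set_lebesgue_integral_def)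
    next
      case (compl A)
      then have A: "A \<in> sets borel" by (simp add: borel_eq_atMost)
      have "(LINT x:(UNIV - A) \<union> A|lborel. f x) = (LINT x:UNIV - A|lborel. f x) + (LINT x:A|lborel. f x)"
        by (rule set_integral_Un) (use int A in auto)
      then show ?case using compl UNIV0 by (simp add: set_lebesgue_integral_def)
    next
      case (union A)
      then have A: "A i \<in> sets borel" for i by (auto simp: borel_eq_atMost)
      have "(LINT x:(\<Union>i. A i)|lborel. f x) = (\<Sum>i. (LINT x:(A i)|lborel. f x))"
      proof (rule lebesgue_integral_countable_add)
        show "set_integrable lborel (\<Union>i. A i) f" using A by (intro int) auto
      qed (use A union(1) in \<open>auto simp: disjoint_family_on_def\<close>)
      then show ?case using union by simp
    qed
  qed
  then have "AE x in lborel. f x = (\<lambda>_. 0) x"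
    by (intro density_unique_real f) (auto simp: set_lebesgue_integral_def)
  then show ?thesis by simp
qed

text \<open>The bumps on \<open>{a..b}\<close> tend almost everywhere to its indicator, so dominated
  convergence shows that \<open>g\<close> has integral 0 over every bounded interval.\<close>

lemma fundamental_lemma:
  assumes g: "locally_integrable g"
    and z: "\<And>\<eta>. test_function \<eta> \<Longrightarrow> (LINT x|lborel. complex_of_real (\<eta> x) * g x) = 0"
  shows "AE x in lborel. g x = 0"
proof -
  have gm: "set_integrable lborel {a..b} g" for a b using g by (simp add: locally_integrable_def)
  have int0: "(LINT x:{a..b}|lborel. g x) = 0" for a b
  proof -
    have "(\<lambda>m. LINT x|lborel. complex_of_real (bump m a b x) * (indicator {a..b} x *\<^sub>R g x)) \<longlonglongrightarrow> (LINT x|lborel. indicator {a..b} x *\<^sub>R g x)"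
    proof (rule integral_dominated_convergence[where w = "\<lambda>x. norm (indicator {a..b} x *\<^sub>R g x)"])
      show "AE x in lborel. (\<lambda>m. complex_of_real (bump m a b x) * (indicator {a..b} x *\<^sub>R g x)) \<longlonglongrightarrow> indicator {a..b} x *\<^sub>R g x"
        using AE_lborel_singleton[of a] AE_lborel_singleton[of b]
      proof eventually_elim
        case (elim x)
        have "(\<lambda>m. complex_of_real (bump m a b x) * (indicator {a..b} x *\<^sub>R g x)) \<longlonglongrightarrow> complex_of_real (indicator {a<..<b} x) * (indicator {a..b} x *\<^sub>R g x)"
          by (intro tendsto_intros bump_tendsto)
        then show ?case using elim by (cases "x \<in> {a..b}") (auto simp: indicator_def)
      qed
      fix m show "AE x in lborel. norm (complex_of_real (bump m a b x) * (indicator {a..b} x *\<^sub>R g x)) \<le> norm (indicator {a..b} x *\<^sub>R g x)"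
        using bump_bounds[of m a b] mult_right_mono[OF bump_bounds(2)] by (intro AE_I2) (auto simp: norm_mult indicator_def)
      show "(\<lambda>x. complex_of_real (bump m a b x) * (indicator {a..b} x *\<^sub>R g x)) \<in> borel_measurable lborel"
        using gm[of a b] borel_measurable_continuous_onI[OF csmooth_continuous[OF csmooth_bump]]
        by (intro borel_measurable_times) (auto simp: set_integrable_def)
    next
      show "integrable lborel (\<lambda>x. norm (indicator {a..b} x *\<^sub>R g x))"
        using gm[of a b] unfolding set_integrable_def by (rule integrable_norm)
    qed (use gm[of a b] in \<open>auto simp: set_integrable_def\<close>)
    moreover have "(LINT x|lborel. complex_of_real (bump m a b x) * (indicator {a..b} x *\<^sub>R g x)) = 0" for m
    proof -
      have "complex_of_real (bump m a b x) * (indicator {a..b} x *\<^sub>R g x) = complex_of_real (bump m a b x) * g x" for x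
        using bump_bounds[of m a b x] by (cases "x \<in> {a..b}") auto
      then show ?thesis using z[OF test_function_bump] by simp
    qed
    ultimately show ?thesis unfolding set_lebesgue_integral_def using LIMSEQ_unique[OF _ tendsto_const] by auto
  qed
  \<comment> \<open>\<open>g\<close> is integrable only locally and is complex, whereas the
    criterion just proved concerns integrable real functions; hence the restriction to
    \<open>{- real n..real n}\<close> and the real functional \<open>T\<close>, which is
    \<open>Re\<close> or \<open>Im\<close> in the end.\<close>
  have part: "AE x in lborel. T (indicator {- real n..real n} x *\<^sub>R g x) = 0"
    if T: "bounded_linear T" for T :: "complex \<Rightarrow> real" and n
  proof (rule AE_eq_0_of_interval_integrals)
    have i: "integrable lborel (\<lambda>x. indicator {- real n..real n} x *\<^sub>R g x)"
      using gm by (simp add: set_integrable_def)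
    show "integrable lborel (\<lambda>x. T (indicator {- real n..real n} x *\<^sub>R g x))"
      by (rule integrable_bounded_linear[OF T i])
    fix a
    have "(LINT x:{..a}|lborel. T (indicator {- real n..real n} x *\<^sub>R g x)) =
        (LINT x|lborel. T (indicator {- real n..min a (real n)} x *\<^sub>R g x))"
      unfolding set_lebesgue_integral_def
      by (rule Bochner_Integration.integral_cong) (auto simp: indicator_def linear_simps[OF T])
    also have "\<dots> = T (LINT x|lborel. indicator {- real n..min a (real n)} x *\<^sub>R g x)"
      by (rule integral_bounded_linear[OF T]) (use gm in \<open>simp add: set_integrable_def\<close>)
    also have "\<dots> = 0" using int0[of "- real n" "min a (real n)"] linear_simps[OF T] by (simp add: set_lebesgue_integral_def)
    finally show "(LINT x:{..a}|lborel. T (indicator {- real n..real n} x *\<^sub>R g x)) = 0" .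
  qed
  have "AE x in lborel. \<forall>n. Re (indicator {- real n..real n} x *\<^sub>R g x) = 0 \<and> Im (indicator {- real n..real n} x *\<^sub>R g x) = 0"
    unfolding AE_all_countable using part[OF bounded_linear_Re] part[OF bounded_linear_Im] by auto
  then show ?thesis
  proof eventually_elim
    case (elim x)
    obtain n where "\<bar>x\<bar> \<le> real n" using real_arch_simple by blast
    then have "x \<in> {- real n..real n}" by auto
    then show ?case using elim[rule_format, of n] by (simp add: complex_eq_iff)
  qed
qed

text \<open>This form admits any function known to be the derivative of the test function, so that
  product rules for test functions need no evaluation of \<open>deriv\<close>.\<close>

lemma has_weak_deriv_1:
  "has_weak_deriv 1 f g \<longleftrightarrow> locally_integrable f \<and> locally_integrable g \<and>
     (\<forall>\<eta> \<eta>'. test_function \<eta> \<longrightarrow> (\<forall>x. (\<eta> has_real_derivative \<eta>' x) (at x)) \<longrightarrow>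
        (LINT x|lborel. complex_of_real (\<eta>' x) * f x) = - (LINT x|lborel. complex_of_real (\<eta> x) * g x))"
proof -
  have "(\<forall>\<eta>. test_function \<eta> \<longrightarrow> P \<eta> (deriv \<eta>)) \<longleftrightarrow>
      (\<forall>\<eta> \<eta>'. test_function \<eta> \<longrightarrow> (\<forall>x. (\<eta> has_real_derivative \<eta>' x) (at x)) \<longrightarrow> P \<eta> \<eta>')" for P
  proof -
    have "deriv \<eta> = \<eta>'" if "\<And>x. (\<eta> has_real_derivative \<eta>' x) (at x)" for \<eta> \<eta>' :: "real \<Rightarrow> real"
      using that DERIV_imp_deriv by blast
    then show ?thesis by (metis test_function_has_deriv)
  qed
  from this[of "\<lambda>\<eta> \<eta>'. (LINT x|lborel. complex_of_real (\<eta>' x) * f x) = - (LINT x|lborel. complex_of_real (\<eta> x) * g x)"]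
  show ?thesis unfolding has_weak_deriv_def by simp
qed

lemma test_function_funpow_deriv: "test_function \<eta> \<Longrightarrow> test_function ((deriv ^^ j) \<eta>)"
proof (induction j)
  case (Suc j)
  then obtain \<eta>' where "\<And>x. ((deriv ^^ j) \<eta> has_real_derivative \<eta>' x) (at x)" "test_function \<eta>'"
    using test_function_has_deriv by blast
  moreover have "deriv ((deriv ^^ j) \<eta>) = \<eta>'" using calculation DERIV_imp_deriv by blast
  ultimately show ?case by simp
qed simp

lemma has_weak_deriv_unique:
  assumes "has_weak_deriv j f g" "has_weak_deriv j f' g'" "AE x in lborel. f x = f' x"
  shows "AE x in lborel. g x = g' x"
proof -
  have li: "locally_integrable g" "locally_integrable g'" "locally_integrable f" "locally_integrable f'"
    using assms by (auto simp: has_weak_deriv_def)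
  have "AE x in lborel. g x - g' x = 0"
  proof (rule fundamental_lemma)
    show "locally_integrable (\<lambda>x. g x - g' x)" using li by (auto simp: locally_integrable_def intro!: set_integral_diff)
    fix \<eta> assume \<eta>: "test_function \<eta>"
    have "(LINT x|lborel. complex_of_real ((deriv ^^ j) \<eta> x) * f x) = (LINT x|lborel. complex_of_real ((deriv ^^ j) \<eta> x) * f' x)"
    proof (rule integral_cong_AE)
      show "AE x in lborel. complex_of_real ((deriv ^^ j) \<eta> x) * f x = complex_of_real ((deriv ^^ j) \<eta> x) * f' x"
        using assms(3) by eventually_elim simp
    qed (intro borel_measurable_integrable integrable_test_mult test_function_funpow_deriv \<eta> li)+
    then have "(-1)^j * (LINT x|lborel. complex_of_real (\<eta> x) * g x) = (-1)^j * (LINT x|lborel. complex_of_real (\<eta> x) * g' x)"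
      using assms(1)[unfolded has_weak_deriv_def, THEN conjunct2, THEN conjunct2, rule_format, OF \<eta>]
        assms(2)[unfolded has_weak_deriv_def, THEN conjunct2, THEN conjunct2, rule_format, OF \<eta>] by simp
    then have "(LINT x|lborel. complex_of_real (\<eta> x) * g x) = (LINT x|lborel. complex_of_real (\<eta> x) * g' x)" by simp
    then show "(LINT x|lborel. complex_of_real (\<eta> x) * (g x - g' x)) = 0"
      using integrable_test_mult[OF li(1) \<eta>] integrable_test_mult[OF li(2) \<eta>] by (simp add: right_diff_distrib)
  qed
  then show ?thesis by eventually_elim simp
qed

lemma has_weak_deriv_0: "locally_integrable f \<Longrightarrow> has_weak_deriv 0 f f"
  by (simp add: has_weak_deriv_def)

lemma has_weak_deriv_Suc:
  assumes "has_weak_deriv 1 f g"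
  shows "has_weak_deriv (Suc j) f h \<longleftrightarrow> has_weak_deriv j g h"
proof -
  have *: "(LINT x|lborel. complex_of_real ((deriv ^^ Suc j) \<eta> x) * f x) = - (LINT x|lborel. complex_of_real ((deriv ^^ j) \<eta> x) * g x)"
    if "test_function \<eta>" for \<eta>
    using assms test_function_funpow_deriv[OF that, of j] by (simp add: has_weak_deriv_def)
  show ?thesis using assms unfolding has_weak_deriv_def by (auto simp: * simp del: funpow.simps)
qed

lemma weak_deriv_AE: "has_weak_deriv j f g \<Longrightarrow> AE x in lborel. weak_deriv j f x = g x"
  unfolding weak_deriv_def
  by (rule has_weak_deriv_unique[OF someI[of "has_weak_deriv j f"]]) auto

lemma locally_integrable_continuous: "continuous_on UNIV f \<Longrightarrow> locally_integrable f"
  unfolding locally_integrable_def using borel_integrable_atLeastAtMost' continuous_on_subset by blast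

lemma locally_integrable_add:
  "locally_integrable f \<Longrightarrow> locally_integrable g \<Longrightarrow> locally_integrable (\<lambda>x. f x + g x)"
  unfolding locally_integrable_def by (simp add: set_integral_add)

lemma locally_integrable_mult:
  assumes "locally_integrable f" "continuous_on UNIV m"
  shows "locally_integrable (\<lambda>x. m x * f x)"
  unfolding locally_integrable_def
proof (intro allI)
  fix a b
  have "bounded (m ` {a..b})"
    by (intro compact_imp_bounded compact_continuous_image continuous_on_subset[OF assms(2)]) auto
  then obtain M where M: "\<And>x. x \<in> {a..b} \<Longrightarrow> norm (m x) \<le> M" unfolding bounded_iff by blast
  define \<eta> where "\<eta> = (\<lambda>x. indicator {a..b} x *\<^sub>R m x)"
  have mm: "m \<in> borel_measurable borel" using assms(2) by (rule borel_measurable_continuous_onI)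
  have "integrable lborel (\<lambda>x. \<eta> x * f x)"
  proof (rule locally_integrable_mult_bounded_support[OF assms(1)])
    show "\<eta> \<in> borel_measurable borel" unfolding \<eta>_def using mm by measurable
    show "norm (\<eta> x) \<le> max M 0" for x using M[of x] by (auto simp: \<eta>_def indicator_def le_max_iff_disj)
    fix x assume "\<bar>x\<bar> > max \<bar>a\<bar> \<bar>b\<bar>"
    then have "x \<notin> {a..b}" by auto
    then show "\<eta> x = 0" by (simp add: \<eta>_def)
  qed
  then show "set_integrable lborel {a..b} (\<lambda>x. m x * f x)" by (simp add: set_integrable_def \<eta>_def)
qed

lemma csmooth_Re: fixes f :: "real \<Rightarrow> complex" assumes "csmooth f" shows "csmooth (\<lambda>x. Re (f x))"
proof -
  have "dbound {} 0 k (\<lambda>x. Re (f x))" if "csmooth f" for k and f :: "real \<Rightarrow> complex"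
    using that
  proof (induction k arbitrary: f)
    case (Suc k)
    obtain g where g: "\<And>x. (f has_vector_derivative g x) (at x)" "csmooth g"
      using csmooth_has_deriv[OF Suc.prems] by blast
    have "((\<lambda>x. Re (f x)) has_vector_derivative Re (g x)) (at x)" for x
      by (rule bounded_linear.has_vector_derivative[OF bounded_linear_Re g(1)])
    then show ?case using Suc.IH[OF g(2)] by (intro dbound_SucI[where g = "\<lambda>x. Re (g x)"]) auto
  qed simp
  then show ?thesis using assms by (simp add: csmooth_def)
qed

lemma csmooth_Im: fixes f :: "real \<Rightarrow> complex" assumes "csmooth f" shows "csmooth (\<lambda>x. Im (f x))"
  using csmooth_Re[OF csmooth_mult[OF csmooth_const[of "- \<i>"] assms]] by simp

lemma has_weak_deriv_add:
  assumes "has_weak_deriv 1 f g" "has_weak_deriv 1 f' g'"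
  shows "has_weak_deriv 1 (\<lambda>x. f x + f' x) (\<lambda>x. g x + g' x)"
  using assms unfolding has_weak_deriv_1
  by (simp add: locally_integrable_add distrib_left integrable_test_mult test_function_deriv)

lemma has_weak_deriv_cmult:
  assumes "has_weak_deriv 1 f g"
  shows "has_weak_deriv 1 (\<lambda>x. c * f x) (\<lambda>x. c * g x)"
  using assms unfolding has_weak_deriv_1
  by (simp add: locally_integrable_mult mult.left_commute[of _ c])

lemma has_weak_deriv_mult_real:
  assumes fg: "has_weak_deriv 1 f g" and m: "csmooth m" "\<And>x. (m has_real_derivative m' x) (at x)"
  shows "has_weak_deriv 1 (\<lambda>x. complex_of_real (m x) * f x) (\<lambda>x. complex_of_real (m' x) * f x + complex_of_real (m x) * g x)"
proof -
  have li: "locally_integrable f" "locally_integrable g" using fg unfolding has_weak_deriv_1 by auto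
  obtain m'' where "\<And>x. (m has_vector_derivative m'' x) (at x)" "csmooth m''" using csmooth_has_deriv[OF m(1)] by blast
  then have sm': "csmooth m'"
    using m(2) by (metis ext has_real_derivative_iff_has_vector_derivative vector_derivative_unique_at)
  have cm: "continuous_on UNIV (\<lambda>x. complex_of_real (m x))" "continuous_on UNIV (\<lambda>x. complex_of_real (m' x))"
    using csmooth_continuous m(1) sm' by (auto intro!: continuous_intros)
  show ?thesis
    unfolding has_weak_deriv_1
  proof (intro conjI allI impI)
    show "locally_integrable (\<lambda>x. complex_of_real (m x) * f x)"
      by (rule locally_integrable_mult[OF li(1) cm(1)])
    show "locally_integrable (\<lambda>x. complex_of_real (m' x) * f x + complex_of_real (m x) * g x)"
      by (intro locally_integrable_add locally_integrable_mult li cm)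
    fix \<eta> \<eta>' assume \<eta>: "test_function \<eta>" and D: "\<forall>x. (\<eta> has_real_derivative \<eta>' x) (at x)"
    have \<eta>': "test_function \<eta>'" using test_function_deriv[OF \<eta>] D by blast
    have t: "test_function (\<lambda>x. m x * \<eta> x)" "test_function (\<lambda>x. m x * \<eta>' x)" "test_function (\<lambda>x. m' x * \<eta> x)"
      using test_function_mult m(1) sm' \<eta> \<eta>' by auto
    have D': "((\<lambda>x. m x * \<eta> x) has_real_derivative m' x * \<eta> x + m x * \<eta>' x) (at x)" for x
      using D m(2) by (auto intro!: derivative_eq_intros)
    have 1: "(LINT x|lborel. complex_of_real (m' x * \<eta> x + m x * \<eta>' x) * f x) = - (LINT x|lborel. complex_of_real (m x * \<eta> x) * g x)"
      using fg[unfolded has_weak_deriv_1, THEN conjunct2, THEN conjunct2, rule_format, OF t(1) D'] .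
    have 2: "(LINT x|lborel. complex_of_real (m' x * \<eta> x + m x * \<eta>' x) * f x) =
        (LINT x|lborel. complex_of_real (m' x * \<eta> x) * f x) + (LINT x|lborel. complex_of_real (m x * \<eta>' x) * f x)"
      using integrable_test_mult[OF li(1) t(3)] integrable_test_mult[OF li(1) t(2)]
      by (subst Bochner_Integration.integral_add[symmetric]) (auto simp: algebra_simps)
    have 3: "(LINT x|lborel. complex_of_real (\<eta> x) * (complex_of_real (m' x) * f x + complex_of_real (m x) * g x)) =
        (LINT x|lborel. complex_of_real (m' x * \<eta> x) * f x) + (LINT x|lborel. complex_of_real (m x * \<eta> x) * g x)"
      using integrable_test_mult[OF li(1) t(3)] integrable_test_mult[OF li(2) t(1)]
      by (subst Bochner_Integration.integral_add[symmetric]) (auto simp: algebra_simps)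
    have 4: "(LINT x|lborel. complex_of_real (\<eta>' x) * (complex_of_real (m x) * f x)) = (LINT x|lborel. complex_of_real (m x * \<eta>' x) * f x)"
      by (rule Bochner_Integration.integral_cong) auto
    have alg: "b + a = - c \<Longrightarrow> a = - (b + c)" for a b c :: complex by algebra
    show "(LINT x|lborel. complex_of_real (\<eta>' x) * (complex_of_real (m x) * f x)) =
       - (LINT x|lborel. complex_of_real (\<eta> x) * (complex_of_real (m' x) * f x + complex_of_real (m x) * g x))"
      unfolding 4 3 by (rule alg) (use 1 in \<open>simp only: 2\<close>)
  qed
qed

text \<open>Test functions are real, so a complex multiplier cannot be moved onto them; its real and
  imaginary parts can.\<close>

lemma has_weak_deriv_mult:
  fixes m :: "real \<Rightarrow> complex"
  assumes fg: "has_weak_deriv 1 f g" and m: "csmooth m" "\<And>x. (m has_vector_derivative m' x) (at x)"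
  shows "has_weak_deriv 1 (\<lambda>x. m x * f x) (\<lambda>x. m' x * f x + m x * g x)"
proof -
  have "((\<lambda>x. Re (m x)) has_real_derivative Re (m' x)) (at x)" "((\<lambda>x. Im (m x)) has_real_derivative Im (m' x)) (at x)" for x
    using m(2)[of x] by (auto simp: has_vector_derivative_complex_iff)
  note re = has_weak_deriv_mult_real[OF fg csmooth_Re[OF m(1)] this(1)]
    and im = has_weak_deriv_mult_real[OF fg csmooth_Im[OF m(1)] this(2)]
  have "z * w = complex_of_real (Re z) * w + \<i> * (complex_of_real (Im z) * w)" for z w :: complex
    by (simp add: complex_eq_iff)
  then have "(\<lambda>x. m x * f x) = (\<lambda>x. complex_of_real (Re (m x)) * f x + \<i> * (complex_of_real (Im (m x)) * f x))"
    "(\<lambda>x. m' x * f x + m x * g x) = (\<lambda>x. (complex_of_real (Re (m' x)) * f x + complex_of_real (Re (m x)) * g x)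
       + \<i> * (complex_of_real (Im (m' x)) * f x + complex_of_real (Im (m x)) * g x))"
    by (auto simp: fun_eq_iff complex_eq_iff)
  then show ?thesis using has_weak_deriv_add[OF re has_weak_deriv_cmult[OF im, of \<i>]] by simp
qed

lemma lborel_integral_FTC_support:
  fixes F :: "real \<Rightarrow> complex"
  assumes "\<And>x. (F has_vector_derivative f x) (at x)" "continuous_on UNIV f"
    and "\<And>x. \<bar>x\<bar> > R \<Longrightarrow> F x = 0" "\<And>x. \<bar>x\<bar> > R \<Longrightarrow> f x = 0"
  shows "(LINT x|lborel. f x) = 0"
proof -
  define S where "S = \<bar>R\<bar> + 1"
  have "(LINT x|lborel. indicator {- S..S} x *\<^sub>R f x) = F S - F (- S)"
    by (rule integral_FTC_atLeastAtMost)
      (use assms in \<open>auto simp: S_def intro: continuous_on_subset has_vector_derivative_at_within\<close>)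
  moreover have "indicator {- S..S} x *\<^sub>R f x = f x" for x
    using assms(4)[of x] by (cases "x \<in> {- S..S}") (auto simp: S_def abs_real_def split: if_splits)
  ultimately show ?thesis using assms(3)[of S] assms(3)[of "- S"] by (simp add: S_def)
qed

lemma has_weak_deriv_classical:
  assumes D: "\<And>x. (f has_vector_derivative f' x) (at x)" and c: "continuous_on UNIV f'"
  shows "has_weak_deriv 1 f f'"
proof -
  have cf: "continuous_on UNIV f"
    using D by (auto intro!: continuous_at_imp_continuous_on intro: has_vector_derivative_continuous)
  have li: "locally_integrable f" "locally_integrable f'" using cf c by (auto intro: locally_integrable_continuous)
  show ?thesis
    unfolding has_weak_deriv_1
  proof (intro conjI allI impI li)
    fix \<eta> \<eta>' assume \<eta>: "test_function \<eta>" and D\<eta>: "\<forall>x. (\<eta> has_real_derivative \<eta>' x) (at x)"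
    have \<eta>': "test_function \<eta>'" using test_function_deriv[OF \<eta>] D\<eta> by blast
    obtain R where R: "\<And>x. \<bar>x\<bar> > R \<Longrightarrow> \<eta> x = 0" "continuous_on UNIV \<eta>" using test_function_bounds[OF \<eta>] by metis
    obtain R' where R': "\<And>x. \<bar>x\<bar> > R' \<Longrightarrow> \<eta>' x = 0" "continuous_on UNIV \<eta>'" using test_function_bounds[OF \<eta>'] by metis
    have "(LINT x|lborel. complex_of_real (\<eta> x) * f' x + complex_of_real (\<eta>' x) * f x) = 0"
    proof (rule lborel_integral_FTC_support[where F = "\<lambda>x. complex_of_real (\<eta> x) * f x" and R = "max R R'"])
      show "((\<lambda>x. complex_of_real (\<eta> x) * f x) has_vector_derivative complex_of_real (\<eta> x) * f' x + complex_of_real (\<eta>' x) * f x) (at x)" for x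
        using D\<eta> D by (auto intro!: has_vector_derivative_mult has_vector_derivative_of_real simp: has_real_derivative_iff_has_vector_derivative)
    qed (use R R' cf c in \<open>auto intro!: continuous_intros\<close>)
    then show "(LINT x|lborel. complex_of_real (\<eta>' x) * f x) = - (LINT x|lborel. complex_of_real (\<eta> x) * f' x)"
      using integrable_test_mult[OF li(2) \<eta>] integrable_test_mult[OF li(1) \<eta>'] by (simp add: eq_neg_iff_add_eq_0 add.commute)
  qed
qed

text \<open>A common condition for functions in some Lebesgue space and for bounded functions which
  makes the integrals of \<open>Jop\<close> converge.\<close>

definition exp_integrable :: "(real \<Rightarrow> complex) \<Rightarrow> bool" where
  "exp_integrable f \<longleftrightarrow> f \<in> borel_measurable borel \<and> (\<forall>x. integrable lborel (\<lambda>y. exp (- \<bar>y - x\<bar>) *\<^sub>R f y))"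

text \<open>The bounded solution of \<open>u' + u = f\<close>, used to recover \<open>u\<close> from \<open>u' + u\<close>.\<close>

definition Jop :: "(real \<Rightarrow> complex) \<Rightarrow> real \<Rightarrow> complex" where
  "Jop f x = (LINT y|lborel. indicator {..x} y *\<^sub>R (exp (y - x) *\<^sub>R f y))"

lemma exp_integrable_bounded:
  "f \<in> borel_measurable borel \<Longrightarrow> (\<And>x. norm (f x) \<le> B) \<Longrightarrow> exp_integrable f"
  unfolding exp_integrable_def using integrable_exp_abs_mult[of 1 f B] by simp

lemma Jop_integrable:
  assumes "exp_integrable f"
  shows "integrable lborel (\<lambda>y. indicator {..x} y *\<^sub>R (exp (y - x) *\<^sub>R f y))"
proof -
  have eq: "indicator {..x} y *\<^sub>R (exp (y - x) *\<^sub>R f y) = indicator {..x} y *\<^sub>R (exp (- \<bar>y - x\<bar>) *\<^sub>R f y)" for y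
    by (auto simp: indicator_def)
  show ?thesis
    unfolding eq using assms by (intro integrable_mult_indicator) (auto simp: exp_integrable_def)
qed

lemma Jop_norm_le:
  assumes "exp_integrable f"
  shows "norm (Jop f x) \<le> (LINT y|lborel. exp (- \<bar>y - x\<bar>) * norm (f y))"
  unfolding Jop_def
proof (rule order_trans[OF integral_norm_bound integral_mono])
  show "integrable lborel (\<lambda>y. exp (- \<bar>y - x\<bar>) * norm (f y))"
    using integrable_norm[of lborel "\<lambda>y. exp (- \<bar>y - x\<bar>) *\<^sub>R f y"] assms by (simp add: exp_integrable_def)
  show "integrable lborel (\<lambda>y. norm (indicator {..x} y *\<^sub>R (exp (y - x) *\<^sub>R f y)))"
    by (rule integrable_norm[OF Jop_integrable[OF assms]])
qed (auto simp: indicator_def)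

lemma Jop_cong_AE:
  assumes "exp_integrable f" "exp_integrable g" "AE x in lborel. f x = g x"
  shows "Jop f x = Jop g x"
  unfolding Jop_def
proof (rule integral_cong_AE)
  show "AE y in lborel. indicator {..x} y *\<^sub>R (exp (y - x) *\<^sub>R f y) = indicator {..x} y *\<^sub>R (exp (y - x) *\<^sub>R g y)"
    using assms(3) by eventually_elim simp
qed (intro borel_measurable_integrable Jop_integrable assms)+

lemma exp_integrable_locally:
  assumes "exp_integrable f" shows "locally_integrable f"
  unfolding locally_integrable_def
proof (intro allI)
  fix a b
  define g where "g = (\<lambda>y. exp (- \<bar>y - 0\<bar>) *\<^sub>R f y)"
  have "integrable lborel g" using assms unfolding exp_integrable_def g_def by blast
  then have "locally_integrable g"
    unfolding locally_integrable_def set_integrable_def by (auto intro!: integrable_mult_indicator)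
  then have "locally_integrable (\<lambda>y. complex_of_real (exp \<bar>y\<bar>) * g y)"
    by (rule locally_integrable_mult) (intro continuous_intros)
  moreover have "complex_of_real (exp \<bar>y\<bar>) * g y = f y" for y
    by (simp add: g_def scaleR_conv_of_real mult.assoc[symmetric] flip: of_real_mult exp_add)
  ultimately show "set_integrable lborel {a..b} f" by (simp add: locally_integrable_def)
qed

text \<open>Splitting off the part of the integral below a fixed \<open>a\<close> leaves an integral
  over \<open>{a..x}\<close>, to which the continuity of indefinite integrals and the fundamental
  theorem apply.\<close>

lemma Jop_local:
  assumes "exp_integrable f" "a \<le> x"
  shows "Jop f x = exp (- x) *\<^sub>R ((LINT y|lborel. indicator {..a} y *\<^sub>R (exp y *\<^sub>R f y)) + integral {a..x} (\<lambda>y. exp y *\<^sub>R f y))"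
proof -
  let ?g = "\<lambda>y. exp y *\<^sub>R f y"
  have eq: "indicator {..t} y *\<^sub>R ?g y = exp t *\<^sub>R (indicator {..t} y *\<^sub>R (exp (y - t) *\<^sub>R f y))" for t y :: real
    by (simp add: exp_diff)
  have i: "set_integrable lborel {..t} ?g" for t
    unfolding set_integrable_def eq by (intro integrable_scaleR_right Jop_integrable assms)
  have e: "exp (y - x) = exp (- x) * exp y" for y by (simp flip: exp_add)
  have "Jop f x = (LINT y|lborel. exp (- x) *\<^sub>R (indicator {..x} y *\<^sub>R ?g y))"
    unfolding Jop_def e by (simp only: scaleR_scaleR mult_ac)
  also have "\<dots> = exp (- x) *\<^sub>R (LINT y:{..x}|lborel. ?g y)"
    unfolding set_lebesgue_integral_def using i[of x, unfolded set_integrable_def]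
    by (simp only: Bochner_Integration.integral_scaleR_right)
  also have "{..x} = {..a} \<union> {a<..x}" using assms(2) by auto
  also have "(LINT y:{..a} \<union> {a<..x}|lborel. ?g y) = (LINT y:{..a}|lborel. ?g y) + (LINT y:{a<..x}|lborel. ?g y)"
    by (rule set_integral_Un[OF _ i set_integrable_subset[OF i[of x]]]) (use assms(2) in auto)
  also have "(LINT y:{a<..x}|lborel. ?g y) = (LINT y:{a..x}|lborel. ?g y)"
    unfolding set_lebesgue_integral_def
  proof (rule integral_cong_AE)
    show "AE y in lborel. indicat_real {a<..x} y *\<^sub>R ?g y = indicat_real {a..x} y *\<^sub>R ?g y"
      using AE_lborel_singleton[of a] by eventually_elim (auto simp: indicator_def)
    show "(\<lambda>y. indicat_real {a<..x} y *\<^sub>R ?g y) \<in> borel_measurable lborel" "(\<lambda>y. indicat_real {a..x} y *\<^sub>R ?g y) \<in> borel_measurable lborel"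
      using assms(1) by (auto simp: exp_integrable_def)
  qed
  also have "\<dots> = integral {a..x} ?g"
    by (rule set_borel_integral_eq_integral) (use set_integrable_subset[OF i[of x]] in auto)
  finally show ?thesis by (simp add: set_lebesgue_integral_def)
qed

lemma exp_integrable_HK:
  assumes "exp_integrable f" shows "(\<lambda>y. exp y *\<^sub>R f y) integrable_on {a..b}"
proof -
  have "locally_integrable (\<lambda>y. complex_of_real (exp y) * f y)"
    by (rule locally_integrable_mult[OF exp_integrable_locally[OF assms]]) (intro continuous_intros)
  then show ?thesis unfolding locally_integrable_def
    using set_borel_integral_eq_integral(1) by (auto simp: scaleR_conv_of_real)
qed

lemma Jop_continuous:
  assumes "exp_integrable f" shows "continuous_on UNIV (Jop f)"
proof (rule continuous_at_imp_continuous_on, intro ballI)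
  fix x :: real
  have "continuous_on {x-1..x+1} (\<lambda>t. integral {x-1..t} (\<lambda>y. exp y *\<^sub>R f y))"
    by (intro indefinite_integral_continuous_1 exp_integrable_HK[OF assms])
  then have "continuous_on {x-1..x+1} (Jop f)"
    by (subst continuous_on_cong[OF refl Jop_local[OF assms, of "x-1"]]) (auto intro!: continuous_intros)
  then show "isCont (Jop f) x"
    by (rule continuous_on_interior) simp
qed

lemma Jop_has_vector_derivative:
  assumes "exp_integrable f" "continuous_on UNIV f"
  shows "(Jop f has_vector_derivative f x - Jop f x) (at x)"
proof -
  let ?g = "\<lambda>y. exp y *\<^sub>R f y"
  define c where "c = (LINT y|lborel. indicator {..x-1} y *\<^sub>R ?g y)"
  have "((\<lambda>t. integral {x-1..t} ?g) has_vector_derivative ?g x) (at x within {x-1..x+1})"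
    by (rule integral_has_vector_derivative) (use assms(2) in \<open>auto intro!: continuous_intros intro: continuous_on_subset\<close>)
  moreover have "at x within {x-1..x+1} = at x" by (intro at_within_interior) auto
  ultimately have D: "((\<lambda>t. integral {x-1..t} ?g) has_vector_derivative ?g x) (at x)" by simp
  have E: "((\<lambda>t. exp (- t)) has_real_derivative - exp (- x)) (at x)" by (auto intro!: derivative_eq_intros)
  have "((\<lambda>t. exp (- t) *\<^sub>R (c + integral {x-1..t} ?g)) has_vector_derivative
      exp (- x) *\<^sub>R (0 + ?g x) + (- exp (- x)) *\<^sub>R (c + integral {x-1..x} ?g)) (at x)"
    by (intro has_vector_derivative_scaleR[OF E has_vector_derivative_add[OF has_vector_derivative_const D]])
  also have "exp (- x) *\<^sub>R (0 + ?g x) + (- exp (- x)) *\<^sub>R (c + integral {x-1..x} ?g) = f x - Jop f x"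
    using Jop_local[OF assms(1), of "x-1" x] by (simp add: c_def flip: exp_add)
  finally show ?thesis
    by (rule has_vector_derivative_transform_within_open[where S = "{x-1<..}"])
      (auto simp: Jop_local[OF assms(1), of "x-1"] c_def)
qed

lemma exp_integrable_norm: "exp_integrable f \<Longrightarrow> exp_integrable (\<lambda>x. complex_of_real (norm (f x)))"
  unfolding exp_integrable_def
proof (intro conjI allI)
  fix x assume f: "f \<in> borel_measurable borel \<and> (\<forall>x. integrable lborel (\<lambda>y. exp (- \<bar>y - x\<bar>) *\<^sub>R f y))"
  then have "f \<in> borel_measurable borel" by blast
  then show "(\<lambda>x. complex_of_real (norm (f x))) \<in> borel_measurable borel" by measurable
  have "integrable lborel (\<lambda>y. complex_of_real (norm (exp (- \<bar>y - x\<bar>) *\<^sub>R f y)))"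
    using f by (intro integrable_of_real integrable_norm) auto
  then show "integrable lborel (\<lambda>y. exp (- \<bar>y - x\<bar>) *\<^sub>R complex_of_real (norm (f y)))"
    by (simp add: scaleR_conv_of_real norm_mult)
qed

text \<open>By Fubini the integral of \<open>(\<eta>' - \<eta>) Jop f\<close> equals that of
  \<open>f y\<close> against the integral of \<open>exp (y - x) (\<eta>' - \<eta>) x\<close> over
  \<open>x \<ge> y\<close>. The latter integrand is the derivative of
  \<open>exp (y - x) \<eta> x\<close>, so the integral is \<open>- \<eta> y\<close>.\<close>

lemma Jop_weak_deriv:
  assumes f: "exp_integrable f"
  shows "has_weak_deriv 1 (Jop f) (\<lambda>x. f x - Jop f x)"
proof -
  have liJ: "locally_integrable (Jop f)" by (intro locally_integrable_continuous Jop_continuous f)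
  have lif: "locally_integrable f" by (rule exp_integrable_locally[OF f])
  have fm: "f \<in> borel_measurable borel" using f by (simp add: exp_integrable_def)
  show ?thesis
    unfolding has_weak_deriv_1
  proof (intro conjI allI impI liJ)
    show "locally_integrable (\<lambda>x. f x - Jop f x)"
      using locally_integrable_add[OF lif locally_integrable_mult[OF liJ continuous_on_const[of _ "-1"]]] by simp
    fix \<eta> \<eta>' assume \<eta>: "test_function \<eta>" and D: "\<forall>x. (\<eta> has_real_derivative \<eta>' x) (at x)"
    have \<eta>': "test_function \<eta>'" using test_function_deriv[OF \<eta>] D by blast
    obtain R where R: "\<And>x. \<bar>x\<bar> > R \<Longrightarrow> \<eta> x = 0" and c\<eta>: "continuous_on UNIV \<eta>" using test_function_bounds[OF \<eta>] by metis
    obtain R' where R': "\<And>x. \<bar>x\<bar> > R' \<Longrightarrow> \<eta>' x = 0" and c\<eta>': "continuous_on UNIV \<eta>'" using test_function_bounds[OF \<eta>'] by metis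
    define \<psi> where "\<psi> = (\<lambda>x. complex_of_real (\<eta>' x - \<eta> x))"
    have c\<psi>: "continuous_on UNIV \<psi>" unfolding \<psi>_def using c\<eta> c\<eta>' by (intro continuous_intros)
    have m\<psi>: "\<psi> \<in> borel_measurable borel" using c\<psi> by (rule borel_measurable_continuous_onI)
    define F where "F = (\<lambda>x y. \<psi> x * (indicator {..x} y *\<^sub>R (exp (y - x) *\<^sub>R f y)))"
    have inner_int: "integrable lborel (F x)" for x
      unfolding F_def by (intro integrable_mult_right Jop_integrable f)
    have FJ: "(LINT y|lborel. F x y) = \<psi> x * Jop f x" for x
      unfolding F_def Jop_def by (rule integral_mult_right_zero)
    have FN: "(LINT y|lborel. norm (F x y)) = Re (complex_of_real (norm (\<psi> x)) * Jop (\<lambda>x. complex_of_real (norm (f x))) x)" for x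
    proof -
      have "Jop (\<lambda>x. complex_of_real (norm (f x))) x = (LINT y|lborel. complex_of_real (indicator {..x} y * (exp (y - x) * norm (f y))))"
        unfolding Jop_def by (simp add: scaleR_conv_of_real)
      also have "\<dots> = complex_of_real (LINT y|lborel. indicator {..x} y * (exp (y - x) * norm (f y)))"
        by (rule integral_complex_of_real)
      finally have J: "Re (complex_of_real (norm (\<psi> x)) * Jop (\<lambda>x. complex_of_real (norm (f x))) x) =
          norm (\<psi> x) * (LINT y|lborel. indicator {..x} y * (exp (y - x) * norm (f y)))" by simp
      have "norm (F x y) = norm (\<psi> x) * (indicator {..x} y * (exp (y - x) * norm (f y)))" for y
        by (simp add: F_def norm_mult)
      then show ?thesis unfolding J by (simp only: integral_mult_right_zero)
    qed
    have pair: "integrable (lborel \<Otimes>\<^sub>M lborel) (\<lambda>(x, y). F x y)"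
    proof (rule lborel_pair.Fubini_integrable)
      have [measurable]: "f \<in> borel_measurable borel" "\<psi> \<in> borel_measurable borel" by (rule fm, rule m\<psi>)
      have "(\<lambda>z. \<psi> (fst z) * (indicator {z. snd z \<le> fst z} z *\<^sub>R (exp (snd z - fst z) *\<^sub>R f (snd z)))) \<in> borel_measurable (borel \<Otimes>\<^sub>M borel)"
        by measurable
      moreover have "(\<lambda>(x, y). F x y) = (\<lambda>z. \<psi> (fst z) * (indicator {z. snd z \<le> fst z} z *\<^sub>R (exp (snd z - fst z) *\<^sub>R f (snd z))))"
        by (auto simp: fun_eq_iff F_def indicator_def)
      ultimately show "(\<lambda>(x, y). F x y) \<in> borel_measurable (lborel \<Otimes>\<^sub>M lborel)" by simp
      have cJ: "continuous_on UNIV (\<lambda>x. complex_of_real (norm (\<psi> x)))" using c\<psi> by (intro continuous_intros)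
      have "integrable lborel (\<lambda>x. complex_of_real (norm (\<psi> x)) * Jop (\<lambda>x. complex_of_real (norm (f x))) x)"
      proof -
        have sup: "\<psi> x = 0" if "\<bar>x\<bar> > max R R'" for x using R R' that by (simp add: \<psi>_def)
        have "bounded (\<psi> ` {- max R R'..max R R'})"
          by (intro compact_imp_bounded compact_continuous_image continuous_on_subset[OF c\<psi>]) auto
        then obtain M where M: "\<And>x. x \<in> {- max R R'..max R R'} \<Longrightarrow> norm (\<psi> x) \<le> M" unfolding bounded_iff by blast
        have "norm (\<psi> x) \<le> max M 0" for x
        proof (cases "\<bar>x\<bar> > max R R'")
          case False
          then have "x \<in> {- max R R'..max R R'}" by auto
          from M[OF this] show ?thesis by simp
        qed (use sup in simp)
        then show ?thesis
          using borel_measurable_continuous_onI[OF cJ] sup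
          by (intro locally_integrable_mult_bounded_support[OF locally_integrable_continuous[OF Jop_continuous[OF exp_integrable_norm[OF f]]],
                where M = "max M 0" and R = "max R R'"]) auto
      qed
      then show "integrable lborel (\<lambda>x. LINT y|lborel. norm (case (x, y) of (x, y) \<Rightarrow> F x y))"
        unfolding prod.case FN by (rule integrable_Re)
      show "AE x in lborel. integrable lborel (\<lambda>y. case (x, y) of (x, y) \<Rightarrow> F x y)"
        using inner_int by simp
    qed
    have "(LINT x|lborel. \<psi> x * Jop f x) = (LINT x|lborel. (LINT y|lborel. F x y))" by (simp add: FJ)
    also have "\<dots> = (LINT y|lborel. (LINT x|lborel. F x y))"
      using lborel_pair.Fubini_integral[OF pair] by simp
    also have "\<dots> = (LINT y|lborel. - (complex_of_real (\<eta> y) * f y))"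
    proof (rule Bochner_Integration.integral_cong[OF refl])
      fix y :: real
      \<comment> \<open>Beyond \<open>S\<close> both \<open>\<eta>\<close> and
        \<open>\<eta>'\<close> vanish, so the half line can be cut off there.\<close>
      define S where "S = max \<bar>y\<bar> (max \<bar>R\<bar> \<bar>R'\<bar>) + 1"
      have I1: "(LINT x|lborel. indicator {y..S} x *\<^sub>R (exp (y - x) *\<^sub>R \<psi> x)) = complex_of_real (exp (y - S) * \<eta> S) - complex_of_real (exp (y - y) * \<eta> y)"
      proof (rule integral_FTC_atLeastAtMost)
        fix x
        have "((\<lambda>x. exp (y - x) * \<eta> x) has_real_derivative exp (y - x) * (\<eta>' x - \<eta> x)) (at x within {y..S})"
          by (rule derivative_eq_intros has_field_derivative_at_within[OF D[rule_format]] refl)+ (simp add: algebra_simps)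
        then show "((\<lambda>x. complex_of_real (exp (y - x) * \<eta> x)) has_vector_derivative exp (y - x) *\<^sub>R \<psi> x) (at x within {y..S})"
          using has_vector_derivative_of_real[of "\<lambda>x. exp (y - x) * \<eta> x" "exp (y - x) * (\<eta>' x - \<eta> x)" "at x within {y..S}"]
          by (simp add: \<psi>_def scaleR_conv_of_real has_real_derivative_iff_has_vector_derivative)
      qed (use c\<psi> in \<open>auto simp: S_def intro!: continuous_intros intro: continuous_on_subset\<close>)
      have \<eta>S: "\<eta> S = 0" using R[of S] by (simp add: S_def)
      have Fx: "F x y = (indicator {y..S} x *\<^sub>R (exp (y - x) *\<^sub>R \<psi> x)) * f y" for x
      proof (cases "x > S")
        case True
        then have "\<eta> x = 0" "\<eta>' x = 0" using R[of x] R'[of x] by (auto simp: S_def)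
        then show ?thesis by (simp add: F_def \<psi>_def)
      qed (auto simp: F_def indicator_def)
      have "(LINT x|lborel. F x y) = (LINT x|lborel. indicator {y..S} x *\<^sub>R (exp (y - x) *\<^sub>R \<psi> x)) * f y"
        unfolding Fx by (rule integral_mult_left_zero)
      then show "(LINT x|lborel. F x y) = - (complex_of_real (\<eta> y) * f y)" unfolding I1 by (simp add: \<eta>S)
    qed
    finally have main: "(LINT x|lborel. \<psi> x * Jop f x) = - (LINT y|lborel. complex_of_real (\<eta> y) * f y)" by simp
    note i = integrable_test_mult[OF liJ \<eta>] integrable_test_mult[OF liJ \<eta>'] integrable_test_mult[OF lif \<eta>]
    have "(LINT x|lborel. \<psi> x * Jop f x) = (LINT x|lborel. complex_of_real (\<eta>' x) * Jop f x) - (LINT x|lborel. complex_of_real (\<eta> x) * Jop f x)"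
      using i by (simp add: \<psi>_def left_diff_distrib)
    then show "(LINT x|lborel. complex_of_real (\<eta>' x) * Jop f x) = - (LINT x|lborel. complex_of_real (\<eta> x) * (f x - Jop f x))"
      using main i by (simp add: right_diff_distrib) (simp add: algebra_simps)
  qed
qed

section \<open>Lebesgue spaces on the line\<close>

text \<open>A test function with integral 0 has an antiderivative that is again a test function. An
  arbitrary one becomes such after subtracting a multiple of one fixed bump, and the integral of
  \<open>f\<close> against that bump determines the constant.\<close>

lemma du_Bois_Reymond:
  assumes f: "locally_integrable f"
    and z: "\<And>\<eta> \<eta>'. test_function \<eta> \<Longrightarrow> (\<And>x. (\<eta> has_real_derivative \<eta>' x) (at x)) \<Longrightarrow>
       (LINT x|lborel. complex_of_real (\<eta>' x) * f x) = 0"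
  shows "\<exists>c. AE x in lborel. f x = c"
proof -
  have ti: "integrable lborel \<zeta>" if t: "test_function \<zeta>" for \<zeta>
  proof -
    have "integrable lborel (\<lambda>x. complex_of_real (\<zeta> x) * 1)"
      by (rule integrable_test_mult[OF locally_integrable_continuous[OF continuous_on_const] t])
    from integrable_Re[OF this] show ?thesis by simp
  qed
  have prim: "(LINT x|lborel. complex_of_real (\<zeta> x) * f x) = 0"
    if t: "test_function \<zeta>" and int0: "(LINT x|lborel. \<zeta> x) = 0" for \<zeta>
  proof -
    obtain R where R: "R > 0" "\<And>x. \<bar>x\<bar> > R \<Longrightarrow> \<zeta> x = 0" and c: "continuous_on UNIV \<zeta>" using test_function_bounds[OF t] by metis
    obtain F where F: "\<And>x. (F has_real_derivative \<zeta> x) (at x)" using continuous_has_antiderivative[OF c] by blast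
    define \<eta> where "\<eta> = (\<lambda>x. F x - F (- R))"
    have D: "(\<eta> has_real_derivative \<zeta> x) (at x)" for x
      unfolding \<eta>_def using F[of x] by (auto intro!: derivative_eq_intros)
    have Fint: "(LINT x|lborel. indicator {- R..b} x *\<^sub>R \<zeta> x) = F b - F (- R)" if "- R \<le> b" for b
      by (rule integral_FTC_atLeastAtMost[OF that])
        (use F c in \<open>auto simp: has_real_derivative_iff_has_vector_derivative intro: has_vector_derivative_at_within continuous_on_subset\<close>)
    have out: "\<eta> x = 0" if "\<bar>x\<bar> > R" for x
    proof (cases "x > R")
      case True
      have "indicator {- R..x} y *\<^sub>R \<zeta> y = \<zeta> y" for y
        using R(2)[of y] True by (cases "\<bar>y\<bar> > R") (auto simp: indicator_def abs_real_def split: if_splits)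
      then have "(LINT y|lborel. indicator {- R..x} y *\<^sub>R \<zeta> y) = 0" using int0 by (simp only:)
      then show ?thesis using Fint[of x] True R(1) by (simp add: \<eta>_def)
    next
      case False
      then have x: "x < - R" using that by auto
      have "F (- R) - F x = 0"
      proof (rule ccontr)
        assume "F (- R) - F x \<noteq> 0"
        moreover have "\<exists>z. x < z \<and> z < - R \<and> F (- R) - F x = (- R - x) * \<zeta> z"
          using MVT2[OF x] F by blast
        ultimately show False using R(2) by auto
      qed
      then show ?thesis by (simp add: \<eta>_def)
    qed
    have "csmooth \<eta>"
      unfolding csmooth_def
    proof
      fix k show "dbound {} 0 k \<eta>"
      proof (cases k)
        case (Suc j)
        have "dbound {} 0 j \<zeta>" using t by (simp add: test_function_iff csmooth_def)
        then show ?thesis unfolding Suc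
          by (intro dbound_SucI[OF _ D[unfolded has_real_derivative_iff_has_vector_derivative]]) auto
      qed simp
    qed
    then have "test_function \<eta>" unfolding test_function_iff using out by blast
    then show ?thesis using z D by blast
  qed
  define \<eta>0 where "\<eta>0 = bump 0 0 1"
  have t0: "test_function \<eta>0" by (simp add: \<eta>0_def test_function_bump)
  define I where "I = (LINT x|lborel. \<eta>0 x)"
  have "I \<noteq> 0"
  proof
    assume "I = 0"
    then have "AE x in lborel. \<eta>0 x = 0"
      using integral_nonneg_eq_0_iff_AE[OF ti[OF t0]] bump_bounds by (auto simp: I_def \<eta>0_def)
    then have "AE x in lborel. x \<notin> {0<..<1::real}"
    proof eventually_elim
      case (elim x)
      then show ?case using flat0_bounds(3)[of x] flat0_bounds(3)[of "1 - x"] by (auto simp: \<eta>0_def bump_def)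
    qed
    then have "emeasure lborel {0<..<1::real} = 0" 
    proof -
      have "{x \<in> space lborel. \<not> x \<notin> {0<..<1::real}} = {0<..<1}" by auto
      from AE_iff_measurable[OF _ this] show ?thesis using \<open>AE x in lborel. x \<notin> {0<..<1::real}\<close> by auto
    qed
    then show False by simp
  qed
  define c where "c = (LINT x|lborel. complex_of_real (\<eta>0 x) * f x) / complex_of_real I"
  have "AE x in lborel. f x - c = 0"
  proof (rule fundamental_lemma)
    have lc: "locally_integrable (\<lambda>x. - c)" by (rule locally_integrable_continuous) simp
    show "locally_integrable (\<lambda>x. f x - c)" using locally_integrable_add[OF f lc] by simp
    fix \<zeta> assume t: "test_function \<zeta>"
    define a where "a = (LINT x|lborel. \<zeta> x) / I"
    have t1: "test_function (\<lambda>x. \<zeta> x + (- a) * \<eta>0 x)"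
    proof -
      obtain R R' where "\<And>x. \<bar>x\<bar> > R \<Longrightarrow> \<zeta> x = 0" "\<And>x. \<bar>x\<bar> > R' \<Longrightarrow> \<eta>0 x = 0"
        using t t0 unfolding test_function_iff by blast
      then have "\<forall>x. \<bar>x\<bar> > max R R' \<longrightarrow> \<zeta> x + (- a) * \<eta>0 x = 0" by simp
      then show ?thesis using t t0 csmooth_add csmooth_mult[OF csmooth_const] unfolding test_function_iff by blast
    qed
    have "(LINT x|lborel. \<zeta> x + (- a) * \<eta>0 x) = 0"
      using ti[OF t] ti[OF t0] \<open>I \<noteq> 0\<close> by (simp add: a_def I_def[symmetric])
    from prim[OF t1 this]
    have "(LINT x|lborel. complex_of_real (\<zeta> x) * f x - complex_of_real a * (complex_of_real (\<eta>0 x) * f x)) = 0"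
      by (simp add: algebra_simps)
    then have "(LINT x|lborel. complex_of_real (\<zeta> x) * f x) = complex_of_real a * (c * complex_of_real I)"
      using integrable_test_mult[OF f t] integrable_test_mult[OF f t0] \<open>I \<noteq> 0\<close> by (simp add: c_def)
    also have "\<dots> = (LINT x|lborel. complex_of_real (\<zeta> x) * c)"
      using ti[OF t] \<open>I \<noteq> 0\<close> by (simp add: a_def)
    finally show "(LINT x|lborel. complex_of_real (\<zeta> x) * (f x - c)) = 0"
      using integrable_test_mult[OF f t] integrable_of_real[OF ti[OF t], where 'a = complex]
      by (simp add: right_diff_distrib)
  qed
  then have "AE x in lborel. f x = c" by eventually_elim simp
  then show ?thesis by blast
qed

lemma powr_le_of_le_mult:
  fixes K I p :: real
  assumes "p \<ge> 1" "K \<ge> 0" "I \<ge> 0" "J \<ge> 0" "J \<le> K powr p * I"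
  shows "J powr (1 / p) \<le> K * I powr (1 / p)"
proof -
  have "J powr (1 / p) \<le> (K powr p * I) powr (1 / p)" using assms by (intro powr_mono2) auto
  also have "\<dots> = K * I powr (1 / p)" using assms by (simp add: powr_mult powr_powr)
  finally show ?thesis .
qed

lemma le_one_plus_powr: fixes t p :: real assumes "p \<ge> 1" "t \<ge> 0" shows "t \<le> 1 + t powr p"
proof (cases "t \<le> 1")
  case False
  then have "t powr 1 \<le> t powr p" using assms by (intro powr_mono) auto
  then show ?thesis using False by simp
qed (auto intro: order_trans)

text \<open>Bounds obtained by exchanging integrals come as nonnegative integrals, before
  integrability is known; here membership and the norm bound are read off from them
  together.\<close>

lemma in_Lp_nn_integral:
  assumes z: "z \<in> borel_measurable borel" and g: "in_Lp p g" and p: "p \<ge> 1" and K: "K \<ge> 0"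
    and le: "(\<integral>\<^sup>+x. ennreal (norm (z x) powr p) \<partial>lborel) \<le> ennreal (K powr p * (LINT x|lborel. norm (g x) powr p))"
  shows "in_Lp p z \<and> Lp_norm p z \<le> K * Lp_norm p g"
proof -
  have m: "(\<lambda>x. norm (z x) powr p) \<in> borel_measurable lborel" using z by measurable
  have i: "integrable lborel (\<lambda>x. norm (z x) powr p)"
    by (rule integrableI_bounded[OF m]) (use le in \<open>auto simp: less_top[symmetric] top_unique\<close>)
  then have "ennreal (LINT x|lborel. norm (z x) powr p) \<le> ennreal (K powr p * (LINT x|lborel. norm (g x) powr p))"
    using le nn_integral_eq_integral[OF i] by simp
  then have "(LINT x|lborel. norm (z x) powr p) \<le> K powr p * (LINT x|lborel. norm (g x) powr p)"
    by (subst (asm) ennreal_le_iff) (auto intro!: mult_nonneg_nonneg)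
  then have "Lp_norm p z \<le> K * Lp_norm p g"
    unfolding Lp_norm_def using p K by (intro powr_le_of_le_mult) auto
  then show ?thesis using i z by (simp add: in_Lp_def)
qed

lemma in_Lp_dominated:
  assumes "z \<in> borel_measurable borel" "in_Lp p g" "p \<ge> 1" "K \<ge> 0" "AE x in lborel. norm (z x) \<le> K * norm (g x)"
  shows "in_Lp p z \<and> Lp_norm p z \<le> K * Lp_norm p g"
proof (rule in_Lp_nn_integral[OF assms(1-4)])
  have i: "integrable lborel (\<lambda>x. norm (g x) powr p)" using assms(2) by (simp add: in_Lp_def)
  have "(\<integral>\<^sup>+x. ennreal (norm (z x) powr p) \<partial>lborel) \<le> (\<integral>\<^sup>+x. ennreal (K powr p * norm (g x) powr p) \<partial>lborel)"
  proof (rule nn_integral_mono_AE)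
    show "AE x in lborel. ennreal (norm (z x) powr p) \<le> ennreal (K powr p * norm (g x) powr p)"
      using assms(5)
    proof eventually_elim
      case (elim x)
      have "norm (z x) powr p \<le> (K * norm (g x)) powr p" using elim assms(3) by (intro powr_mono2) auto
      then show ?case using assms(4) by (simp add: powr_mult ennreal_leI)
    qed
  qed
  also have "\<dots> = ennreal (LINT x|lborel. K powr p * norm (g x) powr p)"
    by (rule nn_integral_eq_integral) (use i in auto)
  finally show "(\<integral>\<^sup>+x. ennreal (norm (z x) powr p) \<partial>lborel) \<le> ennreal (K powr p * (LINT x|lborel. norm (g x) powr p))"
    by simp
qed

lemma Lp_norm_nonneg: "Lp_norm p f \<ge> 0" by (simp add: Lp_norm_def)

lemma Lp_norm_cong:
  assumes "f \<in> borel_measurable borel" "g \<in> borel_measurable borel" "AE x in lborel. f x = g x"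
  shows "Lp_norm p f = Lp_norm p g"
proof -
  have "(LINT x|lborel. norm (f x) powr p) = (LINT x|lborel. norm (g x) powr p)"
  proof (rule integral_cong_AE)
    show "AE x in lborel. norm (f x) powr p = norm (g x) powr p" using assms(3) by eventually_elim simp
  qed (use assms in measurable)
  then show ?thesis by (simp add: Lp_norm_def)
qed

lemma Lp_norm_eq_0:
  assumes "in_Lp p f" "Lp_norm p f = 0" shows "AE x in lborel. f x = 0"
proof -
  have "(LINT x|lborel. norm (f x) powr p) = 0" using assms(2) by (simp add: Lp_norm_def)
  then have "AE x in lborel. norm (f x) powr p = 0"
    using assms(1) by (subst (asm) integral_nonneg_eq_0_iff_AE) (auto simp: in_Lp_def)
  then show ?thesis by eventually_elim simp
qed

lemma in_Lp_measurable: "in_Lp p f \<Longrightarrow> f \<in> borel_measurable borel" by (simp add: in_Lp_def)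

text \<open>A factor 2 comes from bounding the sum by twice the maximum, the other one from taking
  the root of a sum of two terms, which costs \<open>2 powr (1 / p) \<le> 2\<close>.\<close>

lemma in_Lp_add:
  assumes f: "in_Lp p f" and g: "in_Lp p g" and p: "p \<ge> 1"
  shows "in_Lp p (\<lambda>x. f x + g x) \<and> Lp_norm p (\<lambda>x. f x + g x) \<le> 4 * (Lp_norm p f + Lp_norm p g)"
proof -
  have i: "integrable lborel (\<lambda>x. norm (f x) powr p)" "integrable lborel (\<lambda>x. norm (g x) powr p)"
    using f g by (auto simp: in_Lp_def)
  have pw: "norm (f x + g x) powr p \<le> 2 powr p * (norm (f x) powr p + norm (g x) powr p)" for x
  proof -
    have "norm (f x + g x) powr p \<le> (2 * max (norm (f x)) (norm (g x))) powr p"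
      using p norm_triangle_ineq[of "f x" "g x"] by (intro powr_mono2) auto
    also have "\<dots> = 2 powr p * (max (norm (f x)) (norm (g x))) powr p" by (simp add: powr_mult)
    also have "(max (norm (f x)) (norm (g x))) powr p \<le> norm (f x) powr p + norm (g x) powr p" by (simp add: max_def)
    finally show ?thesis by simp
  qed
  have m: "(\<lambda>x. norm (f x + g x) powr p) \<in> borel_measurable lborel" 
  proof -
    have [measurable]: "f \<in> borel_measurable borel" "g \<in> borel_measurable borel" using f g by (auto simp: in_Lp_def)
    show ?thesis by measurable
  qed
  have i2: "integrable lborel (\<lambda>x. 2 powr p * (norm (f x) powr p + norm (g x) powr p))" using i by auto
  have isum: "integrable lborel (\<lambda>x. norm (f x + g x) powr p)"
    by (rule Bochner_Integration.integrable_bound[OF i2 m]) (use pw in \<open>auto intro!: AE_I2\<close>)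
  define A where "A = (LINT x|lborel. norm (f x) powr p)"
  define B where "B = (LINT x|lborel. norm (g x) powr p)"
  have AB: "A \<ge> 0" "B \<ge> 0" by (auto simp: A_def B_def)
  have "(LINT x|lborel. norm (f x + g x) powr p) \<le> (LINT x|lborel. 2 powr p * (norm (f x) powr p + norm (g x) powr p))"
    by (rule integral_mono[OF isum i2 pw])
  also have "\<dots> = 2 powr p * (A + B)" using i by (simp add: A_def B_def)
  also have "\<dots> \<le> 2 powr p * (2 * max A B)" by (intro mult_left_mono) auto
  finally have "(LINT x|lborel. norm (f x + g x) powr p) powr (1/p) \<le> 2 * (2 * max A B) powr (1/p)"
    using p AB by (intro powr_le_of_le_mult) auto
  also have "\<dots> \<le> 2 * (2 * max A B powr (1/p))"
  proof -
    have "(2::real) powr (1/p) \<le> 2 powr 1" using p by (intro powr_mono) auto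
    then show ?thesis using AB by (simp add: powr_mult mult_right_mono)
  qed
  also have "\<dots> \<le> 4 * (A powr (1/p) + B powr (1/p))" by (simp add: max_def)
  finally show ?thesis using f g isum by (auto simp: Lp_norm_def A_def B_def in_Lp_def intro!: borel_measurable_add)
qed

lemma in_Lp_exp_integrable:
  assumes f: "in_Lp p f" and p: "p \<ge> 1" and \<epsilon>: "\<epsilon> > 0"
  shows "integrable lborel (\<lambda>y. exp (- \<epsilon> * \<bar>y - x\<bar>) *\<^sub>R f y)"
    and "integrable lborel (\<lambda>y. exp (- \<epsilon> * \<bar>y - x\<bar>) * norm (f y) powr p)"
    and "(LINT y|lborel. exp (- \<epsilon> * \<bar>y - x\<bar>) * norm (f y)) \<le> 2 / \<epsilon> + (LINT y|lborel. norm (f y) powr p)"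
proof -
  have ip: "integrable lborel (\<lambda>x. norm (f x) powr p)" and fm: "f \<in> borel_measurable lborel" using f by (auto simp: in_Lp_def)
  have ip1: "integrable lborel (\<lambda>y. exp (- \<epsilon> * \<bar>y - x\<bar>) + norm (f y) powr p)"
    using ip integrable_exp_abs[OF \<epsilon>] by (intro Bochner_Integration.integrable_add) auto
  have le1: "exp (- \<epsilon> * \<bar>y - x\<bar>) \<le> 1" for y using \<epsilon> by simp
  \<comment> \<open>The bound \<open>t \<le> 1 + t powr p\<close> splits the integrand into the
    kernel and the integrable power of \<open>f\<close>.\<close>
  have le: "exp (- \<epsilon> * \<bar>y - x\<bar>) * norm (f y) \<le> exp (- \<epsilon> * \<bar>y - x\<bar>) + norm (f y) powr p" for y
  proof -
    have "exp (- \<epsilon> * \<bar>y - x\<bar>) * norm (f y) \<le> exp (- \<epsilon> * \<bar>y - x\<bar>) * (1 + norm (f y) powr p)"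
      by (intro mult_left_mono le_one_plus_powr p) auto
    then show ?thesis using mult_right_mono[OF le1, of "norm (f y) powr p" y] by (simp add: distrib_left)
  qed
  show i: "integrable lborel (\<lambda>y. exp (- \<epsilon> * \<bar>y - x\<bar>) *\<^sub>R f y)"
    by (rule Bochner_Integration.integrable_bound[OF ip1]) (use fm le in \<open>auto intro!: AE_I2 simp: order_trans[OF le abs_ge_self]\<close>)
  show "integrable lborel (\<lambda>y. exp (- \<epsilon> * \<bar>y - x\<bar>) * norm (f y) powr p)"
    by (rule Bochner_Integration.integrable_bound[OF ip]) (use fm le1 in \<open>auto intro!: AE_I2 mult_left_le_one_le\<close>)
  have "(LINT y|lborel. exp (- \<epsilon> * \<bar>y - x\<bar>) * norm (f y)) \<le> (LINT y|lborel. exp (- \<epsilon> * \<bar>y - x\<bar>) + norm (f y) powr p)"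
    by (rule integral_mono[OF _ ip1 le]) (use integrable_norm[OF i] in simp)
  also have "\<dots> = 2 / \<epsilon> + (LINT y|lborel. norm (f y) powr p)"
    using ip integrable_exp_abs[OF \<epsilon>, of x] integral_exp_abs[OF \<epsilon>, of x] by (subst Bochner_Integration.integral_add) auto
  finally show "(LINT y|lborel. exp (- \<epsilon> * \<bar>y - x\<bar>) * norm (f y)) \<le> 2 / \<epsilon> + (LINT y|lborel. norm (f y) powr p)" .
qed

text \<open>Convexity of the power function, in the form that Jensen's inequality needs. It is
  Young's inequality for the powers of \<open>t\<close> and \<open>s\<close>; the case
  \<open>t = 0\<close> is treated directly.\<close>

lemma powr_tangent:
  fixes t s p :: real
  assumes "p \<ge> 1" "s > 0" "t \<ge> 0"
  shows "s powr p + p * s powr (p - 1) * (t - s) \<le> t powr p"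
proof (cases "t = 0")
  case True
  have "s powr p = s * s powr (p - 1)" using assms by (simp add: powr_diff)
  then show ?thesis using True assms mult_right_mono[of 1 p "s * s powr (p - 1)"] by (simp add: mult_ac)
next
  case False
  have "t powr 1 * s powr (p - 1) \<le> 1 / p * t powr p + (1 - 1 / p) * s powr p"
  proof -
    have "(t powr p) powr (1 / p) * (s powr p) powr (1 - 1 / p) \<le> 1 / p * t powr p + (1 - 1 / p) * s powr p"
      by (rule Youngs_inequality_0) (use assms False in auto)
    then show ?thesis using assms by (simp add: powr_powr right_diff_distrib)
  qed
  then have "p * (t * s powr (p - 1)) \<le> t powr p + (p - 1) * s powr p"
    using assms mult_left_mono[of _ _ p] by (fastforce simp: field_simps)
  moreover have "s powr p = s * s powr (p - 1)" using assms by (simp add: powr_diff)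
  ultimately show ?thesis by (simp add: algebra_simps)
qed

text \<open>Jensen's inequality for the probability density
  \<open>\<epsilon> / 2 * exp (- \<epsilon> * \<bar>y - x\<bar>)\<close>: the tangent inequality at
  the mean \<open>s\<close> is integrated, and its linear part drops out.\<close>

lemma exp_kernel_jensen:
  assumes f: "in_Lp p f" and p: "p \<ge> 1" and \<epsilon>: "\<epsilon> > 0"
  shows "(LINT y|lborel. exp (- \<epsilon> * \<bar>y - x\<bar>) * norm (f y)) powr p
     \<le> (2 / \<epsilon>) powr p * (\<epsilon> / 2 * (LINT y|lborel. exp (- \<epsilon> * \<bar>y - x\<bar>) * norm (f y) powr p))"
proof -
  let ?k = "\<lambda>y. exp (- \<epsilon> * \<bar>y - x\<bar>)"
  define m where "m = (LINT y|lborel. ?k y * norm (f y))"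
  define s where "s = \<epsilon> / 2 * m"
  note i1 = integrable_norm[OF in_Lp_exp_integrable(1)[OF assms, of x], simplified]
    and i2 = in_Lp_exp_integrable(2)[OF assms, of x] and i0 = integrable_exp_abs[OF \<epsilon>, of x]
  have m0: "m \<ge> 0" by (auto simp: m_def)
  show ?thesis
  proof (cases "m = 0")
    case True
    then show ?thesis unfolding m_def[symmetric] using \<epsilon> p
      by (auto intro!: mult_nonneg_nonneg Bochner_Integration.integral_nonneg)
  next
    case False
    then have s: "s > 0" using m0 \<epsilon> by (simp add: s_def)
    have "(LINT y|lborel. (s powr p - p * s powr (p - 1) * s) * ?k y + p * s powr (p - 1) * (?k y * norm (f y)))
        \<le> (LINT y|lborel. ?k y * norm (f y) powr p)"
    proof (rule integral_mono)
      show "integrable lborel (\<lambda>y. (s powr p - p * s powr (p - 1) * s) * ?k y + p * s powr (p - 1) * (?k y * norm (f y)))"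
        using i0 i1 by (intro Bochner_Integration.integrable_add integrable_mult_right) auto
      fix y
      have "?k y * (s powr p + p * s powr (p - 1) * (norm (f y) - s)) \<le> ?k y * norm (f y) powr p"
        by (intro mult_left_mono powr_tangent p s) auto
      then show "(s powr p - p * s powr (p - 1) * s) * ?k y + p * s powr (p - 1) * (?k y * norm (f y)) \<le> ?k y * norm (f y) powr p"
        by (simp add: algebra_simps)
    qed (rule i2)
    moreover have "(LINT y|lborel. (s powr p - p * s powr (p - 1) * s) * ?k y + p * s powr (p - 1) * (?k y * norm (f y)))
        = (s powr p - p * s powr (p - 1) * s) * (2 / \<epsilon>) + p * s powr (p - 1) * m"
      using i0 i1 integral_exp_abs[OF \<epsilon>, of x] by (subst Bochner_Integration.integral_add) (auto simp: m_def)
    moreover have "m = s * (2 / \<epsilon>)" using \<epsilon> by (simp add: s_def)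
    then have "(s powr p - p * s powr (p - 1) * s) * (2 / \<epsilon>) + p * s powr (p - 1) * m = s powr p * (2 / \<epsilon>)"
      by (simp add: algebra_simps)
    ultimately have "s powr p * (2 / \<epsilon>) \<le> (LINT y|lborel. ?k y * norm (f y) powr p)" by linarith
    from mult_left_mono[OF this, of "\<epsilon> / 2"] have "s powr p \<le> \<epsilon> / 2 * (LINT y|lborel. ?k y * norm (f y) powr p)"
      using \<epsilon> by simp
    moreover have "m powr p = (2 / \<epsilon>) powr p * s powr p" using \<open>m = s * (2 / \<epsilon>)\<close> s \<epsilon> by (simp only: powr_mult mult.commute)
    ultimately show ?thesis unfolding m_def[symmetric] by (simp only: mult_left_mono powr_ge_zero)
  qed
qed

text \<open>Young's convolution inequality for a kernel of mass \<open>2 / \<epsilon>\<close>.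
  Jensen's inequality moves the power inside, and Tonelli's theorem integrates the kernel in the
  other variable.\<close>

lemma in_Lp_exp_kernel:
  assumes f: "in_Lp p f" and p: "p \<ge> 1" and \<epsilon>: "\<epsilon> > 0" and C: "C \<ge> 0"
    and z: "z \<in> borel_measurable borel" "\<And>x. norm (z x) \<le> C * (LINT y|lborel. exp (- \<epsilon> * \<bar>y - x\<bar>) * norm (f y))"
  shows "in_Lp p z \<and> Lp_norm p z \<le> (C * (2 / \<epsilon>)) * Lp_norm p f"
proof (rule in_Lp_nn_integral[OF z(1) f p])
  define K where "K = C powr p * ((2 / \<epsilon>) powr p * (\<epsilon> / 2))"
  have K0: "K \<ge> 0" using \<epsilon> by (simp add: K_def)
  have [measurable]: "f \<in> borel_measurable borel" using f by (rule in_Lp_measurable)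
  have pt: "norm (z x) powr p \<le> K * (LINT y|lborel. exp (- \<epsilon> * \<bar>y - x\<bar>) * norm (f y) powr p)" for x
  proof -
    have "norm (z x) powr p \<le> (C * (LINT y|lborel. exp (- \<epsilon> * \<bar>y - x\<bar>) * norm (f y))) powr p"
      using z(2)[of x] p by (intro powr_mono2) auto
    also have "\<dots> = C powr p * (LINT y|lborel. exp (- \<epsilon> * \<bar>y - x\<bar>) * norm (f y)) powr p"
      using C by (simp add: powr_mult)
    also have "\<dots> \<le> C powr p * ((2 / \<epsilon>) powr p * (\<epsilon> / 2 * (LINT y|lborel. exp (- \<epsilon> * \<bar>y - x\<bar>) * norm (f y) powr p)))"
      by (intro mult_left_mono exp_kernel_jensen f p \<epsilon>) auto
    finally show ?thesis by (simp add: K_def mult.assoc)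
  qed
  have "(\<integral>\<^sup>+x. ennreal (norm (z x) powr p) \<partial>lborel)
      \<le> (\<integral>\<^sup>+x. ennreal K * (\<integral>\<^sup>+y. ennreal (exp (- \<epsilon> * \<bar>y - x\<bar>) * norm (f y) powr p) \<partial>lborel) \<partial>lborel)"
  proof (rule nn_integral_mono)
    fix x
    have "(\<integral>\<^sup>+y. ennreal (exp (- \<epsilon> * \<bar>y - x\<bar>) * norm (f y) powr p) \<partial>lborel) = ennreal (LINT y|lborel. exp (- \<epsilon> * \<bar>y - x\<bar>) * norm (f y) powr p)"
      by (rule nn_integral_eq_integral[OF in_Lp_exp_integrable(2)[OF f p \<epsilon>]]) auto
    then show "ennreal (norm (z x) powr p) \<le> ennreal K * (\<integral>\<^sup>+y. ennreal (exp (- \<epsilon> * \<bar>y - x\<bar>) * norm (f y) powr p) \<partial>lborel)"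
      using pt[of x] K0 by (simp add: ennreal_mult'[symmetric] ennreal_leI)
  qed
  also have "\<dots> = ennreal K * (\<integral>\<^sup>+x. (\<integral>\<^sup>+y. ennreal (exp (- \<epsilon> * \<bar>y - x\<bar>) * norm (f y) powr p) \<partial>lborel) \<partial>lborel)"
    by (rule nn_integral_cmult) measurable
  also have "(\<integral>\<^sup>+x. (\<integral>\<^sup>+y. ennreal (exp (- \<epsilon> * \<bar>y - x\<bar>) * norm (f y) powr p) \<partial>lborel) \<partial>lborel)
      = (\<integral>\<^sup>+y. (\<integral>\<^sup>+x. ennreal (exp (- \<epsilon> * \<bar>y - x\<bar>) * norm (f y) powr p) \<partial>lborel) \<partial>lborel)"
    by (rule lborel_pair.Fubini'[symmetric]) measurable
  also have "\<dots> = (\<integral>\<^sup>+y. ennreal (2 / \<epsilon> * norm (f y) powr p) \<partial>lborel)"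
  proof (rule nn_integral_cong)
    fix y
    have "(\<integral>\<^sup>+x. ennreal (exp (- \<epsilon> * \<bar>x - y\<bar>)) * ennreal (norm (f y) powr p) \<partial>lborel) = ennreal (2 / \<epsilon>) * ennreal (norm (f y) powr p)"
      using nn_integral_eq_integral[OF integrable_exp_abs[OF \<epsilon>, of y]] integral_exp_abs[OF \<epsilon>, of y]
      by (subst nn_integral_multc) auto
    moreover have "ennreal (exp (- \<epsilon> * \<bar>y - x\<bar>) * norm (f y) powr p) = ennreal (exp (- \<epsilon> * \<bar>x - y\<bar>)) * ennreal (norm (f y) powr p)" for x
      by (subst ennreal_mult'[symmetric]) (auto simp: abs_minus_commute)
    moreover have "ennreal (2 / \<epsilon> * norm (f y) powr p) = ennreal (2 / \<epsilon>) * ennreal (norm (f y) powr p)"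
      by (rule ennreal_mult') (use \<epsilon> in auto)
    ultimately show "(\<integral>\<^sup>+x. ennreal (exp (- \<epsilon> * \<bar>y - x\<bar>) * norm (f y) powr p) \<partial>lborel) = ennreal (2 / \<epsilon> * norm (f y) powr p)"
      by (simp only:)
  qed
  also have "\<dots> = ennreal (LINT y|lborel. 2 / \<epsilon> * norm (f y) powr p)"
    by (rule nn_integral_eq_integral) (use f \<epsilon> in \<open>auto simp: in_Lp_def intro!: integrable_mult_right\<close>)
  also have "(LINT y|lborel. 2 / \<epsilon> * norm (f y) powr p) = 2 / \<epsilon> * (LINT y|lborel. norm (f y) powr p)"
    by (rule integral_mult_right_zero)
  also have "ennreal K * ennreal (2 / \<epsilon> * (LINT y|lborel. norm (f y) powr p)) = ennreal ((C * (2 / \<epsilon>)) powr p * (LINT y|lborel. norm (f y) powr p))"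
  proof -
    have "K * (2 / \<epsilon> * (LINT y|lborel. norm (f y) powr p)) = (C * (2 / \<epsilon>)) powr p * (LINT y|lborel. norm (f y) powr p)"
      using C \<epsilon> by (simp only: K_def powr_mult divide_nonneg_pos zero_le_numeral) simp
    then show ?thesis using K0 by (simp only: ennreal_mult'[symmetric])
  qed
  finally show "(\<integral>\<^sup>+x. ennreal (norm (z x) powr p) \<partial>lborel) \<le> ennreal ((C * (2 / \<epsilon>)) powr p * (LINT x|lborel. norm (f x) powr p))" .
qed (use C \<epsilon> in simp)

lemma in_Lp_imp_exp_integrable: "in_Lp p f \<Longrightarrow> p \<ge> 1 \<Longrightarrow> exp_integrable f"
  unfolding exp_integrable_def using in_Lp_exp_integrable(1)[of p f 1] by (simp add: in_Lp_def)

text \<open>The product \<open>exp x * v x\<close> has weak derivative 0 and is therefore a constant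
  \<open>c\<close>. If \<open>c\<close> were nonzero, \<open>v\<close> would be bounded below by its
  modulus on the negative half line, which has infinite measure.\<close>

lemma in_Lp_decay_eq_0:
  assumes v: "in_Lp p v" and p: "p \<ge> 1" and w: "has_weak_deriv 1 v (\<lambda>x. - v x)"
  shows "AE x in lborel. v x = 0"
proof -
  have ex: "((\<lambda>x. complex_of_real (exp x)) has_vector_derivative complex_of_real (exp x)) (at x)" for x
    by (intro has_vector_derivative_of_real) (simp add: has_real_derivative_iff_has_vector_derivative[symmetric] DERIV_exp)
  have sm: "csmooth (\<lambda>x. complex_of_real (exp x))"
    unfolding csmooth_def
  proof
    fix k show "dbound {} 0 k (\<lambda>x. complex_of_real (exp x))"
      by (induction k) (auto intro!: dbound_SucI[OF _ ex] simp del: dbound.simps(2))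
  qed
  have "has_weak_deriv 1 (\<lambda>x. complex_of_real (exp x) * v x) (\<lambda>x. complex_of_real (exp x) * v x + complex_of_real (exp x) * (- v x))"
    by (rule has_weak_deriv_mult[OF w sm ex])
  then have "has_weak_deriv 1 (\<lambda>x. complex_of_real (exp x) * v x) (\<lambda>x. 0)" by simp
  then have "\<exists>c. AE x in lborel. complex_of_real (exp x) * v x = c"
    unfolding has_weak_deriv_1 by (intro du_Bois_Reymond) auto
  then obtain c where c: "AE x in lborel. complex_of_real (exp x) * v x = c" by blast
  have "c = 0"
  proof (rule ccontr)
    assume "c \<noteq> 0"
    have ip: "integrable lborel (\<lambda>x. norm (v x) powr p)" using v by (simp add: in_Lp_def)
    have "integrable lborel (\<lambda>x. norm c powr p * indicator {..0::real} x)"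
    proof (rule Bochner_Integration.integrable_bound[OF ip])
      show "AE x in lborel. norm (norm c powr p * indicat_real {..0} x) \<le> norm (norm (v x) powr p)"
        using c
      proof eventually_elim
        case (elim x)
        show ?case
        proof (cases "x \<le> 0")
          case True
          have "norm c = exp x * norm (v x)" unfolding elim[symmetric] by (simp add: norm_mult)
          also have "\<dots> \<le> 1 * norm (v x)" using True by (intro mult_right_mono) auto
          finally have "norm c powr p \<le> norm (v x) powr p" using p by (intro powr_mono2) auto
          then show ?thesis using True by simp
        qed simp
      qed
    qed auto
    then have "integrable lborel (indicat_real {..0::real})" using \<open>c \<noteq> 0\<close> by simp
    then have "emeasure lborel {..0::real} < \<infinity>" by (subst (asm) integrable_indicator_iff) auto
    moreover have "emeasure lborel {..0::real} = \<infinity>"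
    proof -
      have "ennreal (real n) \<le> emeasure lborel {..0::real}" for n
      proof -
        have "emeasure lborel {- real n..0} \<le> emeasure lborel {..0::real}" by (intro emeasure_mono) auto
        then show ?thesis by simp
      qed
      then show ?thesis by (metis ennreal_SUP_of_nat_eq_top SUP_least top.extremum_unique ennreal_of_nat_eq_real_of_nat infinity_ennreal_def)
    qed
    ultimately show False by simp
  qed
  show ?thesis using c by eventually_elim (use \<open>c = 0\<close> in simp)
qed

section \<open>Scales of function spaces\<close>

text \<open>A common frame for the scales \<open>W^{k,p}\<close> and \<open>BUC^k\<close>. Equality in the space is equality
  along \<open>Fl\<close>, which is \<open>ae_filter lborel\<close> for Sobolev spaces and \<open>top\<close> for \<open>BUC\<close>; \<open>DR f g\<close> says that
  \<open>g\<close> is a derivative of \<open>f\<close> within the base space. The constant 4 allows a quasi-norm inequality to be used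
  in place of Minkowski's inequality, and \<open>nu n\<close> is the size of a window of length \<open>n\<close>.\<close>

locale deriv_scale =
  fixes mk :: "nat \<Rightarrow> fun_space" and DR :: "(real \<Rightarrow> complex) \<Rightarrow> (real \<Rightarrow> complex) \<Rightarrow> bool"
    and Fl :: "real filter" and nu :: "nat \<Rightarrow> real"
  assumes one_more: "one_more_deriv (mk k) = mk (Suc k)"
    and eq_iff: "space_eq (mk k) f g \<longleftrightarrow> (\<forall>\<^sub>F x in Fl. f x = g x)"
    and carrier_Suc: "space_carrier (mk (Suc k)) =
      {f \<in> space_carrier (mk 0). \<exists>g\<in>space_carrier (mk k). DR f g}"
    and norm_Suc: "f \<in> space_carrier (mk (Suc k)) \<Longrightarrow> DR f g \<Longrightarrow> g \<in> space_carrier (mk k) \<Longrightarrow>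
      space_norm (mk (Suc k)) f = space_norm (mk 0) f + space_norm (mk k) g"
    and space_deriv_eq: "DR f g \<Longrightarrow> \<forall>\<^sub>F x in Fl. space_deriv (mk k) f x = g x"
    and DR_base: "DR f g \<Longrightarrow> f \<in> space_carrier (mk 0) \<and> g \<in> space_carrier (mk 0)"
    and base_add: "f \<in> space_carrier (mk 0) \<Longrightarrow> g \<in> space_carrier (mk 0) \<Longrightarrow>
      (\<lambda>x. f x + g x) \<in> space_carrier (mk 0) \<and>
      space_norm (mk 0) (\<lambda>x. f x + g x) \<le> 4 * (space_norm (mk 0) f + space_norm (mk 0) g)"
    and base_mult: "f \<in> space_carrier (mk 0) \<Longrightarrow> bsmooth m \<Longrightarrow> (\<And>x. norm (m x) \<le> M) \<Longrightarrow>
      (\<lambda>x. m x * f x) \<in> space_carrier (mk 0) \<and>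
      space_norm (mk 0) (\<lambda>x. m x * f x) \<le> M * space_norm (mk 0) f"
    and base_norm_nonneg: "f \<in> space_carrier (mk 0) \<Longrightarrow> 0 \<le> space_norm (mk 0) f"
    and base_norm_eq_0: "f \<in> space_carrier (mk 0) \<Longrightarrow> space_norm (mk 0) f = 0 \<Longrightarrow> \<forall>\<^sub>F x in Fl. f x = 0"
    and base_norm_cong: "f \<in> space_carrier (mk 0) \<Longrightarrow> g \<in> space_carrier (mk 0) \<Longrightarrow>
      \<forall>\<^sub>F x in Fl. f x = g x \<Longrightarrow> space_norm (mk 0) f = space_norm (mk 0) g"
    and DR_add: "DR f g \<Longrightarrow> DR f' g' \<Longrightarrow> DR (\<lambda>x. f x + f' x) (\<lambda>x. g x + g' x)"
    and DR_mult: "DR f g \<Longrightarrow> bsmooth m \<Longrightarrow> (\<And>x. (m has_vector_derivative m' x) (at x)) \<Longrightarrow>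
      DR (\<lambda>x. m x * f x) (\<lambda>x. m' x * f x + m x * g x)"
    and DR_cong: "DR f g \<Longrightarrow> f' \<in> space_carrier (mk 0) \<Longrightarrow> g' \<in> space_carrier (mk 0) \<Longrightarrow>
      \<forall>\<^sub>F x in Fl. f x = f' x \<Longrightarrow> \<forall>\<^sub>F x in Fl. g x = g' x \<Longrightarrow> DR f' g'"
    and DR_unique: "DR f g \<Longrightarrow> DR f' g' \<Longrightarrow> \<forall>\<^sub>F x in Fl. f x = f' x \<Longrightarrow> \<forall>\<^sub>F x in Fl. g x = g' x"
    and DR_classical: "(\<And>x. (f has_vector_derivative f' x) (at x)) \<Longrightarrow> continuous_on UNIV f' \<Longrightarrow>
      f \<in> space_carrier (mk 0) \<Longrightarrow> f' \<in> space_carrier (mk 0) \<Longrightarrow> DR f f'"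
    and base_exp_integrable: "f \<in> space_carrier (mk 0) \<Longrightarrow> exp_integrable f"
    and Jop_bounded: "f \<in> space_carrier (mk 0) \<Longrightarrow> bounded (range (Jop f))"
    and Jop_base: "f \<in> space_carrier (mk 0) \<Longrightarrow> DR (Jop f) (\<lambda>x. f x - Jop f x) \<and>
      space_norm (mk 0) (Jop f) \<le> 2 * space_norm (mk 0) f"
    and Jop_cong: "f \<in> space_carrier (mk 0) \<Longrightarrow> g \<in> space_carrier (mk 0) \<Longrightarrow> \<forall>\<^sub>F x in Fl. f x = g x \<Longrightarrow> Jop f = Jop g"
    and base_kernel: "g1 \<in> space_carrier (mk 0) \<Longrightarrow> g2 \<in> space_carrier (mk 0) \<Longrightarrow> \<epsilon> > 0 \<Longrightarrow> C \<ge> 0 \<Longrightarrow>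
      (\<And>x. (z has_vector_derivative z' x) (at x)) \<Longrightarrow> bounded (range z') \<Longrightarrow>
      (\<And>x. norm (z x) \<le> C * (LINT y|lborel. exp (- \<epsilon> * \<bar>y - x\<bar>) * (norm (g1 y) + norm (g2 y)))) \<Longrightarrow>
      z \<in> space_carrier (mk 0) \<and>
      space_norm (mk 0) z \<le> C * (2 / \<epsilon>) * (4 * (space_norm (mk 0) g1 + space_norm (mk 0) g2))"
    and DR_decay: "DR v (\<lambda>x. - v x) \<Longrightarrow> \<forall>\<^sub>F x in Fl. v x = 0"
    and base_compact: "csmooth f \<Longrightarrow> (\<And>x. \<bar>x\<bar> > R \<Longrightarrow> f x = 0) \<Longrightarrow> f \<in> space_carrier (mk 0)"
    and nu_pos: "n \<ge> 1 \<Longrightarrow> nu n > 0"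
    and base_norm_le: "f \<in> space_carrier (mk 0) \<Longrightarrow> n \<ge> 1 \<Longrightarrow> (\<And>x. norm (f x) \<le> M * indicator {a..a + real n} x) \<Longrightarrow> M \<ge> 0 \<Longrightarrow>
      space_norm (mk 0) f \<le> M * nu n"
    and base_norm_ge: "f \<in> space_carrier (mk 0) \<Longrightarrow> n \<ge> 1 \<Longrightarrow> (\<And>x. x \<in> {a + real n / 4..a + real n / 2} \<Longrightarrow> c \<le> norm (f x)) \<Longrightarrow> c \<ge> 0 \<Longrightarrow>
      c * nu n / 4 \<le> space_norm (mk 0) f"
    and base_no_pole: "f \<in> space_carrier (mk 0) \<Longrightarrow> c > 0 \<Longrightarrow> r > 0 \<Longrightarrow>
      \<forall>\<^sub>F x in Fl. \<bar>x - x0\<bar> < r \<longrightarrow> c \<le> \<bar>x - x0\<bar> * norm (f x) \<Longrightarrow> False"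
begin

abbreviation "C k \<equiv> space_carrier (mk k)"
abbreviation "N k \<equiv> space_norm (mk k)"
abbreviation eqv (infix "\<simeq>" 50) where "f \<simeq> g \<equiv> \<forall>\<^sub>F x in Fl. f x = g x"

lemma C_Suc: "f \<in> C (Suc k) \<longleftrightarrow> (\<exists>g\<in>C k. DR f g)"
  using carrier_Suc DR_base by auto

lemma C_base: "f \<in> C k \<Longrightarrow> f \<in> C 0"
  by (cases k) (auto simp: C_Suc dest: DR_base)

lemma C_SucD: "f \<in> C (Suc k) \<Longrightarrow> f \<in> C k"
proof (induction k arbitrary: f)
  case 0 then show ?case by (rule C_base)
next
  case (Suc k) then show ?case unfolding C_Suc[of f] by blast
qed

lemma N_nonneg: "f \<in> C k \<Longrightarrow> 0 \<le> N k f"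
proof (induction k arbitrary: f)
  case (Suc k)
  then obtain g where "g \<in> C k" "DR f g" by (auto simp: C_Suc)
  then show ?case using norm_Suc[OF Suc.prems] Suc.IH base_norm_nonneg C_base[OF Suc.prems] by (simp add: add_nonneg_nonneg)
qed (rule base_norm_nonneg)

lemma N_Suc_ge: "f \<in> C (Suc k) \<Longrightarrow> N k f \<le> N (Suc k) f"
proof (induction k arbitrary: f)
  case 0
  then obtain g where "g \<in> C 0" "DR f g" by (auto simp: C_Suc)
  then show ?case using norm_Suc[OF 0] base_norm_nonneg by simp
next
  case (Suc k)
  then obtain g where g: "g \<in> C (Suc k)" "DR f g" unfolding C_Suc[of f] by blast
  then show ?case using norm_Suc[OF Suc.prems g(2,1)] norm_Suc[OF C_SucD[OF Suc.prems] g(2) C_SucD[OF g(1)]] Suc.IH[OF g(1)] by simp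
qed

lemma N_ge_base: "f \<in> C k \<Longrightarrow> N 0 f \<le> N k f"
proof (induction k)
  case (Suc k) then show ?case using N_Suc_ge C_SucD by force
qed simp

lemma C_cong: "f \<in> C k \<Longrightarrow> g \<in> C 0 \<Longrightarrow> f \<simeq> g \<Longrightarrow> g \<in> C k \<and> N k g = N k f"
proof (cases k)
  case 0
  assume "f \<in> C k" "g \<in> C 0" "f \<simeq> g"
  then show ?thesis using base_norm_cong 0 by metis
next
  case (Suc j)
  assume f: "f \<in> C k" and g: "g \<in> C 0" and fg: "f \<simeq> g"
  obtain f' where f': "f' \<in> C j" "DR f f'" using f Suc by (auto simp: C_Suc)
  have d: "DR g f'" by (rule DR_cong[OF f'(2) g C_base[OF f'(1)] fg]) simp
  then have gC: "g \<in> C (Suc j)" using f'(1) C_Suc by blast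
  have "N (Suc j) g = N (Suc j) f"
    using norm_Suc[OF gC d f'(1)] norm_Suc[of f j f'] f f' base_norm_cong[OF C_base[OF f] g fg] Suc by simp
  then show ?thesis using gC Suc by simp
qed

lemma C_add: "f \<in> C k \<Longrightarrow> g \<in> C k \<Longrightarrow> (\<lambda>x. f x + g x) \<in> C k \<and> N k (\<lambda>x. f x + g x) \<le> 4 * (N k f + N k g)"
proof (induction k arbitrary: f g)
  case (Suc k)
  obtain f' where f': "f' \<in> C k" "DR f f'" using Suc.prems by (auto simp: C_Suc)
  obtain g' where g': "g' \<in> C k" "DR g g'" using Suc.prems by (auto simp: C_Suc)
  note h = Suc.IH[OF f'(1) g'(1)] and d = DR_add[OF f'(2) g'(2)]
  have c: "(\<lambda>x. f x + g x) \<in> C (Suc k)" using h d C_Suc by blast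
  then show ?case
    using norm_Suc[OF c d] h norm_Suc[OF Suc.prems(1) f'(2,1)] norm_Suc[OF Suc.prems(2) g'(2,1)]
      base_add[OF C_base[OF Suc.prems(1)] C_base[OF Suc.prems(2)]] by auto
qed (rule base_add)

lemma C_add_le:
  "f \<in> C k \<Longrightarrow> g \<in> C k \<Longrightarrow> N k f \<le> a \<Longrightarrow> N k g \<le> b \<Longrightarrow> N k (\<lambda>x. f x + g x) \<le> 4 * (a + b)"
  by (rule order_trans[OF conjunct2[OF C_add]]) auto

text \<open>The product rule feeds the derivative of \<open>m\<close> back into the induction, which
  is why \<open>m\<close> is generalized; the 4s come from the quasi-norm inequality.\<close>

lemma C_mult_ex:
  assumes "bsmooth m"
  shows "\<exists>M\<ge>0. \<forall>f\<in>C k. (\<lambda>x. m x * f x) \<in> C k \<and> N k (\<lambda>x. m x * f x) \<le> M * N k f"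
  using assms
proof (induction k arbitrary: m)
  case 0
  obtain M where "M \<ge> 0" "\<And>x. norm (m x) \<le> M" using bsmooth_bounded[OF 0] by blast
  then show ?case using base_mult[OF _ 0] by blast
next
  case (Suc k)
  obtain m' where m': "\<And>x. (m has_vector_derivative m' x) (at x)" "bsmooth m'" using bsmooth_has_deriv[OF Suc.prems] by blast
  obtain M0 where M0: "M0 \<ge> 0" "\<And>x. norm (m x) \<le> M0" using bsmooth_bounded[OF Suc.prems] by blast
  obtain M1 where M1: "M1 \<ge> 0" "\<And>f. f \<in> C k \<Longrightarrow> (\<lambda>x. m x * f x) \<in> C k \<and> N k (\<lambda>x. m x * f x) \<le> M1 * N k f"
    using Suc.IH[OF Suc.prems] by blast
  obtain M2 where M2: "M2 \<ge> 0" "\<And>f. f \<in> C k \<Longrightarrow> (\<lambda>x. m' x * f x) \<in> C k \<and> N k (\<lambda>x. m' x * f x) \<le> M2 * N k f"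
    using Suc.IH[OF m'(2)] by blast
  show ?case
  proof (intro exI[of _ "M0 + 4 * (M2 + M1)"] conjI ballI)
    fix f assume f: "f \<in> C (Suc k)"
    obtain g where g: "g \<in> C k" "DR f g" using f by (auto simp: C_Suc)
    note d = DR_mult[OF g(2) Suc.prems m'(1)]
    note fk = C_SucD[OF f]
    note h = C_add[OF conjunct1[OF M2(2)[OF fk]] conjunct1[OF M1(2)[OF g(1)]]]
    show c: "(\<lambda>x. m x * f x) \<in> C (Suc k)" using d h C_Suc by blast
    have n: "N (Suc k) f = N 0 f + N k g" by (rule norm_Suc[OF f g(2,1)])
    have "N (Suc k) (\<lambda>x. m x * f x) = N 0 (\<lambda>x. m x * f x) + N k (\<lambda>x. m' x * f x + m x * g x)"
      by (rule norm_Suc[OF c d conjunct1[OF h]])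
    also have "\<dots> \<le> M0 * N 0 f + 4 * (M2 * N k f + M1 * N k g)"
      by (intro add_mono conjunct2[OF base_mult[OF C_base[OF f] Suc.prems M0(2)]]
        C_add_le[OF conjunct1[OF M2(2)[OF fk]] conjunct1[OF M1(2)[OF g(1)]] conjunct2[OF M2(2)[OF fk]] conjunct2[OF M1(2)[OF g(1)]]])
    also have "\<dots> \<le> M0 * N (Suc k) f + 4 * (M2 * N (Suc k) f + M1 * N (Suc k) f)"
      using N_ge_base[OF f] N_Suc_ge[OF f] n base_norm_nonneg[OF C_base[OF f]] M0(1) M1(1) M2(1)
      by (intro add_mono mult_left_mono) auto
    finally show "N (Suc k) (\<lambda>x. m x * f x) \<le> (M0 + 4 * (M2 + M1)) * N (Suc k) f" by (simp add: algebra_simps)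
  qed (use M0 M1 M2 in auto)
qed

lemma C_mult: "f \<in> C k \<Longrightarrow> bsmooth m \<Longrightarrow> (\<lambda>x. m x * f x) \<in> C k"
  using C_mult_ex by blast

lemma C_cmult: "f \<in> C k \<Longrightarrow> (\<lambda>x. c * f x) \<in> C k"
  by (rule C_mult) auto

lemma C_diff: "f \<in> C k \<Longrightarrow> g \<in> C k \<Longrightarrow> (\<lambda>x. f x - g x) \<in> C k"
  using C_add[OF _ C_cmult[of g k "-1"]] by simp

lemma DR_cmult: "DR f g \<Longrightarrow> DR (\<lambda>x. c * f x) (\<lambda>x. c * g x)"
  using DR_mult[of f g "\<lambda>_. c" "\<lambda>_. 0"] by auto

lemma DR_diff: "DR f g \<Longrightarrow> DR f' g' \<Longrightarrow> DR (\<lambda>x. f x - f' x) (\<lambda>x. g x - g' x)"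
  using DR_add[OF _ DR_cmult[of f' g' "-1"]] by simp

text \<open>The difference of the two sides has minus itself as derivative, which
  \<open>DR_decay\<close> excludes unless it vanishes. In this way every element with a derivative
  gets a continuous representative.\<close>

lemma DR_eq_Jop:
  assumes "DR u h" shows "u \<simeq> Jop (\<lambda>x. h x + u x)"
proof -
  let ?f = "\<lambda>x. h x + u x"
  have f: "?f \<in> C 0" using assms DR_base base_add by blast
  have "DR (\<lambda>x. u x - Jop ?f x) (\<lambda>x. h x - (?f x - Jop ?f x))"
    using assms Jop_base[OF f] by (intro DR_diff) auto
  then have "DR (\<lambda>x. u x - Jop ?f x) (\<lambda>x. - (u x - Jop ?f x))" by (simp add: algebra_simps)
  from DR_decay[OF this] show ?thesis by eventually_elim simp
qed

end

section \<open>The first order system with sources in a scale of spaces\<close>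

locale scale_system = deriv_scale + coercive_system +
  assumes al_smooth: "bsmooth al" and q_smooth: "bsmooth q"
begin

definition ial :: "real \<Rightarrow> complex" where "ial x = 1 / complex_of_real (al x)"

lemma ial_smooth: "bsmooth ial"
  unfolding ial_def
  by (rule bsmooth_divide[OF bsmooth_const bsmooth_of_real[OF al_smooth] a0])
    (use al_ge a0 in \<open>auto intro: order_trans[OF _ abs_ge_self]\<close>)

definition weak_solves :: "(real \<Rightarrow> complex) \<Rightarrow> (real \<Rightarrow> complex) \<Rightarrow> (real \<Rightarrow> complex) \<Rightarrow> (real \<Rightarrow> complex) \<Rightarrow> bool" where
  "weak_solves f1 f2 u p \<longleftrightarrow> DR u (\<lambda>x. ial x * p x + f1 x) \<and>
     DR p (\<lambda>x. complex_of_real kap * (ial x * p x) + q x * u x + f2 x)"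

lemma solves_iff:
  "solves f1 f2 UNIV u p \<longleftrightarrow> (\<forall>x. (u has_vector_derivative ial x * p x + f1 x) (at x) \<and>
     (p has_vector_derivative complex_of_real kap * (ial x * p x) + q x * u x + f2 x) (at x))"
  by (simp add: solves_def ial_def)

lemma cont_smooth: "continuous_on UNIV ial" "continuous_on UNIV q"
  using csmooth_continuous bsmooth_csmooth ial_smooth q_smooth by auto

lemma bounded_mult_range:
  fixes f g :: "real \<Rightarrow> complex"
  assumes "bounded (range f)" "bounded (range g)" shows "bounded (range (\<lambda>x. f x * g x))"
proof -
  obtain F G where "\<And>x. norm (f x) \<le> F" "\<And>x. norm (g x) \<le> G" using assms unfolding bounded_iff by auto
  then have "norm (f x * g x) \<le> F * G" for x
    unfolding norm_mult by (intro mult_mono) (auto intro: order_trans[OF norm_ge_zero])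
  then show ?thesis unfolding bounded_iff by blast
qed

lemma bounded_add_range:
  fixes f g :: "real \<Rightarrow> complex"
  assumes "bounded (range f)" "bounded (range g)" shows "bounded (range (\<lambda>x. f x + g x))"
  using bounded_plus_comp[OF assms] .

lemma bounded_smooth: "bounded (range ial)" "bounded (range q)"
  using bsmooth_bounded[OF ial_smooth] bsmooth_bounded[OF q_smooth] unfolding bounded_iff by (metis rangeE)+

lemma bounded_const_range: "bounded (range (\<lambda>_::real. c :: complex))" by (simp add: image_def)

text \<open>Classical solutions need continuous bounded sources. Subtracting \<open>Jop f1\<close>
  from \<open>u\<close> and \<open>Jop f2\<close> from \<open>p\<close> absorbs the rough parts,
  since \<open>Jop f\<close> has the derivative \<open>f - Jop f\<close>; the remainder solves the
  same system with the continuous bounded sources \<open>g1\<close>, \<open>g2\<close>. Its kernel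
  bound becomes a norm bound through \<open>base_kernel\<close>.\<close>

lemma weak_solution_exists:
  "\<exists>K\<ge>0. \<forall>f1\<in>C 0. \<forall>f2\<in>C 0. \<exists>u p. weak_solves f1 f2 u p \<and> N 0 u + N 0 p \<le> K * (N 0 f1 + N 0 f2)"
proof -
  obtain Mi where Mi: "Mi \<ge> 0" "\<And>f. f \<in> C 0 \<Longrightarrow> (\<lambda>x. ial x * f x) \<in> C 0 \<and> N 0 (\<lambda>x. ial x * f x) \<le> Mi * N 0 f"
    using C_mult_ex[OF ial_smooth, of 0] by blast
  obtain Mq where Mq: "Mq \<ge> 0" "\<And>f. f \<in> C 0 \<Longrightarrow> (\<lambda>x. q x * f x) \<in> C 0 \<and> N 0 (\<lambda>x. q x * f x) \<le> Mq * N 0 f"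
    using C_mult_ex[OF q_smooth, of 0] by blast
  obtain Mk where Mk: "Mk \<ge> 0" "\<And>f. f \<in> C 0 \<Longrightarrow> (\<lambda>x. complex_of_real kap * f x) \<in> C 0 \<and> N 0 (\<lambda>x. complex_of_real kap * f x) \<le> Mk * N 0 f"
    using C_mult_ex[OF bsmooth_const, of 0 "complex_of_real kap"] by blast
  define c1 where "c1 = 4 * (1 + Mi)"
  define c2 where "c2 = 4 * (4 * (Mk * Mi + Mq) + 1)"
  define K1 where "K1 = Kb * (2 / rate) * 4 * (c1 + c2)"
  define K where "K = 8 + 16 * K1 + 16 * K1"
  have c: "c1 \<ge> 0" "c2 \<ge> 0" using Mi(1) Mq(1) Mk(1) by (auto simp: c1_def c2_def)
  have K1: "K1 \<ge> 0" using Kb_pos rate_pos c by (auto simp: K1_def intro!: mult_nonneg_nonneg divide_nonneg_nonneg less_imp_le[OF Kb_pos] less_imp_le[OF rate_pos])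
  show ?thesis
  proof (intro exI[of _ K] conjI ballI)
    show "K \<ge> 0" using K1 by (simp add: K_def)
    fix f1 f2 assume f: "f1 \<in> C 0" "f2 \<in> C 0"
    let ?B1 = "Jop f1" and ?B2 = "Jop f2"
    have B: "?B1 \<in> C 0" "?B2 \<in> C 0" using Jop_base f DR_base by blast+
    have nB: "N 0 ?B1 \<le> 2 * N 0 f1" "N 0 ?B2 \<le> 2 * N 0 f2" using Jop_base f by auto
    have cB: "continuous_on UNIV ?B1" "continuous_on UNIV ?B2" using Jop_continuous base_exp_integrable f by auto
    have bB: "bounded (range ?B1)" "bounded (range ?B2)" using Jop_bounded f by auto
    \<comment> \<open>What remains of the equation for \<open>u\<close> after inserting
      \<open>u = Jop f1 + v\<close> and \<open>p = Jop f2 + r\<close>: the summand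
      \<open>Jop f1\<close> from the derivative and the coupling to \<open>Jop f2\<close>.\<close>
    define g1 where "g1 = (\<lambda>x. ?B1 x + ial x * ?B2 x)"
    define g2 where "g2 = (\<lambda>x. complex_of_real kap * (ial x * ?B2 x) + q x * ?B1 x + ?B2 x)"
    have iB: "(\<lambda>x. ial x * ?B2 x) \<in> C 0" "(\<lambda>x. q x * ?B1 x) \<in> C 0" "(\<lambda>x. complex_of_real kap * (ial x * ?B2 x)) \<in> C 0"
      using Mi(2)[OF B(2)] Mq(2)[OF B(1)] Mk(2) by auto
    have g: "g1 \<in> C 0" "g2 \<in> C 0" using B iB C_add unfolding g1_def g2_def by auto
    have n0: "N 0 ?B1 \<ge> 0" "N 0 ?B2 \<ge> 0" using base_norm_nonneg B by auto
    have ng1: "N 0 g1 \<le> c1 * (N 0 ?B1 + N 0 ?B2)"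
    proof -
      have "N 0 g1 \<le> 4 * (N 0 ?B1 + Mi * N 0 ?B2)"
        unfolding g1_def by (rule C_add_le[OF B(1) iB(1) order_refl conjunct2[OF Mi(2)[OF B(2)]]])
      also have "\<dots> \<le> c1 * (N 0 ?B1 + N 0 ?B2)" using n0 Mi(1) by (simp add: c1_def algebra_simps)
      finally show ?thesis .
    qed
    have ng2: "N 0 g2 \<le> c2 * (N 0 ?B1 + N 0 ?B2)"
    proof -
      have "N 0 (\<lambda>x. complex_of_real kap * (ial x * ?B2 x)) \<le> Mk * (Mi * N 0 ?B2)"
        using conjunct2[OF Mk(2)[OF iB(1)]] mult_left_mono[OF conjunct2[OF Mi(2)[OF B(2)]] Mk(1)] by (rule order_trans)
      then have "N 0 g2 \<le> 4 * (4 * (Mk * (Mi * N 0 ?B2) + Mq * N 0 ?B1) + N 0 ?B2)"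
        unfolding g2_def
        by (intro C_add_le C_add[THEN conjunct1] iB B order_refl conjunct2[OF Mq(2)[OF B(1)]])
      also have "\<dots> \<le> c2 * (N 0 ?B1 + N 0 ?B2)" using n0 Mi(1) Mk(1) Mq(1) by (simp add: c2_def algebra_simps)
      finally show ?thesis .
    qed
    have cg: "continuous_on UNIV g1" "continuous_on UNIV g2"
      unfolding g1_def g2_def using cB cont_smooth by (auto intro!: continuous_intros)
    have bg: "bounded (range g1)" "bounded (range g2)"
      unfolding g1_def g2_def using bB bounded_smooth by (intro bounded_add_range bounded_mult_range bounded_const_range; simp)+
    obtain G1 G2 where G: "\<And>x. norm (g1 x) \<le> G1" "\<And>x. norm (g2 x) \<le> G2" using bg unfolding bounded_iff by auto
    have "\<And>x. norm (g1 x) \<le> max G1 G2" "\<And>x. norm (g2 x) \<le> max G1 G2" using G by (auto simp: le_max_iff_disj)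
    from bounded_solution_exists[OF cg this]
    obtain v r B where v: "solves g1 g2 UNIV v r" "\<And>x. amp v r x \<le> B" by blast
    have est: "amp v r x \<le> Kb * (LINT y|lborel. exp (- rate * \<bar>y - x\<bar>) * (norm (g1 y) + norm (g2 y)))" for x
      by (rule amp_estimate_global[OF v cg]) (use G in \<open>auto intro: add_mono\<close>)
    have bv: "bounded (range v)" "bounded (range r)"
      using norm_le_amp v(2) unfolding bounded_iff by (metis order_trans rangeE)+
    have cv: "continuous_on UNIV v" "continuous_on UNIV r" using solves_continuous[OF v(1)] by auto
    let ?v' = "\<lambda>x. ial x * r x + g1 x" and ?r' = "\<lambda>x. complex_of_real kap * (ial x * r x) + q x * v x + g2 x"
    have D: "(v has_vector_derivative ?v' x) (at x)" "(r has_vector_derivative ?r' x) (at x)" for x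
      using v(1) unfolding solves_iff by auto
    have bD: "bounded (range ?v')" "bounded (range ?r')"
      using bv bg bounded_smooth by (intro bounded_add_range bounded_mult_range bounded_const_range; simp)+
    have cD: "continuous_on UNIV ?v'" "continuous_on UNIV ?r'"
      using cv cg cont_smooth by (auto intro!: continuous_intros)
    have kv: "v \<in> C 0 \<and> N 0 v \<le> Kb * (2 / rate) * (4 * (N 0 g1 + N 0 g2))"
      by (rule base_kernel[OF g rate_pos less_imp_le[OF Kb_pos] D(1) bD(1)]) (rule order_trans[OF norm_le_amp(1) est])
    have kr: "r \<in> C 0 \<and> N 0 r \<le> Kb * (2 / rate) * (4 * (N 0 g1 + N 0 g2))"
      by (rule base_kernel[OF g rate_pos less_imp_le[OF Kb_pos] D(2) bD(2)]) (rule order_trans[OF norm_le_amp(2) est])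
    have Cv': "?v' \<in> C 0" "?r' \<in> C 0" using kv kr g ial_smooth q_smooth by (auto intro!: C_mult conjunct1[OF C_add] C_cmult)
    have DRv: "DR v ?v'" "DR r ?r'" using DR_classical D cD kv kr Cv' by auto
    define u where "u = (\<lambda>x. ?B1 x + v x)"
    define p where "p = (\<lambda>x. ?B2 x + r x)"
    have "DR u (\<lambda>x. (f1 x - ?B1 x) + ?v' x)" unfolding u_def using Jop_base[OF f(1)] DRv by (intro DR_add) auto
    moreover have "(\<lambda>x. (f1 x - ?B1 x) + ?v' x) = (\<lambda>x. ial x * p x + f1 x)"
      by (auto simp: fun_eq_iff p_def g1_def algebra_simps)
    moreover have "DR p (\<lambda>x. (f2 x - ?B2 x) + ?r' x)" unfolding p_def using Jop_base[OF f(2)] DRv by (intro DR_add) auto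
    moreover have "(\<lambda>x. (f2 x - ?B2 x) + ?r' x) = (\<lambda>x. complex_of_real kap * (ial x * p x) + q x * u x + f2 x)"
      by (auto simp: fun_eq_iff p_def u_def g2_def algebra_simps)
    ultimately have ws: "weak_solves f1 f2 u p" by (simp add: weak_solves_def)
    let ?F = "N 0 f1 + N 0 f2"
    have K1': "Kb * (2 / rate) * (4 * (N 0 g1 + N 0 g2)) \<le> K1 * (N 0 ?B1 + N 0 ?B2)"
    proof -
      have "Kb * (2 / rate) * (4 * (N 0 g1 + N 0 g2)) \<le> Kb * (2 / rate) * (4 * ((c1 + c2) * (N 0 ?B1 + N 0 ?B2)))"
        using ng1 ng2 Kb_pos rate_pos by (intro mult_left_mono) (auto simp: distrib_right)
      then show ?thesis by (simp only: K1_def mult.assoc)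
    qed
    have K1'': "K1 * (N 0 ?B1 + N 0 ?B2) \<le> K1 * (2 * ?F)" using nB K1 by (intro mult_left_mono) auto
    have "N 0 u + N 0 p \<le> 4 * (N 0 ?B1 + N 0 v) + 4 * (N 0 ?B2 + N 0 r)"
      unfolding u_def p_def
      by (intro add_mono C_add_le[OF B(1) conjunct1[OF kv] order_refl order_refl] C_add_le[OF B(2) conjunct1[OF kr] order_refl order_refl])
    also have "\<dots> \<le> 4 * (2 * ?F + 2 * (K1 * (2 * ?F)))" 
    proof -
      have arith: "A \<le> 2 * a \<Longrightarrow> A' \<le> 2 * a' \<Longrightarrow> x \<le> Z \<Longrightarrow> y \<le> Z \<Longrightarrow> 4 * (A + x) + 4 * (A' + y) \<le> 4 * (2 * (a + a') + 2 * Z)"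
        for A a A' a' x y Z :: real by simp
      show ?thesis
        by (rule arith[OF nB order_trans[OF conjunct2[OF kv] order_trans[OF K1' K1'']] order_trans[OF conjunct2[OF kr] order_trans[OF K1' K1'']]])
    qed
    also have "\<dots> \<le> K * ?F" using base_norm_nonneg f K1 by (simp add: K_def algebra_simps)
    finally show "\<exists>u p. weak_solves f1 f2 u p \<and> N 0 u + N 0 p \<le> K * ?F" using ws by blast
  qed
qed

text \<open>A weak solution agrees with continuous representatives of the form \<open>Jop F\<close>.
  These solve the system classically and are bounded, so the kernel estimate with zero sources
  applies to them.\<close>

lemma weak_solution_unique:
  assumes "weak_solves (\<lambda>_. 0) (\<lambda>_. 0) u p" shows "u \<simeq> (\<lambda>_. 0) \<and> p \<simeq> (\<lambda>_. 0)"
proof -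
  have D: "DR u (\<lambda>x. ial x * p x)" "DR p (\<lambda>x. complex_of_real kap * (ial x * p x) + q x * u x)"
    using assms by (auto simp: weak_solves_def)
  define F1 where "F1 = (\<lambda>x. ial x * p x + u x)"
  define F2 where "F2 = (\<lambda>x. complex_of_real kap * (ial x * p x) + q x * u x + p x)"
  define ju where "ju = Jop F1"
  define jp where "jp = Jop F2"
  have up: "u \<in> C 0" "p \<in> C 0" using D DR_base by blast+
  have F: "F1 \<in> C 0" "F2 \<in> C 0" unfolding F1_def F2_def
    using up ial_smooth q_smooth by (auto intro!: C_mult conjunct1[OF C_add] C_cmult)
  have uj: "u \<simeq> ju" and pj: "p \<simeq> jp" using DR_eq_Jop D unfolding ju_def jp_def F1_def F2_def by auto
  have j: "ju \<in> C 0" "jp \<in> C 0" using Jop_base[OF F(1)] Jop_base[OF F(2)] DR_base unfolding ju_def jp_def by blast+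
  define H1 where "H1 = (\<lambda>x. ial x * jp x + ju x)"
  define H2 where "H2 = (\<lambda>x. complex_of_real kap * (ial x * jp x) + q x * ju x + jp x)"
  have H: "H1 \<in> C 0" "H2 \<in> C 0" unfolding H1_def H2_def
    using j ial_smooth q_smooth by (auto intro!: C_mult conjunct1[OF C_add] C_cmult)
  have FH: "F1 \<simeq> H1" "F2 \<simeq> H2" unfolding F1_def F2_def H1_def H2_def
    using uj pj by (eventually_elim, simp)+
  \<comment> \<open>\<open>F1\<close> and \<open>F2\<close> contain \<open>u\<close> and
    \<open>p\<close>, which need not be continuous. Replacing these by their representatives does
    not change the integrals but makes the integrands continuous, so that \<open>Jop\<close> has a
    classical derivative.\<close>
  have J: "ju = Jop H1" "jp = Jop H2"
    unfolding ju_def jp_def by (rule Jop_cong[OF F(1) H(1) FH(1)], rule Jop_cong[OF F(2) H(2) FH(2)])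
  have cj: "continuous_on UNIV ju" "continuous_on UNIV jp"
    using Jop_continuous base_exp_integrable F unfolding ju_def jp_def by auto
  have cH: "continuous_on UNIV H1" "continuous_on UNIV H2"
    unfolding H1_def H2_def using cj cont_smooth by (auto intro!: continuous_intros)
  have "(ju has_vector_derivative H1 x - ju x) (at x)" "(jp has_vector_derivative H2 x - jp x) (at x)" for x
    using Jop_has_vector_derivative[OF base_exp_integrable[OF H(1)] cH(1)]
      Jop_has_vector_derivative[OF base_exp_integrable[OF H(2)] cH(2)] J by auto
  then have sol: "solves (\<lambda>_. 0) (\<lambda>_. 0) UNIV ju jp" unfolding solves_iff by (simp add: H1_def H2_def)
  obtain B1 B2 where B: "\<And>x. norm (ju x) \<le> B1" "\<And>x. norm (jp x) \<le> B2"
    using Jop_bounded[OF F(1)] Jop_bounded[OF F(2)] unfolding bounded_iff ju_def jp_def by auto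
  have "amp ju jp x \<le> B1 + B2" for x using amp_le[of ju jp x] B[of x] by linarith
  then have "amp ju jp x \<le> Kb * (LINT y|lborel. exp (- rate * \<bar>y - x\<bar>) * (norm (0::complex) + norm (0::complex)))" for x
    by (intro amp_estimate_global[OF sol]) auto
  then have "ju x = 0 \<and> jp x = 0" for x
  proof -
    have "amp ju jp x \<le> 0" using \<open>amp ju jp x \<le> Kb * _\<close> by simp
    then show ?thesis using norm_le_amp(1)[of ju x jp] norm_le_amp(2)[of jp x ju] by (metis norm_le_zero_iff order_trans)
  qed
  then show ?thesis using uj pj by auto
qed

lemma weak_solves_diff:
  assumes "weak_solves f1 f2 u p" "weak_solves f1 f2 v r"
  shows "weak_solves (\<lambda>_. 0) (\<lambda>_. 0) (\<lambda>x. u x - v x) (\<lambda>x. p x - r x)"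
proof -
  have "DR (\<lambda>x. u x - v x) (\<lambda>x. (ial x * p x + f1 x) - (ial x * r x + f1 x))"
    "DR (\<lambda>x. p x - r x) (\<lambda>x. (complex_of_real kap * (ial x * p x) + q x * u x + f2 x) -
       (complex_of_real kap * (ial x * r x) + q x * v x + f2 x))"
    by (rule DR_diff; use assms in \<open>simp add: weak_solves_def\<close>)+
  then show ?thesis unfolding weak_solves_def by (simp add: algebra_simps)
qed

lemma weak_solution_bound:
  "\<exists>K\<ge>0. \<forall>f1\<in>C 0. \<forall>f2\<in>C 0. \<forall>u p. weak_solves f1 f2 u p \<longrightarrow> N 0 u + N 0 p \<le> K * (N 0 f1 + N 0 f2)"
proof -
  obtain K where K: "K \<ge> 0" "\<And>f1 f2. f1 \<in> C 0 \<Longrightarrow> f2 \<in> C 0 \<Longrightarrow> \<exists>u p. weak_solves f1 f2 u p \<and> N 0 u + N 0 p \<le> K * (N 0 f1 + N 0 f2)"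
    using weak_solution_exists by blast
  show ?thesis
  proof (intro exI[of _ K] conjI ballI allI impI K(1))
    fix f1 f2 u p assume f: "f1 \<in> C 0" "f2 \<in> C 0" and s: "weak_solves f1 f2 u p"
    obtain v r where v: "weak_solves f1 f2 v r" "N 0 v + N 0 r \<le> K * (N 0 f1 + N 0 f2)" using K(2)[OF f] by blast
    from weak_solution_unique[OF weak_solves_diff[OF s v(1)]]
    have "u \<simeq> v" "p \<simeq> r" by (auto elim: eventually_mono)
    then have "N 0 u = N 0 v" "N 0 p = N 0 r"
      using s v(1) unfolding weak_solves_def by (auto intro!: base_norm_cong dest: DR_base)
    then show "N 0 u + N 0 p \<le> K * (N 0 f1 + N 0 f2)" using v(2) by simp
  qed
qed

text \<open>The system expresses the derivatives of \<open>u\<close> and \<open>p\<close> by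
  \<open>u\<close>, \<open>p\<close> and the sources. So membership and bounds at order
  \<open>k\<close> pass to order \<open>Suc k\<close>, as long as the sources have order
  \<open>k\<close>.\<close>

lemma weak_solution_regular:
  "\<exists>K\<ge>0. \<forall>f1\<in>C k. \<forall>f2\<in>C k. \<forall>u p. weak_solves f1 f2 u p \<longrightarrow>
     u \<in> C (Suc k) \<and> p \<in> C (Suc k) \<and> N (Suc k) u + N (Suc k) p \<le> K * (N k f1 + N k f2)"
proof -
  have step: "\<exists>K'\<ge>0. \<forall>f1\<in>C k. \<forall>f2\<in>C k. \<forall>u p. weak_solves f1 f2 u p \<longrightarrow>
     u \<in> C (Suc k) \<and> p \<in> C (Suc k) \<and> N (Suc k) u + N (Suc k) p \<le> K' * (N k f1 + N k f2)"
    if K: "K \<ge> 0" "\<And>f1 f2 u p. f1 \<in> C k \<Longrightarrow> f2 \<in> C k \<Longrightarrow> weak_solves f1 f2 u p \<Longrightarrow>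
       u \<in> C k \<and> p \<in> C k \<and> N k u + N k p \<le> K * (N k f1 + N k f2)" for k K
  proof -
    obtain Mi where Mi: "Mi \<ge> 0" "\<And>f. f \<in> C k \<Longrightarrow> (\<lambda>x. ial x * f x) \<in> C k \<and> N k (\<lambda>x. ial x * f x) \<le> Mi * N k f"
      using C_mult_ex[OF ial_smooth, of k] by blast
    obtain Mq where Mq: "Mq \<ge> 0" "\<And>f. f \<in> C k \<Longrightarrow> (\<lambda>x. q x * f x) \<in> C k \<and> N k (\<lambda>x. q x * f x) \<le> Mq * N k f"
      using C_mult_ex[OF q_smooth, of k] by blast
    obtain Mk where Mk: "Mk \<ge> 0" "\<And>f. f \<in> C k \<Longrightarrow> (\<lambda>x. complex_of_real kap * f x) \<in> C k \<and> N k (\<lambda>x. complex_of_real kap * f x) \<le> Mk * N k f"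
      using C_mult_ex[OF bsmooth_const, of k "complex_of_real kap"] by blast
    define M where "M = 1 + 4 * Mi + 16 * (Mk * Mi) + 16 * Mq"
    define K' where "K' = M * K + 4"
    show ?thesis
    proof (intro exI[of _ K'] conjI ballI allI impI)
      show "K' \<ge> 0" using K(1) Mi(1) Mq(1) Mk(1) by (simp add: K'_def M_def)
      fix f1 f2 u p assume f: "f1 \<in> C k" "f2 \<in> C k" and s: "weak_solves f1 f2 u p"
      have up: "u \<in> C k" "p \<in> C k" and b: "N k u + N k p \<le> K * (N k f1 + N k f2)" using K(2)[OF f s] by auto
      let ?u' = "\<lambda>x. ial x * p x + f1 x" and ?p' = "\<lambda>x. complex_of_real kap * (ial x * p x) + q x * u x + f2 x"
      have D: "DR u ?u'" "DR p ?p'" using s by (auto simp: weak_solves_def)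
      have t: "(\<lambda>x. ial x * p x) \<in> C k" "(\<lambda>x. q x * u x) \<in> C k" "(\<lambda>x. complex_of_real kap * (ial x * p x)) \<in> C k"
        using Mi(2)[OF up(2)] Mq(2)[OF up(1)] Mk(2) by auto
      have C': "?u' \<in> C k" "?p' \<in> C k" using t f C_add by auto
      show S: "u \<in> C (Suc k)" "p \<in> C (Suc k)" using D C' C_Suc by blast+
      have "N k ?u' \<le> 4 * (Mi * N k p + N k f1)" 
        by (rule C_add_le[OF t(1) f(1) conjunct2[OF Mi(2)[OF up(2)]] order_refl])
      moreover have "N k (\<lambda>x. complex_of_real kap * (ial x * p x)) \<le> Mk * (Mi * N k p)"
        using conjunct2[OF Mk(2)[OF t(1)]] mult_left_mono[OF conjunct2[OF Mi(2)[OF up(2)]] Mk(1)] by (rule order_trans)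
      then have "N k ?p' \<le> 4 * (4 * (Mk * (Mi * N k p) + Mq * N k u) + N k f2)"
        by (intro C_add_le C_add[THEN conjunct1] t f order_refl conjunct2[OF Mq(2)[OF up(1)]])
      moreover have "N (Suc k) u = N 0 u + N k ?u'" "N (Suc k) p = N 0 p + N k ?p'"
        using norm_Suc S D C' by auto
      ultimately have "N (Suc k) u + N (Suc k) p \<le> (N k u + N k p) + 4 * (Mi * N k p + N k f1) + 4 * (4 * (Mk * (Mi * N k p) + Mq * N k u) + N k f2)"
        using N_ge_base[OF up(1)] N_ge_base[OF up(2)] by linarith
      also have "\<dots> \<le> M * (N k u + N k p) + 4 * (N k f1 + N k f2)"
      proof -
        have "0 \<le> 4 * (Mi * N k u) + 16 * (Mk * Mi * N k u) + 16 * (Mq * N k p)"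
          using N_nonneg[OF up(1)] N_nonneg[OF up(2)] Mi(1) Mq(1) Mk(1) by simp
        then show ?thesis by (simp add: M_def algebra_simps)
      qed
      also have "\<dots> \<le> M * (K * (N k f1 + N k f2)) + 4 * (N k f1 + N k f2)"
        using b Mi(1) Mq(1) Mk(1) by (intro add_right_mono mult_left_mono) (auto simp: M_def)
      finally show "N (Suc k) u + N (Suc k) p \<le> K' * (N k f1 + N k f2)" by (simp add: K'_def algebra_simps)
    qed
  qed
  show ?thesis
  proof (induction k)
    case 0
    obtain K where K: "K \<ge> 0" "\<And>f1 f2 u p. f1 \<in> C 0 \<Longrightarrow> f2 \<in> C 0 \<Longrightarrow> weak_solves f1 f2 u p \<Longrightarrow> N 0 u + N 0 p \<le> K * (N 0 f1 + N 0 f2)"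
      using weak_solution_bound by blast
    show ?case by (rule step[OF K(1)]) (use K(2) in \<open>auto simp: weak_solves_def dest: DR_base\<close>)
  next
    case (Suc k)
    then obtain K where K: "K \<ge> 0" "\<And>f1 f2 u p. f1 \<in> C k \<Longrightarrow> f2 \<in> C k \<Longrightarrow> weak_solves f1 f2 u p \<Longrightarrow>
      u \<in> C (Suc k) \<and> p \<in> C (Suc k) \<and> N (Suc k) u + N (Suc k) p \<le> K * (N k f1 + N k f2)" by blast
    show ?case
    proof (rule step[OF K(1)])
      fix f1 f2 u p assume f: "f1 \<in> C (Suc k)" "f2 \<in> C (Suc k)" and s: "weak_solves f1 f2 u p"
      have "K * (N k f1 + N k f2) \<le> K * (N (Suc k) f1 + N (Suc k) f2)"
        using N_Suc_ge f K(1) by (intro mult_left_mono add_mono) auto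
      then show "u \<in> C (Suc k) \<and> p \<in> C (Suc k) \<and> N (Suc k) u + N (Suc k) p \<le> K * (N (Suc k) f1 + N (Suc k) f2)"
        using K(2)[OF C_SucD[OF f(1)] C_SucD[OF f(2)] s] by linarith
    qed
  qed
qed

end

section \<open>The resolvent equation\<close>

text \<open>What the analysis uses of the wave: the profile equation written out, its limit
  \<open>h0_eq\<close>, smoothness with all derivatives bounded, positive lower bounds, and
  smallness near infinity of the deviations from the limits together with finitely many
  derivatives.\<close>

locale rg_wave =
  fixes gp gh Cf Ct c h0 phim phip bm pm :: real and b ph :: "real \<Rightarrow> real"
  assumes gp: "gp > 0" and gh: "gh > 0" and Cf: "Cf > 0" and Ct: "Ct > 0" and c: "c > 0" and h0: "h0 > 0"
    and phim: "phim > 0" and phip: "phip > 0" and bm: "bm > 0" and pm: "pm > 0"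
    and b_smooth: "bsmooth b" and ph_smooth: "bsmooth ph"
    and b_ge: "b x \<ge> bm" and ph_ge: "ph x \<ge> pm"
    and profile: "(gp + 3 * b x * ph x) * b x * deriv b x + deriv ph x * (b x)^3 = gh * b x - Cf * c^2"
    and h0_eq: "gh * h0 = Cf * c^2"
    and tail_b: "\<epsilon> > 0 \<Longrightarrow> \<exists>R. dbound ({R..} \<union> {..-R}) \<epsilon> k (\<lambda>x. b x - h0)"
    and tail_ph_plus: "\<epsilon> > 0 \<Longrightarrow> \<exists>R. dbound {R..} \<epsilon> k (\<lambda>x. ph x - phip)"
    and tail_ph_minus: "\<epsilon> > 0 \<Longrightarrow> \<exists>R. dbound {..-R} \<epsilon> k (\<lambda>x. ph x - phim)"
begin

text \<open>Eliminating \<open>h\<close>, \<open>\<Phi>\<close> and \<open>\<phi>\<close> from \<open>(\<lambda> - L) W = G\<close> leaves a scalar equation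
  \<open>(al U')' - kap U' - qq \<lambda> U = F\<close>, and \<open>\<Phi>\<close> satisfies \<open>(\<lambda> + dmp) \<Phi> = G\<^sub>3\<close>.\<close>

definition "av x = gp + 3 * b x * ph x"
definition "al x = av x * (b x)^2"
definition "kap = Cf * c^2"
definition "qq lam x = lam^2 * complex_of_real (b x) + complex_of_real (2 * Cf * c) * lam"
definition "dmp x = 2 * (Cf - Ct) * c^3 / ((b x)^3 * ph x)"

lemma b_pos: "b x > 0" using b_ge[of x] bm by linarith
lemma ph_pos: "ph x > 0" using ph_ge[of x] pm by linarith
lemma av_pos: "av x > 0" unfolding av_def using gp b_pos[of x] ph_pos[of x] by (simp add: add_pos_pos)
lemma av_ge: "av x \<ge> gp" unfolding av_def using b_pos[of x] ph_pos[of x] by simp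
lemma al_pos: "al x > 0" using av_pos[of x] b_pos[of x] by (simp add: al_def)
lemma kap_pos: "kap > 0" using Cf c by (simp add: kap_def)

lemma bsmooth_deriv:
  fixes f :: "real \<Rightarrow> real" assumes "bsmooth f"
  shows "(f has_real_derivative deriv f x) (at x)" "bsmooth (deriv f)"
proof -
  obtain f' where f': "\<And>x. (f has_vector_derivative f' x) (at x)" "bsmooth f'" using bsmooth_has_deriv[OF assms] by blast
  have "deriv f = f'"
    by (rule ext, rule DERIV_imp_deriv) (simp add: has_real_derivative_iff_has_vector_derivative f')
  then show "(f has_real_derivative deriv f x) (at x)" "bsmooth (deriv f)"
    using f' by (auto simp: has_real_derivative_iff_has_vector_derivative)
qed

lemma Db: "(b has_real_derivative deriv b x) (at x)" and Dph: "(ph has_real_derivative deriv ph x) (at x)"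
  using bsmooth_deriv b_smooth ph_smooth by auto

lemma av_smooth: "bsmooth av"
  unfolding av_def by (intro bsmooth_add bsmooth_mult bsmooth_const b_smooth ph_smooth)

lemma abv_smooth: "bsmooth (\<lambda>x. b x * av x)" by (intro bsmooth_mult b_smooth av_smooth)

lemma al_smooth: "bsmooth al"
  unfolding al_def by (intro bsmooth_mult bsmooth_power b_smooth av_smooth)

lemma qq_smooth: "bsmooth (qq lam)"
  unfolding qq_def by (intro bsmooth_add bsmooth_mult bsmooth_const bsmooth_of_real b_smooth)

lemma al_ge: "al x \<ge> gp * bm^2"
  unfolding al_def using av_ge[of x] b_ge[of x] bm gp by (intro mult_mono power_mono) auto

lemma abv_ge: "b x * av x \<ge> bm * gp"
  using av_ge[of x] b_ge[of x] bm gp by (intro mult_mono) auto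

lemma b3ph_ge: "(b x)^3 * ph x \<ge> bm^3 * pm"
  using b_ge[of x] ph_ge[of x] bm pm by (intro mult_mono power_mono) auto

lemma dmp_smooth: "bsmooth dmp"
  unfolding dmp_def
  by (rule bsmooth_divide[where \<delta> = "bm^3 * pm"])
    (use b3ph_ge bm pm in \<open>auto intro!: bsmooth_const bsmooth_mult bsmooth_power b_smooth ph_smooth simp: order_trans[OF b3ph_ge abs_ge_self]\<close>)

end

locale rg_scale = rg_wave + deriv_scale
begin

abbreviation "cx \<equiv> complex_of_real"
abbreviation "LL k \<equiv> rg_linearized gp gh Cf Ct c b ph (mk k)"

text \<open>\<open>abv\<close> is the derivative of the pressure with respect to the height, taken
  at the wave; \<open>rr\<close> is the right side of the profile equation; \<open>kp2\<close> is
  the coefficient of \<open>\<Phi>\<close> in the second equation after multiplication by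
  \<open>b\<close>.\<close>

definition "abv x = b x * (gp + 3 * b x * ph x)"
definition "rr x = gh * b x - kap"
definition "kp2 x = c^2 * (Ct - Cf) / ph x"

lemma abv_eq: "abv x = av x * b x" by (simp add: abv_def av_def)
lemma abv_sm: "bsmooth abv" using abv_smooth by (simp add: abv_def[abs_def] av_def)
lemma rr_sm: "bsmooth rr" unfolding rr_def by (intro bsmooth_diff bsmooth_mult bsmooth_const b_smooth)
lemma kp2_sm: "bsmooth kp2" unfolding kp2_def
  by (rule bsmooth_divide[OF bsmooth_const ph_smooth pm]) (use ph_ge in \<open>auto intro: order_trans[OF _ abs_ge_self]\<close>)

lemma DR_rmult:
  assumes "DR f g" "bsmooth m" "\<And>x. (m has_real_derivative m' x) (at x)"
  shows "DR (\<lambda>x. cx (m x) * f x) (\<lambda>x. cx (m' x) * f x + cx (m x) * g x)"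
  by (rule DR_mult[OF assms(1) bsmooth_of_real[OF assms(2)]])
    (use assms(3) in \<open>auto intro!: has_vector_derivative_of_real simp: has_real_derivative_iff_has_vector_derivative\<close>)

text \<open>The second equation is multiplied by \<open>b\<close>, and derivatives are separate
  arguments, so that pointwise algebra can be done without reference to the derivative of the space
  in question.\<close>

definition eqs where "eqs lam h hdv U Ud F Fd phi phid G1 G2 G3 G4 x \<longleftrightarrow>
    lam * h x + (cx (deriv b x) * U x + cx (b x) * Ud x) = G1 x \<and>
    lam * cx (b x) * U x + cx (abv x) * hdv x - cx (gh - deriv abv x) * h x + cx (2 * Cf * c) * U x
      + (cx (3 * (b x)^2 * deriv b x) * (F x + phi x) + cx ((b x)^3) * (Fd x + phid x)) + cx (kp2 x) * F x = cx (b x) * G2 x \<and>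
    (lam + cx (dmp x)) * F x = G3 x \<and>
    lam * phi x + cx (deriv ph x) * U x = G4 x"

lemma state_eq_iff:
  assumes "DR h hdv" "DR U Ud" "DR F Fd" "DR phi phid"
  shows "state_eq (mk k) (shifted lam (LL k) (h, U, F, phi)) (G1, G2, G3, G4) \<longleftrightarrow>
    (\<forall>\<^sub>F x in Fl. eqs lam h hdv U Ud F Fd phi phid G1 G2 G3 G4 x)"
proof -
  have D1: "\<forall>\<^sub>F x in Fl. space_deriv (mk k) (\<lambda>y. cx (b y) * U y) x = cx (deriv b x) * U x + cx (b x) * Ud x"
    by (rule space_deriv_eq[OF DR_rmult[OF assms(2) b_smooth Db]])
  have D2: "\<forall>\<^sub>F x in Fl. space_deriv (mk k) h x = hdv x" by (rule space_deriv_eq[OF assms(1)])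
  have D3': "((\<lambda>x. (b x)^3) has_real_derivative 3 * (b x)^2 * deriv b x) (at x)" for x
    using Db[of x] by (auto intro!: derivative_eq_intros)
  have D3: "\<forall>\<^sub>F x in Fl. space_deriv (mk k) (\<lambda>y. cx ((b y)^3) * (F y + phi y)) x =
      cx (3 * (b x)^2 * deriv b x) * (F x + phi x) + cx ((b x)^3) * (Fd x + phid x)"
    by (rule space_deriv_eq[OF DR_rmult[OF DR_add[OF assms(3,4)] bsmooth_power[OF b_smooth] D3']])
  have ab: "deriv (\<lambda>y. b y * (gp + 3 * b y * ph y)) x = deriv abv x" for x by (simp add: abv_def[abs_def])
  \<comment> \<open>\<open>Z2\<close> and \<open>Z3\<close> stand for the two differentiated terms;
    with them abstract, the equivalence is multiplication by \<open>b\<close>, which is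
    nonzero.\<close>
  have iff2: "lam * U x - (- cx (gp + 3 * b x * ph x) * Z2 + cx ((1 / b x) * (gh - deriv abv x)) * h x
         - cx (2 * Cf * c * (1 / b x)) * U x - cx (1 / b x) * Z3 - cx (c^2 * (Ct - Cf) / (ph x * b x)) * F x) = G2 x \<longleftrightarrow>
      lam * cx (b x) * U x + cx (abv x) * Z2 - cx (gh - deriv abv x) * h x + cx (2 * Cf * c) * U x
         + Z3 + cx (kp2 x) * F x = cx (b x) * G2 x" for x Z2 Z3
  proof -
    define B where "B = cx (b x)"
    have B: "B \<noteq> 0" "B * cx (1 / b x) = 1" using b_pos[of x] by (auto simp: B_def)
    have "cx (c^2 * (Ct - Cf) / (ph x * b x)) = cx (kp2 x) * cx (1 / b x)" by (simp add: kp2_def)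
    moreover have "cx (abv x) = B * cx (gp + 3 * b x * ph x)" by (simp add: abv_def B_def)
    moreover have "cx ((1 / b x) * (gh - deriv abv x)) = cx (1 / b x) * cx (gh - deriv abv x)" "cx (2 * Cf * c * (1 / b x)) = cx (2 * Cf * c) * cx (1 / b x)"
      by (simp_all only: of_real_mult)
    ultimately have "lam * B * U x + cx (abv x) * Z2 - cx (gh - deriv abv x) * h x + cx (2 * Cf * c) * U x
         + Z3 + cx (kp2 x) * F x - B * G2 x = B * ((lam * U x - (- cx (gp + 3 * b x * ph x) * Z2 + cx ((1 / b x) * (gh - deriv abv x)) * h x
         - cx (2 * Cf * c * (1 / b x)) * U x - cx (1 / b x) * Z3 - cx (c^2 * (Ct - Cf) / (ph x * b x)) * F x)) - G2 x)"
      using B(2) by algebra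
    then show ?thesis using B(1) unfolding B_def by (metis eq_iff_diff_eq_0 mult_eq_0_iff)
  qed
  have iff3: "lam * F x - (- cx (2 * (Cf - Ct) * c^3 / ((b x)^3 * ph x)) * F x) = (lam + cx (dmp x)) * F x" for x
    by (simp add: dmp_def algebra_simps)
  have iff1: "lam * h x - - Z = lam * h x + Z" "lam * phi x - - cx (deriv ph x) * U x = lam * phi x + cx (deriv ph x) * U x" for x Z
    by simp_all
  have "state_eq (mk k) (shifted lam (LL k) (h, U, F, phi)) (G1, G2, G3, G4) \<longleftrightarrow>
     (\<forall>\<^sub>F x in Fl. (lam * h x - - space_deriv (mk k) (\<lambda>y. cx (b y) * U y) x = G1 x \<and>
       lam * U x - (- cx (gp + 3 * b x * ph x) * space_deriv (mk k) h x + cx ((1 / b x) * (gh - deriv abv x)) * h x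
         - cx (2 * Cf * c * (1 / b x)) * U x - cx (1 / b x) * space_deriv (mk k) (\<lambda>y. cx ((b y)^3) * (F y + phi y)) x
         - cx (c^2 * (Ct - Cf) / (ph x * b x)) * F x) = G2 x \<and>
       lam * F x - (- cx (2 * (Cf - Ct) * c^3 / ((b x)^3 * ph x)) * F x) = G3 x \<and>
       lam * phi x - - cx (deriv ph x) * U x = G4 x))"
    by (simp only: shifted_def rg_linearized.simps prod.case state_eq.simps eq_iff eventually_conj_iff ab)
  also have "\<dots> \<longleftrightarrow> (\<forall>\<^sub>F x in Fl. eqs lam h hdv U Ud F Fd phi phid G1 G2 G3 G4 x)"
    unfolding iff1 iff2 iff3 eqs_def
  proof (rule eventually_subst)
    show "\<forall>\<^sub>F x in Fl. (lam * h x + space_deriv (mk k) (\<lambda>y. cx (b y) * U y) x = G1 x \<and>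
        lam * cx (b x) * U x + cx (abv x) * space_deriv (mk k) h x - cx (gh - deriv abv x) * h x + cx (2 * Cf * c) * U x +
        space_deriv (mk k) (\<lambda>y. cx ((b y)^3) * (F y + phi y)) x + cx (kp2 x) * F x = cx (b x) * G2 x \<and>
        (lam + cx (dmp x)) * F x = G3 x \<and> lam * phi x + cx (deriv ph x) * U x = G4 x) =
       (lam * h x + (cx (deriv b x) * U x + cx (b x) * Ud x) = G1 x \<and>
        lam * cx (b x) * U x + cx (abv x) * hdv x - cx (gh - deriv abv x) * h x + cx (2 * Cf * c) * U x +
        (cx (3 * (b x)^2 * deriv b x) * (F x + phi x) + cx ((b x)^3) * (Fd x + phid x)) + cx (kp2 x) * F x = cx (b x) * G2 x \<and>
        (lam + cx (dmp x)) * F x = G3 x \<and> lam * phi x + cx (deriv ph x) * U x = G4 x)"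
      using D1 D2 D3 by eventually_elim simp
  qed
  finally show ?thesis .
qed

lemma X_carrier_iff: "(G1, G2, G3, G4) \<in> X_carrier (mk k) \<longleftrightarrow> G1 \<in> C k \<and> G2 \<in> C k \<and> G3 \<in> C (Suc k) \<and> G4 \<in> C (Suc k)"
  by (auto simp: X_carrier_def one_more)

lemma D_carrier_iff: "(h, U, F, phi) \<in> D_carrier (mk k) \<longleftrightarrow> h \<in> C (Suc k) \<and> U \<in> C (Suc k) \<and> F \<in> C (Suc k) \<and> phi \<in> C (Suc k)"
  by (auto simp: D_carrier_def one_more)

text \<open>\<open>QQ\<close> is the linearized pressure, the only combination of \<open>h\<close>,
  \<open>\<Phi>\<close>, \<open>\<phi>\<close> that the second equation differentiates.
  \<open>PP\<close> is designed so that the first and last equations become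
  \<open>U' = PP / al + F1\<close>: they turn \<open>lam * QQ\<close> into terms with
  \<open>U\<close> and \<open>U'\<close>, and by the profile equation the coefficient of
  \<open>U\<close> is \<open>- rr\<close>.\<close>

definition "F1 lam G1 F G4 x = (cx (abv x) * G1 x + cx ((b x)^3) * (lam * F x + G4 x)) / cx (al x)"
definition "F2 lam G1 G2 F G4 x = cx kap * F1 lam G1 F G4 x + (- (lam * cx (b x) * G2 x) + lam * cx (kp2 x) * F x - cx gh * G1 x)"
definition "QQ h F phi x = cx (abv x) * h x + cx ((b x)^3) * (F x + phi x)"
definition "PP lam h U F phi x = - (lam * QQ h F phi x + cx (rr x) * U x)"

lemma profile_cx: "cx (abv x) * cx (deriv b x) + cx (deriv ph x) * cx (b x)^3 = cx gh * cx (b x) - cx kap"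
proof -
  have "abv x * deriv b x + deriv ph x * (b x)^3 = gh * b x - kap"
    using profile[of x] by (simp add: abv_def kap_def mult.commute)
  from arg_cong[OF this, of cx] show ?thesis by simp
qed

lemma eqs_imp_U:
  assumes "eqs lam h hdv U Ud F Fd phi phid G1 G2 G3 G4 x"
  shows "Ud x = 1 / cx (al x) * PP lam h U F phi x + F1 lam G1 F G4 x"
proof -
  have E: "lam * h x + (cx (deriv b x) * U x + cx (b x) * Ud x) = G1 x" "lam * phi x + cx (deriv ph x) * U x = G4 x"
    using assms by (auto simp: eqs_def)
  have al: "cx (al x) = cx (abv x) * cx (b x)" "cx (al x) \<noteq> 0" using al_pos[of x] by (auto simp: al_def abv_eq power2_eq_square)
  have rr: "cx (rr x) = cx gh * cx (b x) - cx kap" by (simp add: rr_def)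
  have "cx (al x) * Ud x = PP lam h U F phi x + (cx (abv x) * G1 x + cx (b x)^3 * (lam * F x + G4 x))"
    unfolding PP_def QQ_def al(1) rr E(1)[symmetric] E(2)[symmetric] of_real_power using profile_cx[of x] by algebra
  then show ?thesis using al(2) by (simp add: F1_def field_simps)
qed

text \<open>Multiply the second equation by \<open>lam\<close> and replace \<open>lam * h\<close> in
  its gravity term by means of the first one. The resulting \<open>gh\<close> times the derivative
  of \<open>b U\<close> cancels against the derivative of \<open>rr U\<close> up to
  \<open>kap U'\<close>, since \<open>rr = gh b - kap\<close>.\<close>

lemma eqs_imp_P:
  assumes "eqs lam h hdv U Ud F Fd phi phid G1 G2 G3 G4 x"
  shows "- (lam * (cx (deriv abv x) * h x + cx (abv x) * hdv x + (cx (3 * (b x)^2 * deriv b x) * (F x + phi x) + cx ((b x)^3) * (Fd x + phid x)))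
      + (cx (gh * deriv b x) * U x + cx (rr x) * Ud x)) =
    cx kap * (1 / cx (al x) * PP lam h U F phi x) + qq lam x * U x + F2 lam G1 G2 F G4 x"
proof -
  define V where "V = cx (3 * (b x)^2 * deriv b x) * (F x + phi x) + cx ((b x)^3) * (Fd x + phid x)"
  have E: "lam * h x + (cx (deriv b x) * U x + cx (b x) * Ud x) = G1 x"
    "lam * cx (b x) * U x + cx (abv x) * hdv x - (cx gh - cx (deriv abv x)) * h x + cx (2 * Cf * c) * U x
      + V + cx (kp2 x) * F x = cx (b x) * G2 x"
    using assms by (auto simp: eqs_def V_def)
  have rr: "cx (rr x) = cx gh * cx (b x) - cx kap" "cx (gh * deriv b x) = cx gh * cx (deriv b x)" by (simp_all add: rr_def)
  have "- (lam * (cx (deriv abv x) * h x + cx (abv x) * hdv x + V) + (cx (gh * deriv b x) * U x + cx (rr x) * Ud x)) =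
     cx kap * Ud x + qq lam x * U x + (- (lam * (cx (b x) * G2 x)) + lam * cx (kp2 x) * F x - cx gh * G1 x)"
    unfolding E(1)[symmetric] E(2)[symmetric] rr qq_def by algebra
  also have "cx kap * Ud x = cx kap * (1 / cx (al x) * PP lam h U F phi x) + cx kap * F1 lam G1 F G4 x"
    unfolding eqs_imp_U[OF assms] by (simp add: distrib_left)
  finally show ?thesis unfolding V_def[symmetric] F2_def by (simp add: algebra_simps)
qed

lemma DR_QQ:
  assumes "DR h hdv" "DR F Fd" "DR phi phid"
  shows "DR (QQ h F phi) (\<lambda>x. cx (deriv abv x) * h x + cx (abv x) * hdv x
     + (cx (3 * (b x)^2 * deriv b x) * (F x + phi x) + cx ((b x)^3) * (Fd x + phid x)))"
proof -
  have D3: "((\<lambda>x. (b x)^3) has_real_derivative 3 * (b x)^2 * deriv b x) (at x)" for x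
    using Db[of x] by (auto intro!: derivative_eq_intros)
  show ?thesis unfolding QQ_def[abs_def]
    by (intro DR_add DR_rmult[OF assms(1) abv_sm] DR_rmult[OF DR_add[OF assms(2,3)] bsmooth_power[OF b_smooth]] D3 bsmooth_deriv(1)[OF abv_sm])
qed

lemma DR_rr: "DR U Ud \<Longrightarrow> DR (\<lambda>x. cx (rr x) * U x) (\<lambda>x. cx (gh * deriv b x) * U x + cx (rr x) * Ud x)"
proof (rule DR_rmult[OF _ rr_sm])
  show "(rr has_real_derivative gh * deriv b x) (at x)" for x
    unfolding rr_def[abs_def] using Db[of x] by (auto intro!: derivative_eq_intros)
qed

lemma DR_PP:
  assumes "DR h hdv" "DR U Ud" "DR F Fd" "DR phi phid"
  shows "DR (PP lam h U F phi) (\<lambda>x. - (lam * (cx (deriv abv x) * h x + cx (abv x) * hdv x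
     + (cx (3 * (b x)^2 * deriv b x) * (F x + phi x) + cx ((b x)^3) * (Fd x + phid x)))
     + (cx (gh * deriv b x) * U x + cx (rr x) * Ud x)))"
  using DR_cmult[OF DR_add[OF DR_cmult[OF DR_QQ[OF assms(1,3,4)]] DR_rr[OF assms(2)]], of "-1" lam]
  by (simp add: PP_def[abs_def])

end

context deriv_scale
begin

lemma C_zero: "(\<lambda>_. 0) \<in> C k \<and> N k (\<lambda>_. 0) = 0"
proof -
  have z: "(\<lambda>_. 0) \<in> C 0" by (rule base_compact[where R = 0]) (auto intro: csmooth_const)
  have "N 0 (\<lambda>x. 0 * (0::complex)) \<le> 0 * N 0 (\<lambda>_. 0)"
    using base_mult[OF z bsmooth_const[of 0], of 0] by auto
  then have n: "N 0 (\<lambda>_. 0) = 0" using base_norm_nonneg[OF z] by auto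
  have d: "DR (\<lambda>_. 0) (\<lambda>_. 0)" by (rule DR_classical) (use z in auto)
  show ?thesis
  proof (induction k)
    case (Suc k)
    have "(\<lambda>_. 0) \<in> C (Suc k)" unfolding C_Suc using Suc d by blast
    then show ?case using norm_Suc[OF _ d] Suc n by auto
  qed (use z n in auto)
qed

lemma C_comb2:
  assumes "bsmooth m1" "bsmooth m2"
  shows "\<exists>M\<ge>0. \<forall>f\<in>C k. \<forall>g\<in>C k. (\<lambda>x. m1 x * f x + m2 x * g x) \<in> C k \<and>
    N k (\<lambda>x. m1 x * f x + m2 x * g x) \<le> M * (N k f + N k g)"
proof -
  obtain M1 where M1: "M1 \<ge> 0" "\<And>f. f \<in> C k \<Longrightarrow> (\<lambda>x. m1 x * f x) \<in> C k \<and> N k (\<lambda>x. m1 x * f x) \<le> M1 * N k f"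
    using C_mult_ex[OF assms(1), of k] by blast
  obtain M2 where M2: "M2 \<ge> 0" "\<And>f. f \<in> C k \<Longrightarrow> (\<lambda>x. m2 x * f x) \<in> C k \<and> N k (\<lambda>x. m2 x * f x) \<le> M2 * N k f"
    using C_mult_ex[OF assms(2), of k] by blast
  show ?thesis
  proof (intro exI[of _ "4 * (M1 + M2)"] conjI ballI)
    fix f g assume fg: "f \<in> C k" "g \<in> C k"
    note h1 = M1(2)[OF fg(1)] and h2 = M2(2)[OF fg(2)]
    show "(\<lambda>x. m1 x * f x + m2 x * g x) \<in> C k" using C_add h1 h2 by blast
    have "N k (\<lambda>x. m1 x * f x + m2 x * g x) \<le> 4 * (M1 * N k f + M2 * N k g)"
      using h1 h2 by (intro C_add_le) auto
    also have "\<dots> \<le> 4 * ((M1 + M2) * N k f + (M1 + M2) * N k g)"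
      using N_nonneg fg M1(1) M2(1) by (intro mult_left_mono add_mono mult_right_mono) auto
    finally show "N k (\<lambda>x. m1 x * f x + m2 x * g x) \<le> 4 * (M1 + M2) * (N k f + N k g)" by (simp add: algebra_simps)
  qed (use M1(1) M2(1) in auto)
qed

lemma C_comb4:
  assumes "bsmooth m1" "bsmooth m2" "bsmooth m3" "bsmooth m4"
  shows "\<exists>M\<ge>0. \<forall>f\<in>C k. \<forall>g\<in>C k. \<forall>h\<in>C k. \<forall>i\<in>C k. (\<lambda>x. m1 x * f x + m2 x * g x + (m3 x * h x + m4 x * i x)) \<in> C k \<and>
    N k (\<lambda>x. m1 x * f x + m2 x * g x + (m3 x * h x + m4 x * i x)) \<le> M * (N k f + N k g + N k h + N k i)"
proof -
  obtain M1 where M1: "M1 \<ge> 0" "\<And>f g. f \<in> C k \<Longrightarrow> g \<in> C k \<Longrightarrow> (\<lambda>x. m1 x * f x + m2 x * g x) \<in> C k \<and> N k (\<lambda>x. m1 x * f x + m2 x * g x) \<le> M1 * (N k f + N k g)"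
    using C_comb2[OF assms(1,2), of k] by blast
  obtain M2 where M2: "M2 \<ge> 0" "\<And>f g. f \<in> C k \<Longrightarrow> g \<in> C k \<Longrightarrow> (\<lambda>x. m3 x * f x + m4 x * g x) \<in> C k \<and> N k (\<lambda>x. m3 x * f x + m4 x * g x) \<le> M2 * (N k f + N k g)"
    using C_comb2[OF assms(3,4), of k] by blast
  show ?thesis
  proof (intro exI[of _ "4 * (M1 + M2)"] conjI ballI)
    fix f g h i assume fg: "f \<in> C k" "g \<in> C k" "h \<in> C k" "i \<in> C k"
    note h1 = M1(2)[OF fg(1,2)] and h2 = M2(2)[OF fg(3,4)]
    show "(\<lambda>x. m1 x * f x + m2 x * g x + (m3 x * h x + m4 x * i x)) \<in> C k" using C_add[OF conjunct1[OF h1] conjunct1[OF h2]] by blast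
    have "N k (\<lambda>x. m1 x * f x + m2 x * g x + (m3 x * h x + m4 x * i x)) \<le> 4 * (M1 * (N k f + N k g) + M2 * (N k h + N k i))"
      using h1 h2 by (intro C_add_le) auto
    also have "\<dots> \<le> 4 * ((M1 + M2) * (N k f + N k g) + (M1 + M2) * (N k h + N k i))"
      using N_nonneg fg M1(1) M2(1) by (intro mult_left_mono add_mono mult_right_mono) (auto intro: add_nonneg_nonneg)
    finally show "N k (\<lambda>x. m1 x * f x + m2 x * g x + (m3 x * h x + m4 x * i x)) \<le> 4 * (M1 + M2) * (N k f + N k g + N k h + N k i)"
      by (simp add: algebra_simps)
  qed (use M1(1) M2(1) in auto)
qed

end

context rg_scale
begin

lemma eqs_diff:
  assumes e: "eqs lam h hd1 U Ud F Fd phi pd G1 G2 G3 G4 x" and e': "eqs lam h' hd1' U' Ud' F' Fd' phi' pd' G1 G2 G3 G4 x"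
  shows "eqs lam (\<lambda>x. h' x - h x) (\<lambda>x. hd1' x - hd1 x) (\<lambda>x. U' x - U x) (\<lambda>x. Ud' x - Ud x)
       (\<lambda>x. F' x - F x) (\<lambda>x. Fd' x - Fd x) (\<lambda>x. phi' x - phi x) (\<lambda>x. pd' x - pd x) (\<lambda>_. 0) (\<lambda>_. 0) (\<lambda>_. 0) (\<lambda>_. 0) x"
  unfolding eqs_def
proof (intro conjI)
  note a = e[unfolded eqs_def] and a' = e'[unfolded eqs_def]
  show "lam * (h' x - h x) + (cx (deriv b x) * (U' x - U x) + cx (b x) * (Ud' x - Ud x)) = 0"
  proof -
    have "lam * (h' x - h x) + (cx (deriv b x) * (U' x - U x) + cx (b x) * (Ud' x - Ud x)) =
      (lam * h' x + (cx (deriv b x) * U' x + cx (b x) * Ud' x)) - (lam * h x + (cx (deriv b x) * U x + cx (b x) * Ud x))"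
      by algebra
    then show ?thesis unfolding conjunct1[OF a] conjunct1[OF a'] by simp
  qed
  show "lam * cx (b x) * (U' x - U x) + cx (abv x) * (hd1' x - hd1 x) - cx (gh - deriv abv x) * (h' x - h x) +
     cx (2 * Cf * c) * (U' x - U x) + (cx (3 * (b x)^2 * deriv b x) * (F' x - F x + (phi' x - phi x)) +
     cx ((b x)^3) * (Fd' x - Fd x + (pd' x - pd x))) + cx (kp2 x) * (F' x - F x) = cx (b x) * 0"
    (is "?L = _")
  proof -
    have "?L = (lam * cx (b x) * U' x + cx (abv x) * hd1' x - cx (gh - deriv abv x) * h' x + cx (2 * Cf * c) * U' x
      + (cx (3 * (b x)^2 * deriv b x) * (F' x + phi' x) + cx ((b x)^3) * (Fd' x + pd' x)) + cx (kp2 x) * F' x) -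
      (lam * cx (b x) * U x + cx (abv x) * hd1 x - cx (gh - deriv abv x) * h x + cx (2 * Cf * c) * U x
      + (cx (3 * (b x)^2 * deriv b x) * (F x + phi x) + cx ((b x)^3) * (Fd x + pd x)) + cx (kp2 x) * F x)"
      by algebra
    then show ?thesis unfolding conjunct1[OF conjunct2[OF a]] conjunct1[OF conjunct2[OF a']] by simp
  qed
  show "(lam + cx (dmp x)) * (F' x - F x) = 0" "lam * (phi' x - phi x) + cx (deriv ph x) * (U' x - U x) = 0"
    using conjunct2[OF conjunct2[OF a]] conjunct2[OF conjunct2[OF a']] by (simp_all add: right_diff_distrib) (metis add_diff_add diff_self)
qed

text \<open>Uniqueness needs no separate proof: the difference of two solutions solves the equation
  with zero data, and the bound makes its norm vanish.\<close>

lemma bounded_inverse_imp_resolvent: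
  assumes ex: "\<And>G. G \<in> X_carrier (mk k) \<Longrightarrow> \<exists>W\<in>D_carrier (mk k). state_eq (mk k) (shifted lam (LL k) W) G"
    and bd: "\<And>G W. G \<in> X_carrier (mk k) \<Longrightarrow> W \<in> D_carrier (mk k) \<Longrightarrow> state_eq (mk k) (shifted lam (LL k) W) G \<Longrightarrow>
       X_norm (mk k) W \<le> K * X_norm (mk k) G"
  shows "in_resolvent_set (mk k) (LL k) lam"
  unfolding in_resolvent_set_def
proof (intro conjI ballI exI[of _ K] impI bd)
  fix G assume G: "G \<in> X_carrier (mk k)"
  obtain W where W: "W \<in> D_carrier (mk k)" "state_eq (mk k) (shifted lam (LL k) W) G" using ex[OF G] by blast
  have "state_eq (mk k) W' W" if W': "W' \<in> D_carrier (mk k)" "state_eq (mk k) (shifted lam (LL k) W') G" for W'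
  proof -
    obtain h U F phi where Weq: "W = (h, U, F, phi)" by (cases W)
    obtain h' U' F' phi' where Weq': "W' = (h', U', F', phi')" by (cases W')
    obtain G1 G2 G3 G4 where Geq: "G = (G1, G2, G3, G4)" by (cases G)
    have m: "h \<in> C (Suc k)" "U \<in> C (Suc k)" "F \<in> C (Suc k)" "phi \<in> C (Suc k)"
      "h' \<in> C (Suc k)" "U' \<in> C (Suc k)" "F' \<in> C (Suc k)" "phi' \<in> C (Suc k)"
      using W(1) W'(1) by (auto simp: Weq Weq' D_carrier_iff)
    obtain hd1 Ud Fd pd where d: "DR h hd1" "DR U Ud" "DR F Fd" "DR phi pd" using m C_Suc by metis
    obtain hd1' Ud' Fd' pd' where d': "DR h' hd1'" "DR U' Ud'" "DR F' Fd'" "DR phi' pd'" using m C_Suc by metis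
    have "\<forall>\<^sub>F x in Fl. eqs lam h hd1 U Ud F Fd phi pd G1 G2 G3 G4 x" "\<forall>\<^sub>F x in Fl. eqs lam h' hd1' U' Ud' F' Fd' phi' pd' G1 G2 G3 G4 x"
      using W(2) W'(2) unfolding Weq Weq' Geq state_eq_iff[OF d] state_eq_iff[OF d'] by auto
    then have "\<forall>\<^sub>F x in Fl. eqs lam (\<lambda>x. h' x - h x) (\<lambda>x. hd1' x - hd1 x) (\<lambda>x. U' x - U x) (\<lambda>x. Ud' x - Ud x)
       (\<lambda>x. F' x - F x) (\<lambda>x. Fd' x - Fd x) (\<lambda>x. phi' x - phi x) (\<lambda>x. pd' x - pd x) (\<lambda>_. 0) (\<lambda>_. 0) (\<lambda>_. 0) (\<lambda>_. 0) x"
      by eventually_elim (rule eqs_diff)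
    then have s: "state_eq (mk k) (shifted lam (LL k) (\<lambda>x. h' x - h x, \<lambda>x. U' x - U x, \<lambda>x. F' x - F x, \<lambda>x. phi' x - phi x)) (\<lambda>_. 0, \<lambda>_. 0, \<lambda>_. 0, \<lambda>_. 0)"
      using state_eq_iff[OF DR_diff[OF d'(1) d(1)] DR_diff[OF d'(2) d(2)] DR_diff[OF d'(3) d(3)] DR_diff[OF d'(4) d(4)]] by blast
    have md: "(\<lambda>x. h' x - h x) \<in> C (Suc k)" "(\<lambda>x. U' x - U x) \<in> C (Suc k)" "(\<lambda>x. F' x - F x) \<in> C (Suc k)" "(\<lambda>x. phi' x - phi x) \<in> C (Suc k)"
      using m C_diff by auto
    have "X_norm (mk k) (\<lambda>x. h' x - h x, \<lambda>x. U' x - U x, \<lambda>x. F' x - F x, \<lambda>x. phi' x - phi x) \<le> K * X_norm (mk k) (\<lambda>_. 0, \<lambda>_. 0, \<lambda>_. 0, \<lambda>_. 0)"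
      by (rule bd[OF _ _ s]) (use md C_zero in \<open>auto simp: X_carrier_iff D_carrier_iff\<close>)
    then have le0: "N k (\<lambda>x. h' x - h x) + N k (\<lambda>x. U' x - U x) + N (Suc k) (\<lambda>x. F' x - F x) + N (Suc k) (\<lambda>x. phi' x - phi x) \<le> 0"
      using C_zero by (simp add: one_more)
    have nn: "f \<in> C j \<Longrightarrow> N j f \<le> 0 \<Longrightarrow> f \<simeq> (\<lambda>_. 0)" for f j
      using base_norm_eq_0[OF C_base] N_ge_base[of f j] base_norm_nonneg[OF C_base, of f j] by fastforce
    note n = N_nonneg[OF C_SucD[OF md(1)]] N_nonneg[OF C_SucD[OF md(2)]] N_nonneg[OF md(3)] N_nonneg[OF md(4)]
    have "(\<lambda>x. h' x - h x) \<simeq> (\<lambda>_. 0)" "(\<lambda>x. U' x - U x) \<simeq> (\<lambda>_. 0)" "(\<lambda>x. F' x - F x) \<simeq> (\<lambda>_. 0)" "(\<lambda>x. phi' x - phi x) \<simeq> (\<lambda>_. 0)"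
      by (rule nn[OF C_SucD[OF md(1)]] nn[OF C_SucD[OF md(2)]] nn[OF md(3)] nn[OF md(4)], use le0 n in linarith)+
    then show ?thesis unfolding Weq Weq' by (simp add: eq_iff)
  qed
  then show "\<exists>W\<in>D_carrier (mk k). state_eq (mk k) (shifted lam (LL k) W) G \<and>
        (\<forall>W'\<in>D_carrier (mk k). state_eq (mk k) (shifted lam (LL k) W') G \<longrightarrow> state_eq (mk k) W' W)"
    using W by blast
qed

text \<open>The unknowns are determined in the order \<open>\<Phi>\<close> (division by
  \<open>lam + dmp\<close>), then \<open>U\<close> and \<open>PP\<close> (first order system),
  \<open>\<phi>\<close> (last equation), and \<open>h\<close> (definition of \<open>PP\<close>).
  Since \<open>h\<close> is recovered algebraically, it has the regularity of \<open>U\<close> and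
  \<open>PP\<close>, one derivative more than the data of the first equation. For the bound a given
  solution is put into this form; for existence the elimination is reversed.\<close>

theorem resolvent_of_coercive:
  assumes lam: "lam \<noteq> 0" and \<delta>: "\<delta> > 0" "\<And>x. norm (lam + cx (dmp x)) \<ge> \<delta>"
    and co: "coercive_system al kap (qq lam) w w' a0 Q Wb d"
  shows "in_resolvent_set (mk k) (LL k) lam"
proof -
  interpret S: scale_system mk DR Fl nu al kap "qq lam" w w' a0 Q Wb d
    by (intro scale_system.intro co deriv_scale_axioms scale_system_axioms.intro al_smooth qq_smooth)
  have iale: "S.ial x = 1 / cx (al x)" for x by (simp add: S.ial_def)
  note sm = bsmooth_mult bsmooth_add bsmooth_minus bsmooth_const bsmooth_of_real bsmooth_power b_smooth abv_sm rr_sm kp2_sm S.ial_smooth bsmooth_deriv(2)[OF ph_smooth]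
  define mi where "mi = (\<lambda>x. 1 / (lam + cx (dmp x)))"
  have mi_sm: "bsmooth mi" unfolding mi_def
    by (rule bsmooth_divide[OF _ _ \<delta>]) (intro bsmooth_const bsmooth_add bsmooth_of_real dmp_smooth)+
  have mi1: "mi x * (lam + cx (dmp x)) = 1" for x using \<delta>(1) \<delta>(2)[of x] by (auto simp: mi_def)
  define iabv where "iabv = (\<lambda>x. 1 / cx (abv x))"
  have abv_pos: "abv x > 0" for x using av_pos[of x] b_pos[of x] by (simp add: abv_eq)
  have iabv_sm: "bsmooth iabv" unfolding iabv_def
  proof (rule bsmooth_divide[OF bsmooth_const bsmooth_of_real[OF abv_sm]])
    show "bm * gp > 0" using bm gp by simp
    show "norm (cx (abv x)) \<ge> bm * gp" for x
      using abv_ge[of x] by (simp only: abv_eq norm_of_real mult.commute[of "av x"] order_trans[OF _ abs_ge_self])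
  qed
  let ?u = "\<lambda>_::real. 1::complex"
  define f1a where "f1a = (\<lambda>x. S.ial x * cx (abv x))"
  define f1b where "f1b = (\<lambda>x. S.ial x * cx (b x)^3 * lam)"
  define f1c where "f1c = (\<lambda>x. S.ial x * cx (b x)^3)"
  have f1sm: "bsmooth f1a" "bsmooth f1b" "bsmooth f1c" unfolding f1a_def f1b_def f1c_def by (intro sm)+
  have F1eq: "F1 lam G1 F G4 = (\<lambda>x. f1a x * G1 x + 0 * G2 x + (f1b x * F x + f1c x * G4 x))" for G1 G2 F G4
    by (rule ext) (simp add: F1_def f1a_def f1b_def f1c_def iale add_divide_distrib algebra_simps)
  have F2eq: "F2 lam G1 G2 F G4 = (\<lambda>x. (cx kap * f1a x + - cx gh) * G1 x + (- (lam * cx (b x))) * G2 x +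
      ((cx kap * f1b x + lam * cx (kp2 x)) * F x + (cx kap * f1c x) * G4 x))" for G1 G2 F G4
    by (rule ext) (simp add: F2_def F1eq[of _ _ _ "\<lambda>_. 0"] algebra_simps)
  have bz: "bsmooth (\<lambda>_. 0 :: complex)" by (rule bsmooth_const)
  obtain M1 where M1a: "M1 \<ge> 0" and M1b: "\<And>G1 G2 F G4. G1 \<in> C k \<Longrightarrow> G2 \<in> C k \<Longrightarrow> F \<in> C k \<Longrightarrow> G4 \<in> C k \<Longrightarrow>
     (\<lambda>x. f1a x * G1 x + 0 * G2 x + (f1b x * F x + f1c x * G4 x)) \<in> C k \<and>
     N k (\<lambda>x. f1a x * G1 x + 0 * G2 x + (f1b x * F x + f1c x * G4 x)) \<le> M1 * (N k G1 + N k G2 + N k F + N k G4)"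
    using C_comb4[OF f1sm(1) bz f1sm(2,3), of k] by blast
  note M1 = M1a M1b[folded F1eq]
  have f2sm: "bsmooth (\<lambda>x. cx kap * f1a x + - cx gh)" "bsmooth (\<lambda>x. - (lam * cx (b x)))" "bsmooth (\<lambda>x. cx kap * f1b x + lam * cx (kp2 x))" "bsmooth (\<lambda>x. cx kap * f1c x)"
    by (intro sm f1sm)+
  obtain M2 where M2: "M2 \<ge> 0" "\<And>G1 G2 F G4. G1 \<in> C k \<Longrightarrow> G2 \<in> C k \<Longrightarrow> F \<in> C k \<Longrightarrow> G4 \<in> C k \<Longrightarrow>
     F2 lam G1 G2 F G4 \<in> C k \<and> N k (F2 lam G1 G2 F G4) \<le> M2 * (N k G1 + N k G2 + N k F + N k G4)"
    using C_comb4[OF f2sm, of k] unfolding F2eq by blast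
  define ps where "ps = (\<lambda>G4 U (x::real). (1 / lam) * G4 x + (- (1 / lam) * cx (deriv ph x)) * U x)"
  have pssm: "bsmooth (\<lambda>_. 1 / lam)" "bsmooth (\<lambda>x. - (1 / lam) * cx (deriv ph x))" by (intro sm)+
  obtain M3 where M3: "M3 \<ge> 0" "\<And>G4 U. G4 \<in> C (Suc k) \<Longrightarrow> U \<in> C (Suc k) \<Longrightarrow> ps G4 U \<in> C (Suc k) \<and> N (Suc k) (ps G4 U) \<le> M3 * (N (Suc k) G4 + N (Suc k) U)"
    using C_comb2[OF pssm, of "Suc k"] unfolding ps_def by blast
  \<comment> \<open>The relation \<open>PP lam h U F phi = P\<close> solved for \<open>h\<close>,
    which requires \<open>lam\<close> and \<open>abv\<close> to be nonzero.\<close>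
  define hs where "hs = (\<lambda>U P F phi (x::real). (- (1 / lam) * (iabv x * cx (rr x))) * U x + (- (1 / lam) * iabv x) * P x +
      ((- (iabv x * cx (b x)^3)) * F x + (- (iabv x * cx (b x)^3)) * phi x))"
  have hssm: "bsmooth (\<lambda>x. - (1 / lam) * (iabv x * cx (rr x)))" "bsmooth (\<lambda>x. - (1 / lam) * iabv x)" "bsmooth (\<lambda>x. - (iabv x * cx (b x)^3))"
    by (intro sm iabv_sm)+
  obtain M4 where M4: "M4 \<ge> 0" "\<And>U P F phi. U \<in> C (Suc k) \<Longrightarrow> P \<in> C (Suc k) \<Longrightarrow> F \<in> C (Suc k) \<Longrightarrow> phi \<in> C (Suc k) \<Longrightarrow> hs U P F phi \<in> C (Suc k) \<and>
      N (Suc k) (hs U P F phi) \<le> M4 * (N (Suc k) U + N (Suc k) P + N (Suc k) F + N (Suc k) phi)"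
    using C_comb4[OF hssm(1,2,3,3), of "Suc k"] unfolding hs_def by blast
  obtain M5 where M5: "M5 \<ge> 0" "\<And>f. f \<in> C (Suc k) \<Longrightarrow> (\<lambda>x. mi x * f x) \<in> C (Suc k) \<and> N (Suc k) (\<lambda>x. mi x * f x) \<le> M5 * N (Suc k) f"
    using C_mult_ex[OF mi_sm, of "Suc k"] by blast
  obtain K where K: "K \<ge> 0" "\<And>f1 f2 u p. f1 \<in> C k \<Longrightarrow> f2 \<in> C k \<Longrightarrow> S.weak_solves f1 f2 u p \<Longrightarrow>
     u \<in> C (Suc k) \<and> p \<in> C (Suc k) \<and> N (Suc k) u + N (Suc k) p \<le> K * (N k f1 + N k f2)"
    using S.weak_solution_regular[of k] by blast
  define c1 where "c1 = K * ((M1 + M2) * (3 + M5))"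
  define c2 where "c2 = M3 * (1 + c1)"
  define c3 where "c3 = M4 * (c1 + M5 + c2)"
  define KK where "KK = c3 + c1 + M5 + c2"
  show ?thesis
  proof (rule bounded_inverse_imp_resolvent[where K = KK])
    fix G W assume "G \<in> X_carrier (mk k)" "W \<in> D_carrier (mk k)" "state_eq (mk k) (shifted lam (LL k) W) G"
    moreover obtain h U F phi where Weq: "W = (h, U, F, phi)" by (cases W)
    moreover obtain G1 G2 G3 G4 where Geq: "G = (G1, G2, G3, G4)" by (cases G)
    ultimately have m: "h \<in> C (Suc k)" "U \<in> C (Suc k)" "F \<in> C (Suc k)" "phi \<in> C (Suc k)"
      and g: "G1 \<in> C k" "G2 \<in> C k" "G3 \<in> C (Suc k)" "G4 \<in> C (Suc k)"
      and s: "state_eq (mk k) (shifted lam (LL k) (h, U, F, phi)) (G1, G2, G3, G4)"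
      by (auto simp: X_carrier_iff D_carrier_iff)
    obtain hd1 Ud Fd pd where d: "DR h hd1" "DR U Ud" "DR F Fd" "DR phi pd" using m C_Suc by metis
    have E: "\<forall>\<^sub>F x in Fl. eqs lam h hd1 U Ud F Fd phi pd G1 G2 G3 G4 x" using s state_eq_iff[OF d] by blast
    define P where "P = PP lam h U F phi"
    define f1 where "f1 = F1 lam G1 F G4"
    define f2 where "f2 = F2 lam G1 G2 F G4"
    define X where "X = N k G1 + N k G2 + N (Suc k) G3 + N (Suc k) G4"
    note nn = N_nonneg[OF g(1)] N_nonneg[OF g(2)] N_nonneg[OF g(3)] N_nonneg[OF g(4)]
    have X0: "X \<ge> 0" using nn by (simp add: X_def)
    have "F \<simeq> (\<lambda>x. mi x * G3 x)" using E
    proof eventually_elim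
      case (elim x)
      then have "(lam + cx (dmp x)) * F x = G3 x" by (simp add: eqs_def)
      then show ?case using mi1[of x] by (metis mult.assoc mult.left_neutral)
    qed
    then have "N (Suc k) F = N (Suc k) (\<lambda>x. mi x * G3 x)"
      using C_cong[OF m(3) C_base[OF conjunct1[OF M5(2)[OF g(3)]]]] by simp
    also have "\<dots> \<le> M5 * X" 
      by (rule order_trans[OF conjunct2[OF M5(2)[OF g(3)]] mult_left_mono[OF _ M5(1)]]) (use nn in \<open>simp add: X_def\<close>)
    finally have NF: "N (Suc k) F \<le> M5 * X" .
    have f: "f1 \<in> C k" "f2 \<in> C k" "N k f1 \<le> M1 * (N k G1 + N k G2 + N k F + N k G4)" "N k f2 \<le> M2 * (N k G1 + N k G2 + N k F + N k G4)"
      using M1(2)[OF g(1,2) C_SucD[OF m(3)] C_SucD[OF g(4)]] M2(2)[OF g(1,2) C_SucD[OF m(3)] C_SucD[OF g(4)]] by (auto simp: f1_def f2_def)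
    have S3: "N k G1 + N k G2 + N k F + N k G4 \<le> (3 + M5) * X"
      using N_Suc_ge[OF m(3)] N_Suc_ge[OF g(4)] NF nn X0 by (simp add: distrib_right X_def)
    have Nf: "N k f1 + N k f2 \<le> (M1 + M2) * ((3 + M5) * X)"
      using f(3,4) mult_left_mono[OF S3 M1(1)] mult_left_mono[OF S3 M2(1)] by (simp add: distrib_right)
    have "S.weak_solves f1 f2 U P"
      unfolding S.weak_solves_def
    proof
      have P0: "P \<in> C 0" unfolding P_def using DR_PP[OF d] DR_base by blast
      have c: "(\<lambda>x. S.ial x * P x + f1 x) \<in> C 0"
        using C_add C_mult[OF P0 S.ial_smooth] C_base[OF f(1)] by blast
      show "DR U (\<lambda>x. S.ial x * P x + f1 x)"
      proof (rule DR_cong[OF d(2) C_base[OF m(2)] c])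
        show "Ud \<simeq> (\<lambda>x. S.ial x * P x + f1 x)" using E
          by eventually_elim (simp add: eqs_imp_U iale P_def f1_def)
      qed simp
      show "DR P (\<lambda>x. cx kap * (S.ial x * P x) + qq lam x * U x + f2 x)"
        unfolding P_def
      proof (rule DR_cong[OF DR_PP[OF d]])
        show "PP lam h U F phi \<in> C 0" using P0 by (simp add: P_def)
        show "(\<lambda>x. cx kap * (S.ial x * PP lam h U F phi x) + qq lam x * U x + f2 x) \<in> C 0"
          using C_mult[OF P0 S.ial_smooth] C_cmult C_mult[OF C_base[OF m(2)] qq_smooth] C_base[OF f(2)] C_add unfolding P_def by auto
        show "(\<lambda>x. - (lam * (cx (deriv abv x) * h x + cx (abv x) * hd1 x
     + (cx (3 * (b x)^2 * deriv b x) * (F x + phi x) + cx ((b x)^3) * (Fd x + pd x)))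
     + (cx (gh * deriv b x) * U x + cx (rr x) * Ud x))) \<simeq> (\<lambda>x. cx kap * (S.ial x * PP lam h U F phi x) + qq lam x * U x + f2 x)"
          using E by eventually_elim (simp only: eqs_imp_P iale f2_def)
      qed simp
    qed
    from K(2)[OF f(1,2) this] have UP: "U \<in> C (Suc k)" "P \<in> C (Suc k)" and NUP: "N (Suc k) U + N (Suc k) P \<le> c1 * X"
      using mult_left_mono[OF Nf K(1)] by (auto simp: c1_def mult.assoc)
    have NU: "N (Suc k) U \<le> c1 * X" using NUP N_nonneg[OF UP(2)] by linarith
    have "phi \<simeq> ps G4 U" using E
    proof eventually_elim
      case (elim x)
      then have "lam * phi x + cx (deriv ph x) * U x = G4 x" by (simp add: eqs_def)
      then show ?case using lam by (simp add: ps_def field_simps)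
    qed
    then have "N (Suc k) phi = N (Suc k) (ps G4 U)"
      using C_cong[OF m(4) C_base[OF conjunct1[OF M3(2)[OF g(4) UP(1)]]]] by simp
    also have "\<dots> \<le> M3 * (X + c1 * X)"
      by (rule order_trans[OF conjunct2[OF M3(2)[OF g(4) UP(1)]]]) (use NU nn M3(1) in \<open>auto simp: X_def intro!: mult_left_mono\<close>)
    finally have Np: "N (Suc k) phi \<le> c2 * X" by (simp add: c2_def algebra_simps)
    have "h = hs U P F phi"
    proof
      fix x
      have nz: "cx (abv x) \<noteq> 0" using abv_pos[of x] by simp
      have "hs U P F phi x = iabv x * (- (1 / lam) * (P x + cx (rr x) * U x) - cx (b x)^3 * (F x + phi x))" by (simp add: hs_def algebra_simps)
      also have "- (1 / lam) * (P x + cx (rr x) * U x) = QQ h F phi x" using lam by (simp add: P_def PP_def)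
      finally show "h x = hs U P F phi x" using nz by (simp add: QQ_def iabv_def)
    qed
    then have "N (Suc k) h \<le> M4 * (N (Suc k) U + N (Suc k) P + N (Suc k) F + N (Suc k) phi)"
      using M4(2)[OF UP m(3,4)] by simp
    also have "\<dots> \<le> M4 * (c1 * X + M5 * X + c2 * X)" using NUP NF Np M4(1) by (intro mult_left_mono) auto
    finally have Nh: "N (Suc k) h \<le> c3 * X" by (simp add: c3_def algebra_simps)
    have "X_norm (mk k) W = N k h + N k U + N (Suc k) F + N (Suc k) phi" by (simp add: Weq one_more)
    also have "\<dots> \<le> c3 * X + c1 * X + M5 * X + c2 * X"
      using Nh N_Suc_ge[OF m(1)] NU N_Suc_ge[OF m(2)] NF Np by (intro add_mono) auto
    also have "\<dots> = KK * X_norm (mk k) G" by (simp add: KK_def X_def Geq one_more algebra_simps)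
    finally show "X_norm (mk k) W \<le> KK * X_norm (mk k) G" .
  next
    fix G assume "G \<in> X_carrier (mk k)"
    moreover obtain G1 G2 G3 G4 where Geq: "G = (G1, G2, G3, G4)" by (cases G)
    ultimately have g: "G1 \<in> C k" "G2 \<in> C k" "G3 \<in> C (Suc k)" "G4 \<in> C (Suc k)"
      by (auto simp: X_carrier_iff)
    define F where "F = (\<lambda>x. mi x * G3 x)"
    have F: "F \<in> C (Suc k)" using M5(2)[OF g(3)] by (simp add: F_def)
    define f1 where "f1 = F1 lam G1 F G4"
    define f2 where "f2 = F2 lam G1 G2 F G4"
    have f: "f1 \<in> C k" "f2 \<in> C k"
      using M1(2)[OF g(1,2) C_SucD[OF F] C_SucD[OF g(4)]] M2(2)[OF g(1,2) C_SucD[OF F] C_SucD[OF g(4)]] by (auto simp: f1_def f2_def)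
    obtain U P where ws: "S.weak_solves f1 f2 U P"
      using S.weak_solution_exists C_base[OF f(1)] C_base[OF f(2)] by blast
    have UP: "U \<in> C (Suc k)" "P \<in> C (Suc k)" using K(2)[OF f ws] by auto
    define phi where "phi = ps G4 U"
    have phi: "phi \<in> C (Suc k)" using M3(2)[OF g(4) UP(1)] by (simp add: phi_def)
    define h where "h = hs U P F phi"
    have h: "h \<in> C (Suc k)" using M4(2)[OF UP F phi] by (simp add: h_def)
    obtain hd1 Fd pd where d: "DR h hd1" "DR F Fd" "DR phi pd" using h F phi C_Suc by metis
    define Ud where "Ud = (\<lambda>x. S.ial x * P x + f1 x)"
    have dU: "DR U Ud" and dP: "DR P (\<lambda>x. cx kap * (S.ial x * P x) + qq lam x * U x + f2 x)"
      using ws by (auto simp: S.weak_solves_def Ud_def)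
    have QPeq: "lam * QQ h F phi x = - (P x + cx (rr x) * U x)" for x
    proof -
      have nz: "cx (abv x) * iabv x = 1" using abv_pos[of x] by (simp add: iabv_def)
      have "QQ h F phi x = (cx (abv x) * iabv x) * (- (1 / lam) * (P x + cx (rr x) * U x) - cx (b x)^3 * (F x + phi x)) + cx ((b x)^3) * (F x + phi x)"
        by (simp add: QQ_def h_def hs_def algebra_simps)
      then have "QQ h F phi x = - (1 / lam) * (P x + cx (rr x) * U x)" unfolding nz by simp
      then show ?thesis using lam by simp
    qed
    have PPeq: "PP lam h U F phi = P" by (rule ext) (simp add: PP_def QPeq)
    \<comment> \<open>\<open>P\<close> has two derivatives, one computed from the formula for
      \<open>PP\<close> and one given by the weak system. Their equality \<open>A\<close> carries
      the second equation of \<open>eqs\<close>; the first one comes from the formula for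
      \<open>Ud\<close>.\<close>
    from DR_unique[OF DR_PP[OF d(1) dU d(2,3), of lam, unfolded PPeq] dP]
    have "\<forall>\<^sub>F x in Fl. eqs lam h hd1 U Ud F Fd phi pd G1 G2 G3 G4 x"
    proof (rule eventually_mono)
      fix x
      let ?V = "cx (3 * (b x)^2 * deriv b x) * (F x + phi x) + cx ((b x)^3) * (Fd x + pd x)"
      assume A: "- (lam * (cx (deriv abv x) * h x + cx (abv x) * hd1 x + ?V) + (cx (gh * deriv b x) * U x + cx (rr x) * Ud x)) =
         cx kap * (S.ial x * P x) + qq lam x * U x + f2 x"
      have E3: "(lam + cx (dmp x)) * F x = G3 x" using mi1[of x] by (metis F_def mult.assoc mult.commute mult.left_neutral)
      have E4: "lam * phi x + cx (deriv ph x) * U x = G4 x" using lam by (simp add: phi_def ps_def field_simps)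
      have al: "cx (al x) = cx (abv x) * cx (b x)" "cx (al x) \<noteq> 0" using al_pos[of x] by (auto simp: al_def abv_eq power2_eq_square)
      have rr: "cx (rr x) = cx gh * cx (b x) - cx kap" by (simp add: rr_def)
      have U1: "cx (abv x) * cx (b x) * Ud x = P x + (cx (abv x) * G1 x + cx (b x)^3 * (lam * F x + G4 x))"
        using al(2) unfolding al(1) by (simp add: Ud_def f1_def F1_def iale al(1) field_simps)
      have Qx: "lam * (cx (abv x) * h x + cx (b x)^3 * (F x + phi x)) = - (P x + (cx gh * cx (b x) - cx kap) * U x)"
        using QPeq[of x] by (simp add: QQ_def rr)
      have "cx (abv x) * (lam * h x + (cx (deriv b x) * U x + cx (b x) * Ud x)) = cx (abv x) * G1 x"
        using U1 Qx E4 profile_cx[of x] by algebra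
      then have E1: "lam * h x + (cx (deriv b x) * U x + cx (b x) * Ud x) = G1 x" using al by auto
      have f2x: "cx kap * (S.ial x * P x) + f2 x = cx kap * Ud x + (- (lam * (cx (b x) * G2 x)) + lam * cx (kp2 x) * F x - cx gh * G1 x)"
        by (simp add: f2_def F2_def Ud_def f1_def algebra_simps)
      \<comment> \<open>The system was obtained after multiplication by \<open>lam\<close>, so the
        second equation is recovered with this factor, which is then cancelled.\<close>
      have "lam * (lam * cx (b x) * U x + cx (abv x) * hd1 x - (cx gh - cx (deriv abv x)) * h x + cx (2 * Cf * c) * U x + ?V + cx (kp2 x) * F x) = lam * (cx (b x) * G2 x)"
      proof -
        define V where "V = ?V"
        have "- (lam * (cx (deriv abv x) * h x + cx (abv x) * hd1 x + V) + (cx gh * cx (deriv b x) * U x + (cx gh * cx (b x) - cx kap) * Ud x)) =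
         cx kap * Ud x + (- (lam * (cx (b x) * G2 x)) + lam * cx (kp2 x) * F x - cx gh * G1 x) + (lam^2 * cx (b x) + cx (2 * Cf * c) * lam) * U x"
          using A f2x unfolding V_def[symmetric] rr qq_def of_real_mult[of gh] by algebra
        then show ?thesis unfolding V_def[symmetric] using E1 by algebra
      qed
      then have E2: "lam * cx (b x) * U x + cx (abv x) * hd1 x - (cx gh - cx (deriv abv x)) * h x + cx (2 * Cf * c) * U x + ?V + cx (kp2 x) * F x = cx (b x) * G2 x"
        using lam by (metis mult_left_cancel)
      show "eqs lam h hd1 U Ud F Fd phi pd G1 G2 G3 G4 x"
        unfolding eqs_def using E1 E2 E3 E4 by (simp only: of_real_diff)
    qed simp
    then have "state_eq (mk k) (shifted lam (LL k) (h, U, F, phi)) G"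
      unfolding Geq state_eq_iff[OF d(1) dU d(2,3)] .
    then show "\<exists>W\<in>D_carrier (mk k). state_eq (mk k) (shifted lam (LL k) W) G"
      using h UP F phi by (intro bexI[of _ "(h, U, F, phi)"]) (auto simp: D_carrier_iff)
  qed
qed

end

section \<open>Unstable spectrum\<close>

lemma bsmooth_exp_imaginary:
  assumes "Re \<mu> = 0" shows "bsmooth (\<lambda>x. exp (\<mu> * complex_of_real x))"
proof (rule bsmoothI)
  fix k
  have D: "((\<lambda>x. cc * exp (\<mu> * complex_of_real x)) has_vector_derivative (cc * \<mu>) * exp (\<mu> * complex_of_real x)) (at x)" for cc x
  proof -
    have "((\<lambda>z. cc * exp (\<mu> * z)) has_field_derivative (cc * \<mu>) * exp (\<mu> * complex_of_real x)) (at (complex_of_real x))"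
      by (auto intro!: derivative_eq_intros)
    then show ?thesis by (rule has_vector_derivative_real_field)
  qed
  have n: "norm (exp (\<mu> * complex_of_real x)) = 1" for x using assms by simp
  have "dbound UNIV (norm cc * max 1 (norm \<mu>) ^ k) k (\<lambda>x. cc * exp (\<mu> * complex_of_real x))" for cc
  proof (induction k arbitrary: cc)
    case (Suc k)
    have "norm (cc * \<mu>) * max 1 (norm \<mu>) ^ k \<le> norm cc * max 1 (norm \<mu>) ^ Suc k"
      by (simp add: norm_mult mult.assoc mult_left_mono mult_right_mono)
    then have "dbound UNIV (norm cc * max 1 (norm \<mu>) ^ Suc k) k (\<lambda>x. (cc * \<mu>) * exp (\<mu> * complex_of_real x))"
      by (rule dbound_mono[OF Suc])
    moreover have "norm (cc * exp (\<mu> * complex_of_real x)) \<le> norm cc * max 1 (norm \<mu>) ^ Suc k" for x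
      using mult_left_mono[OF one_le_power[of "max 1 (norm \<mu>)" "Suc k"], of "norm cc"] by (simp only: norm_mult n) simp
    ultimately show ?case by (intro dbound_SucI[OF _ D]) auto
  qed (simp add: norm_mult assms)
  from this[of 1] show "\<exists>M. dbound UNIV M k (\<lambda>x. exp (\<mu> * complex_of_real x))" by (metis (no_types, lifting) mult_1 ext)
qed

lemma has_vector_derivative_zero_outside:
  fixes f :: "real \<Rightarrow> complex"
  assumes D: "\<And>x. (f has_vector_derivative f' x) (at x)" and z: "\<And>x. x \<notin> {a..b} \<Longrightarrow> f x = 0" and x: "x \<notin> {a..b}"
  shows "f' x = 0"
proof -
  have "((\<lambda>_. 0) has_vector_derivative 0) (at x)" by simp
  then have "(f has_vector_derivative 0) (at x)"
    by (rule has_vector_derivative_transform_within_open[where S = "- {a..b}"]) (use z x in auto)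
  then show ?thesis using D vector_derivative_unique_at by blast
qed

context deriv_scale
begin

lemma DR_csmooth:
  assumes f: "csmooth f" and supp: "\<forall>x. x \<notin> {a..b} \<longrightarrow> f x = 0" and D: "\<And>x. (f has_vector_derivative f' x) (at x)"
  shows "DR f f'" "csmooth f'" "\<forall>x. x \<notin> {a..b} \<longrightarrow> f' x = 0"
proof -
  have z: "f x = 0" if "x \<notin> {a..b}" for x using supp that by blast
  show sm: "csmooth f'" unfolding csmooth_def
    using f dbound_Suc_deriv[OF _ D] unfolding csmooth_def by blast
  have z': "f' x = 0" if "x \<notin> {a..b}" for x by (rule has_vector_derivative_zero_outside[OF D z that])
  then show "\<forall>x. x \<notin> {a..b} \<longrightarrow> f' x = 0" by blast
  have out: "x \<notin> {a..b}" if "\<bar>x\<bar> > max \<bar>a\<bar> \<bar>b\<bar>" for x using that by auto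
  show "DR f f'"
    by (rule DR_classical[OF D csmooth_continuous[OF sm] base_compact[OF f z[OF out]] base_compact[OF sm z'[OF out]]])
qed

lemma C_csmooth:
  assumes "csmooth f" "\<forall>x. x \<notin> {a..b} \<longrightarrow> f x = 0" shows "f \<in> C k"
  using assms
proof (induction k arbitrary: f)
  case 0
  have out: "x \<notin> {a..b}" if "\<bar>x\<bar> > max \<bar>a\<bar> \<bar>b\<bar>" for x using that by auto
  show ?case by (rule base_compact[OF 0(1) 0(2)[rule_format, OF out]])
next
  case (Suc k)
  obtain f' where f': "\<And>x. (f has_vector_derivative f' x) (at x)" using csmooth_has_deriv[OF Suc.prems(1)] by blast
  note h = DR_csmooth[OF Suc.prems f']
  show ?case unfolding C_Suc
  proof (intro bexI)
    show "DR f f'" by (rule h(1))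
    show "f' \<in> C k" by (rule Suc.IH[OF h(2,3)])
  qed
qed

lemma N_window_le:
  assumes "csmooth f" "\<forall>x. x \<notin> {a..a + real n} \<longrightarrow> f x = 0" "dbound {a..a + real n} M k f" "n \<ge> 1" "M \<ge> 0"
  shows "N k f \<le> (real k + 1) * M * nu n"
  using assms(1-3)
proof (induction k arbitrary: f)
  case 0
  have "N 0 f \<le> M * nu n"
  proof (rule base_norm_le[OF C_csmooth[OF 0(1,2)] assms(4) _ assms(5)])
    show "norm (f x) \<le> M * indicator {a..a + real n} x" for x
      using 0 dbound_le[OF 0(3), of x] by (cases "x \<in> {a..a + real n}") auto
  qed
  then show ?case by simp
next
  case (Suc k)
  obtain f' where f': "\<And>x. (f has_vector_derivative f' x) (at x)" using csmooth_has_deriv[OF Suc.prems(1)] by blast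
  note h = DR_csmooth[OF Suc.prems(1,2) f']
  have "N 0 f \<le> M * nu n"
  proof (rule base_norm_le[OF C_csmooth[OF Suc.prems(1,2)] assms(4) _ assms(5)])
    show "norm (f x) \<le> M * indicator {a..a + real n} x" for x
      using Suc.prems(2) dbound_le[OF Suc.prems(3), of x] by (cases "x \<in> {a..a + real n}") auto
  qed
  moreover have "N k f' \<le> (real k + 1) * M * nu n"
    by (rule Suc.IH[OF h(2,3) dbound_Suc_deriv[OF Suc.prems(3) f']])
  moreover have "N (Suc k) f = N 0 f + N k f'"
    by (rule norm_Suc[OF C_csmooth[OF Suc.prems(1,2)] h(1) C_csmooth[OF h(2,3)]])
  ultimately show ?case by (simp add: algebra_simps)
qed

end

lemma bump_lower:
  assumes "1/4 \<le> y" "y \<le> 1/2" shows "bump 0 0 1 y \<ge> exp (-6)"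
proof -
  have "1 / y \<le> 4" "1 / (1 - y) \<le> 2" using assms by (auto simp: field_simps)
  then have "exp (-4) \<le> exp (- (1 / y))" "exp (-2) \<le> exp (- (1 / (1 - y)))" by auto
  then have "exp (-4) * exp (-2) \<le> exp (- (1 / y)) * exp (- (1 / (1 - y :: real)))" by (intro mult_mono) auto
  then show ?thesis using assms by (simp add: bump_def flat_def flip: exp_add)
qed

context rg_scale
begin

text \<open>At \<open>\<lambda> = - dmp 0\<close> the third equation forces a first order pole of \<open>\<Phi>\<close> at 0.\<close>

lemma not_resolvent_of_Ct_gt:
  assumes "Ct > Cf"
  shows "\<exists>lam. Re lam > 0 \<and> \<not> in_resolvent_set (mk k) (LL k) lam"
proof -
  define lam where "lam = - cx (dmp 0)"
  have lpos: "Re lam > 0"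
    using assms b_pos[of 0] ph_pos[of 0] c by (simp add: lam_def dmp_def zero_less_mult_iff divide_neg_pos mult_neg_pos)
  have "\<not> in_resolvent_set (mk k) (LL k) lam"
  proof
    assume R: "in_resolvent_set (mk k) (LL k) lam"
    define G3 where "G3 = (\<lambda>x. cx (bump 0 (-1) 1 x))"
    have sm: "csmooth G3" unfolding G3_def csmooth_def
    proof
      fix k show "dbound {} 0 k (\<lambda>x. cx (bump 0 (-1) 1 x))"
        by (rule dbound_of_real) (use csmooth_bump csmooth_def in blast)
    qed
    have z: "\<forall>x. x \<notin> {-1..1} \<longrightarrow> G3 x = 0"
    proof (intro allI impI)
      fix x :: real assume "x \<notin> {-1..1}"
      then show "G3 x = 0" using bump_bounds(1,3)[of 0 "-1" 1 x] by (auto simp: G3_def)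
    qed
    have "((\<lambda>_. 0), (\<lambda>_. 0), G3, (\<lambda>_. 0)) \<in> X_carrier (mk k)" using C_csmooth[OF sm z] C_zero by (simp add: X_carrier_iff)
    then obtain W where W: "W \<in> D_carrier (mk k)" "state_eq (mk k) (shifted lam (LL k) W) ((\<lambda>_. 0), (\<lambda>_. 0), G3, (\<lambda>_. 0))"
      using R unfolding in_resolvent_set_def by blast
    obtain h U F phi where Weq: "W = (h, U, F, phi)" by (cases W)
    have m: "h \<in> C (Suc k)" "U \<in> C (Suc k)" "F \<in> C (Suc k)" "phi \<in> C (Suc k)" using W(1) by (auto simp: Weq D_carrier_iff)
    obtain hd1 Ud Fd pd where d: "DR h hd1" "DR U Ud" "DR F Fd" "DR phi pd" using m C_Suc by metis
    have E: "\<forall>\<^sub>F x in Fl. (lam + cx (dmp x)) * F x = G3 x"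
      using W(2) unfolding Weq state_eq_iff[OF d] eqs_def by (auto elim: eventually_mono)
    obtain d' where d': "\<And>x. (dmp has_vector_derivative d' x) (at x)" "bsmooth d'" using bsmooth_has_deriv[OF dmp_smooth] by blast
    obtain L where L: "L \<ge> 0" "\<And>x. norm (d' x) \<le> L" using bsmooth_bounded[OF d'(2)] by blast
    have lip: "\<bar>dmp x - dmp 0\<bar> \<le> L * \<bar>x\<bar>" for x
      using field_differentiable_bound[of UNIV dmp d' L 0 x] d'(1) L(2)
      by (simp add: has_real_derivative_iff_has_vector_derivative)
    show False
    proof (rule base_no_pole[OF C_base[OF m(3)], where c = "exp (-4) / (L + 1)" and r = "1/2" and ?x0.0 = 0])
      \<comment> \<open>The bump is at least \<open>exp (-4)\<close> for
        \<open>\<bar>x\<bar> < 1/2\<close>, and \<open>L\<close> is a Lipschitz constant of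
        \<open>dmp\<close>, so that \<open>lam + dmp\<close> vanishes at least linearly at 0. Using
        \<open>L + 1\<close> avoids a division by 0 if \<open>dmp\<close> is constant.\<close>
      show "\<forall>\<^sub>F x in Fl. \<bar>x - 0\<bar> < 1/2 \<longrightarrow> exp (-4) / (L + 1) \<le> \<bar>x - 0\<bar> * norm (F x)"
        using E
      proof (eventually_elim, intro impI)
        fix x assume e: "(lam + cx (dmp x)) * F x = G3 x" and x: "\<bar>x - 0\<bar> < 1/2"
        have "1 / (x + 1) \<le> 2" "1 / (1 - x) \<le> 2" using x by (auto simp: field_simps)
        then have "exp (-2) \<le> exp (- (1 / (x + 1)))" "exp (-2) \<le> exp (- (1 / (1 - x)))" by auto
        then have "exp (-2) * exp (-2) \<le> exp (- (1 / (x + 1))) * exp (- (1 / (1 - x)))" by (intro mult_mono) auto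
        then have "exp (-4) \<le> exp (- (1 / (x + 1))) * exp (- (1 / (1 - x)))" by (simp flip: exp_add)
        moreover have "bump 0 (-1) 1 x = exp (- (1 / (x + 1))) * exp (- (1 / (1 - x)))"
        proof -
          have "x + 1 > 0" "1 - x > 0" using x by auto
          then show ?thesis by (simp add: bump_def flat_def)
        qed
        ultimately have "exp (-4) \<le> bump 0 (-1) 1 x" by (simp only:)
        then have "exp (-4) \<le> norm (G3 x)" unfolding G3_def norm_of_real by (rule order_trans[OF _ abs_ge_self])
        also have "\<dots> = norm (lam + cx (dmp x)) * norm (F x)" unfolding e[symmetric] norm_mult ..
        also have "norm (lam + cx (dmp x)) = \<bar>dmp x - dmp 0\<bar>"
          unfolding lam_def by (metis add.commute norm_of_real of_real_diff uminus_add_conv_diff)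
        also have "\<bar>dmp x - dmp 0\<bar> * norm (F x) \<le> (L + 1) * (\<bar>x\<bar> * norm (F x))"
          using mult_right_mono[OF order_trans[OF lip[of x] mult_right_mono[of L "L + 1" "\<bar>x\<bar>"]], of "norm (F x)"] by (simp add: mult.assoc)
        finally show "exp (-4) / (L + 1) \<le> \<bar>x - 0\<bar> * norm (F x)" using L(1) by (simp add: divide_le_eq mult.commute)
      qed
    qed (use L(1) in auto)
  qed
  then show ?thesis using lpos by blast
qed

text \<open>The sets \<open>T R\<close> are half lines that shrink towards one end as
  \<open>R\<close> grows, so both ends can be treated by one argument.\<close>

definition tail_null :: "(real \<Rightarrow> real set) \<Rightarrow> (real \<Rightarrow> complex) \<Rightarrow> bool" where
  "tail_null T f \<longleftrightarrow> (\<forall>k. \<forall>\<epsilon>>0. \<exists>R. dbound (T R) \<epsilon> k f)"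

lemma tail_null_add:
  assumes anti: "\<And>R S. R \<le> S \<Longrightarrow> T S \<subseteq> T R" and "tail_null T f" "tail_null T g"
  shows "tail_null T (\<lambda>x. f x + g x)"
  unfolding tail_null_def
proof (intro allI impI)
  fix k and \<epsilon> :: real assume "\<epsilon> > 0"
  then obtain R S where "dbound (T R) (\<epsilon>/2) k f" "dbound (T S) (\<epsilon>/2) k g"
    using assms(2,3) unfolding tail_null_def by (meson half_gt_zero)
  then have "dbound (T (max R S)) (\<epsilon>/2) k f" "dbound (T (max R S)) (\<epsilon>/2) k g"
    using anti[of R "max R S"] anti[of S "max R S"] by (auto intro: dbound_subset)
  from dbound_add[OF this] show "\<exists>R. dbound (T R) \<epsilon> k (\<lambda>x. f x + g x)" by auto
qed

lemma tail_null_mult: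
  assumes m: "bsmooth m" and f: "tail_null T f" shows "tail_null T (\<lambda>x. m x * f x)"
  unfolding tail_null_def
proof (intro allI impI)
  fix k and \<epsilon> :: real assume \<epsilon>: "\<epsilon> > 0"
  obtain M where M: "M \<ge> 0" "dbound UNIV M k m" using m unfolding bsmooth_def by blast
  define \<delta> where "\<delta> = \<epsilon> / (2^k * (M + 1))"
  have "\<delta> > 0" using \<epsilon> M(1) by (simp add: \<delta>_def)
  then obtain R where R: "dbound (T R) \<delta> k f" using f unfolding tail_null_def by blast
  have "dbound (T R) (2^k * M * \<delta>) k (\<lambda>x. m x * f x)"
    by (rule dbound_mult[OF dbound_subset[OF M(2)] R]) (use M(1) \<open>\<delta> > 0\<close> in auto)
  moreover have "2^k * M * \<delta> = \<epsilon> * (M / (M + 1))" by (simp add: \<delta>_def)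
  then have "2^k * M * \<delta> \<le> \<epsilon>" using \<epsilon> M(1) mult_left_le[of "M / (M + 1)" \<epsilon>] by simp
  ultimately show "\<exists>R. dbound (T R) \<epsilon> k (\<lambda>x. m x * f x)" using dbound_mono by blast
qed

lemma tail_null_deriv:
  assumes "tail_null T f" "\<And>x. (f has_vector_derivative f' x) (at x)" shows "tail_null T f'"
  unfolding tail_null_def using assms(1) dbound_Suc_deriv[OF _ assms(2)] unfolding tail_null_def by meson

text \<open>A bump function times \<open>exp (\<mu> x)\<close>, stretched over a long window near infinity, is an approximate
  eigenfunction. Solving the first and last equations for \<open>h\<close> and \<open>\<phi>\<close> exactly keeps the
  whole error \<open>g\<close> in the second one.\<close>

lemma weyl_identity:
  fixes U U1 U2 :: "real \<Rightarrow> complex"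
  assumes lam: "lam \<noteq> 0"
    and h: "h = (\<lambda>x. - (1 / lam) * (cx (deriv b x) * U x + cx (b x) * U1 x))"
    and phi: "phi = (\<lambda>x. - (1 / lam) * (cx (deriv ph x) * U x))"
    and DU: "\<And>x. (U has_vector_derivative U1 x) (at x)" "\<And>x. (U1 has_vector_derivative U2 x) (at x)"
    and Dh: "\<And>x. (h has_vector_derivative hd1 x) (at x)" and Dphi: "\<And>x. (phi has_vector_derivative pd x) (at x)"
    and g: "g = (\<lambda>x. - (1 / (lam * cx (b x))) * (cx (al x) * U2 x + (cx (deriv al x) - cx kap) * U1 x - qq lam x * U x))"
  shows "eqs lam h hd1 U U1 (\<lambda>_. 0) (\<lambda>_. 0) phi pd (\<lambda>_. 0) g (\<lambda>_. 0) (\<lambda>_. 0) x"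
proof -
  have E1: "lam * h x + (cx (deriv b x) * U x + cx (b x) * U1 x) = 0" using lam by (simp add: h)
  have E4: "lam * phi x + cx (deriv ph x) * U x = 0" using lam by (simp add: phi)
  have cxD: "((\<lambda>x. cx (m x)) has_vector_derivative cx (deriv m x)) (at x)" if "bsmooth m" for m x
    using bsmooth_deriv(1)[OF that] by (auto intro!: has_vector_derivative_of_real simp: has_real_derivative_iff_has_vector_derivative)
  have D3: "((\<lambda>x. cx ((b x)^3)) has_vector_derivative cx (3 * (b x)^2 * deriv b x)) (at x)" for x
  proof -
    have "((\<lambda>x. (b x)^3) has_real_derivative 3 * (b x)^2 * deriv b x) (at x)" using Db[of x] by (auto intro!: derivative_eq_intros)
    then show ?thesis by (rule has_vector_derivative_of_real)
  qed
  have Q: "lam * (cx (abv y) * h y + cx ((b y)^3) * phi y) = - (cx (al y) * U1 y + cx (rr y) * U y)" for y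
  proof -
    have "lam * (cx (abv y) * h y + cx (b y)^3 * phi y) =
        - (cx (abv y) * (cx (deriv b y) * U y + cx (b y) * U1 y) + cx (b y)^3 * (cx (deriv ph y) * U y))"
      using lam by (simp add: h phi field_simps)
    also have "\<dots> = - (cx (abv y) * cx (b y) * U1 y + (cx gh * cx (b y) - cx kap) * U y)"
      using profile_cx[of y] by algebra
    finally show ?thesis by (simp add: al_def abv_eq rr_def power2_eq_square)
  qed
  have "((\<lambda>y. lam * (cx (abv y) * h y + cx ((b y)^3) * phi y)) has_vector_derivative
      lam * ((cx (abv x) * hd1 x + cx (deriv abv x) * h x) + (cx ((b x)^3) * pd x + cx (3 * (b x)^2 * deriv b x) * phi x))) (at x)"
    by (intro has_vector_derivative_mult_right has_vector_derivative_add has_vector_derivative_mult cxD abv_sm Dh D3 Dphi)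
  moreover have "((\<lambda>y. - (cx (al y) * U1 y + cx (rr y) * U y)) has_vector_derivative
      - ((cx (al x) * U2 x + cx (deriv al x) * U1 x) + (cx (rr x) * U1 x + cx (deriv rr x) * U x))) (at x)"
    by (intro has_vector_derivative_minus has_vector_derivative_add has_vector_derivative_mult cxD al_smooth rr_sm DU)
  ultimately have QD: "lam * ((cx (abv x) * hd1 x + cx (deriv abv x) * h x) + (cx ((b x)^3) * pd x + cx (3 * (b x)^2 * deriv b x) * phi x)) =
      - ((cx (al x) * U2 x + cx (deriv al x) * U1 x) + (cx (rr x) * U1 x + cx (deriv rr x) * U x))"
    unfolding Q using vector_derivative_unique_at by blast
  have drr: "deriv rr x = gh * deriv b x"
    by (rule DERIV_imp_deriv) (unfold rr_def[abs_def], use Db[of x] in \<open>auto intro!: derivative_eq_intros\<close>)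
  have rr: "cx (rr x) = cx gh * cx (b x) - cx kap" "cx (deriv rr x) = cx gh * cx (deriv b x)" by (simp_all add: rr_def drr)
  define B where "B = cx (b x) * g x"
  have Bx: "lam * B = - (cx (al x) * U2 x + (cx (deriv al x) - cx kap) * U1 x - qq lam x * U x)"
    using lam b_pos[of x] by (simp add: B_def g)
  define V where "V = cx ((b x)^3) * pd x + cx (3 * (b x)^2 * deriv b x) * phi x"
  have "lam * (lam * cx (b x) * U x + cx (abv x) * hd1 x - (cx gh - cx (deriv abv x)) * h x + cx (2 * Cf * c) * U x + V) = lam * B"
    unfolding Bx qq_def using QD E1 unfolding V_def[symmetric] rr by algebra
  then have "lam * cx (b x) * U x + cx (abv x) * hd1 x - (cx gh - cx (deriv abv x)) * h x + cx (2 * Cf * c) * U x + V = B"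
    using lam by (metis mult_left_cancel)
  then show ?thesis
    unfolding eqs_def using E1 E4 by (simp only: of_real_diff V_def B_def) (simp add: algebra_simps)
qed

text \<open>\<open>disp\<close> says that \<open>exp (\<mu> x)\<close> solves the limiting
  homogeneous equation for \<open>U\<close>. Within \<open>T R\<close> there is room for windows of
  every length, on which the coefficients are as close to their limits as desired. So the data
  become small compared to \<open>U\<close>, and no resolvent bound \<open>K\<close> can
  hold.\<close>

lemma weyl_not_resolvent:
  fixes T :: "real \<Rightarrow> real set"
  assumes lam: "lam \<noteq> 0" and mu: "Re \<mu> = 0"
    and disp: "cx ((gp + 3 * h0 * ph0) * h0^2) * \<mu>^2 - cx kap * \<mu> - (lam^2 * cx h0 + cx (2 * Cf * c) * lam) = 0"
    and anti: "\<And>R S. R \<le> S \<Longrightarrow> T S \<subseteq> T R" and win: "\<And>R n. \<exists>a. {a..a + real n} \<subseteq> T R"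
    and tb: "\<And>k \<epsilon>. \<epsilon> > 0 \<Longrightarrow> \<exists>R. dbound (T R) \<epsilon> k (\<lambda>x. b x - h0)"
    and tp: "\<And>k \<epsilon>. \<epsilon> > 0 \<Longrightarrow> \<exists>R. dbound (T R) \<epsilon> k (\<lambda>x. ph x - ph0)"
  shows "\<not> in_resolvent_set (mk k) (LL k) lam"
proof
  assume "in_resolvent_set (mk k) (LL k) lam"
  then obtain K where K: "\<And>G W. G \<in> X_carrier (mk k) \<Longrightarrow> W \<in> D_carrier (mk k) \<Longrightarrow> state_eq (mk k) (shifted lam (LL k) W) G \<Longrightarrow>
       X_norm (mk k) W \<le> K * X_norm (mk k) G" unfolding in_resolvent_set_def by blast
  define al0 where "al0 = (gp + 3 * h0 * ph0) * h0^2"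
  have nb: "tail_null T (\<lambda>x. cx (b x - h0))" and np: "tail_null T (\<lambda>x. cx (ph x - ph0))"
    unfolding tail_null_def using tb tp dbound_of_real by blast+
  note sm = bsmooth_mult bsmooth_add bsmooth_minus bsmooth_const bsmooth_of_real bsmooth_power b_smooth ph_smooth
  have ale: "cx (al x - al0) = (cx gp * (cx (b x) + cx h0) + cx 3 * (cx (b x)^2 + cx (b x) * cx h0 + cx h0^2) * cx (ph x)) * cx (b x - h0)
       + cx (3 * h0^3) * cx (ph x - ph0)" for x
  proof -
    have "al x - al0 = (gp * (b x + h0) + 3 * ((b x)^2 + b x * h0 + h0^2) * ph x) * (b x - h0) + 3 * h0^3 * (ph x - ph0)"
      unfolding al_def al0_def av_def by algebra
    from arg_cong[OF this, of cx] show ?thesis by simp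
  qed
  have na: "tail_null T (\<lambda>x. cx (al x - al0))"
    unfolding ale by (intro tail_null_add[OF anti] tail_null_mult[OF _ nb] tail_null_mult[OF _ np] sm)
  have Dal: "((\<lambda>x. cx (al x - al0)) has_vector_derivative cx (deriv al x)) (at x)" for x
  proof -
    have "((\<lambda>x. al x - al0) has_real_derivative deriv al x) (at x)"
      using bsmooth_deriv(1)[OF al_smooth, of x] by (auto intro!: derivative_eq_intros)
    then show ?thesis by (rule has_vector_derivative_of_real)
  qed
  note nda = tail_null_deriv[OF na Dal]
  \<comment> \<open>The symbol of the second order operator at \<open>\<mu>\<close>; it is small
    near the end in question, together with its derivatives, because its limit is the left side of
    \<open>disp\<close>. The coefficient \<open>z1\<close> accompanies the first derivative of the
    envelope.\<close>
  define z0 where "z0 = (\<lambda>x. cx (al x) * \<mu>^2 + (cx (deriv al x) - cx kap) * \<mu> - qq lam x)"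
  have z0e: "z0 x = \<mu>^2 * cx (al x - al0) + (\<mu> * cx (deriv al x) + (- (lam^2)) * cx (b x - h0))" for x
    using disp unfolding z0_def qq_def al0_def[symmetric] of_real_diff by algebra
  have nz: "tail_null T z0"
    unfolding z0e[abs_def] by (intro tail_null_add[OF anti] tail_null_mult[OF _ na] tail_null_mult[OF _ nda] tail_null_mult[OF _ nb] sm)
  define z1 where "z1 = (\<lambda>x. cx 2 * cx (al x) * \<mu> + (cx (deriv al x) + - cx kap))"
  have z1s: "bsmooth z1" unfolding z1_def by (intro sm al_smooth bsmooth_deriv(2)[OF al_smooth])
  have als: "bsmooth (\<lambda>x. cx (al x))" by (intro sm al_smooth)
  define mm where "mm = (\<lambda>x. - (1 / lam) * (1 / cx (b x)) * exp (\<mu> * cx x))"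
  have mms: "bsmooth mm"
    unfolding mm_def
    by (intro sm bsmooth_exp_imaginary[OF mu] bsmooth_divide[where \<delta> = bm] bm) (use b_ge in \<open>auto intro: order_trans[OF _ abs_ge_self]\<close>)
  define X0 where "X0 = (\<lambda>x. cx (bump 0 0 1 x))"
  have X0c: "csmooth X0" unfolding X0_def csmooth_def
  proof
    fix k show "dbound {} 0 k (\<lambda>x. cx (bump 0 0 1 x))" by (rule dbound_of_real) (use csmooth_bump csmooth_def in blast)
  qed
  have X0z: "X0 x = 0" if "x \<notin> {0..1}" for x using bump_bounds(1,3)[of 0 0 1 x] that by (auto simp: X0_def)
  have "bsmooth X0" 
  proof (rule csmooth_bounded_support_bsmooth[OF X0c])
    fix x :: real assume "\<bar>x\<bar> > 1"
    then show "X0 x = 0" by (intro X0z) auto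
  qed
  then obtain X1 where X1: "\<And>x. (X0 has_vector_derivative X1 x) (at x)" "bsmooth X1" using bsmooth_has_deriv by blast
  then obtain X2 where X2: "\<And>x. (X1 has_vector_derivative X2 x) (at x)" "bsmooth X2" using bsmooth_has_deriv by blast
  obtain B0 where B0: "B0 \<ge> 0" "dbound UNIV B0 k X0" using \<open>bsmooth X0\<close> unfolding bsmooth_def by blast
  obtain B1 where B1: "B1 \<ge> 0" "dbound UNIV B1 k X1" using X1(2) unfolding bsmooth_def by blast
  obtain B2 where B2: "B2 \<ge> 0" "dbound UNIV B2 k X2" using X2(2) unfolding bsmooth_def by blast
  obtain Bz where Bz: "Bz \<ge> 0" "dbound UNIV Bz k z1" using z1s unfolding bsmooth_def by blast
  obtain Ba where Ba: "Ba \<ge> 0" "dbound UNIV Ba k (\<lambda>x. cx (al x))" using als unfolding bsmooth_def by blast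
  obtain Bm where Bm: "Bm \<ge> 0" "dbound UNIV Bm k mm" using mms unfolding bsmooth_def by blast
  \<comment> \<open>The three parts of the error: the symbol, of size \<open>\<delta>\<close>, and
    the terms in which the envelope is differentiated once or twice, of sizes \<open>1 / n\<close>
    and \<open>1 / n^2\<close>. The powers of 2 come from \<open>dbound_mult\<close>.\<close>
  define bound where "bound = (\<lambda>\<delta> n. 2^k * Bm * (2^k * \<delta> * B0 + (2^k * (2^k * Bz * \<bar>1 / real n\<bar>) * B1 + 2^k * (2^k * Ba * \<bar>(1 / real n)^2\<bar>) * B2)))"
  have key: "exp (-6) / 4 \<le> \<bar>K\<bar> * ((real k + 1) * bound \<delta> n)" if \<delta>: "\<delta> > 0" and n: "n \<ge> 1" for \<delta> n
  proof -
    obtain R where R: "dbound (T R) \<delta> k z0" using nz \<delta> unfolding tail_null_def by blast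
    obtain a where a: "{a..a + real n} \<subseteq> T R" using win by blast
    define I where "I = {a..a + real n}"
    define s where "s = 1 / real n"
    have s: "0 < s" "s \<le> 1" "\<bar>s\<bar> \<le> 1" using n by (auto simp: s_def)
    define Y where "Y = (\<lambda>(X :: real \<Rightarrow> complex) x. X (s * x + (- s * a)))"
    have Yin: "s * x + (- s * a) \<in> {0..1} \<longleftrightarrow> x \<in> I" for x
      using n by (auto simp: s_def I_def field_simps)
    have Yd: "dbound UNIV B k X \<Longrightarrow> dbound I B k (Y X)" for B and X :: "real \<Rightarrow> complex"
      unfolding Y_def by (rule dbound_subset[OF dbound_affine[OF _ s(3)]]) auto
    have DY: "(Y X has_vector_derivative cx s * Y X' x) (at x)" if "\<And>x. (X has_vector_derivative X' x) (at x)" for X X' x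
      using has_vector_derivative_affine[OF that, of s "- s * a"] by (simp add: Y_def[abs_def] scaleR_conv_of_real)
    define e where "e = (\<lambda>x. exp (\<mu> * cx x))"
    have De: "(e has_vector_derivative \<mu> * e x) (at x)" for x
    proof -
      have "((\<lambda>z. exp (\<mu> * z)) has_field_derivative \<mu> * exp (\<mu> * cx x)) (at (cx x))" by (auto intro!: derivative_eq_intros)
      then show ?thesis unfolding e_def by (rule has_vector_derivative_real_field)
    qed
    define U where "U = (\<lambda>x. e x * Y X0 x)"
    define U1 where "U1 = (\<lambda>x. e x * (cx s * Y X1 x) + \<mu> * e x * Y X0 x)"
    define U2 where "U2 = (\<lambda>x. (e x * (cx s * (cx s * Y X2 x)) + \<mu> * e x * (cx s * Y X1 x)) + (\<mu> * e x * (cx s * Y X1 x) + \<mu> * (\<mu> * e x) * Y X0 x))"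
    have DU: "(U has_vector_derivative U1 x) (at x)" "(U1 has_vector_derivative U2 x) (at x)" for x
      unfolding U_def U1_def U2_def
      by (intro has_vector_derivative_add has_vector_derivative_mult has_vector_derivative_mult_right De DY X1 X2)+
    have Uz: "\<forall>x. x \<notin> I \<longrightarrow> U x = 0"
    proof (intro allI impI)
      fix x assume "x \<notin> I"
      then have "s * x + (- s * a) \<notin> {0..1}" using Yin[of x] by blast
      from X0z[OF this] show "U x = 0" by (simp only: U_def Y_def mult_zero_right)
    qed
    have es: "csmooth e" unfolding e_def by (rule bsmooth_csmooth[OF bsmooth_exp_imaginary[OF mu]])
    have Us: "csmooth U" unfolding U_def Y_def by (intro csmooth_mult es csmooth_affine X0c)
    note U1h = DR_csmooth[OF Us Uz[unfolded I_def] DU(1)]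
    note U2h = DR_csmooth[OF U1h(2,3) DU(2)]
    define h where "h = (\<lambda>x. - (1 / lam) * (cx (deriv b x) * U x + cx (b x) * U1 x))"
    define phi where "phi = (\<lambda>x. - (1 / lam) * (cx (deriv ph x) * U x))"
    have hs: "csmooth h" "csmooth phi" unfolding h_def phi_def
      by (intro csmooth_mult csmooth_add csmooth_const Us U1h(2) bsmooth_csmooth[OF bsmooth_of_real] b_smooth bsmooth_deriv(2) ph_smooth)+
    have hz: "\<forall>x. x \<notin> {a..a + real n} \<longrightarrow> h x = 0" "\<forall>x. x \<notin> {a..a + real n} \<longrightarrow> phi x = 0"
      using Uz U1h(3) by (auto simp: h_def phi_def I_def)
    obtain hd1 where hd1: "\<And>x. (h has_vector_derivative hd1 x) (at x)" using csmooth_has_deriv[OF hs(1)] by blast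
    obtain pd where pd: "\<And>x. (phi has_vector_derivative pd x) (at x)" using csmooth_has_deriv[OF hs(2)] by blast
    define g where "g = (\<lambda>x. - (1 / (lam * cx (b x))) * (cx (al x) * U2 x + (cx (deriv al x) - cx kap) * U1 x - qq lam x * U x))"
    have ge: "g = (\<lambda>x. mm x * (z0 x * Y X0 x + ((z1 x * cx s) * Y X1 x + (cx (al x) * cx (s^2)) * Y X2 x)))"
    proof
      fix x
      have "cx (al x) * U2 x + (cx (deriv al x) - cx kap) * U1 x - qq lam x * U x =
         e x * (z0 x * Y X0 x + ((z1 x * cx s) * Y X1 x + (cx (al x) * cx (s^2)) * Y X2 x))"
        unfolding U_def U1_def U2_def z0_def z1_def of_real_power of_real_numeral by algebra
      then show "g x = mm x * (z0 x * Y X0 x + ((z1 x * cx s) * Y X1 x + (cx (al x) * cx (s^2)) * Y X2 x))"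
        by (simp add: g_def mm_def e_def)
    qed
    have gd: "dbound I (bound \<delta> n) k g"
      unfolding ge bound_def s_def[symmetric]
      by (intro dbound_mult dbound_add Yd B0 B1 B2 dbound_subset[OF Bm(2)] dbound_subset[OF Bz(2)] dbound_subset[OF Ba(2)] dbound_subset[OF R]
          dbound_const subset_UNIV a[folded I_def] Bm(1) Bz(1) Ba(1) B0(1) B1(1) B2(1) mult_nonneg_nonneg add_nonneg_nonneg less_imp_le[OF \<delta>] zero_le_power abs_ge_zero)
        (auto simp: norm_power)
    have b0: "bound \<delta> n \<ge> 0" unfolding bound_def using B0 B1 B2 Bz Ba Bm \<delta> by (intro mult_nonneg_nonneg add_nonneg_nonneg) auto
    have gs: "csmooth g" unfolding g_def
    proof -
      have inv: "bsmooth (\<lambda>x. 1 / cx (b x))"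
        by (rule bsmooth_divide[OF _ _ bm]) (use b_ge in \<open>auto intro!: sm intro: order_trans[OF _ abs_ge_self]\<close>)
      have "csmooth (\<lambda>x. (- (1 / lam) * (1 / cx (b x))) * (cx (al x) * U2 x + (cx (deriv al x) + - cx kap) * U1 x + (- 1) * (qq lam x * U x)))"
        by (intro csmooth_mult csmooth_add csmooth_const Us U1h(2) U2h(2) bsmooth_csmooth[OF inv] bsmooth_csmooth[OF qq_smooth] bsmooth_csmooth[OF als]
            bsmooth_csmooth[OF bsmooth_of_real[OF bsmooth_deriv(2)[OF al_smooth]]])
      then show "csmooth (\<lambda>x. - (1 / (lam * cx (b x))) * (cx (al x) * U2 x + (cx (deriv al x) - cx kap) * U1 x - qq lam x * U x))" by simp
    qed
    have gz: "\<forall>x. x \<notin> {a..a + real n} \<longrightarrow> g x = 0"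
      using Uz U1h(3) U2h(3) by (auto simp: g_def I_def)
    have d: "DR h hd1" "DR U U1" "DR (\<lambda>_. 0) (\<lambda>_. 0)" "DR phi pd"
      using DR_csmooth(1)[OF hs(1) hz(1) hd1] DR_csmooth(1)[OF hs(2) hz(2) pd] U1h(1)
        DR_csmooth(1)[OF csmooth_const[of 0], of 0 0 "\<lambda>_. 0"] by auto
    have "state_eq (mk k) (shifted lam (LL k) (h, U, (\<lambda>_. 0), phi)) ((\<lambda>_. 0), g, (\<lambda>_. 0), (\<lambda>_. 0))"
      unfolding state_eq_iff[OF d]
      by (intro always_eventually allI weyl_identity[OF lam h_def phi_def DU hd1 pd g_def])
    then have "X_norm (mk k) (h, U, (\<lambda>_. 0), phi) \<le> K * X_norm (mk k) ((\<lambda>_. 0), g, (\<lambda>_. 0), (\<lambda>_. 0))"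
      by (intro K) (use C_csmooth[OF hs(1) hz(1)] C_csmooth[OF hs(2) hz(2)] C_csmooth[OF Us Uz[unfolded I_def]] C_csmooth[OF gs gz] C_zero in
        \<open>auto simp: X_carrier_iff D_carrier_iff\<close>)
    then have "N k h + N k U + N (Suc k) phi \<le> K * N k g" using C_zero by (simp add: one_more)
    then have "N k U \<le> K * N k g"
      using N_nonneg[OF C_csmooth[OF hs(1) hz(1)], of k] N_nonneg[OF C_csmooth[OF hs(2) hz(2)], of "Suc k"] by linarith
    also have "\<dots> \<le> \<bar>K\<bar> * N k g" using N_nonneg[OF C_csmooth[OF gs gz], of k] by (intro mult_right_mono) auto
    also have "\<dots> \<le> \<bar>K\<bar> * ((real k + 1) * bound \<delta> n * nu n)"
      by (intro mult_left_mono N_window_le[OF gs gz gd[unfolded I_def] n b0]) auto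
    finally have up: "N k U \<le> \<bar>K\<bar> * ((real k + 1) * bound \<delta> n * nu n)" .
    \<comment> \<open>On the second quarter of the window the bump is at least
      \<open>exp (-6)\<close>, and the oscillating factor has modulus 1 as \<open>\<mu>\<close> is
      imaginary. Both this lower bound and the upper bound for the data scale like
      \<open>nu n\<close>, which therefore cancels.\<close>
    have "exp (-6) * nu n / 4 \<le> N 0 U"
    proof (rule base_norm_ge[OF C_csmooth[OF Us Uz[unfolded I_def]] n])
      fix x assume x: "x \<in> {a + real n / 4..a + real n / 2}"
      have "1/4 \<le> s * x + (- s * a)" "s * x + (- s * a) \<le> 1/2" using x n by (auto simp: s_def field_simps)
      from bump_lower[OF this] show "exp (-6) \<le> norm (U x)"
        using mu by (simp add: U_def Y_def X0_def e_def norm_mult)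
    qed auto
    also have "\<dots> \<le> N k U" by (rule N_ge_base[OF C_csmooth[OF Us Uz[unfolded I_def]]])
    finally have "exp (-6) / 4 * nu n \<le> \<bar>K\<bar> * ((real k + 1) * bound \<delta> n) * nu n" using up by (simp add: mult.assoc)
    then show ?thesis using nu_pos[OF n] by (simp add: mult_le_cancel_right)
  qed
  have i: "(\<lambda>n. 1 / real (Suc n)) \<longlonglongrightarrow> 0" using LIMSEQ_inverse_real_of_nat by (simp add: inverse_eq_divide)
  \<comment> \<open>The tolerance for the symbol and the slope of the envelope tend to 0
    simultaneously.\<close>
  have "(\<lambda>n. \<bar>K\<bar> * ((real k + 1) * bound (1 / real (Suc n)) (Suc n))) \<longlonglongrightarrow>
     \<bar>K\<bar> * ((real k + 1) * (2^k * Bm * (2^k * 0 * B0 + (2^k * (2^k * Bz * \<bar>0\<bar>) * B1 + 2^k * (2^k * Ba * \<bar>0^2\<bar>) * B2))))"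
    unfolding bound_def by (intro tendsto_intros i)
  then have "(\<lambda>n. \<bar>K\<bar> * ((real k + 1) * bound (1 / real (Suc n)) (Suc n))) \<longlonglongrightarrow> 0" by simp
  moreover have "exp (-6) / 4 \<le> \<bar>K\<bar> * ((real k + 1) * bound (1 / real (Suc n)) (Suc n))" for n by (rule key) auto
  ultimately have "exp (-6) / 4 \<le> (0::real)" by (intro LIMSEQ_le_const[of _ 0]) auto
  then show False by simp
qed

end

section \<open>Sobolev spaces and spaces of uniformly continuous functions\<close>

lemma uniformly_continuous_of_bounded_deriv:
  fixes f :: "real \<Rightarrow> complex"
  assumes "\<And>x. (f has_vector_derivative f' x) (at x)" "bounded (range f')"
  shows "uniformly_continuous_on UNIV f"
proof -
  obtain B where B: "B > 0" "\<And>x. norm (f' x) \<le> B" using assms(2) unfolding bounded_pos by auto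
  have lip: "norm (f x - f y) \<le> B * norm (x - y)" for x y
  proof (rule differentiable_bound[of UNIV f "\<lambda>x h. h *\<^sub>R f' x"])
    show "(f has_derivative (\<lambda>h. h *\<^sub>R f' x)) (at x within UNIV)" for x
      using assms(1) by (simp add: has_vector_derivative_def)
    show "onorm (\<lambda>h. h *\<^sub>R f' x) \<le> B" for x
      by (rule onorm_le) (use mult_left_mono[OF B(2) abs_ge_zero] in \<open>simp add: mult.commute\<close>)
  qed auto
  show ?thesis
    unfolding uniformly_continuous_on_def
  proof (intro allI impI)
    fix e :: real assume "e > 0"
    then have "dist (f x') (f x) < e" if "dist x' x < e / B" for x x'
      using lip[of x' x] that B(1) by (simp add: dist_norm field_simps)
    then show "\<exists>d>0. \<forall>x\<in>UNIV. \<forall>x'\<in>UNIV. dist x' x < d \<longrightarrow> dist (f x') (f x) < e"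
      using \<open>e > 0\<close> B(1) by (intro exI[of _ "e / B"]) auto
  qed
qed

lemma locally_integrable_measurable:
  assumes "locally_integrable f" shows "f \<in> borel_measurable borel"
proof (rule borel_measurable_LIMSEQ_metric)
  show "(\<lambda>x. indicator {- real n..real n} x *\<^sub>R f x) \<in> borel_measurable borel" for n
    using borel_measurable_integrable[of lborel "\<lambda>x. indicator {- real n..real n} x *\<^sub>R f x"] assms
    unfolding locally_integrable_def set_integrable_def by simp
  fix x :: real
  have "\<forall>\<^sub>F n in sequentially. indicator {- real n..real n} x *\<^sub>R f x = f x"
  proof -
    obtain m where "\<bar>x\<bar> \<le> real m" using real_arch_simple by blast
    then have "indicator {- real n..real n} x *\<^sub>R f x = f x" if "m \<le> n" for n using that by (auto simp: indicator_def)
    then show ?thesis by (rule eventually_mono[OF eventually_ge_at_top])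
  qed
  then show "(\<lambda>n. indicator {- real n..real n} x *\<^sub>R f x) \<longlonglongrightarrow> f x" by (rule tendsto_eventually)
qed

lemma has_weak_deriv_cong:
  assumes "has_weak_deriv 1 f g" "locally_integrable f'" "locally_integrable g'"
    and "AE x in lborel. f x = f' x" "AE x in lborel. g x = g' x"
  shows "has_weak_deriv 1 f' g'"
proof -
  have li: "locally_integrable f" "locally_integrable g" using assms(1) unfolding has_weak_deriv_def by auto
  have cong: "(LINT x|lborel. complex_of_real (\<eta> x) * u x) = (LINT x|lborel. complex_of_real (\<eta> x) * v x)"
    if "test_function \<eta>" "locally_integrable u" "locally_integrable v" "AE x in lborel. u x = v x" for \<eta> u v
  proof (rule integral_cong_AE)
    show "AE x in lborel. complex_of_real (\<eta> x) * u x = complex_of_real (\<eta> x) * v x" using that(4) by eventually_elim simp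
  qed (intro borel_measurable_integrable integrable_test_mult that)+
  show ?thesis
    unfolding has_weak_deriv_1
  proof (intro conjI assms allI impI)
    fix \<eta> \<eta>' assume \<eta>: "test_function \<eta>" and D: "\<forall>x. (\<eta> has_real_derivative \<eta>' x) (at x)"
    have "(LINT x|lborel. complex_of_real (\<eta>' x) * f x) = - (LINT x|lborel. complex_of_real (\<eta> x) * g x)"
      using assms(1) \<eta> D unfolding has_weak_deriv_1 by blast
    then show "(LINT x|lborel. complex_of_real (\<eta>' x) * f' x) = - (LINT x|lborel. complex_of_real (\<eta> x) * g' x)"
      using cong[OF test_function_deriv[OF \<eta> D[rule_format]] li(1) assms(2,4)] cong[OF \<eta> li(2) assms(3,5)] by simp
  qed
qed

section \<open>Sobolev spaces as a scale\<close>

context fixes p :: real assumes p: "p \<ge> 1"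
begin

lemma in_Lp_locally: "in_Lp p f \<Longrightarrow> locally_integrable f"
  using exp_integrable_locally[OF in_Lp_imp_exp_integrable[OF _ p]] .

lemma Sobolev_0: "f \<in> space_carrier (Sobolev 0 p) \<longleftrightarrow> in_Lp p f"
  using has_weak_deriv_0 in_Lp_locally by auto

lemma Sobolev_norm_0: "in_Lp p f \<Longrightarrow> space_norm (Sobolev 0 p) f = Lp_norm p f"
proof -
  assume f: "in_Lp p f"
  then have w: "has_weak_deriv 0 f f" using has_weak_deriv_0 in_Lp_locally by blast
  then have "has_weak_deriv 0 f (weak_deriv 0 f)" unfolding weak_deriv_def by (rule someI[of "has_weak_deriv 0 f"])
  then have "weak_deriv 0 f \<in> borel_measurable borel" unfolding has_weak_deriv_def using locally_integrable_measurable by blast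
  then show ?thesis using Lp_norm_cong[OF _ in_Lp_measurable[OF f] weak_deriv_AE[OF w]] by simp
qed

lemma Sobolev_Suc:
  "space_carrier (Sobolev (Suc k) p) = {f. in_Lp p f \<and> (\<exists>g\<in>space_carrier (Sobolev k p). has_weak_deriv 1 f g)}"
proof (intro set_eqI iffI; clarsimp)
  fix f assume f: "in_Lp p f" and ex: "\<forall>j\<le>Suc k. \<exists>g. in_Lp p g \<and> has_weak_deriv j f g"
  obtain g where g: "in_Lp p g" "has_weak_deriv 1 f g" using ex[rule_format, of 1] by auto
  have "\<exists>h. in_Lp p h \<and> has_weak_deriv j g h" if "j \<le> k" for j
    using ex[rule_format, of "Suc j"] that has_weak_deriv_Suc[OF g(2)] by auto
  then show "\<exists>g. in_Lp p g \<and> (\<forall>j\<le>k. \<exists>ga. in_Lp p ga \<and> has_weak_deriv j g ga) \<and> has_weak_deriv (Suc 0) f g"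
    using g by auto
next
  fix f g j assume f: "in_Lp p f" and g: "in_Lp p g" "\<forall>j\<le>k. \<exists>ga. in_Lp p ga \<and> has_weak_deriv j g ga" "has_weak_deriv (Suc 0) f g"
    and j: "j \<le> Suc k"
  show "\<exists>g. in_Lp p g \<and> has_weak_deriv j f g"
  proof (cases j)
    case 0 then show ?thesis using f has_weak_deriv_0 in_Lp_locally by blast
  next
    case (Suc i) then show ?thesis using g j has_weak_deriv_Suc[of f g i] by auto
  qed
qed

lemma weak_deriv_measurable: "has_weak_deriv j f g \<Longrightarrow> weak_deriv j f \<in> borel_measurable borel"
proof -
  assume "has_weak_deriv j f g"
  then have "has_weak_deriv j f (weak_deriv j f)" unfolding weak_deriv_def by (rule someI[of "has_weak_deriv j f"])
  then show ?thesis unfolding has_weak_deriv_def using locally_integrable_measurable by blast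
qed

lemma Sobolev_norm_Suc:
  assumes "f \<in> space_carrier (Sobolev (Suc k) p)" "has_weak_deriv 1 f g" "g \<in> space_carrier (Sobolev k p)"
  shows "space_norm (Sobolev (Suc k) p) f = space_norm (Sobolev 0 p) f + space_norm (Sobolev k p) g"
proof -
  have "Lp_norm p (weak_deriv (Suc j) f) = Lp_norm p (weak_deriv j g)" if j: "j \<le> k" for j
  proof -
    obtain h where h: "has_weak_deriv j g h" using assms(3) j unfolding space_carrier.simps mem_Collect_eq by blast
    then have h': "has_weak_deriv (Suc j) f h" using has_weak_deriv_Suc[OF assms(2)] by blast
    have "AE x in lborel. weak_deriv (Suc j) f x = weak_deriv j g x"
      using weak_deriv_AE[OF h] weak_deriv_AE[OF h'] by eventually_elim simp
    then show ?thesis by (rule Lp_norm_cong[OF weak_deriv_measurable[OF h'] weak_deriv_measurable[OF h]])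
  qed
  then have "(\<Sum>j\<le>k. Lp_norm p (weak_deriv (Suc j) f)) = (\<Sum>j\<le>k. Lp_norm p (weak_deriv j g))" by (intro sum.cong) auto
  then show ?thesis by (simp add: sum.atMost_Suc_shift del: sum.atMost_Suc)
qed

lemma in_Lp_compact:
  assumes "csmooth f" "\<And>x. \<bar>x\<bar> > R \<Longrightarrow> f x = 0" shows "in_Lp p f"
proof -
  obtain M where M: "M \<ge> 0" "\<And>x. norm (f x) \<le> M" using bsmooth_bounded[OF csmooth_bounded_support_bsmooth[OF assms]] by blast
  have m: "f \<in> borel_measurable borel" by (rule borel_measurable_continuous_onI[OF csmooth_continuous[OF assms(1)]])
  have "integrable lborel (\<lambda>x. norm (f x) powr p)"
  proof (rule Bochner_Integration.integrable_bound)
    show "integrable lborel (\<lambda>x. M powr p * indicator {- R..R} x)"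
      by (intro integrable_mult_right integrable_real_indicator) (auto simp: emeasure_lborel_Icc_eq)
    show "AE x in lborel. norm (norm (f x) powr p) \<le> norm (M powr p * indicat_real {- R..R} x)"
    proof (intro AE_I2)
      fix x show "norm (norm (f x) powr p) \<le> norm (M powr p * indicat_real {- R..R} x)"
      proof (cases "\<bar>x\<bar> > R")
        case False
        then have "x \<in> {- R..R}" by auto
        then show ?thesis using powr_mono2[of p "norm (f x)" M] M(2)[of x] p by simp
      qed (use assms(2) in simp)
    qed
    show "(\<lambda>x. norm (f x) powr p) \<in> borel_measurable lborel" using m by measurable
  qed
  then show ?thesis using m by (simp add: in_Lp_def)
qed

lemma Lp_norm_window_le:
  assumes f: "in_Lp p f" "n \<ge> 1" "\<And>x. norm (f x) \<le> M * indicator {a..a + real n} x" "M \<ge> 0"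
  shows "Lp_norm p f \<le> M * real n powr (1 / p)"
proof -
  have "(LINT x|lborel. norm (f x) powr p) \<le> (LINT x|lborel. M powr p * indicator {a..a + real n} x)"
  proof (rule integral_mono)
    show "integrable lborel (\<lambda>x. norm (f x) powr p)" using f(1) by (simp add: in_Lp_def)
    show "integrable lborel (\<lambda>x. M powr p * indicat_real {a..a + real n} x)" by (intro integrable_mult_right) auto
    fix x show "norm (f x) powr p \<le> M powr p * indicator {a..a + real n} x"
      using f(3)[of x] powr_mono2[of p "norm (f x)" M] p by (cases "x \<in> {a..a + real n}") auto
  qed
  also have "\<dots> = M powr p * real n" by simp
  finally show ?thesis unfolding Lp_norm_def using p f(4) by (intro powr_le_of_le_mult) auto
qed

lemma Lp_norm_window_ge:
  assumes f: "in_Lp p f" "n \<ge> 1" "\<And>x. x \<in> {a + real n / 4..a + real n / 2} \<Longrightarrow> c \<le> norm (f x)" "c \<ge> 0"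
  shows "c * real n powr (1 / p) / 4 \<le> Lp_norm p f"
proof -
  have "(LINT x|lborel. c powr p * indicator {a + real n / 4..a + real n / 2} x) \<le> (LINT x|lborel. norm (f x) powr p)"
  proof (rule integral_mono)
    show "integrable lborel (\<lambda>x. norm (f x) powr p)" using f(1) by (simp add: in_Lp_def)
    show "integrable lborel (\<lambda>x. c powr p * indicat_real {a + real n / 4..a + real n / 2} x)" by (intro integrable_mult_right) auto
    fix x show "c powr p * indicator {a + real n / 4..a + real n / 2} x \<le> norm (f x) powr p"
      using f(3)[of x] powr_mono2[of p c "norm (f x)"] p f(4) by (cases "x \<in> {a + real n / 4..a + real n / 2}") auto
  qed
  also have "(LINT x|lborel. c powr p * indicator {a + real n / 4..a + real n / 2} x) = c powr p * (real n / 4)" using f(2) by simp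
  finally have "(c powr p * (real n / 4)) powr (1 / p) \<le> Lp_norm p f"
    unfolding Lp_norm_def using p by (intro powr_mono2) auto
  moreover have "(c powr p * (real n / 4)) powr (1 / p) = c * real n powr (1 / p) * (1/4) powr (1 / p)"
    using p f(4) by (simp add: powr_mult powr_powr powr_divide)
  moreover have "(1/4) powr (1 / p) \<ge> (1/4::real) powr 1" using p by (intro powr_mono') auto
  then have "c * real n powr (1 / p) * (1/4) \<le> c * real n powr (1 / p) * (1/4) powr (1 / p)"
    using f(4) by (intro mult_left_mono) auto
  ultimately show ?thesis by simp
qed

text \<open>Functions in a Lebesgue space are locally integrable, whereas
  \<open>1 / \<bar>x - x0\<bar>\<close> has a logarithmically divergent integral.\<close>

lemma in_Lp_no_pole:
  assumes f: "in_Lp p f" and c: "c > 0" and r: "r > 0"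
    and ae: "AE x in lborel. \<bar>x - x0\<bar> < r \<longrightarrow> c \<le> \<bar>x - x0\<bar> * norm (f x)"
  shows False
proof -
  define A where "A = (LINT x|lborel. indicator {x0..x0 + r/2} x *\<^sub>R norm (f x))"
  have iA: "integrable lborel (\<lambda>x. indicator {x0..x0 + r/2} x *\<^sub>R norm (f x))"
    using in_Lp_locally[OF f] integrable_norm[of lborel "\<lambda>x. indicator {x0..x0 + r/2} x *\<^sub>R f x"]
    unfolding locally_integrable_def set_integrable_def by simp
  have A0: "A \<ge> 0" unfolding A_def by (intro Bochner_Integration.integral_nonneg) auto
  \<comment> \<open>Chosen so that the integral of \<open>c / (x - x0)\<close> between the distances
    \<open>\<delta>\<close> and \<open>r/2\<close> is exactly \<open>A + 1\<close>, one more than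
    the integral of the modulus of \<open>f\<close> allows.\<close>
  define \<delta> where "\<delta> = r/2 * exp (- ((A + 1) / c))"
  have \<delta>: "0 < \<delta>" "\<delta> \<le> r/2" using r c A0 by (auto simp: \<delta>_def)
  let ?g = "\<lambda>x. c / (x - x0)"
  have cg: "continuous_on {x0 + \<delta>..x0 + r/2} ?g" using \<delta> by (auto intro!: continuous_intros)
  have "(LINT x|lborel. indicator {x0 + \<delta>..x0 + r/2} x *\<^sub>R ?g x) = c * ln (x0 + r/2 - x0) - c * ln (x0 + \<delta> - x0)"
  proof (rule integral_FTC_atLeastAtMost[OF _ _ cg])
    fix x assume x: "x0 + \<delta> \<le> x"
    have "((\<lambda>x. c * ln (x - x0)) has_real_derivative ?g x) (at x within {x0 + \<delta>..x0 + r/2})"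
      using x \<delta>(1) by (auto intro!: derivative_eq_intros)
    then show "((\<lambda>x. c * ln (x - x0)) has_vector_derivative ?g x) (at x within {x0 + \<delta>..x0 + r/2})"
      by (simp add: has_real_derivative_iff_has_vector_derivative)
  qed (use \<delta> in auto)
  also have "\<dots> = A + 1"
  proof -
    have "ln \<delta> = ln (r/2) - (A + 1) / c" using r by (simp only: \<delta>_def ln_mult) (simp add: ln_mult)
    then show ?thesis using c by (simp add: right_diff_distrib)
  qed
  finally have "A + 1 = (LINT x|lborel. indicator {x0 + \<delta>..x0 + r/2} x *\<^sub>R ?g x)" by simp
  also have "\<dots> \<le> A"
    unfolding A_def
  proof (rule integral_mono_AE[OF _ iA])
    show "integrable lborel (\<lambda>x. indicat_real {x0 + \<delta>..x0 + r/2} x *\<^sub>R ?g x)"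
      using borel_integrable_atLeastAtMost'[OF cg] by (simp add: set_integrable_def)
    show "AE x in lborel. indicat_real {x0 + \<delta>..x0 + r/2} x *\<^sub>R ?g x \<le> indicat_real {x0..x0 + r/2} x *\<^sub>R norm (f x)"
      using ae
    proof eventually_elim
      case (elim x)
      show ?case
      proof (cases "x \<in> {x0 + \<delta>..x0 + r/2}")
        case True
        then have "0 < x - x0" "\<bar>x - x0\<bar> < r" using \<delta> r by auto
        then show ?thesis using True elim \<delta>(1) by (auto simp: field_simps)
      qed simp
    qed
  qed
  finally show False by simp
qed

text \<open>The size \<open>real n powr (1 / p)\<close> is the norm of the indicator of an interval
  of length \<open>n\<close>. A derivative in the sense of the scale requires both functions to be
  in the Lebesgue space.\<close>

lemma Sobolev_scale:
  "deriv_scale (\<lambda>k. Sobolev k p) (\<lambda>f g. in_Lp p f \<and> in_Lp p g \<and> has_weak_deriv 1 f g) (ae_filter lborel) (\<lambda>n. real n powr (1 / p))"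
proof
  show "one_more_deriv (Sobolev k p) = Sobolev (Suc k) p" for k by simp
  show "space_eq (Sobolev k p) f g \<longleftrightarrow> (AE x in lborel. f x = g x)" for k f g by simp
  have sub: "f \<in> space_carrier (Sobolev k p) \<Longrightarrow> in_Lp p f" for f k by simp
  show "space_carrier (Sobolev (Suc k) p) = {f \<in> space_carrier (Sobolev 0 p). \<exists>g\<in>space_carrier (Sobolev k p). in_Lp p f \<and> in_Lp p g \<and> has_weak_deriv 1 f g}" for k
    unfolding Sobolev_Suc using sub Sobolev_0 by blast
  show "f \<in> space_carrier (Sobolev (Suc k) p) \<Longrightarrow> in_Lp p f \<and> in_Lp p g \<and> has_weak_deriv 1 f g \<Longrightarrow> g \<in> space_carrier (Sobolev k p) \<Longrightarrow>
      space_norm (Sobolev (Suc k) p) f = space_norm (Sobolev 0 p) f + space_norm (Sobolev k p) g" for f g k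
    using Sobolev_norm_Suc by blast
  show "in_Lp p f \<and> in_Lp p g \<and> has_weak_deriv 1 f g \<Longrightarrow> AE x in lborel. space_deriv (Sobolev k p) f x = g x" for f g k
    using weak_deriv_AE[of 1 f g] by simp
  show "in_Lp p f \<and> in_Lp p g \<and> has_weak_deriv 1 f g \<Longrightarrow> f \<in> space_carrier (Sobolev 0 p) \<and> g \<in> space_carrier (Sobolev 0 p)" for f g
    using Sobolev_0 by blast
  show "f \<in> space_carrier (Sobolev 0 p) \<Longrightarrow> g \<in> space_carrier (Sobolev 0 p) \<Longrightarrow> (\<lambda>x. f x + g x) \<in> space_carrier (Sobolev 0 p) \<and>
      space_norm (Sobolev 0 p) (\<lambda>x. f x + g x) \<le> 4 * (space_norm (Sobolev 0 p) f + space_norm (Sobolev 0 p) g)" for f g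
    unfolding Sobolev_0 using in_Lp_add[OF _ _ p] Sobolev_norm_0 by metis
  show mult: "(\<lambda>x. m x * f x) \<in> space_carrier (Sobolev 0 p) \<and> space_norm (Sobolev 0 p) (\<lambda>x. m x * f x) \<le> M * space_norm (Sobolev 0 p) f"
    if "f \<in> space_carrier (Sobolev 0 p)" "bsmooth m" "\<And>x. norm (m x) \<le> M" for f m M
  proof -
    have f: "in_Lp p f" using that(1) Sobolev_0 by blast
    have "(\<lambda>x. m x * f x) \<in> borel_measurable borel"
      by (intro borel_measurable_times borel_measurable_continuous_onI[OF csmooth_continuous[OF bsmooth_csmooth[OF that(2)]]] in_Lp_measurable[OF f])
    from in_Lp_dominated[OF this f p, of M] have h: "in_Lp p (\<lambda>x. m x * f x) \<and> Lp_norm p (\<lambda>x. m x * f x) \<le> M * Lp_norm p f"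
      using order_trans[OF norm_ge_zero that(3)] that(3) by (simp add: norm_mult mult_right_mono)
    then show ?thesis unfolding Sobolev_0 using Sobolev_norm_0[OF f] Sobolev_norm_0 by simp
  qed
  show "f \<in> space_carrier (Sobolev 0 p) \<Longrightarrow> 0 \<le> space_norm (Sobolev 0 p) f" for f by (simp add: Lp_norm_nonneg)
  show "f \<in> space_carrier (Sobolev 0 p) \<Longrightarrow> space_norm (Sobolev 0 p) f = 0 \<Longrightarrow> AE x in lborel. f x = 0" for f
    unfolding Sobolev_0 using Lp_norm_eq_0 Sobolev_norm_0 by metis
  show "f \<in> space_carrier (Sobolev 0 p) \<Longrightarrow> g \<in> space_carrier (Sobolev 0 p) \<Longrightarrow> AE x in lborel. f x = g x \<Longrightarrow>
      space_norm (Sobolev 0 p) f = space_norm (Sobolev 0 p) g" for f g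
    unfolding Sobolev_0 using Lp_norm_cong[OF in_Lp_measurable in_Lp_measurable] Sobolev_norm_0 by metis
  have madd: "in_Lp p f \<Longrightarrow> in_Lp p g \<Longrightarrow> in_Lp p (\<lambda>x. f x + g x)" for f g using in_Lp_add[OF _ _ p] by blast
  have mm: "in_Lp p f \<Longrightarrow> bsmooth m \<Longrightarrow> in_Lp p (\<lambda>x. m x * f x)" for f m
    using mult bsmooth_bounded Sobolev_0 by metis
  show "in_Lp p f \<and> in_Lp p g \<and> has_weak_deriv 1 f g \<Longrightarrow> in_Lp p f' \<and> in_Lp p g' \<and> has_weak_deriv 1 f' g' \<Longrightarrow>
      in_Lp p (\<lambda>x. f x + f' x) \<and> in_Lp p (\<lambda>x. g x + g' x) \<and> has_weak_deriv 1 (\<lambda>x. f x + f' x) (\<lambda>x. g x + g' x)" for f g f' g'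
    using madd has_weak_deriv_add by blast
  show "in_Lp p (\<lambda>x. m x * f x) \<and> in_Lp p (\<lambda>x. m' x * f x + m x * g x) \<and> has_weak_deriv 1 (\<lambda>x. m x * f x) (\<lambda>x. m' x * f x + m x * g x)"
    if "in_Lp p f \<and> in_Lp p g \<and> has_weak_deriv 1 f g" "bsmooth m" "\<And>x. (m has_vector_derivative m' x) (at x)" for f g m m'
  proof -
    have "bsmooth m'" unfolding bsmooth_def using dbound_Suc_deriv[OF _ that(3)] that(2) unfolding bsmooth_def by meson
    then show ?thesis using that mm madd has_weak_deriv_mult[OF _ bsmooth_csmooth[OF that(2)] that(3)] by blast
  qed
  show "in_Lp p f \<and> in_Lp p g \<and> has_weak_deriv 1 f g \<Longrightarrow> f' \<in> space_carrier (Sobolev 0 p) \<Longrightarrow> g' \<in> space_carrier (Sobolev 0 p) \<Longrightarrow>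
      AE x in lborel. f x = f' x \<Longrightarrow> AE x in lborel. g x = g' x \<Longrightarrow> in_Lp p f' \<and> in_Lp p g' \<and> has_weak_deriv 1 f' g'" for f g f' g'
    unfolding Sobolev_0 using has_weak_deriv_cong in_Lp_locally by blast
  show "in_Lp p f \<and> in_Lp p g \<and> has_weak_deriv 1 f g \<Longrightarrow> in_Lp p f' \<and> in_Lp p g' \<and> has_weak_deriv 1 f' g' \<Longrightarrow>
      AE x in lborel. f x = f' x \<Longrightarrow> AE x in lborel. g x = g' x" for f g f' g'
    using has_weak_deriv_unique by blast
  show "in_Lp p f \<and> in_Lp p f' \<and> has_weak_deriv 1 f f'" if "\<And>x. (f has_vector_derivative f' x) (at x)" "continuous_on UNIV f'"
     "f \<in> space_carrier (Sobolev 0 p)" "f' \<in> space_carrier (Sobolev 0 p)" for f f'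
    using that has_weak_deriv_classical[OF that(1,2)] Sobolev_0 by blast
  have ei: "f \<in> space_carrier (Sobolev 0 p) \<Longrightarrow> exp_integrable f" for f
    unfolding Sobolev_0 using in_Lp_imp_exp_integrable p by blast
  then show "f \<in> space_carrier (Sobolev 0 p) \<Longrightarrow> exp_integrable f" for f .
  show "bounded (range (Jop f))" if "f \<in> space_carrier (Sobolev 0 p)" for f
  proof -
    have "norm (Jop f x) \<le> 2 / 1 + (LINT y|lborel. norm (f y) powr p)" for x
      using Jop_norm_le[OF ei[OF that], of x] in_Lp_exp_integrable(3)[of p f 1 x] that p unfolding Sobolev_0 by simp
    then show ?thesis unfolding bounded_iff by blast
  qed
  have Jk: "in_Lp p (Jop f) \<and> Lp_norm p (Jop f) \<le> 2 * Lp_norm p f" if "in_Lp p f" for f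
  proof -
    have e: "exp_integrable f" using in_Lp_imp_exp_integrable[OF that p] .
    have "in_Lp p (Jop f) \<and> Lp_norm p (Jop f) \<le> 1 * (2 / 1) * Lp_norm p f"
      by (rule in_Lp_exp_kernel[OF that p]) (use Jop_norm_le[OF e] borel_measurable_continuous_onI[OF Jop_continuous[OF e]] in auto)
    then show ?thesis by simp
  qed
  show "(in_Lp p (Jop f) \<and> in_Lp p (\<lambda>x. f x - Jop f x) \<and> has_weak_deriv 1 (Jop f) (\<lambda>x. f x - Jop f x)) \<and>
      space_norm (Sobolev 0 p) (Jop f) \<le> 2 * space_norm (Sobolev 0 p) f" if "f \<in> space_carrier (Sobolev 0 p)" for f
  proof -
    have f: "in_Lp p f" using that Sobolev_0 by blast
    have "in_Lp p (\<lambda>x. f x + (-1) * Jop f x)" using madd[OF f mm[OF conjunct1[OF Jk[OF f]] bsmooth_const]] .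
    then show ?thesis using Jk[OF f] Jop_weak_deriv[OF ei[OF that]] Sobolev_norm_0 f by simp
  qed
  show "Jop f = Jop g" if "f \<in> space_carrier (Sobolev 0 p)" "g \<in> space_carrier (Sobolev 0 p)" "AE x in lborel. f x = g x" for f g
    by (rule ext, rule Jop_cong_AE[OF ei[OF that(1)] ei[OF that(2)] that(3)])
  show "z \<in> space_carrier (Sobolev 0 p) \<and> space_norm (Sobolev 0 p) z \<le> C * (2 / \<epsilon>) * (4 * (space_norm (Sobolev 0 p) g1 + space_norm (Sobolev 0 p) g2))"
    if "g1 \<in> space_carrier (Sobolev 0 p)" "g2 \<in> space_carrier (Sobolev 0 p)" "\<epsilon> > 0" "C \<ge> 0" "\<And>x. (z has_vector_derivative z' x) (at x)" "bounded (range z')"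
      "\<And>x. norm (z x) \<le> C * (LINT y|lborel. exp (- \<epsilon> * \<bar>y - x\<bar>) * (norm (g1 y) + norm (g2 y)))" for g1 g2 \<epsilon> C z z'
  proof -
    define n1 where "n1 = (\<lambda>x. complex_of_real (norm (g1 x)))"
    define n2 where "n2 = (\<lambda>x. complex_of_real (norm (g2 x)))"
    have g: "in_Lp p g1" "in_Lp p g2" using that(1,2) Sobolev_0 by auto
    have n: "in_Lp p n1 \<and> Lp_norm p n1 = Lp_norm p g1" "in_Lp p n2 \<and> Lp_norm p n2 = Lp_norm p g2"
      using g by (auto simp: n1_def n2_def in_Lp_def Lp_norm_def)
    have s: "in_Lp p (\<lambda>x. n1 x + n2 x) \<and> Lp_norm p (\<lambda>x. n1 x + n2 x) \<le> 4 * (Lp_norm p g1 + Lp_norm p g2)"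
      using in_Lp_add[OF conjunct1[OF n(1)] conjunct1[OF n(2)] p] n by simp
    have nn: "norm (n1 y + n2 y) = norm (g1 y) + norm (g2 y)" for y
      unfolding n1_def n2_def of_real_add[symmetric] norm_of_real by simp
    have "continuous_on UNIV z" using that(5) by (auto intro!: continuous_at_imp_continuous_on intro: has_vector_derivative_continuous)
    then have "in_Lp p z \<and> Lp_norm p z \<le> C * (2 / \<epsilon>) * Lp_norm p (\<lambda>x. n1 x + n2 x)"
      by (intro in_Lp_exp_kernel[OF conjunct1[OF s] p that(3,4)] borel_measurable_continuous_onI) (use that(7) nn in auto)
    moreover have "C * (2 / \<epsilon>) * Lp_norm p (\<lambda>x. n1 x + n2 x) \<le> C * (2 / \<epsilon>) * (4 * (Lp_norm p g1 + Lp_norm p g2))"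
      using s that(3,4) by (intro mult_left_mono) auto
    ultimately show ?thesis unfolding Sobolev_0 using Sobolev_norm_0 g by fastforce
  qed
  show "in_Lp p v \<and> in_Lp p (\<lambda>x. - v x) \<and> has_weak_deriv 1 v (\<lambda>x. - v x) \<Longrightarrow> AE x in lborel. v x = 0" for v
    using in_Lp_decay_eq_0[OF _ p] by blast
  show "csmooth f \<Longrightarrow> (\<And>x. \<bar>x\<bar> > R \<Longrightarrow> f x = 0) \<Longrightarrow> f \<in> space_carrier (Sobolev 0 p)" for f R
    unfolding Sobolev_0 by (rule in_Lp_compact)
  show "n \<ge> 1 \<Longrightarrow> real n powr (1 / p) > 0" for n by simp
  show "space_norm (Sobolev 0 p) f \<le> M * real n powr (1 / p)"
    if "f \<in> space_carrier (Sobolev 0 p)" "n \<ge> 1" "\<And>x. norm (f x) \<le> M * indicator {a..a + real n} x" "M \<ge> 0" for f n M a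
    using Lp_norm_window_le[of f n M a] that Sobolev_norm_0 unfolding Sobolev_0 by simp
  show "c * real n powr (1 / p) / 4 \<le> space_norm (Sobolev 0 p) f"
    if "f \<in> space_carrier (Sobolev 0 p)" "n \<ge> 1" "\<And>x. x \<in> {a + real n / 4..a + real n / 2} \<Longrightarrow> c \<le> norm (f x)" "c \<ge> 0" for f n c a
    using Lp_norm_window_ge[of f n a c] that Sobolev_norm_0 unfolding Sobolev_0 by simp
  show "f \<in> space_carrier (Sobolev 0 p) \<Longrightarrow> c > 0 \<Longrightarrow> r > 0 \<Longrightarrow>
      AE x in lborel. \<bar>x - x0\<bar> < r \<longrightarrow> c \<le> \<bar>x - x0\<bar> * norm (f x) \<Longrightarrow> False" for f c r x0
    unfolding Sobolev_0 using in_Lp_no_pole by blast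
qed

end

section \<open>Spaces of bounded uniformly continuous functions as a scale\<close>

lemma BUC_0: "f \<in> space_carrier (BUC 0) \<longleftrightarrow> bounded (range f) \<and> uniformly_continuous_on UNIV f" by simp

lemma BUC_norm_0: "space_norm (BUC 0) f = (SUP x. norm (f x))" by simp

lemma BUC_le: "f \<in> space_carrier (BUC 0) \<Longrightarrow> norm (f x) \<le> space_norm (BUC 0) f"
  unfolding BUC_norm_0 BUC_0 by (rule cSUP_upper) (auto simp: bounded_iff bdd_above_def)

lemma BUC_norm_leI: "(\<And>x. norm (f x) \<le> B) \<Longrightarrow> space_norm (BUC 0) f \<le> B"
  unfolding BUC_norm_0 by (rule cSUP_least) auto

lemma classical_deriv_eqI: "(\<And>x. (f has_vector_derivative g x) (at x)) \<Longrightarrow> classical_deriv f = g"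
  unfolding classical_deriv_def using vector_derivative_at by blast

lemma BUC_Suc:
  "space_carrier (BUC (Suc k)) = {f \<in> space_carrier (BUC 0). \<exists>g\<in>space_carrier (BUC k). \<forall>x. (f has_vector_derivative g x) (at x)}"
proof (intro set_eqI iffI)
  fix f assume f: "f \<in> space_carrier (BUC (Suc k))"
  have D: "(f has_vector_derivative classical_deriv f x) (at x)" for x
  proof -
    have "f differentiable_on UNIV" using f by (auto dest: spec[of _ 0])
    then show ?thesis unfolding classical_deriv_def differentiable_on_def by (simp add: vector_derivative_works[symmetric])
  qed
  have sh: "(classical_deriv ^^ j) (classical_deriv f) = (classical_deriv ^^ Suc j) f" for j by (simp add: funpow_swap1)
  have "classical_deriv f \<in> space_carrier (BUC k)"
    using f unfolding space_carrier.simps mem_Collect_eq sh by auto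
  moreover have "f \<in> space_carrier (BUC 0)" using f by (auto dest: spec[of _ 0])
  ultimately show "f \<in> {f \<in> space_carrier (BUC 0). \<exists>g\<in>space_carrier (BUC k). \<forall>x. (f has_vector_derivative g x) (at x)}"
    using D by blast
next
  fix f assume "f \<in> {f \<in> space_carrier (BUC 0). \<exists>g\<in>space_carrier (BUC k). \<forall>x. (f has_vector_derivative g x) (at x)}"
  then obtain g where f: "f \<in> space_carrier (BUC 0)" and g: "g \<in> space_carrier (BUC k)" and D: "\<And>x. (f has_vector_derivative g x) (at x)" by blast
  have eq: "classical_deriv f = g" using D by (rule classical_deriv_eqI)
  have sh: "(classical_deriv ^^ Suc j) f = (classical_deriv ^^ j) g" for j using eq by (simp add: funpow_swap1)
  have dif: "f differentiable_on UNIV" unfolding differentiable_on_def using D by (auto intro: differentiableI_vector)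
  show "f \<in> space_carrier (BUC (Suc k))"
    unfolding space_carrier.simps mem_Collect_eq
  proof (intro conjI allI impI)
    fix j assume j: "j < Suc k"
    show "(classical_deriv ^^ j) f differentiable_on UNIV"
      using g j dif by (cases j) (auto simp: sh simp del: funpow.simps(2))
  next
    fix j assume j: "j \<le> Suc k"
    show "bounded (range ((classical_deriv ^^ j) f))" "uniformly_continuous_on UNIV ((classical_deriv ^^ j) f)"
      using g j f by (cases j; auto simp: sh simp del: funpow.simps(2))+
  qed
qed

lemma BUC_norm_Suc:
  assumes "\<And>x. (f has_vector_derivative g x) (at x)"
  shows "space_norm (BUC (Suc k)) f = space_norm (BUC 0) f + space_norm (BUC k) g"
proof -
  have "(classical_deriv ^^ Suc j) f = (classical_deriv ^^ j) g" for j
    using classical_deriv_eqI[of f g] assms by (simp add: funpow_swap1)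
  then show ?thesis by (simp add: sum.atMost_Suc_shift del: sum.atMost_Suc funpow.simps(2))
qed

lemma bounded_uniformly_continuous_mult:
  fixes f m :: "real \<Rightarrow> complex"
  assumes "bounded (range f)" "uniformly_continuous_on UNIV f" "bounded (range m)" "uniformly_continuous_on UNIV m"
  shows "uniformly_continuous_on UNIV (\<lambda>x. m x * f x)"
  unfolding uniformly_continuous_on_def
proof (intro allI impI)
  fix e :: real assume e: "e > 0"
  obtain F where F: "F > 0" "\<And>x. norm (f x) \<le> F" using assms(1) unfolding bounded_pos by auto
  obtain G where G: "G > 0" "\<And>x. norm (m x) \<le> G" using assms(3) unfolding bounded_pos by auto
  obtain d1 where d1: "d1 > 0" "\<And>x x'. dist x' x < d1 \<Longrightarrow> dist (f x') (f x) < e / (2 * G)"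
    using assms(2)[unfolded uniformly_continuous_on_def, rule_format, of "e / (2 * G)"] e G(1) by auto
  obtain d2 where d2: "d2 > 0" "\<And>x x'. dist x' x < d2 \<Longrightarrow> dist (m x') (m x) < e / (2 * F)"
    using assms(4)[unfolded uniformly_continuous_on_def, rule_format, of "e / (2 * F)"] e F(1) by auto
  have "dist (m x' * f x') (m x * f x) < e" if "dist x' x < min d1 d2" for x x'
  proof -
    have "m x' * f x' - m x * f x = m x' * (f x' - f x) + (m x' - m x) * f x" by (simp add: algebra_simps)
    then have "norm (m x' * f x' - m x * f x) \<le> norm (m x') * norm (f x' - f x) + norm (m x' - m x) * norm (f x)"
      by (metis norm_mult norm_triangle_ineq)
    also have "\<dots> \<le> G * norm (f x' - f x) + norm (m x' - m x) * F"
      using F(2) G(2) by (intro add_mono mult_right_mono mult_left_mono) auto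
    also have "\<dots> < G * (e / (2 * G)) + e / (2 * F) * F"
      using d1(2)[of x' x] d2(2)[of x' x] that F(1) G(1)
      by (intro add_strict_mono mult_strict_left_mono mult_strict_right_mono) (auto simp: dist_norm)
    also have "\<dots> = e" using F(1) G(1) by simp
    finally show ?thesis by (simp add: dist_norm)
  qed
  then show "\<exists>d>0. \<forall>x\<in>UNIV. \<forall>x'\<in>UNIV. dist x' x < d \<longrightarrow> dist (m x' * f x') (m x * f x) < e"
    using d1(1) d2(1) by (intro exI[of _ "min d1 d2"]) auto
qed

lemma bsmooth_BUC: fixes m :: "real \<Rightarrow> complex" assumes "bsmooth m" shows "m \<in> space_carrier (BUC 0)"
proof -
  obtain m' where m': "\<And>x. (m has_vector_derivative m' x) (at x)" "bsmooth m'" using bsmooth_has_deriv[OF assms] by blast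
  have b: "bounded (range f)" if "bsmooth f" for f :: "real \<Rightarrow> complex"
    using bsmooth_bounded[OF that] unfolding bounded_iff by (metis rangeE)
  show ?thesis unfolding BUC_0 using uniformly_continuous_of_bounded_deriv[OF m'(1) b[OF m'(2)]] b[OF assms] by blast
qed

lemma BUC_add: "f \<in> space_carrier (BUC 0) \<Longrightarrow> g \<in> space_carrier (BUC 0) \<Longrightarrow> (\<lambda>x. f x + g x) \<in> space_carrier (BUC 0)"
  unfolding BUC_0 using bounded_plus_comp[of f UNIV g] uniformly_continuous_on_add[of UNIV f g] by blast

lemma BUC_mult: "f \<in> space_carrier (BUC 0) \<Longrightarrow> m \<in> space_carrier (BUC 0) \<Longrightarrow> (\<lambda>x. m x * f x) \<in> space_carrier (BUC 0)"
proof -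
  assume f: "f \<in> space_carrier (BUC 0)" and m: "m \<in> space_carrier (BUC 0)"
  have "norm (m x * f x) \<le> space_norm (BUC 0) m * space_norm (BUC 0) f" for x
    unfolding norm_mult using BUC_le[OF f, of x] BUC_le[OF m, of x] by (intro mult_mono) (auto intro: order_trans[OF norm_ge_zero])
  then have "bounded (range (\<lambda>x. m x * f x))" unfolding bounded_iff by blast
  then show ?thesis using bounded_uniformly_continuous_mult f m unfolding BUC_0 by blast
qed

lemma BUC_continuous: "f \<in> space_carrier (BUC 0) \<Longrightarrow> continuous_on UNIV f"
  unfolding BUC_0 using uniformly_continuous_imp_continuous by blast

lemma BUC_exp_integrable: "f \<in> space_carrier (BUC 0) \<Longrightarrow> exp_integrable f"
  by (rule exp_integrable_bounded[OF borel_measurable_continuous_onI[OF BUC_continuous] BUC_le])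

lemma BUC_kernel_le:
  assumes g: "g1 \<in> space_carrier (BUC 0)" "g2 \<in> space_carrier (BUC 0)" and \<epsilon>: "\<epsilon> > 0"
  shows "(LINT y|lborel. exp (- \<epsilon> * \<bar>y - x\<bar>) * (norm (g1 y) + norm (g2 y))) \<le> (2 / \<epsilon>) * (space_norm (BUC 0) g1 + space_norm (BUC 0) g2)"
proof -
  let ?B = "space_norm (BUC 0) g1 + space_norm (BUC 0) g2"
  have "(LINT y|lborel. exp (- \<epsilon> * \<bar>y - x\<bar>) * (norm (g1 y) + norm (g2 y))) \<le> (LINT y|lborel. exp (- \<epsilon> * \<bar>y - x\<bar>) * ?B)"
  proof (rule integral_mono)
    have m: "(\<lambda>y. norm (g1 y) + norm (g2 y)) \<in> borel_measurable lborel"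
      using BUC_continuous[OF g(1)] BUC_continuous[OF g(2)] by (auto intro!: borel_measurable_continuous_onI continuous_intros)
    show "integrable lborel (\<lambda>y. exp (- \<epsilon> * \<bar>y - x\<bar>) * (norm (g1 y) + norm (g2 y)))"
      using integrable_exp_abs_mult[OF \<epsilon> m, of ?B x] BUC_le[OF g(1)] BUC_le[OF g(2)] by (auto intro!: add_mono)
    show "integrable lborel (\<lambda>y. exp (- \<epsilon> * \<bar>y - x\<bar>) * ?B)" by (intro integrable_mult_left integrable_exp_abs \<epsilon>)
    show "exp (- \<epsilon> * \<bar>y - x\<bar>) * (norm (g1 y) + norm (g2 y)) \<le> exp (- \<epsilon> * \<bar>y - x\<bar>) * ?B" for y
      by (intro mult_left_mono add_mono BUC_le g) auto
  qed
  also have "\<dots> = (LINT y|lborel. exp (- \<epsilon> * \<bar>y - x\<bar>)) * ?B" by (rule integral_mult_left_zero)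
  also have "\<dots> = (2 / \<epsilon>) * ?B" unfolding integral_exp_abs[OF \<epsilon>] ..
  finally show ?thesis .
qed

lemma BUC_zero: "(\<lambda>_. 0) \<in> space_carrier (BUC 0)" "space_norm (BUC 0) (\<lambda>_. 0) = 0"
  using bsmooth_BUC[OF bsmooth_const[of 0]] by auto

lemma BUC_scale:
  "deriv_scale BUC (\<lambda>f g. f \<in> space_carrier (BUC 0) \<and> g \<in> space_carrier (BUC 0) \<and> (\<forall>x. (f has_vector_derivative g x) (at x))) top (\<lambda>_. 1)"
proof
  let ?B = "space_carrier (BUC 0)" and ?N = "space_norm (BUC 0)"
  let ?D = "\<lambda>f g. f \<in> ?B \<and> g \<in> ?B \<and> (\<forall>x. (f has_vector_derivative g x) (at x))"
  show "one_more_deriv (BUC k) = BUC (Suc k)" for k by simp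
  show "space_eq (BUC k) f g \<longleftrightarrow> (\<forall>\<^sub>F x in top. f x = g x)" for k f g by (simp add: fun_eq_iff)
  have sub: "f \<in> space_carrier (BUC k) \<Longrightarrow> f \<in> ?B" for f k by (cases k) (auto simp only: BUC_Suc)
  show "space_carrier (BUC (Suc k)) = {f \<in> ?B. \<exists>g\<in>space_carrier (BUC k). ?D f g}" for k
    unfolding BUC_Suc using sub by blast
  show "f \<in> space_carrier (BUC (Suc k)) \<Longrightarrow> ?D f g \<Longrightarrow> g \<in> space_carrier (BUC k) \<Longrightarrow>
      space_norm (BUC (Suc k)) f = ?N f + space_norm (BUC k) g" for f g k
    using BUC_norm_Suc by blast
  show "?D f g \<Longrightarrow> \<forall>\<^sub>F x in top. space_deriv (BUC k) f x = g x" for f g k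
    using classical_deriv_eqI[of f g] by simp
  show "?D f g \<Longrightarrow> f \<in> ?B \<and> g \<in> ?B" for f g by blast
  show "(\<lambda>x. f x + g x) \<in> ?B \<and> ?N (\<lambda>x. f x + g x) \<le> 4 * (?N f + ?N g)" if "f \<in> ?B" "g \<in> ?B" for f g
  proof -
    have "norm (f x + g x) \<le> ?N f + ?N g" for x
      by (intro order_trans[OF norm_triangle_ineq] add_mono BUC_le that)
    then have "?N (\<lambda>x. f x + g x) \<le> ?N f + ?N g" by (rule BUC_norm_leI)
    moreover have "0 \<le> ?N f" "0 \<le> ?N g" using order_trans[OF norm_ge_zero BUC_le] that by blast+
    ultimately show ?thesis using BUC_add[OF that] by simp
  qed
  show mult: "(\<lambda>x. m x * f x) \<in> ?B \<and> ?N (\<lambda>x. m x * f x) \<le> M * ?N f" if "f \<in> ?B" "bsmooth m" "\<And>x. norm (m x) \<le> M" for f m M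
  proof -
    have "norm (m x * f x) \<le> M * ?N f" for x
      unfolding norm_mult using that(3)[of x] BUC_le[OF that(1), of x] by (intro mult_mono) (auto intro: order_trans[OF norm_ge_zero])
    then show ?thesis using BUC_mult[OF that(1) bsmooth_BUC[OF that(2)]] BUC_norm_leI[of "\<lambda>x. m x * f x" "M * ?N f"] by blast
  qed
  show "f \<in> ?B \<Longrightarrow> 0 \<le> ?N f" for f using order_trans[OF norm_ge_zero BUC_le] by blast
  show "f \<in> ?B \<Longrightarrow> ?N f = 0 \<Longrightarrow> \<forall>\<^sub>F x in top. f x = 0" for f using BUC_le[of f] by simp
  show "f \<in> ?B \<Longrightarrow> g \<in> ?B \<Longrightarrow> \<forall>\<^sub>F x in top. f x = g x \<Longrightarrow> ?N f = ?N g" for f g by simp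
  show "?D f g \<Longrightarrow> ?D f' g' \<Longrightarrow> ?D (\<lambda>x. f x + f' x) (\<lambda>x. g x + g' x)" for f g f' g'
    using BUC_add has_vector_derivative_add by blast
  show "?D (\<lambda>x. m x * f x) (\<lambda>x. m' x * f x + m x * g x)" if "?D f g" "bsmooth m" "\<And>x. (m has_vector_derivative m' x) (at x)" for f g m m'
  proof -
    have "bsmooth m'" unfolding bsmooth_def using dbound_Suc_deriv[OF _ that(3)] that(2) unfolding bsmooth_def by meson
    then have "(\<lambda>x. m x * f x) \<in> ?B" "(\<lambda>x. m' x * f x + m x * g x) \<in> ?B"
      using that BUC_add BUC_mult bsmooth_BUC by blast+
    moreover have "((\<lambda>x. m x * f x) has_vector_derivative m' x * f x + m x * g x) (at x)" for x
      using has_vector_derivative_mult[OF that(3), of f "g x"] that(1) by (simp add: add.commute)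
    ultimately show ?thesis by blast
  qed
  show "?D f g \<Longrightarrow> f' \<in> ?B \<Longrightarrow> g' \<in> ?B \<Longrightarrow> \<forall>\<^sub>F x in top. f x = f' x \<Longrightarrow> \<forall>\<^sub>F x in top. g x = g' x \<Longrightarrow> ?D f' g'" for f g f' g'
    by (simp add: fun_eq_iff[symmetric])
  show "?D f g \<Longrightarrow> ?D f' g' \<Longrightarrow> \<forall>\<^sub>F x in top. f x = f' x \<Longrightarrow> \<forall>\<^sub>F x in top. g x = g' x" for f g f' g'
    using vector_derivative_unique_at by (simp add: fun_eq_iff[symmetric]) blast
  show "?D f f'" if "\<And>x. (f has_vector_derivative f' x) (at x)" "continuous_on UNIV f'" "f \<in> ?B" "f' \<in> ?B" for f f'
    using that by blast
  show "f \<in> ?B \<Longrightarrow> exp_integrable f" for f by (rule BUC_exp_integrable)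
  have Jle: "norm (Jop f x) \<le> 2 * ?N f" if "f \<in> ?B" for f x
    using Jop_norm_le[OF BUC_exp_integrable[OF that], of x] BUC_kernel_le[OF that BUC_zero(1), of 1 x] BUC_zero(2) by simp
  then show Jb: "f \<in> ?B \<Longrightarrow> bounded (range (Jop f))" for f unfolding bounded_iff by blast
  show "?D (Jop f) (\<lambda>x. f x - Jop f x) \<and> ?N (Jop f) \<le> 2 * ?N f" if "f \<in> ?B" for f
  proof -
    have D: "(Jop f has_vector_derivative f x - Jop f x) (at x)" for x
      by (rule Jop_has_vector_derivative[OF BUC_exp_integrable[OF that] BUC_continuous[OF that]])
    have "bounded (range (\<lambda>x. f x - Jop f x))" using that Jb[OF that] unfolding BUC_0 by (intro bounded_minus_comp) auto
    from uniformly_continuous_of_bounded_deriv[OF D this] have J: "Jop f \<in> ?B" using Jb[OF that] unfolding BUC_0 by blast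
    have "(\<lambda>x. f x + (-1) * Jop f x) \<in> ?B" using BUC_add[OF that BUC_mult[OF J bsmooth_BUC[OF bsmooth_const]]] .
    then have "(\<lambda>x. f x - Jop f x) \<in> ?B" by simp
    then show ?thesis using J D BUC_norm_leI[of "Jop f", OF Jle[OF that]] by blast
  qed
  show "f \<in> ?B \<Longrightarrow> g \<in> ?B \<Longrightarrow> \<forall>\<^sub>F x in top. f x = g x \<Longrightarrow> Jop f = Jop g" for f g by (simp add: fun_eq_iff[symmetric])
  show "z \<in> ?B \<and> ?N z \<le> C * (2 / \<epsilon>) * (4 * (?N g1 + ?N g2))"
    if "g1 \<in> ?B" "g2 \<in> ?B" "\<epsilon> > 0" "C \<ge> 0" "\<And>x. (z has_vector_derivative z' x) (at x)" "bounded (range z')"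
      "\<And>x. norm (z x) \<le> C * (LINT y|lborel. exp (- \<epsilon> * \<bar>y - x\<bar>) * (norm (g1 y) + norm (g2 y)))" for g1 g2 \<epsilon> C z z'
  proof -
    have le: "norm (z x) \<le> C * ((2 / \<epsilon>) * (?N g1 + ?N g2))" for x
      by (rule order_trans[OF that(7) mult_left_mono[OF BUC_kernel_le[OF that(1-3)] that(4)]])
    have n0: "0 \<le> ?N g1" "0 \<le> ?N g2" using order_trans[OF norm_ge_zero BUC_le] that(1,2) by blast+
    have "bounded (range z)" using le unfolding bounded_iff by blast
    then have "z \<in> ?B" unfolding BUC_0 using uniformly_continuous_of_bounded_deriv[OF that(5,6)] by blast
    moreover have "?N z \<le> C * ((2 / \<epsilon>) * (?N g1 + ?N g2))" by (rule BUC_norm_leI[OF le])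
    moreover have "C * ((2 / \<epsilon>) * (?N g1 + ?N g2)) \<le> C * ((2 / \<epsilon>) * (4 * (?N g1 + ?N g2)))"
      using n0 that(3,4) by (intro mult_left_mono) auto
    ultimately show ?thesis unfolding mult.assoc by (intro conjI; linarith)
  qed
  show "\<forall>\<^sub>F x in top. v x = 0" if "?D v (\<lambda>x. - v x)" for v
  proof -
    have D: "((\<lambda>x. exp x *\<^sub>R v x) has_vector_derivative 0) (at x)" for x
    proof -
      have "((\<lambda>x. exp x *\<^sub>R v x) has_vector_derivative exp x *\<^sub>R (- v x) + exp x *\<^sub>R v x) (at x)"
        using that by (intro has_vector_derivative_scaleR DERIV_exp) auto
      then show ?thesis by simp
    qed
    obtain cc where "\<And>x. exp x *\<^sub>R v x = cc"
      by (rule has_vector_derivative_zero_constant[of UNIV, THEN exE]) (use D in auto)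
    then have c: "exp x *\<^sub>R v x = exp 0 *\<^sub>R v 0" for x by metis
    \<comment> \<open>Going to the left, \<open>v\<close> would have to grow like an exponential,
      which its boundedness excludes.\<close>
    have "v 0 = 0"
    proof (rule ccontr)
      assume nz: "v 0 \<noteq> 0"
      have "norm (v 0) \<le> exp (- real n) * ?N v" for n
      proof -
        have "norm (v 0) = exp (- real n) * norm (v (- real n))" using arg_cong[OF c[of "- real n"], of norm] by simp
        then show ?thesis using BUC_le[of v "- real n"] that by (simp add: mult_left_mono)
      qed
      moreover have "(\<lambda>n. exp (- real n) * ?N v) \<longlonglongrightarrow> 0 * ?N v"
        using exp_neg_of_nat_tendsto[of 1] by (intro tendsto_intros) auto
      ultimately have "norm (v 0) \<le> 0 * ?N v" by (intro LIMSEQ_le_const) auto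
      then show False using nz by simp
    qed
    then have "v x = 0" for x using c[of x] by simp
    then show ?thesis by simp
  qed
  show "f \<in> ?B" if "csmooth f" "\<And>x. \<bar>x\<bar> > R \<Longrightarrow> f x = 0" for f R
    by (rule bsmooth_BUC[OF csmooth_bounded_support_bsmooth[OF that]])
  show "?N f \<le> M * 1" if "f \<in> ?B" "n \<ge> 1" "\<And>x. norm (f x) \<le> M * indicator {a..a + real n} x" "M \<ge> 0" for f n M a
  proof (rule BUC_norm_leI)
    show "norm (f x) \<le> M * 1" for x using that(3)[of x] that(4) by (cases "x \<in> {a..a + real n}") auto
  qed
  show "c * 1 / 4 \<le> ?N f" if "f \<in> ?B" "n \<ge> 1" "\<And>x. x \<in> {a + real n / 4..a + real n / 2} \<Longrightarrow> c \<le> norm (f x)" "c \<ge> 0" for f n c a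
    using that(3)[of "a + real n / 2"] BUC_le[OF that(1), of "a + real n / 2"] that(4) by simp
  show False if "f \<in> ?B" "c > 0" "r > 0" "\<forall>\<^sub>F x in top. \<bar>x - x0\<bar> < r \<longrightarrow> c \<le> \<bar>x - x0\<bar> * norm (f x)" for f c r x0
  proof -
    have N0: "0 \<le> ?N f" using order_trans[OF norm_ge_zero BUC_le[OF that(1)]] .
    \<comment> \<open>A point so close to \<open>x0\<close> that the bound on \<open>f\<close>
      permits at most half of the required value \<open>c\<close>.\<close>
    define t where "t = min (r / 2) (c / (2 * (?N f + 1)))"
    have t: "0 < t" "t < r" "t \<le> c / (2 * (?N f + 1))" using that(2,3) N0 by (auto simp: t_def)
    have "c \<le> t * norm (f (x0 + t))" using that(4) t by (auto dest: spec[of _ "x0 + t"])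
    also have "\<dots> \<le> c / (2 * (?N f + 1)) * (?N f + 1)"
      using t BUC_le[OF that(1), of "x0 + t"] N0 that(2) by (intro mult_mono) auto
    also have "\<dots> = c / 2" using N0 by (simp add: field_simps)
    finally show False using that(2) by simp
  qed
qed auto

section \<open>Stability criteria\<close>

text \<open>The coefficients \<open>al\<close> and \<open>kap\<close> are real, so conjugating
  \<open>q\<close> and \<open>w\<close> corresponds to conjugating \<open>u\<close> and
  \<open>p\<close> in the form. This reduces spectral parameters in the lower half plane to those in
  the upper one.\<close>

lemma coercive_system_cnj:
  assumes "coercive_system al kap q w w' a0 Q Wb d"
  shows "coercive_system al kap (\<lambda>x. cnj (q x)) (\<lambda>x. cnj (w x)) (\<lambda>x. cnj (w' x)) a0 Q Wb d"
proof -
  interpret coercive_system al kap q w w' a0 Q Wb d by (rule assms)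
  show ?thesis
  proof
    show "continuous_on UNIV (\<lambda>x. cnj (q x))" by (intro continuous_on_cnj q_cont)
    show "((\<lambda>x. cnj (w x)) has_vector_derivative cnj (w' x)) (at x)" for x
      by (rule bounded_linear.has_vector_derivative[OF bounded_linear_cnj w_deriv])
    fix u p x
    have "Re ((cnj (w' x) + \<i> * complex_of_real (kap * Im (cnj (w x)) / al x)) * p * cnj u)
        = Re (cnj ((w' x + \<i> * complex_of_real (kap * Im (w x) / al x)) * cnj p * cnj (cnj u)))"
      by (simp add: algebra_simps)
    moreover have "Re (cnj (w x) * cnj (q x)) = Re (w x * q x)" by simp
    ultimately show "d * ((norm u)^2 + (norm p)^2) \<le> Re (cnj (w x)) / al x * (norm p)^2
       + Re ((cnj (w' x) + \<i> * complex_of_real (kap * Im (cnj (w x)) / al x)) * p * cnj u)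
       + (Re (cnj (w x) * cnj (q x)) - kap / 2 * Re (cnj (w' x))) * (norm u)^2"
      using coercive[of "cnj u" "cnj p" x] by (simp only: complex_mod_cnj cnj.sel(1))
  qed (use al_cont a0 al_ge q_le kap w_le Wb d in auto)
qed

lemma dbound_1_le:
  fixes f :: "real \<Rightarrow> real"
  assumes "\<And>x. (f has_real_derivative f' x) (at x)" "dbound I \<epsilon> 1 (\<lambda>x. f x - l)" "x \<in> I"
  shows "\<bar>f x - l\<bar> \<le> \<epsilon> \<and> \<bar>f' x\<bar> \<le> \<epsilon>"
proof -
  have "((\<lambda>x. f x - l) has_vector_derivative f' x) (at x)" for x
    using assms(1)[of x] by (auto intro!: derivative_eq_intros simp flip: has_real_derivative_iff_has_vector_derivative)
  from dbound_Suc_deriv[OF _ this] assms(2) have "dbound I \<epsilon> 0 f'" by (metis One_nat_def)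
  then show ?thesis using dbound_le[OF assms(2,3)] assms(3) by simp
qed

lemma dbound_tail_tendsto:
  fixes f :: "real \<Rightarrow> real"
  assumes D: "\<And>x. (f has_real_derivative f' x) (at x)"
    and T: "\<And>\<epsilon>. \<epsilon> > 0 \<Longrightarrow> \<exists>R. dbound (T R) \<epsilon> 1 (\<lambda>x. f x - l)" and Fl: "\<And>R. \<forall>\<^sub>F x in Fl. x \<in> T R"
  shows "(f \<longlongrightarrow> l) Fl" "(f' \<longlongrightarrow> 0) Fl"
proof -
  have "\<forall>\<^sub>F x in Fl. dist (f x) l < e \<and> dist (f' x) 0 < e" if e: "e > 0" for e
  proof -
    obtain R where R: "dbound (T R) (e / 2) 1 (\<lambda>x. f x - l)" using T[OF half_gt_zero[OF e]] by blast
    show ?thesis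
      using Fl[of R]
    proof eventually_elim
      case (elim x)
      show ?case using dbound_1_le[OF D R elim] that by (simp add: dist_real_def)
    qed
  qed
  then show "(f \<longlongrightarrow> l) Fl" "(f' \<longlongrightarrow> 0) Fl" unfolding tendsto_iff eventually_conj_iff by blast+
qed

lemma eventually_tails:
  "\<forall>\<^sub>F x in at_top. x \<in> {R..} \<union> {..- R}" "\<forall>\<^sub>F x in at_top. x \<in> {R..}"
  "\<forall>\<^sub>F x in at_bot. x \<in> {R..} \<union> {..- R}" "\<forall>\<^sub>F x in at_bot. x \<in> {..- R}" for R :: real
  by (rule eventually_mono[OF eventually_ge_at_top[of R]] eventually_mono[OF eventually_le_at_bot[of "- R"]]; simp)+

section \<open>Coercivity under the Froude conditions\<close>

context rg_wave
begin

text \<open>The limit of \<open>al\<close> at the end where \<open>ph\<close> tends to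
  \<open>ph0\<close>. The squared Froude number there is \<open>c^2 * h0 / alim ph0\<close>, so the
  threshold 2 becomes \<open>4 * alim ph0 = c^2 * h0\<close>.\<close>

definition "alim ph0 = (gp + 3 * h0 * ph0) * h0^2"

lemma limits_plus: "(b \<longlongrightarrow> h0) at_top" "(deriv b \<longlongrightarrow> 0) at_top" "(ph \<longlongrightarrow> phip) at_top"
  and limits_minus: "(b \<longlongrightarrow> h0) at_bot" "(ph \<longlongrightarrow> phim) at_bot"
proof -
  note t = eventually_tails(1,2) and u = eventually_tails(3,4)
  show "(b \<longlongrightarrow> h0) at_top" "(deriv b \<longlongrightarrow> 0) at_top" by (rule dbound_tail_tendsto[OF Db tail_b t(1)]; simp)+
  show "(b \<longlongrightarrow> h0) at_bot" by (rule dbound_tail_tendsto(1)[OF Db tail_b u(1)])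
  show "(ph \<longlongrightarrow> phip) at_top" by (rule dbound_tail_tendsto(1)[OF Dph tail_ph_plus t(2)])
  show "(ph \<longlongrightarrow> phim) at_bot" by (rule dbound_tail_tendsto(1)[OF Dph tail_ph_minus u(2)])
qed

text \<open>With \<open>1 + \<lambda> h0 / (Cf c) = A + \<i> B\<close> one has \<open>T0 = B / A\<close>, and the claim at the end states
  reduces to \<open>B\<^sup>2 / A\<^sup>2 \<le> A\<^sup>2 + B\<^sup>2 - 1\<close>, that is \<open>(A\<^sup>2 - 1) (A\<^sup>2 + B\<^sup>2) \<ge> 0\<close>.\<close>

lemma far_field:
  assumes lam: "Re lam \<ge> 0" "lam \<noteq> 0" and al0: "Re lam > 0 \<and> 4 * alim ph0 \<ge> c^2 * h0 \<or> 4 * alim ph0 > c^2 * h0"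
    and T0: "T0 = Im lam * h0 / (Cf * c + Re lam * h0)"
    and b: "(b \<longlongrightarrow> h0) F" and ph: "(ph \<longlongrightarrow> ph0) F"
  shows "\<exists>\<eta>>0. \<forall>\<^sub>F x in F. kap^2 * T0^2 + \<eta> \<le> 4 * al x * (Re (qq lam x) + T0 * Im (qq lam x))"
proof -
  define m where "m = (\<lambda>x. 4 * al x * (Re (qq lam x) + T0 * Im (qq lam x)))"
  define m0 where "m0 = 4 * alim ph0 * (((Re lam)^2 - (Im lam)^2) * h0 + 2 * Cf * c * Re lam
      + T0 * (2 * Re lam * Im lam * h0 + 2 * Cf * c * Im lam))"
  have "m = (\<lambda>x. 4 * ((gp + 3 * b x * ph x) * (b x)^2) * (((Re lam)^2 - (Im lam)^2) * b x + 2 * Cf * c * Re lam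
      + T0 * (2 * Re lam * Im lam * b x + 2 * Cf * c * Im lam)))"
    by (rule ext) (simp add: m_def al_def av_def qq_def power2_eq_square)
  then have lim: "(m \<longlongrightarrow> m0) F" unfolding m0_def alim_def by (auto intro!: tendsto_intros b ph)
  define s where "s = Cf * c / h0"
  define A where "A = 1 + Re lam / s"
  define B where "B = Im lam / s"
  have s: "s > 0" using Cf c h0 by (simp add: s_def)
  have lamAB: "Re lam = s * (A - 1)" "Im lam = s * B" using s by (simp_all add: A_def B_def)
  have A: "A \<ge> 1" using lam s by (simp add: A_def)
  have cf: "Cf * c = s * h0" using h0 by (simp add: s_def)
  have T0': "T0 * A = B"
  proof -
    have "Cf * c + Re lam * h0 = s * h0 * A" unfolding cf lamAB by algebra
    then show ?thesis unfolding T0 lamAB using s h0 A by simp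
  qed
  have m0e: "m0 = 4 * alim ph0 * (s^2 * h0 * (A^2 + B^2 - 1))"
  proof -
    have e2: "2 * Cf * c * x = 2 * (s * h0) * x" for x using cf by (metis mult.assoc)
    have "(s * (A - 1))\<^sup>2 - (s * B)\<^sup>2 = s^2 * ((A-1)^2 - B^2)" by algebra
    then show ?thesis unfolding m0_def lamAB e2 using T0' by algebra
  qed
  have kap2: "kap^2 = c^2 * (s * h0)^2" using cf by (metis kap_def mult.commute mult.left_commute power2_eq_square)
  have AB: "B \<noteq> 0 \<or> A > 1"
  proof (rule ccontr)
    assume "\<not> (B \<noteq> 0 \<or> A > 1)"
    then have "A = 1" "B = 0" using A by auto
    then show False using lamAB lam(2) by (simp add: complex_eq_iff)
  qed
  have T02: "A^2 * T0^2 = B^2" using T0' by (metis power_mult_distrib mult.commute)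
  have ineq: "T0^2 \<le> A^2 + B^2 - 1 \<and> 0 < A^2 + B^2 - 1 \<and> (A > 1 \<longrightarrow> T0^2 < A^2 + B^2 - 1)"
  proof -
    have id: "A^2 * (A^2 + B^2 - 1 - T0^2) = (A^2 - 1) * (A^2 + B^2)" using T02 by algebra
    have A2: "A^2 \<ge> 1" "A^2 > 0" using A one_le_power[of A 2] by (auto intro: zero_less_power)
    have "0 \<le> A^2 * (A^2 + B^2 - 1 - T0^2)" unfolding id using A2 by (intro mult_nonneg_nonneg) auto
    then have 1: "T0^2 \<le> A^2 + B^2 - 1" using A2 by (simp add: zero_le_mult_iff)
    have 2: "T0^2 < A^2 + B^2 - 1" if "A > 1"
    proof -
      have "A^2 > 1" using one_less_power[OF that, of 2] by simp
      then have "0 < A^2 * (A^2 + B^2 - 1 - T0^2)" unfolding id using A2(2) by (intro mult_pos_pos add_pos_nonneg) auto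
      then show ?thesis using A2 by (simp add: zero_less_mult_iff)
    qed
    have "0 < A^2 + B^2 - 1"
    proof (cases "A > 1")
      case True then show ?thesis using 2 zero_le_power2[of T0] by linarith
    next
      case False then have "B^2 > 0" using AB by simp
      then show ?thesis using A2 by linarith
    qed
    then show ?thesis using 1 2 by blast
  qed
  have "kap^2 * T0^2 < m0"
  proof -
    have sh: "(s * h0)^2 > 0" "s^2 * h0 > 0" using s h0 by simp_all
    have l: "kap^2 * T0^2 = (c^2 * h0) * (s^2 * h0) * T0^2" unfolding kap2 by algebra
    have r: "m0 = (4 * alim ph0) * (s^2 * h0) * (A^2 + B^2 - 1)" unfolding m0e by algebra
    have ch: "c^2 * h0 > 0" using c h0 by simp
    \<comment> \<open>Strictness comes from one of two sources: from \<open>A > 1\<close> if the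
      real part of \<open>lam\<close> is positive, and otherwise from the strict Froude
      condition.\<close>
    show ?thesis
      using al0
    proof
      assume a: "Re lam > 0 \<and> 4 * alim ph0 \<ge> c^2 * h0"
      then have "A > 1" using s by (simp add: A_def)
      then have "(c^2 * h0) * (s^2 * h0) * T0^2 < (c^2 * h0) * (s^2 * h0) * (A^2 + B^2 - 1)"
        using ineq ch sh by (intro mult_strict_left_mono) auto
      also have "\<dots> \<le> (4 * alim ph0) * (s^2 * h0) * (A^2 + B^2 - 1)"
        using ineq a sh by (intro mult_right_mono) auto
      finally show ?thesis unfolding l r .
    next
      assume a: "4 * alim ph0 > c^2 * h0"
      have "(c^2 * h0) * (s^2 * h0) * T0^2 \<le> (c^2 * h0) * (s^2 * h0) * (A^2 + B^2 - 1)"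
        using ineq ch sh by (intro mult_left_mono) auto
      also have "\<dots> < (4 * alim ph0) * (s^2 * h0) * (A^2 + B^2 - 1)"
        using ineq a sh by (intro mult_strict_right_mono) auto
      finally show ?thesis unfolding l r .
    qed
  qed
  then have "\<forall>\<^sub>F x in F. m x > (kap^2 * T0^2 + m0) / 2" using lim by (intro order_tendstoD) auto
  then have "\<forall>\<^sub>F x in F. kap^2 * T0^2 + (m0 - kap^2 * T0^2) / 2 \<le> m x" by eventually_elim (simp add: field_simps)
  then show ?thesis unfolding m_def using \<open>kap^2 * T0^2 < m0\<close> by (intro exI[of _ "(m0 - kap^2 * T0^2) / 2"]) auto
qed

text \<open>\<open>far_field\<close> supplies the required inequality near both ends with the same
  \<open>T0\<close>, which depends on \<open>h0\<close> but not on the limit of \<open>ph\<close>.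
  So a single constant weight serves at infinity although the two end states may differ.\<close>

lemma coercive_exists_upper:
  assumes lam: "Re lam \<ge> 0" "lam \<noteq> 0" "Im lam \<ge> 0"
    and al0: "\<And>ph0. ph0 \<in> {phim, phip} \<Longrightarrow> Re lam > 0 \<and> 4 * alim ph0 \<ge> c^2 * h0 \<or> 4 * alim ph0 > c^2 * h0"
  shows "\<exists>w w' Q Wb d. coercive_system al kap (qq lam) w w' (gp * bm^2) Q Wb d"
proof -
  obtain a1 where a1: "\<And>x. norm (al x) \<le> a1" using bsmooth_bounded[OF al_smooth] by blast
  obtain Q where Q: "Q \<ge> 0" "\<And>x. norm (qq lam x) \<le> Q" using bsmooth_bounded[OF qq_smooth] by blast
  define T0 where "T0 = Im lam * h0 / (Cf * c + Re lam * h0)"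
  have T0: "T0 \<ge> 0" using lam h0 Cf c by (simp add: T0_def)
  have Imq: "Im (qq lam x) = 2 * Re lam * Im lam * b x + 2 * Cf * c * Im lam" for x by (simp add: qq_def power2_eq_square)
  have Imge: "Im (qq lam x) \<ge> 2 * Cf * c * Im lam" for x
    unfolding Imq using lam b_pos[of x] by simp
  obtain \<eta>p where p: "\<eta>p > 0" "\<forall>\<^sub>F x in at_top. kap^2 * T0^2 + \<eta>p \<le> 4 * al x * (Re (qq lam x) + T0 * Im (qq lam x))"
    using far_field[OF lam(1,2) al0 T0_def limits_plus(1,3)] by auto
  obtain \<eta>m where m: "\<eta>m > 0" "\<forall>\<^sub>F x in at_bot. kap^2 * T0^2 + \<eta>m \<le> 4 * al x * (Re (qq lam x) + T0 * Im (qq lam x))"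
    using far_field[OF lam(1,2) al0 T0_def limits_minus] by auto
  obtain Rp where Rp: "\<And>x. x \<ge> Rp \<Longrightarrow> kap^2 * T0^2 + \<eta>p \<le> 4 * al x * (Re (qq lam x) + T0 * Im (qq lam x))"
    using p(2) unfolding eventually_at_top_linorder by blast
  obtain Rm where Rm: "\<And>x. x \<le> Rm \<Longrightarrow> kap^2 * T0^2 + \<eta>m \<le> 4 * al x * (Re (qq lam x) + T0 * Im (qq lam x))"
    using m(2) unfolding eventually_at_bot_linorder by blast
  \<comment> \<open>Off the real axis the imaginary part of \<open>qq lam\<close> is bounded below
    by \<open>e > 0\<close>, and \<open>Q / e\<close> times it outweighs the real part. For real
    \<open>lam \<ge> 0\<close> the real part is itself nonnegative, and \<open>T1 = 0\<close> will
    do.\<close>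
  obtain T1 where T1: "\<And>x. 0 \<le> Re (qq lam x) + T1 * Im (qq lam x)"
  proof (cases "Im lam > 0")
    case True
    define e where "e = 2 * Cf * c * Im lam"
    have e: "e > 0" using True Cf c by (simp add: e_def)
    have "0 \<le> Re (qq lam x) + Q / e * Im (qq lam x)" for x
    proof -
      have "Q / e * e \<le> Q / e * Im (qq lam x)" using Imge[of x] Q e by (intro mult_left_mono) (auto simp: e_def)
      then show ?thesis using Q(2)[of x] abs_Re_le_cmod[of "qq lam x"] e by simp
    qed
    then show ?thesis using that by blast
  next
    case False
    then have "Im lam = 0" using lam by simp
    then have "Re (qq lam x) \<ge> 0" for x using lam b_pos[of x] Cf c by (simp add: qq_def)
    then have "0 \<le> Re (qq lam x) + 0 * Im (qq lam x)" for x by simp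
    then show ?thesis using that by blast
  qed
  have "\<exists>w w' Wb d. coercive_system al kap (qq lam) w w' (gp * bm^2) Q Wb d"
  proof (rule coercive_weight_exists[where R = "max 1 (max Rp (- Rm))" and \<eta> = "min \<eta>p \<eta>m" and ?T0.0 = T0 and ?T1.0 = T1 and ?a1.0 = a1])
    show "continuous_on UNIV al" "continuous_on UNIV (qq lam)"
      using csmooth_continuous bsmooth_csmooth al_smooth qq_smooth by auto
    show "al x \<le> a1" for x using a1[of x] by simp
    show "Im (qq lam x) \<ge> 0" for x using Imge[of x] lam Cf c by (smt (verit) mult_nonneg_nonneg)
    fix x assume "\<bar>x\<bar> \<ge> max 1 (max Rp (- Rm))"
    then have "x \<ge> Rp \<or> x \<le> Rm" by linarith
    then show "kap^2 * T0^2 + min \<eta>p \<eta>m \<le> 4 * al x * (Re (qq lam x) + T0 * Im (qq lam x))"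
      using Rp[of x] Rm[of x] by linarith
  qed (use al_ge gp bm Q kap_pos p(1) m(1) T0 T1 in auto)
  then show ?thesis by blast
qed

lemma coercive_exists:
  assumes lam: "Re lam \<ge> 0" "lam \<noteq> 0"
    and al0: "\<And>ph0. ph0 \<in> {phim, phip} \<Longrightarrow> Re lam > 0 \<and> 4 * alim ph0 \<ge> c^2 * h0 \<or> 4 * alim ph0 > c^2 * h0"
  shows "\<exists>w w' Q Wb d. coercive_system al kap (qq lam) w w' (gp * bm^2) Q Wb d"
proof (cases "Im lam \<ge> 0")
  case True then show ?thesis using coercive_exists_upper[OF lam _ al0] by blast
next
  case False
  then obtain w w' Q Wb d where "coercive_system al kap (qq (cnj lam)) w w' (gp * bm^2) Q Wb d"
    using coercive_exists_upper[of "cnj lam"] lam al0 by auto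
  from coercive_system_cnj[OF this] have "coercive_system al kap (\<lambda>x. cnj (qq (cnj lam) x)) (\<lambda>x. cnj (w x)) (\<lambda>x. cnj (w' x)) (gp * bm^2) Q Wb d" .
  moreover have "(\<lambda>x. cnj (qq (cnj lam) x)) = qq lam" by (rule ext) (simp add: qq_def)
  ultimately show ?thesis by metis
qed

end

section \<open>Spectral criteria in terms of the limiting coefficients\<close>

context rg_scale
begin

text \<open>The condition \<open>Cf \<ge> Ct\<close> makes \<open>dmp\<close> nonnegative, so adding
  it to \<open>lam\<close> in the closed right half plane cannot decrease the modulus; this is the
  separation that the equation for \<open>\<Phi>\<close> needs.\<close>

lemma resolvent_of_stable:
  assumes lam: "Re lam \<ge> 0" "lam \<noteq> 0" and "Cf \<ge> Ct"
    and al0: "\<And>ph0. ph0 \<in> {phim, phip} \<Longrightarrow> Re lam > 0 \<and> 4 * alim ph0 \<ge> c^2 * h0 \<or> 4 * alim ph0 > c^2 * h0"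
  shows "in_resolvent_set (mk k) (LL k) lam"
proof -
  obtain w w' Q Wb d where co: "coercive_system al kap (qq lam) w w' (gp * bm^2) Q Wb d" using coercive_exists[OF lam al0] by blast
  have "dmp x \<ge> 0" for x unfolding dmp_def using assms(3) b_pos[of x] ph_pos[of x] c by simp
  then have "norm lam \<le> norm (lam + cx (dmp x))" for x
    unfolding cmod_def using lam(1) by (auto intro!: real_sqrt_le_mono power_mono)
  then show ?thesis using resolvent_of_coercive[OF lam(2) _ _ co] lam(2) by (metis zero_less_norm_iff)
qed

text \<open>The parametrization \<open>1 + \<lambda> h0 / (Cf c) = R - \<i> s\<close> solves the imaginary part of the dispersion
  relation with \<open>\<mu> = 2 \<i> R s Cf / h0\<close>; \<open>rs\<close> is its real part.\<close>

lemma not_resolvent_of_dispersion: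
  assumes ph0: "ph0 \<in> {phim, phip}" and R: "R \<ge> 1" and s: "s > 0" and rs: "4 * alim ph0 * R^2 * s^2 = h0 * c^2 * (1 + s^2 - R^2)"
    and lam: "lam = Complex ((R - 1) * c * (Cf / h0)) (- s * c * (Cf / h0))"
  shows "\<not> in_resolvent_set (mk k) (LL k) lam"
proof -
  define r where "r = Cf / h0"
  have Cfr: "Cf = r * h0" using h0 by (simp add: r_def)
  have rpos: "r > 0" using Cf h0 by (simp add: r_def)
  have lam0: "lam \<noteq> 0" unfolding lam r_def[symmetric] using s c rpos by (simp add: complex_eq_iff)
  define \<mu> where "\<mu> = Complex 0 (2 * R * s * r)"
  have mu: "Re \<mu> = 0" by (simp add: \<mu>_def)
  have disp: "cx ((gp + 3 * h0 * ph0) * h0^2) * \<mu>^2 - cx kap * \<mu> - (lam^2 * cx h0 + cx (2 * Cf * c) * lam) = 0"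
    unfolding alim_def[symmetric] lam r_def[symmetric] \<mu>_def kap_def
  proof (rule complex_eqI)
    have "- (alim ph0 * (2 * R * s * r)^2) - ((((R - 1) * c * r)^2 - (s * c * r)^2) * h0 + 2 * (r * h0) * c * ((R - 1) * c * r))
        = - (r^2) * (4 * alim ph0 * R^2 * s^2 - h0 * c^2 * (1 + s^2 - R^2))" by algebra
    also have "\<dots> = 0" using rs by simp
    finally show "Re (cx (alim ph0) * (Complex 0 (2 * R * s * r))^2 - cx (Cf * c^2) * Complex 0 (2 * R * s * r)
         - ((Complex ((R - 1) * c * r) (- s * c * r))^2 * cx h0 + cx (2 * Cf * c) * Complex ((R - 1) * c * r) (- s * c * r))) = Re 0"
      unfolding Cfr by (simp add: power2_eq_square)
    have "- (r * h0 * c^2 * (2 * R * s * r)) - ((2 * ((R - 1) * c * r) * (- s * c * r)) * h0 + 2 * (r * h0) * c * (- s * c * r)) = 0" by algebra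
    then show "Im (cx (alim ph0) * (Complex 0 (2 * R * s * r))^2 - cx (Cf * c^2) * Complex 0 (2 * R * s * r)
         - ((Complex ((R - 1) * c * r) (- s * c * r))^2 * cx h0 + cx (2 * Cf * c) * Complex ((R - 1) * c * r) (- s * c * r))) = Im 0"
      unfolding Cfr by (simp add: power2_eq_square)
  qed
  show ?thesis
  proof (cases "ph0 = phip")
    case True
    show ?thesis
    proof (rule weyl_not_resolvent[OF lam0 mu disp, where T = "\<lambda>R. {R..}"])
      show "\<exists>a. {a..a + real n} \<subseteq> {R..}" for R n by (rule exI[of _ R]) auto
      show "\<exists>R. dbound {R..} \<epsilon> k (\<lambda>x. b x - h0)" if "\<epsilon> > 0" for k \<epsilon>
        using tail_b[OF that, of k] dbound_subset by (metis sup_ge1)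
      show "\<exists>R. dbound {R..} \<epsilon> k (\<lambda>x. ph x - ph0)" if "\<epsilon> > 0" for k \<epsilon>
        using tail_ph_plus[OF that] True by simp
    qed auto
  next
    case False
    then have m: "ph0 = phim" using ph0 by simp
    show ?thesis
    proof (rule weyl_not_resolvent[OF lam0 mu disp, where T = "\<lambda>R. {..-R}"])
      show "\<exists>a. {a..a + real n} \<subseteq> {..- R}" for R n by (rule exI[of _ "- R - real n"]) auto
      show "\<exists>R. dbound {..-R} \<epsilon> k (\<lambda>x. b x - h0)" if "\<epsilon> > 0" for k \<epsilon>
        using tail_b[OF that, of k] dbound_subset by (metis sup_ge2)
      show "\<exists>R. dbound {..-R} \<epsilon> k (\<lambda>x. ph x - ph0)" if "\<epsilon> > 0" for k \<epsilon>
        using tail_ph_minus[OF that] m by simp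
    qed auto
  qed
qed

lemma alim_pos: "ph0 \<in> {phim, phip} \<Longrightarrow> alim ph0 > 0"
  unfolding alim_def using gp h0 phim phip by (auto intro!: mult_pos_pos add_pos_pos)

text \<open>With \<open>A = 4 * alim ph0 / (h0 * c^2)\<close> the dispersion relation reads
  \<open>A R^2 s^2 = 1 + s^2 - R^2\<close>. For \<open>A < 1\<close> every value of
  \<open>R^2\<close> strictly between 1 and \<open>1 / A\<close> gives a positive
  \<open>s^2\<close>; the midpoint is taken. The real part of \<open>lam\<close> is positive because
  \<open>R > 1\<close>.\<close>

lemma unstable_of_froude_gt:
  assumes ph0: "ph0 \<in> {phim, phip}" and lt: "4 * alim ph0 < c^2 * h0"
  shows "\<exists>lam. Re lam > 0 \<and> \<not> in_resolvent_set (mk k) (LL k) lam"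
proof -
  define A where "A = 4 * alim ph0 / (h0 * c^2)"
  have hc: "h0 * c^2 > 0" using h0 c by simp
  have A: "0 < A" "A < 1" using lt hc alim_pos[OF ph0] by (auto simp: A_def mult.commute)
  define R2 where "R2 = (1 + 1 / A) / 2"
  have R2: "R2 > 1" "A * R2 < 1" using A by (auto simp: R2_def field_simps)
  define S where "S = (R2 - 1) / (1 - A * R2)"
  have S: "S > 0" using R2 by (simp add: S_def)
  have SR: "A * R2 * S = 1 + S - R2" using R2(2) by (simp add: S_def field_simps)
  have "4 * alim ph0 * R2 * S = h0 * c^2 * (1 + S - R2)"
  proof -
    have "4 * alim ph0 = A * (h0 * c^2)" using hc unfolding A_def by (metis nonzero_eq_divide_eq order_less_irrefl)
    then show ?thesis using SR by algebra
  qed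
  then have "\<not> in_resolvent_set (mk k) (LL k) (Complex ((sqrt R2 - 1) * c * (Cf / h0)) (- sqrt S * c * (Cf / h0)))"
    using R2 S by (intro not_resolvent_of_dispersion[OF ph0 _ _ _ refl]) auto
  then show ?thesis using R2 c Cf h0 by (intro exI[of _ "Complex ((sqrt R2 - 1) * c * (Cf / h0)) (- sqrt S * c * (Cf / h0))"]) auto
qed

text \<open>For \<open>R = 1\<close> the threshold equality turns the dispersion relation into an
  identity in \<open>s\<close>; the witness is \<open>s = 1\<close>.\<close>

lemma imaginary_spectrum_of_froude_eq:
  assumes ph0: "ph0 \<in> {phim, phip}" and "4 * alim ph0 = c^2 * h0"
  shows "\<exists>lam. Re lam = 0 \<and> lam \<noteq> 0 \<and> \<not> in_resolvent_set (mk k) (LL k) lam"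
proof -
  have "\<not> in_resolvent_set (mk k) (LL k) (Complex ((1 - 1) * c * (Cf / h0)) (- 1 * c * (Cf / h0)))"
    using assms(2) by (intro not_resolvent_of_dispersion[OF ph0 _ _ _ refl]) auto
  then show ?thesis using c Cf h0 by (intro exI[of _ "Complex ((1 - 1) * c * (Cf / h0)) (- 1 * c * (Cf / h0))"]) (auto simp: complex_eq_iff)
qed

lemma spectral_stability_iff:
  "spectrally_stable gp gh Cf Ct c b ph (mk k) \<longleftrightarrow> Cf \<ge> Ct \<and> 4 * alim phip \<ge> c^2 * h0 \<and> 4 * alim phim \<ge> c^2 * h0"
    (is "_ \<longleftrightarrow> ?R")
proof -
  have "spectrally_stable gp gh Cf Ct c b ph (mk k) \<longleftrightarrow> (\<forall>lam. Re lam > 0 \<longrightarrow> in_resolvent_set (mk k) (LL k) lam)"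
    unfolding spectrally_stable_def op_spectrum_def by force
  also have "\<dots> \<longleftrightarrow> ?R"
  proof
    assume st: "\<forall>lam. Re lam > 0 \<longrightarrow> in_resolvent_set (mk k) (LL k) lam"
    have "4 * alim ph0 \<ge> c^2 * h0" if "ph0 \<in> {phim, phip}" for ph0
      using unstable_of_froude_gt[OF that, of k] st leI by blast
    moreover have "Cf \<ge> Ct" using not_resolvent_of_Ct_gt[of k] st leI by blast
    ultimately show ?R by simp
  next
    assume r: ?R
    have "in_resolvent_set (mk k) (LL k) lam" if "Re lam > 0" for lam
      using r that by (intro resolvent_of_stable) auto
    then show "\<forall>lam. Re lam > 0 \<longrightarrow> in_resolvent_set (mk k) (LL k) lam" by blast
  qed
  finally show ?thesis .
qed

lemma strong_spectral_stability_iff: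
  "strongly_spectrally_stable gp gh Cf Ct c b ph (mk k) \<longleftrightarrow> Cf \<ge> Ct \<and> 4 * alim phip > c^2 * h0 \<and> 4 * alim phim > c^2 * h0"
    (is "_ \<longleftrightarrow> ?R")
proof -
  have "Z \<subseteq> {lam. Re lam < 0} \<union> {0} \<longleftrightarrow> (\<forall>lam. Re lam \<ge> 0 \<and> lam \<noteq> 0 \<longrightarrow> lam \<notin> Z)" for Z
  proof
    show "Z \<subseteq> {lam. Re lam < 0} \<union> {0}" if "\<forall>lam. Re lam \<ge> 0 \<and> lam \<noteq> 0 \<longrightarrow> lam \<notin> Z"
    proof
      fix x assume "x \<in> Z"
      then have "\<not> (Re x \<ge> 0 \<and> x \<noteq> 0)" using that by blast
      then show "x \<in> {lam. Re lam < 0} \<union> {0}" by auto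
    qed
  qed auto
  then have "strongly_spectrally_stable gp gh Cf Ct c b ph (mk k) \<longleftrightarrow>
      (\<forall>lam. Re lam \<ge> 0 \<and> lam \<noteq> 0 \<longrightarrow> in_resolvent_set (mk k) (LL k) lam)"
    unfolding strongly_spectrally_stable_def op_spectrum_def by simp
  also have "\<dots> \<longleftrightarrow> ?R"
  proof
    assume st: "\<forall>lam. Re lam \<ge> 0 \<and> lam \<noteq> 0 \<longrightarrow> in_resolvent_set (mk k) (LL k) lam"
    have st': "in_resolvent_set (mk k) (LL k) lam" if "Re lam > 0" for lam using st that by (cases "lam = 0") auto
    have "4 * alim ph0 > c^2 * h0" if ph0: "ph0 \<in> {phim, phip}" for ph0
    proof (rule ccontr)
      assume "\<not> 4 * alim ph0 > c^2 * h0"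
      then consider "4 * alim ph0 < c^2 * h0" | "4 * alim ph0 = c^2 * h0" by linarith
      then show False
      proof cases
        case 1 then show ?thesis using unstable_of_froude_gt[OF that, of k] st' by blast
      next
        case 2
        then obtain lam where "Re lam = 0" "lam \<noteq> 0" "\<not> in_resolvent_set (mk k) (LL k) lam"
          using imaginary_spectrum_of_froude_eq[OF ph0] by blast
        then show ?thesis using st by simp
      qed
    qed
    moreover have "Cf \<ge> Ct" using not_resolvent_of_Ct_gt[of k] st' leI by blast
    ultimately show ?R by simp
  next
    assume r: ?R
    have "in_resolvent_set (mk k) (LL k) lam" if "Re lam \<ge> 0" "lam \<noteq> 0" for lam
      using r that by (intro resolvent_of_stable) auto
    then show "\<forall>lam. Re lam \<ge> 0 \<and> lam \<noteq> 0 \<longrightarrow> in_resolvent_set (mk k) (LL k) lam" by blast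
  qed
  finally show ?thesis .
qed

end

section \<open>From the assumptions on the wave to the locale\<close>

lemma dbound_Un: "dbound I M k f \<Longrightarrow> dbound J M k f \<Longrightarrow> dbound (I \<union> J) M k f"
proof (induction k arbitrary: f)
  case (Suc k)
  obtain g where g: "\<And>x. (f has_vector_derivative g x) (at x)" "dbound I M k g" using Suc.prems(1) by auto
  have "dbound J M k g" by (rule dbound_Suc_deriv[OF Suc.prems(2) g(1)])
  then show ?case
    using Suc.IH[OF g(2)] dbound_le[OF Suc.prems(1)] dbound_le[OF Suc.prems(2)] by (intro dbound_SucI[OF _ g(1)]) auto
qed auto

lemma exp_localized_dbound:
  assumes f: "smooth_real f" and e: "exp_localized_on A f"
  shows "\<exists>\<theta>>0. \<exists>K. \<forall>k T. dbound (A \<inter> {x. \<bar>x\<bar> \<ge> T}) (K k * exp (- \<theta> * T)) k f"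
proof -
  obtain \<theta> where \<theta>: "\<theta> > 0" "\<And>k. \<exists>K. \<forall>x\<in>A. \<bar>(deriv ^^ k) f x\<bar> \<le> K * exp (- \<theta> * \<bar>x\<bar>)" using e unfolding exp_localized_on_def by blast
  then obtain K0 where K0: "\<And>k x. x \<in> A \<Longrightarrow> \<bar>(deriv ^^ k) f x\<bar> \<le> K0 k * exp (- \<theta> * \<bar>x\<bar>)" by metis
  \<comment> \<open>A single constant for all derivatives up to order \<open>k\<close>, with one
    rate \<open>\<theta>\<close> for all orders.\<close>
  define K where "K = (\<lambda>k. \<Sum>j\<le>k. \<bar>K0 j\<bar>)"
  show ?thesis
  proof (intro exI[of _ \<theta>] exI[of _ K] conjI allI \<theta>(1))
    fix k T
    show "dbound (A \<inter> {x. \<bar>x\<bar> \<ge> T}) (K k * exp (- \<theta> * T)) k f"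
    proof (rule dbound_of_deriv_bounds[OF f])
      fix j x assume j: "j \<le> k" and x: "x \<in> A \<inter> {x. \<bar>x\<bar> \<ge> T}"
      have "K0 j \<le> K k" unfolding K_def using j member_le_sum[of j "{..k}" "\<lambda>j. \<bar>K0 j\<bar>"] by auto
      moreover have "exp (- \<theta> * \<bar>x\<bar>) \<le> exp (- \<theta> * T)" using x \<theta>(1) by simp
      moreover have "0 \<le> K k" by (simp add: K_def sum_nonneg)
      ultimately have "K0 j * exp (- \<theta> * \<bar>x\<bar>) \<le> K k * exp (- \<theta> * T)" by (intro mult_mono) auto
      then show "\<bar>(deriv ^^ j) f x\<bar> \<le> K k * exp (- \<theta> * T)" using K0[of x j] x by auto
    qed
  qed
qed

lemma exp_localized_tail:
  assumes "smooth_real f" "exp_localized_on A f" "\<epsilon> > 0"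
  shows "\<exists>R. dbound (A \<inter> {x. \<bar>x\<bar> \<ge> R}) \<epsilon> k f"
proof -
  obtain \<theta> K where h: "\<theta> > 0" "\<And>k T. dbound (A \<inter> {x. \<bar>x\<bar> \<ge> T}) (K k * exp (- \<theta> * T)) k f"
    using exp_localized_dbound[OF assms(1,2)] by blast
  have "(\<lambda>n. K k * exp (- (\<theta> * real n))) \<longlonglongrightarrow> K k * 0" using exp_neg_of_nat_tendsto[OF h(1)] by (intro tendsto_intros) auto
  then have "\<forall>\<^sub>F n in sequentially. K k * exp (- (\<theta> * real n)) < \<epsilon>" using assms(3) by (intro order_tendstoD) auto
  then obtain n where "K k * exp (- \<theta> * real n) < \<epsilon>" by (auto simp: eventually_sequentially)
  then show ?thesis using dbound_mono[OF h(2)] by (meson less_imp_le)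
qed

lemma exp_localized_bound:
  assumes "smooth_real f" "exp_localized_on A f" shows "\<exists>M. dbound A M k f"
proof -
  obtain \<theta> K where h: "\<theta> > 0" "\<And>k T. dbound (A \<inter> {x. \<bar>x\<bar> \<ge> T}) (K k * exp (- \<theta> * T)) k f"
    using exp_localized_dbound[OF assms] by blast
  from h(2)[of 0 k] show ?thesis by auto
qed

lemma positive_lower_bound:
  fixes f :: "real \<Rightarrow> real"
  assumes f: "continuous_on UNIV f" "\<And>x. f x > 0" and lim: "(f \<longlongrightarrow> l) at_bot" "(f \<longlongrightarrow> r) at_top" "l > 0" "r > 0"
  shows "\<exists>m>0. \<forall>x. f x \<ge> m"
proof -
  have "\<forall>\<^sub>F x in at_bot. f x > l / 2" "\<forall>\<^sub>F x in at_top. f x > r / 2"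
    using lim(3,4) by (intro order_tendstoD(1)[OF lim(1)] order_tendstoD(1)[OF lim(2)]; simp)+
  then obtain a b where ab: "\<And>x. x \<le> a \<Longrightarrow> f x > l / 2" "\<And>x. x \<ge> b \<Longrightarrow> f x > r / 2"
    unfolding eventually_at_bot_linorder eventually_at_top_linorder by blast
  obtain y where y: "y \<in> {a..max a b}" "\<And>x. x \<in> {a..max a b} \<Longrightarrow> f y \<le> f x"
    using continuous_attains_inf[of "{a..max a b}" f] continuous_on_subset[OF f(1)] by auto
  have "min (f y) (min (l / 2) (r / 2)) \<le> f x" for x
    using y(2)[of x] ab[of x] by (cases "x \<le> a"; cases "x \<ge> b") auto
  then show ?thesis using f(2)[of y] lim(3,4) by (intro exI[of _ "min (f y) (min (l / 2) (r / 2))"]) auto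
qed

lemma smooth_real_deriv: "smooth_real f \<Longrightarrow> (f has_real_derivative deriv f x) (at x)"
  using DERIV_deriv_iff_real_differentiable unfolding smooth_real_def differentiable_on_def
  by (metis UNIV_I funpow_0)

lemma smooth_real_diff_const: "smooth_real f \<Longrightarrow> smooth_real (\<lambda>x. f x - l)"
  using csmooth_add[OF _ csmooth_const[of "- l"]] unfolding smooth_real_iff_csmooth by simp

text \<open>The momentum equation is evaluated at time 0. The time derivative contributes
  \<open>- c^2\<close> times the slope of \<open>h\<close> and the advective flux contributes the
  opposite, so only the pressure is left.\<close>

lemma convective_wave_profile:
  assumes w: "smooth_convective_wave gp gh Cf Ct c h U Phi phi" and c: "c > 0"
  shows "(gp + 3 * h x * phi x) * h x * deriv h x + deriv phi x * (h x)^3 = gh * h x - Cf * c^2"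
proof -
  have U: "U y = c" and Phi: "Phi y = 0" and pos: "phi y > 0" for y using w by (auto simp: smooth_convective_wave_def)
  have Dh: "(h has_real_derivative deriv h y) (at y)" and Dphi: "(phi has_real_derivative deriv phi y) (at y)" for y
    using w by (auto simp: smooth_convective_wave_def intro: smooth_real_deriv)
  have "deriv (\<lambda>s. h (x - c * s) * U (x - c * s)) 0 + deriv (\<lambda>y. h (y - c * 0) * (U (y - c * 0))^2
       + rg_pressure gp (h (y - c * 0)) (Phi (y - c * 0)) (phi (y - c * 0))) x
     = gh * h (x - c * 0) - rg_friction Cf Ct (Phi (x - c * 0)) (phi (x - c * 0)) * \<bar>U (x - c * 0)\<bar> * U (x - c * 0)"
    using w unfolding smooth_convective_wave_def rg_solution_def Let_def by blast
  then have eq: "deriv (\<lambda>s. h (x - c * s) * c) 0 + deriv (\<lambda>y. h y * c^2 + (gp * (h y)^2 / 2 + phi y * (h y)^3)) x = gh * h x - Cf * c^2"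
    using pos[of x] c by (simp add: U Phi rg_pressure_def rg_friction_def power2_eq_square mult.assoc)
  have "((\<lambda>s. h (x - c * s) * c) has_real_derivative deriv h x * (- c) * c) (at 0)"
  proof -
    have "((\<lambda>s. x - c * s) has_real_derivative - c) (at 0)" by (auto intro!: derivative_eq_intros)
    from DERIV_chain2[OF _ this, of h "deriv h x"] have "((\<lambda>s. h (x - c * s)) has_real_derivative deriv h x * (- c)) (at 0)" using Dh[of x] by simp
    then show ?thesis by (rule DERIV_cmult_right)
  qed
  moreover have "((\<lambda>y. h y * c^2 + (gp * (h y)^2 / 2 + phi y * (h y)^3)) has_real_derivative
     deriv h x * c^2 + ((gp + 3 * h x * phi x) * h x * deriv h x + deriv phi x * (h x)^3)) (at x)"
    using Dh[of x] Dphi[of x] by (auto intro!: derivative_eq_intros simp: algebra_simps power2_eq_square)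
  ultimately show ?thesis using eq by (simp add: DERIV_imp_deriv power2_eq_square)
qed

text \<open>The profile of \<open>phib\<close> approaches different constants at the two ends, so
  its bounds are obtained on each half line and joined at 0.\<close>

lemma convective_wave_rg_wave:
  assumes pos: "gp > 0" "gh > 0" "Cf > 0" "Ct > 0" "c > 0"
    and w: "smooth_convective_wave gp gh Cf Ct c hb Ub Phib phib"
    and lim: "h0 > 0" "phim > 0" "phip > 0" and ef: "limits_reached_exp_fast hb phib h0 phim phip"
  shows "\<exists>bm pm. rg_wave gp gh Cf Ct c h0 phim phip bm pm hb phib"
proof -
  have sm: "smooth_real hb" "smooth_real phib" and hpos: "hb x > 0" "phib x > 0" for x
    using w by (auto simp: smooth_convective_wave_def)
  have eb: "exp_localized_on UNIV (\<lambda>x. hb x - h0)" and em: "exp_localized_on {..0} (\<lambda>x. phib x - phim)"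
    and ep: "exp_localized_on {0..} (\<lambda>x. phib x - phip)" using ef by (auto simp: limits_reached_exp_fast_def)
  note sd = smooth_real_diff_const
  have tb: "\<exists>R. dbound ({R..} \<union> {..-R}) \<epsilon> k (\<lambda>x. hb x - h0)" if \<epsilon>: "\<epsilon> > 0" for \<epsilon> k
  proof -
    obtain R where R: "dbound (UNIV \<inter> {x. \<bar>x\<bar> \<ge> R}) \<epsilon> k (\<lambda>x. hb x - h0)" using exp_localized_tail[OF sd[OF sm(1)] eb \<epsilon>] by blast
    have "dbound ({R..} \<union> {..-R}) \<epsilon> k (\<lambda>x. hb x - h0)" by (rule dbound_subset[OF R]) auto
    then show ?thesis by blast
  qed
  have tp: "\<exists>R. dbound {R..} \<epsilon> k (\<lambda>x. phib x - phip)" if \<epsilon>: "\<epsilon> > 0" for \<epsilon> k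
  proof -
    obtain R where R: "dbound ({0..} \<inter> {x. \<bar>x\<bar> \<ge> R}) \<epsilon> k (\<lambda>x. phib x - phip)" using exp_localized_tail[OF sd[OF sm(2)] ep \<epsilon>] by blast
    have "dbound {max R 0..} \<epsilon> k (\<lambda>x. phib x - phip)" by (rule dbound_subset[OF R]) auto
    then show ?thesis by blast
  qed
  have tm: "\<exists>R. dbound {..-R} \<epsilon> k (\<lambda>x. phib x - phim)" if \<epsilon>: "\<epsilon> > 0" for \<epsilon> k
  proof -
    obtain R where R: "dbound ({..0} \<inter> {x. \<bar>x\<bar> \<ge> R}) \<epsilon> k (\<lambda>x. phib x - phim)" using exp_localized_tail[OF sd[OF sm(2)] em \<epsilon>] by blast
    have "dbound {..- max R 0} \<epsilon> k (\<lambda>x. phib x - phim)" by (rule dbound_subset[OF R]) auto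
    then show ?thesis by blast
  qed
  have bb: "bsmooth hb"
  proof (rule bsmoothI)
    fix k
    obtain M where "dbound UNIV M k (\<lambda>x. hb x - h0)" using exp_localized_bound[OF sd[OF sm(1)] eb] by blast
    from dbound_add[OF this dbound_const[OF order_refl, where c = h0]] show "\<exists>M. dbound UNIV M k hb" by auto
  qed
  have bp: "bsmooth phib"
  proof (rule bsmoothI)
    fix k
    obtain M where "dbound {..0} M k (\<lambda>x. phib x - phim)" using exp_localized_bound[OF sd[OF sm(2)] em] by blast
    from dbound_add[OF this dbound_const[OF order_refl, where c = phim]] have 1: "dbound {..0} (M + \<bar>phim\<bar>) k phib" by simp
    obtain M' where "dbound {0..} M' k (\<lambda>x. phib x - phip)" using exp_localized_bound[OF sd[OF sm(2)] ep] by blast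
    from dbound_add[OF this dbound_const[OF order_refl, where c = phip]] have 2: "dbound {0..} (M' + \<bar>phip\<bar>) k phib" by simp
    let ?M = "max (M + \<bar>phim\<bar>) (M' + \<bar>phip\<bar>)"
    have "dbound ({..0} \<union> {0..}) ?M k phib"
      by (rule dbound_Un[OF dbound_mono[OF 1] dbound_mono[OF 2]]) auto
    moreover have "{..0} \<union> {0..} = (UNIV :: real set)" by auto
    ultimately show "\<exists>M. dbound UNIV M k phib" by auto
  qed
  note Dh = smooth_real_deriv[OF sm(1)] and Dp = smooth_real_deriv[OF sm(2)]
  note t = eventually_tails(1,2) and u = eventually_tails(3,4)
  note lbp = dbound_tail_tendsto[OF Dh tb t(1)] and lbm = dbound_tail_tendsto(1)[OF Dh tb u(1)]
    and lpp = dbound_tail_tendsto[OF Dp tp t(2)] and lpm = dbound_tail_tendsto(1)[OF Dp tm u(2)]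
  have cont: "continuous_on UNIV hb" "continuous_on UNIV phib" using csmooth_continuous bsmooth_csmooth bb bp by auto
  obtain bm where bm: "bm > 0" "\<And>x. hb x \<ge> bm" using positive_lower_bound[OF cont(1) hpos(1) lbm lbp(1) lim(1,1)] by blast
  obtain pm where pm: "pm > 0" "\<And>x. phib x \<ge> pm" using positive_lower_bound[OF cont(2) hpos(2) lpm lpp(1) lim(2,3)] by blast
  note prof = convective_wave_profile[OF w pos(5)]
  \<comment> \<open>By the profile equation this function is a combination of the slopes of
    \<open>hb\<close> and \<open>phib\<close>, which tend to 0; its limit is also computed from that
    of \<open>hb\<close>. Comparing the two gives the value of \<open>h0\<close>.\<close>
  have "((\<lambda>x. gh * hb x - Cf * c^2) \<longlongrightarrow> (gp + 3 * h0 * phip) * h0 * 0 + 0 * h0^3) at_top"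
    unfolding prof[symmetric] by (intro tendsto_intros lbp lpp)
  moreover have "((\<lambda>x. gh * hb x - Cf * c^2) \<longlongrightarrow> gh * h0 - Cf * c^2) at_top" by (intro tendsto_intros lbp)
  ultimately have "gh * h0 - Cf * c^2 = (gp + 3 * h0 * phip) * h0 * 0 + 0 * h0^3" using tendsto_unique trivial_limit_at_top_linorder by blast
  then have "gh * h0 = Cf * c^2" by simp
  then have "rg_wave gp gh Cf Ct c h0 phim phip bm pm hb phib"
    by unfold_locales (use pos lim bm pm bb bp prof tb tp tm in auto)
  then show ?thesis by blast
qed

section \<open>Froude numbers and the conclusion\<close>

context rg_wave
begin

text \<open>Inserting \<open>gh = Cf * c^2 / h0\<close> eliminates the friction coefficient and
  leaves the usual quotient of the squared speed by the squared sound speed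
  \<open>h0 * (gp + 3 * h0 * ph0)\<close>. The factors 4 match the threshold.\<close>

lemma froude_sq: "ph0 > 0 \<Longrightarrow> (froude gp gh Cf h0 ph0)^2 = 4 * (c^2 * h0 / (4 * alim ph0))"
proof -
  assume "ph0 > 0"
  then have a: "gp + 3 * h0 * ph0 > 0" using gp h0 by (simp add: add_pos_pos)
  have "gh = Cf * c^2 / h0" using h0_eq h0 by (simp add: eq_divide_eq)
  then show ?thesis
    unfolding froude_def alim_def using a gh Cf c h0 by (simp add: power2_eq_square)
qed

lemma froude_le_iff: "ph0 > 0 \<Longrightarrow> froude gp gh Cf h0 ph0 \<le> 2 \<longleftrightarrow> 4 * alim ph0 \<ge> c^2 * h0"
  and froude_less_iff: "ph0 > 0 \<Longrightarrow> froude gp gh Cf h0 ph0 < 2 \<longleftrightarrow> 4 * alim ph0 > c^2 * h0"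
proof -
  assume p: "ph0 > 0"
  then have a: "4 * alim ph0 > 0" unfolding alim_def using gp h0 by (simp add: add_pos_pos)
  have nn: "froude gp gh Cf h0 ph0 \<ge> 0" unfolding froude_def using gh Cf gp h0 p by simp
  have "froude gp gh Cf h0 ph0 \<le> 2 \<longleftrightarrow> (froude gp gh Cf h0 ph0)^2 \<le> 2^2" using nn power_mono_iff[of _ "2::real" 2] by simp
  also have "\<dots> \<longleftrightarrow> 4 * alim ph0 \<ge> c^2 * h0" unfolding froude_sq[OF p] using a by (simp add: divide_le_eq)
  finally show "froude gp gh Cf h0 ph0 \<le> 2 \<longleftrightarrow> 4 * alim ph0 \<ge> c^2 * h0" .
  have "froude gp gh Cf h0 ph0 < 2 \<longleftrightarrow> (froude gp gh Cf h0 ph0)^2 < 2^2" using power_mono_iff[of 2 "froude gp gh Cf h0 ph0" 2] nn by (simp flip: not_le)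
  also have "\<dots> \<longleftrightarrow> 4 * alim ph0 > c^2 * h0" unfolding froude_sq[OF p] using a by (simp add: divide_less_eq)
  finally show "froude gp gh Cf h0 ph0 < 2 \<longleftrightarrow> 4 * alim ph0 > c^2 * h0" .
qed

lemma stability_on_scale:
  assumes "deriv_scale mk DR Fl nu"
  shows "(spectrally_stable gp gh Cf Ct c b ph (mk k) \<longleftrightarrow>
            Cf \<ge> Ct \<and> froude gp gh Cf h0 phip \<le> 2 \<and> froude gp gh Cf h0 phim \<le> 2) \<and>
         (strongly_spectrally_stable gp gh Cf Ct c b ph (mk k) \<longleftrightarrow>
            Cf \<ge> Ct \<and> froude gp gh Cf h0 phip < 2 \<and> froude gp gh Cf h0 phim < 2)"
proof -
  interpret rg_scale gp gh Cf Ct c h0 phim phip bm pm b ph mk DR Fl nu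
    by (intro rg_scale.intro rg_wave_axioms assms)
  show ?thesis
    unfolding spectral_stability_iff strong_spectral_stability_iff using froude_le_iff froude_less_iff phim phip by simp
qed

end

theorem theorem5p5:
  fixes gp gh Cf Ct c h0 phim phip :: real
    and hb Ub Phib phib :: "real \<Rightarrow> real"
    and S :: fun_space
  assumes "gp > 0" and "gh > 0" and "Cf > 0" and "Ct > 0" and "c > 0"
    and "smooth_convective_wave gp gh Cf Ct c hb Ub Phib phib"
    and "asymptotically_constant hb phib h0 phim phip"
    and "h0 > 0" and "phim > 0" and "phip > 0"
    and "limits_reached_exp_fast hb phib h0 phim phip"
    and "admissible S"
  shows "(spectrally_stable gp gh Cf Ct c hb phib S \<longleftrightarrow>
            Cf \<ge> Ct \<and> froude gp gh Cf h0 phip \<le> 2 \<and> froude gp gh Cf h0 phim \<le> 2) \<and>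
         (strongly_spectrally_stable gp gh Cf Ct c hb phib S \<longleftrightarrow>
            Cf \<ge> Ct \<and> froude gp gh Cf h0 phip < 2 \<and> froude gp gh Cf h0 phim < 2)"
proof -
  obtain bm pm where "rg_wave gp gh Cf Ct c h0 phim phip bm pm hb phib"
    using convective_wave_rg_wave[OF assms(1-6,8-11)] by blast
  then interpret rg_wave gp gh Cf Ct c h0 phim phip bm pm hb phib .
  show ?thesis
  proof (cases S)
    case (Sobolev k p)
    then have "p \<ge> 1" using assms(12) by simp
    from stability_on_scale[OF Sobolev_scale[OF this], of k] show ?thesis unfolding Sobolev .
  next
    case (BUC k)
    from stability_on_scale[OF BUC_scale, of k] show ?thesis unfolding BUC .
  qed
qed

end
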